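(* Let $n\ge 1$ and let $\iota:\mathbb{P}U(n+1)\longrightarrow \operatorname{Symp}(\mathbb{CP}^n,\omega_{FS})$ be the inclusion given by the action of the projective unitary group on $\mathbb{CP}^n$. Then for every positive integer $j\le 2n+1$ the induced homomorphism $$\pi_j(\iota):\pi_j(\mathbb{P}U(n+1))\longrightarrow\pi_j(\operatorname{Symp}(\mathbb{CP}^n,\omega_{FS}))$$ is injective.
   Context: $\omega_{FS}$ is the Fubini–Study symplectic form on $\mathbb{CP}^n$, which is invariant under $\mathbb{P}U(n+1)=U(n+1)/U(1)$. $\operatorname{Symp}(\mathbb{CP}^n,\omega_{FS})$ is the group of symplectomorphisms with the $C^\infty$-topology; homotopy groups are based at the identity. *)

theory Defs
  imports "HOL-Analysis.Analysis" "HOL-Algebra.Coset"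
begin

section \<open>Homotopy groups\<close>

definition cube :: "nat \<Rightarrow> (nat \<Rightarrow> real) topology" where
  "cube j = product_topology (\<lambda>_. top_of_set {0..1}) {..<j}"

definition cube_boundary :: "nat \<Rightarrow> (nat \<Rightarrow> real) set" where
  "cube_boundary j = {t \<in> topspace (cube j). \<exists>i<j. t i = 0 \<or> t i = 1}"

definition based_cubes :: "nat \<Rightarrow> 'a topology \<Rightarrow> 'a \<Rightarrow> ((nat \<Rightarrow> real) \<Rightarrow> 'a) set" where
  "based_cubes j X x0 =
     {f. continuous_map (cube j) X f \<and> (\<forall>t\<in>cube_boundary j. f t = x0)}"

definition cube_homotopy ::
    "nat \<Rightarrow> 'a topology \<Rightarrow> 'a \<Rightarrow> (((nat \<Rightarrow> real) \<Rightarrow> 'a) \<times> ((nat \<Rightarrow> real) \<Rightarrow> 'a)) set" where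
  "cube_homotopy j X x0 =
     {(f, g). f \<in> based_cubes j X x0 \<and> g \<in> based_cubes j X x0 \<and>
        homotopic_with (\<lambda>h. \<forall>t\<in>cube_boundary j. h t = x0) (cube j) X f g}"

definition cube_concat ::
    "((nat \<Rightarrow> real) \<Rightarrow> 'a) \<Rightarrow> ((nat \<Rightarrow> real) \<Rightarrow> 'a) \<Rightarrow> (nat \<Rightarrow> real) \<Rightarrow> 'a" where
  "cube_concat f g t =
     (if t 0 \<le> 1/2 then f (t(0 := 2 * t 0)) else g (t(0 := 2 * t 0 - 1)))"

text \<open>The group \<open>\<pi>\<^sub>j(X, x0)\<close>; the multiplication is meaningful for \<open>j \<ge> 1\<close> only.\<close>

definition homotopy_group ::
    "nat \<Rightarrow> 'a topology \<Rightarrow> 'a \<Rightarrow> ((nat \<Rightarrow> real) \<Rightarrow> 'a) set monoid" where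
  "homotopy_group j X x0 =
     \<lparr> carrier = based_cubes j X x0 // cube_homotopy j X x0,
       mult = (\<lambda>A B. cube_homotopy j X x0 `` {cube_concat f g | f g. f \<in> A \<and> g \<in> B}),
       one = cube_homotopy j X x0 `` {\<lambda>_. x0} \<rparr>"

text \<open>The map \<open>\<pi>\<^sub>j(X, x0) \<rightarrow> \<pi>\<^sub>j(Y, h x0)\<close> induced by \<open>h\<close>. The source space does not
  occur because a class is given as its set of representatives.\<close>

definition homotopy_group_map ::
    "nat \<Rightarrow> 'b topology \<Rightarrow> 'b \<Rightarrow> ('a \<Rightarrow> 'b)
       \<Rightarrow> ((nat \<Rightarrow> real) \<Rightarrow> 'a) set \<Rightarrow> ((nat \<Rightarrow> real) \<Rightarrow> 'b) set" where
  "homotopy_group_map j Y y0 h A = cube_homotopy j Y y0 `` ((\<lambda>f. h \<circ> f) ` A)"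


section \<open>Smooth maps between open subsets of Euclidean spaces\<close>

primrec iterated_deriv ::
    "'a list \<Rightarrow> ('a::real_normed_vector \<Rightarrow> 'b::real_normed_vector) \<Rightarrow> 'a \<Rightarrow> 'b" where
  "iterated_deriv [] f = f"
| "iterated_deriv (v # vs) f = (\<lambda>x. frechet_derivative (iterated_deriv vs f) (at x) v)"

text \<open>Intended for open sets: all iterated directional derivatives exist and are
  (Frechet) differentiable, hence continuous.\<close>

definition smooth_on ::
    "'a set \<Rightarrow> ('a::euclidean_space \<Rightarrow> 'b::euclidean_space) \<Rightarrow> bool" where
  "smooth_on S f \<longleftrightarrow> (\<forall>vs. \<forall>x\<in>S. iterated_deriv vs f differentiable (at x))"


section \<open>Complex projective space\<close>

text \<open>For a finite type \<open>'n\<close> with \<open>n\<close> elements, homogeneous coordinates on \<open>\<complex>P\<^sup>n\<close> are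
  indexed by \<open>'n option\<close>, which has \<open>n + 1\<close> elements. Every \<open>n \<ge> 1\<close> arises, and only those.\<close>

typedef (overloaded) ('n::finite) cproj =
  "{L :: (complex ^ 'n option) set. vec.subspace L \<and> vec.dim L = 1}"
proof -
  have "vec.dim (vec.span {axis None 1 :: complex ^ 'n option}) = 1"
    by (subst vec.dim_span, subst vec.dim_eq_card_independent) (auto simp: vec.dependent_single axis_eq_0_iff)
  then show ?thesis by (blast intro: vec.subspace_span)
qed

definition line_through :: "complex ^ 'n::finite option \<Rightarrow> 'n cproj" where
  "line_through z = Abs_cproj (vec.span {z})"

text \<open>\<open>homog i c w\<close> has the entry \<open>c\<close> at position \<open>i\<close> and the entries of \<open>w\<close> at the other
  positions; if \<open>i = Some k\<close>, the entry \<open>w $ k\<close> displaced by \<open>c\<close> goes to position \<open>None\<close>.\<close>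

definition homog :: "'n::finite option \<Rightarrow> complex \<Rightarrow> complex ^ 'n \<Rightarrow> complex ^ 'n option" where
  "homog i c w =
     (\<chi> l. if l = i then c else case l of None \<Rightarrow> w $ the i | Some m \<Rightarrow> w $ m)"

text \<open>The standard affine charts, given by their inverse parametrizations.\<close>

definition affine_param :: "'n::finite option \<Rightarrow> complex ^ 'n \<Rightarrow> 'n cproj" where
  "affine_param i w = line_through (homog i 1 w)"

definition chart_domain :: "'n::finite option \<Rightarrow> 'n cproj set" where
  "chart_domain i = range (affine_param i)"

definition chart :: "'n::finite option \<Rightarrow> 'n cproj \<Rightarrow> complex ^ 'n" where
  "chart i = inv_into UNIV (affine_param i)"

definition local_rep ::
    "'n::finite option \<Rightarrow> 'n option \<Rightarrow> ('n cproj \<Rightarrow> 'n cproj) \<Rightarrow> complex ^ 'n \<Rightarrow> complex ^ 'n" where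
  "local_rep i k f = chart k \<circ> f \<circ> affine_param i"

definition local_rep_domain ::
    "'n::finite option \<Rightarrow> 'n option \<Rightarrow> ('n cproj \<Rightarrow> 'n cproj) \<Rightarrow> (complex ^ 'n) set" where
  "local_rep_domain i k f = {w. f (affine_param i w) \<in> chart_domain k}"

text \<open>Openness of all the local domains says that \<open>f\<close> is continuous with respect to the
  manifold topology.\<close>

definition smooth_map :: "('n::finite cproj \<Rightarrow> 'n cproj) \<Rightarrow> bool" where
  "smooth_map f \<longleftrightarrow>
     (\<forall>i k. open (local_rep_domain i k f) \<and> smooth_on (local_rep_domain i k f) (local_rep i k f))"

text \<open>The weak (compact-open) \<open>C\<^sup>\<infinity>\<close> topology on the smooth self-maps, generated by the sets
  of maps that are uniformly close to \<open>f\<close>, with all partial derivatives up to some order,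
  on a compact set in chart coordinates. Since \<open>\<complex>P\<^sup>n\<close> is compact it is also the strong one.\<close>

definition smooth_nhd ::
    "('n::finite cproj \<Rightarrow> 'n cproj) \<Rightarrow> 'n option \<Rightarrow> 'n option \<Rightarrow> (complex ^ 'n) set \<Rightarrow> nat \<Rightarrow> real
       \<Rightarrow> ('n cproj \<Rightarrow> 'n cproj) set" where
  "smooth_nhd f i k K r e =
     {g. smooth_map g \<and> K \<subseteq> local_rep_domain i k g \<and>
         (\<forall>vs. set vs \<subseteq> Basis \<and> length vs \<le> r \<longrightarrow>
            (\<forall>w\<in>K. norm (iterated_deriv vs (local_rep i k f) w
                         - iterated_deriv vs (local_rep i k g) w) < e))}"

definition smooth_topology :: "('n::finite cproj \<Rightarrow> 'n cproj) topology" where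
  "smooth_topology = topology_generated_by
     {smooth_nhd f i k K r e | f i k K r e.
        smooth_map f \<and> compact K \<and> K \<subseteq> local_rep_domain i k f \<and> e > 0}"


section \<open>The Fubini-Study form and symplectomorphisms\<close>

definition herm :: "complex ^ 'm::finite \<Rightarrow> complex ^ 'm \<Rightarrow> complex" where
  "herm a b = (\<Sum>l\<in>UNIV. a $ l * cnj (b $ l))"

lemma herm_simps: "herm (a+b) c = herm a c + herm b c" "herm a (b+c) = herm a b + herm a c"
  "herm (s *s a) b = s * herm a b" "herm a (s *s b) = cnj s * herm a b"
  "cnj (herm a b) = herm b a"
  by (simp_all add: herm_def algebra_simps sum.distrib sum_distrib_left)

lemma herm_self: "herm z z = of_real ((norm z)\<^sup>2)"
  by (simp add: herm_def norm_vec_def L2_set_def sum_nonneg complex_norm_square[symmetric]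
      del: of_real_power)

text \<open>The form \<open>(\<i>/2) \<partial> \<partial>-bar log |z|\<^sup>2\<close> on the nonzero vectors, evaluated at tangent vectors
  \<open>a\<close>, \<open>b\<close> at \<open>z\<close>. It is the pullback of the Fubini-Study form under the projection to \<open>\<complex>P\<^sup>n\<close>.
  In the chart \<open>i\<close>, the latter is therefore its pullback under the section
  \<open>w \<mapsto> homog i 1 w\<close>, whose derivative is \<open>homog i 0\<close>. The minus sign comes from
  \<open>(\<i>/2) (h(a,b) - h(b,a)) = - Im h(a,b)\<close> for a Hermitian form \<open>h\<close>. (The normalizing
  constant does not affect the symplectomorphism group.)\<close>

definition fs_homog :: "complex ^ 'm::finite \<Rightarrow> complex ^ 'm \<Rightarrow> complex ^ 'm \<Rightarrow> real" where
  "fs_homog z a b = - Im (herm a b / herm z z - herm a z * herm z b / (herm z z)\<^sup>2)"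

lemma fs_homog_basic:
  assumes "z \<noteq> 0" "c \<noteq> 0"
  shows "fs_homog (c *s z) (c *s a + s *s z) (c *s b + t *s z) = fs_homog z a b"
proof -
  have h: "herm z z \<noteq> 0" using assms by (simp add: herm_self)
  have "herm (c *s a + s *s z) (c *s b + t *s z) / herm (c *s z) (c *s z)
     - herm (c *s a + s *s z) (c *s z) * herm (c *s z) (c *s b + t *s z) / (herm (c *s z) (c *s z))\<^sup>2
     = herm a b / herm z z - herm a z * herm z b / (herm z z)\<^sup>2"
    using h assms by (simp add: herm_simps field_simps power2_eq_square)
  then show ?thesis by (simp add: fs_homog_def)
qed

definition fs_form :: "'n::finite option \<Rightarrow> complex ^ 'n \<Rightarrow> complex ^ 'n \<Rightarrow> complex ^ 'n \<Rightarrow> real" where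
  "fs_form i w u v = fs_homog (homog i 1 w) (homog i 0 u) (homog i 0 v)"

definition preserves_fs :: "('n::finite cproj \<Rightarrow> 'n cproj) \<Rightarrow> bool" where
  "preserves_fs f \<longleftrightarrow>
     (\<forall>i k. \<forall>w\<in>local_rep_domain i k f. \<forall>u v.
        let D = frechet_derivative (local_rep i k f) (at w)
        in fs_form k (local_rep i k f w) (D u) (D v) = fs_form i w u v)"

definition Symp :: "('n::finite cproj \<Rightarrow> 'n cproj) set" where
  "Symp = {f. bij f \<and> smooth_map f \<and> smooth_map (inv_into UNIV f) \<and> preserves_fs f}"

definition Symp_topology :: "('n::finite cproj \<Rightarrow> 'n cproj) topology" where
  "Symp_topology = subtopology smooth_topology Symp"


section \<open>The projective unitary group and its action\<close>

definition unitary_group :: "(complex ^ 'm::finite ^ 'm) monoid" where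
  "unitary_group =
     \<lparr> carrier = {A. map_matrix cnj (transpose A) ** A = mat 1}, mult = (**), one = mat 1 \<rparr>"

definition unit_scalars :: "(complex ^ 'm::finite ^ 'm) set" where
  "unit_scalars = mat ` {c. norm c = 1}"

definition PU :: "(complex ^ 'm::finite ^ 'm) set monoid" where
  "PU = unitary_group Mod unit_scalars"

definition PU_open :: "(complex ^ 'm::finite ^ 'm) set set \<Rightarrow> bool" where
  "PU_open V \<longleftrightarrow> V \<subseteq> carrier PU \<and>
     openin (top_of_set (carrier unitary_group))
       {A \<in> carrier unitary_group. unit_scalars #>\<^bsub>unitary_group\<^esub> A \<in> V}"

definition PU_topology :: "(complex ^ 'm::finite ^ 'm) set topology" where
  "PU_topology = topology PU_open"

lemma istopology_PU_open: "istopology (PU_open :: (complex ^ 'm::finite ^ 'm) set set \<Rightarrow> bool)"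
proof -
  define P where "P V = {A \<in> carrier unitary_group. unit_scalars #>\<^bsub>unitary_group\<^esub> A \<in> V}"
    for V :: "(complex ^ 'm ^ 'm) set set"
  have P: "P (S \<inter> T) = P S \<inter> P T" "P (\<Union>K) = \<Union>(P ` K)" for S T K
    by (auto simp: P_def)
  have "istopology (\<lambda>V. V \<subseteq> carrier PU \<and> openin (top_of_set (carrier unitary_group)) (P V))"
    unfolding istopology_def P by (blast intro: openin_Int openin_Union)
  then show ?thesis by (simp add: PU_open_def[abs_def] P_def)
qed

lemma openin_PU_topology: "openin PU_topology V \<longleftrightarrow> PU_open V"
  by (simp add: PU_topology_def istopology_PU_open)

text \<open>All representatives of a class act in the same way, so \<open>the_elem\<close> is applied to a
  singleton.\<close>

definition PU_action ::
    "(complex ^ 'n option ^ 'n option) set \<Rightarrow> 'n::finite cproj \<Rightarrow> 'n cproj" where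
  "PU_action C p = the_elem ((\<lambda>A. Abs_cproj ((*v) A ` Rep_cproj p)) ` C)"

end

theory Submission
  imports Defs "HOL-Algebra.FiniteProduct" "HOL-Real_Asymp.Real_Asymp"
begin

text \<open>A homotopy in the symplectomorphism group between two maps into the projective unitary
  group enters only through the continuous family of self-maps of projective space that it defines.
  Multiplied by the inverse of one end, this family lifts to circle-equivariant self-maps
  \<open>F (s, x)\<close> of the unit sphere in dimension \<open>m = n + 1\<close>, joining a unitary matrix \<open>A x\<close> to the
  identity. Clifford multiplication by \<open>F\<close>, compressed to polynomials of degree \<open>d + p\<close> with values in
  the \<open>p\<close>-th exterior power (\<open>p = 0, ..., m\<close>), is an odd operator, and by equivariance it is almost
  a unitary involution when \<open>d\<close> is large. Comparing its blocks at the two ends of the homotopy gives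
  in the stable K-group, for all large \<open>d\<close>, that the alternating sum over \<open>p\<close> of
  \<open>(d + p + m - 1) choose (m - 1)\<close> times the class of the \<open>p\<close>-th exterior power of \<open>A\<close> vanishes.
  These relations force the class of \<open>A\<close> itself to vanish. Since \<open>j \<le> 2 n + 1\<close>, general position
  removes the stabilization, and orthonormalization gives a null homotopy of \<open>A\<close> through unitary
  matrices. The integrals over the sphere are replaced by sums over finite point sets that are exact
  for polynomials of bounded degree.\<close>

section \<open>Row-finite operators\<close>

text \<open>Equivariance makes each component of \<open>F\<close> raise the polynomial degree by
  one, so that the operator is a Koszul complex in disguise and its only defect is leakage out of
  the chosen degrees. Being odd and invertible it identifies the odd part with the even part,
  continuously in all parameters; at the start of the homotopy this identification is the one at its
  end conjugated by the exterior powers of \<open>A\<close>. Hence the two parts carry the same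
  class of \<open>A\<close>. The binomials are dimensions of spaces of polynomials. As they are
  polynomial in \<open>d\<close>, relations for large \<open>d\<close> continue to all integers, and
  at \<open>d = - m - 1\<close> the terms with \<open>2 <= p <= m\<close> drop out while
  \<open>p = 1\<close> keeps a sign; \<open>p = 0\<close> is trivial from the outset. The bound on
  \<open>j\<close> is a dimension count: the homotopy has at most \<open>2 n + 2\<close> parameters,
  and a column can be cleared if it avoids the zeros of a map into a space of dimension
  \<open>2 m + 1 = 2 n + 3\<close>. Lines lift to unit vectors only up to phase. The lift at the
  start is therefore a unitary matrix times a circle-valued function on the sphere, and this factor
  must be removed through a logarithm before the Clifford argument applies.\<close>

text \<open>Finitely supported matrices added to the identity of this ring form the stable linear group.\<close>

typedef 'i lop = "{f :: ('i => complex) => ('i => complex).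
  (ALL u v. f (%k. u k + v k) = (%k. f u k + f v k)) \<and>
  (ALL c u. f (%k. c * u k) = (%k. c * f u k)) \<and>
  (ALL i. EX S. finite S & (ALL u v. (ALL k:S. u k = v k) --> f u i = f v i))}"
 morphisms app Abs_lop
 by (rule exI[of _ "%u. u"]) (auto intro: exI[of _ "{_}"])

setup_lifting type_definition_lop

instantiation lop :: (type) ring_1
begin

lift_definition zero_lop :: "'a lop" is "%u k. 0" by auto
lift_definition one_lop :: "'a lop" is "%u. u" by (auto intro: exI[of _ "{_}"])
lift_definition plus_lop :: "'a lop => 'a lop => 'a lop" is "%f g u k. f u k + g u k"
proof (intro conjI CollectI allI, goal_cases)
 case (3 f g i)
 then obtain S T where "finite S" "ALL u v. (ALL k:S. u k = v k) --> f u i = f v i"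
  "finite T" "ALL u v. (ALL k:T. u k = v k) --> g u i = g v i" by blast
 thus ?case by (intro exI[of _ "S \<union> T"]) (metis UnI1 UnI2 finite_UnI)
qed (auto simp: algebra_simps fun_eq_iff)
lift_definition minus_lop :: "'a lop => 'a lop => 'a lop" is "%f g u k. f u k - g u k"
proof (intro conjI CollectI allI, goal_cases)
 case (3 f g i)
 then obtain S T where "finite S" "ALL u v. (ALL k:S. u k = v k) --> f u i = f v i"
  "finite T" "ALL u v. (ALL k:T. u k = v k) --> g u i = g v i" by blast
 thus ?case by (intro exI[of _ "S \<union> T"]) (metis UnI1 UnI2 finite_UnI)
qed (auto simp: algebra_simps fun_eq_iff)
lift_definition uminus_lop :: "'a lop => 'a lop" is "%f u k. - f u k"
 by (auto simp: algebra_simps fun_eq_iff)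
lift_definition times_lop :: "'a lop => 'a lop => 'a lop" is "%f g u. f (g u)"
proof (intro conjI CollectI allI, goal_cases)
 case (3 f g i)
 then obtain S where S: "finite S" "ALL u v. (ALL k:S. u k = v k) --> f u i = f v i" by blast
 have "ALL k. EX T. finite T & (ALL u v. (ALL l:T. u l = v l) --> g u k = g v k)" using 3 by blast
 then obtain T where T: "!!k. finite (T k)" "!!k u v. (ALL l:T k. u l = v l) ==> g u k = g v k" by metis
 show ?case using S T by (intro exI[of _ "UN k:S. T k"]) auto
qed auto

instance
proof
 show "(0::'a lop) ~= 1"
 proof
  assume "(0::'a lop) = 1"
  hence "app (0::'a lop) (%_. 1) = app 1 (%_. 1)" by simp
  thus False by (simp add: zero_lop.rep_eq one_lop.rep_eq fun_eq_iff)
 qed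
next
 fix a b c :: "'a lop"
 show "a * (b + c) = a * b + a * c"
  by transfer (auto simp: fun_eq_iff)
qed (transfer; auto simp: fun_eq_iff algebra_simps)+

end

lemma app_add: "app f (%k. u k + v k) i = app f u i + app f v i"
 using app[of f] by (auto simp: fun_eq_iff)

lemma app_scale: "app f (%k. c * u k) i = c * app f u i"
 using app[of f] by (auto simp: fun_eq_iff)

lemma app_finite_dep: "EX S. finite S & (ALL u v. (ALL k:S. u k = v k) --> app f u i = app f v i)"
 using app[of f] by blast

lemma app_zero [simp]: "app f (%k. 0) i = 0"
 using app_scale[of f 0 "%k. 0" i] by simp

lemma app_sum: "app f (%k. SUM j:J. u j k) i = (SUM j:J. app f (u j) i)"
 by (induction J rule: infinite_finite_induct) (auto simp: app_zero app_add)

lemma app_ring [simp]: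
 "app 0 u = (%k. 0)" "app 1 u = u" "app (f + g) u = (%k. app f u k + app g u k)"
 "app (f - g) u = (%k. app f u k - app g u k)" "app (- f) u = (%k. - app f u k)"
 "app (f * g) u = app f (app g u)"
 by (simp_all add: zero_lop.rep_eq one_lop.rep_eq plus_lop.rep_eq minus_lop.rep_eq
   uminus_lop.rep_eq times_lop.rep_eq)

lemma app_sum_lop [simp]: "app (SUM j:J. f j) u = (%i. SUM j:J. app (f j) u i)"
 by (induction J rule: infinite_finite_induct) auto

definition delta :: "'i => 'i => complex" where
 "delta k = (%i. if i = k then 1 else 0)"

definition ent :: "'i lop => 'i => 'i => complex" where
 "ent f i k = app f (delta k) i"

lemma app_expand:
 assumes "finite S" "!!u v. (ALL k:S. u k = v k) ==> app f u i = app f v i"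
 shows "app f u i = (SUM k:S. ent f i k * u k)"
proof -
 have "app f u i = app f (%l. SUM k:S. u k * delta k l) i"
 proof (rule assms(2), rule ballI)
  fix l assume "l : S"
  have "(SUM k:S. u k * delta k l) = (SUM k:S. if k = l then u k else 0)"
   by (rule sum.cong) (auto simp: delta_def)
  thus "u l = (SUM k:S. u k * delta k l)" using \<open>l : S\<close> assms(1) by simp
 qed
 also have "... = (SUM k:S. ent f i k * u k)"
  by (simp add: app_sum app_scale ent_def mult.commute)
 finally show ?thesis .
qed

lemma ent_ring [simp]:
 "ent 0 i k = 0" "ent (f + g) i k = ent f i k + ent g i k"
 "ent (f - g) i k = ent f i k - ent g i k" "ent (- f) i k = - ent f i k"
 by (simp_all add: ent_def)

lemma ent_one: "ent 1 i k = (if i = k then 1 else 0)"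
 by (simp add: ent_def delta_def)

text \<open>Row-finiteness is what makes this work: a linear map on all functions is in general not
  determined by its values on the \<open>delta k\<close>, but a coordinate that reads only finitely
  many inputs is.\<close>

lemma lop_eqI:
 assumes "!!i k. ent f i k = ent g i k"
 shows "f = g"
proof -
 have "app f u i = app g u i" for u i
 proof -
  obtain S where S: "finite S" "ALL u v. (ALL k:S. u k = v k) --> app f u i = app f v i"
   using app_finite_dep[of f i] by (elim exE conjE)
  obtain T where T: "finite T" "ALL u v. (ALL k:T. u k = v k) --> app g u i = app g v i"
   using app_finite_dep[of g i] by (elim exE conjE)
  have "app f u i = (SUM k:S \<union> T. ent f i k * u k)"
   by (rule app_expand) (use S T in \<open>simp, metis UnI1\<close>)
  moreover have "app g u i = (SUM k:S \<union> T. ent g i k * u k)"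
   by (rule app_expand) (use S T in \<open>simp, metis UnI2\<close>)
  ultimately show ?thesis using assms by simp
 qed
 hence "app f = app g" by (intro ext)
 thus ?thesis by (simp add: app_inject)
qed

lemma lop_appI: "(!!u i. app f u i = app g u i) ==> f = g"
 by (simp add: app_inject[symmetric] fun_eq_iff)

text \<open>Block form: rows and columns outside \<open>S\<close> are zero. The column condition is
  phrased as dependence on the inputs in \<open>S\<close>, which makes sense for infinite
  \<open>S\<close> as well; \<open>supported_iff_ent\<close> gives the entrywise form for finite
  \<open>S\<close>.\<close>

definition supported :: "'i set => 'i lop => bool" where
 "supported S f \<longleftrightarrow> (ALL u i. i ~: S --> app f u i = 0) \<and>
   (ALL u v. (ALL k:S. u k = v k) --> app f u = app f v)"

lemma supportedI:
 assumes "!!u i. i ~: S ==> app f u i = 0"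
  and "!!u v. (!!k. k : S ==> u k = v k) ==> app f u = app f v"
 shows "supported S f"
 unfolding supported_def
proof (intro conjI allI impI)
 show "app f u = app f v" if "ALL k:S. u k = v k" for u v
  by (rule assms(2)) (rule bspec[OF that])
qed (rule assms(1))

lemma supported_outside:
 assumes "supported S f" "i ~: S" shows "app f u i = 0"
 by (rule assms(1)[unfolded supported_def, THEN conjunct1, THEN spec, THEN spec, THEN mp, OF assms(2)])

lemma supported_dep:
 assumes "supported S f" "!!k. k : S ==> u k = v k" shows "app f u = app f v"
 by (rule assms(1)[unfolded supported_def, THEN conjunct2, THEN spec, THEN spec, THEN mp])
   (intro ballI assms(2))

lemma supported_expand:
 assumes "finite S" "supported S f" shows "app f u i = (SUM k:S. ent f i k * u k)"
 by (rule app_expand[OF assms(1)]) (rule fun_cong[OF supported_dep[OF assms(2)]], blast)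

lemma supported_mono: assumes "supported S f" "S <= T" shows "supported T f"
 by (rule supportedI) (use assms(2) in \<open>blast intro: supported_outside[OF assms(1)] supported_dep[OF assms(1)]\<close>)+

lemma supported_0 [simp]: "supported S 0" by (simp add: supported_def)

lemma supported_add: assumes "supported S f" "supported S g" shows "supported S (f + g)"
proof (rule supportedI)
 fix u v :: "'a => complex" assume *: "!!k. k : S ==> u k = v k"
 have "app f u = app f v" "app g u = app g v"
  by (rule supported_dep[OF assms(1) *], assumption) (rule supported_dep[OF assms(2) *], assumption)
 thus "app (f + g) u = app (f + g) v" by simp
qed (simp add: supported_outside[OF assms(1)] supported_outside[OF assms(2)])

lemma supported_mult: assumes "supported S f" "supported S g" shows "supported S (f * g)"
proof (rule supportedI)
 fix u v :: "'a => complex" assume *: "!!k. k : S ==> u k = v k"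
 have "app g u = app g v" by (rule supported_dep[OF assms(2) *])
 thus "app (f * g) u = app (f * g) v" by simp
qed (simp add: supported_outside[OF assms(1)])

lemma supported_uminus: assumes "supported S f" shows "supported S (- f)"
proof (rule supportedI)
 fix u v :: "'a => complex" assume *: "!!k. k : S ==> u k = v k"
 have "app f u = app f v" by (rule supported_dep[OF assms *])
 thus "app (- f) u = app (- f) v" by simp
qed (simp add: supported_outside[OF assms(1)])

lemma supported_sum: "(!!j. j : J ==> supported S (f j)) ==> supported S (SUM j:J. f j)"
 by (induction J rule: infinite_finite_induct) (auto intro: supported_add)

lemma ent_unsupported: assumes "supported S f" "i ~: S \<or> k ~: S" shows "ent f i k = 0"
proof (cases "i : S")
 case True
 hence "app f (delta k) = app f (%_. 0)" using assms
  by (intro supported_dep[OF assms(1)]) (auto simp: delta_def)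
 thus ?thesis by (simp add: ent_def app_zero)
qed (simp add: supported_outside[OF assms(1)] ent_def)

lemma ent_mult:
 assumes "finite S" "supported S f"
 shows "ent (f * g) i k = (SUM l:S. ent f i l * ent g l k)"
proof -
 have "ent (f * g) i k = app f (app g (delta k)) i" by (simp add: ent_def)
 also have "... = (SUM l:S. ent f i l * app g (delta k) l)" by (rule supported_expand[OF assms])
 finally show ?thesis by (simp add: ent_def[of g])
qed

text \<open>The value 0 for infinite \<open>S\<close> keeps the operator row-finite without a side
  condition.\<close>

lift_definition mk_lop :: "'i set => ('i => 'i => complex) => 'i lop" is
 "%S M u i. if finite S & i : S then SUM k:S. M i k * u k else 0"
proof (intro conjI CollectI allI, goal_cases)
 case (3 S M i)
 show ?case
 proof (cases "finite S")
  case True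
  thus ?thesis by (intro exI[of _ S] conjI allI impI) (simp_all cong: sum.cong)
 qed (intro exI[of _ "{}"], simp)
qed (simp_all add: fun_eq_iff algebra_simps sum.distrib sum_distrib_left)

lemma app_mk_lop: "finite S ==> app (mk_lop S M) u i = (if i : S then SUM k:S. M i k * u k else 0)"
 by (simp add: mk_lop.rep_eq)

lemma ent_mk_lop: "finite S ==> ent (mk_lop S M) i k = (if i : S & k : S then M i k else 0)"
 by (auto simp: ent_def app_mk_lop delta_def if_distrib cong: if_cong)

lemma supported_mk_lop: "supported S (mk_lop S M)"
 by (rule supportedI) (simp_all add: mk_lop.rep_eq fun_eq_iff)

lemma supported_iff_ent:
 assumes "finite S" shows "supported S f \<longleftrightarrow> (ALL i k. i ~: S \<or> k ~: S --> ent f i k = 0)"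
proof
 assume *: "ALL i k. i ~: S \<or> k ~: S --> ent f i k = 0"
 have "f = mk_lop S (ent f)" by (rule lop_eqI) (use * assms in \<open>auto simp: ent_mk_lop\<close>)
 thus "supported S f" by (metis supported_mk_lop)
qed (simp add: ent_unsupported)

text \<open>Takes the place of a complex algebra structure on the ring; these elements are central
  by \<open>scal_commute\<close>.\<close>

lift_definition scal :: "complex => 'i lop" is "%c u k. c * u k"
proof (intro conjI CollectI allI, goal_cases)
 case (3 c i)
 show ?case by (intro exI[of _ "{i}"]) simp
qed (auto simp: algebra_simps fun_eq_iff)

lemma app_scal [simp]: "app (scal c) u = (%k. c * u k)" by (simp add: scal.rep_eq)

lemma scal_simps: "scal 1 = 1" "scal 0 = 0" "scal (a + b) = scal a + scal b"
 "scal (a * b) = scal a * scal b" "scal (- a) = - scal a" "scal (a - b) = scal a - scal b"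
 by (rule lop_appI; simp add: algebra_simps)+

lemma scal_commute: "f * scal c = scal c * f"
 by (rule lop_appI) (simp add: app_scale)

lemma scal_left_commute: "f * (scal c * g) = scal c * (f * g)"
 by (simp only: mult.assoc[symmetric] scal_commute)

lemma ent_scal_mult [simp]: "ent (scal c * f) i k = c * ent f i k"
 by (simp add: ent_def)

lemma supported_scal: assumes "supported S f" shows "supported S (scal c * f)"
proof (rule supportedI)
 fix u v :: "'a => complex" assume *: "!!k. k : S ==> u k = v k"
 have "app f u = app f v" by (rule supported_dep[OF assms *])
 thus "app (scal c * f) u = app (scal c * f) v" by simp
qed (simp add: supported_outside[OF assms(1)])

section \<open>Families\<close>

text \<open>The finite support is uniform over \<open>X\<close> while continuity is asked of single
  entries only; together they describe a continuous map into one finite matrix algebra.\<close>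

definition fsf :: "'x::topological_space set => ('x => 'i lop) => bool" where
 "fsf X q \<longleftrightarrow> (EX S. finite S & (ALL x:X. supported S (q x))) \<and>
   (ALL i k. continuous_on X (%x. ent (q x) i k))"

lemma fsf_const: "finite S ==> supported S f ==> fsf X (%x. f)"
 by (auto simp: fsf_def)

lemma fsf_0: "fsf X (%x. 0)" by (rule fsf_const[of "{}"]) auto

lemma fsf_common: assumes "fsf X p" "fsf X q"
 obtains S where "finite S" "!!x. x : X ==> supported S (p x)" "!!x. x : X ==> supported S (q x)"
proof -
 obtain S T where "finite S" "ALL x:X. supported S (p x)" "finite T" "ALL x:X. supported T (q x)"
  using assms unfolding fsf_def by blast
 thus ?thesis by (intro that[of "S \<union> T"]) (auto intro: supported_mono)
qed

lemma fsf_add: assumes "fsf X p" "fsf X q" shows "fsf X (%x. p x + q x)"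
proof -
 obtain S where S: "finite S" "!!x. x : X ==> supported S (p x)" "!!x. x : X ==> supported S (q x)"
  using fsf_common assms by blast
 thus ?thesis using assms unfolding fsf_def
  by (auto intro!: continuous_intros exI[of _ S] supported_add)
qed

lemma fsf_uminus: "fsf X p ==> fsf X (%x. - p x)"
 unfolding fsf_def by (auto intro!: continuous_intros supported_uminus)

lemma fsf_diff: "fsf X p ==> fsf X q ==> fsf X (%x. p x - q x)"
 using fsf_add[of X p "%x. - q x"] fsf_uminus[of X q] by simp

lemma fsf_scal: assumes "fsf X p" "continuous_on X c" shows "fsf X (%x. scal (c x) * p x)"
 using assms unfolding fsf_def by (auto intro!: continuous_intros supported_scal)

lemma fsf_mult: assumes "fsf X p" "fsf X q" shows "fsf X (%x. p x * q x)"
proof -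
 obtain S where S: "finite S" "!!x. x : X ==> supported S (p x)" "!!x. x : X ==> supported S (q x)"
  using fsf_common assms by blast
 have "continuous_on X (%x. ent (p x * q x) i k)" for i k
 proof -
  have "continuous_on X (%x. SUM l:S. ent (p x) i l * ent (q x) l k)"
   using assms unfolding fsf_def by (intro continuous_intros) auto
  thus ?thesis by (rule continuous_on_eq) (simp add: ent_mult[OF S(1,2)])
 qed
 thus ?thesis unfolding fsf_def using S by (auto intro!: exI[of _ S] supported_mult)
qed

lemma fsf_sum: "(!!j. j : J ==> fsf X (p j)) ==> fsf X (%x. SUM j:J. p j x)"
 by (induction J rule: infinite_finite_induct) (auto intro: fsf_add fsf_0)

lemma fsf_compose: assumes "fsf X p" "continuous_on Y g" "g ` Y <= X" shows "fsf Y (%y. p (g y))"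
proof -
 have "continuous_on Y (%y. ent (p (g y)) i k)" for i k
  by (rule continuous_on_compose2[of X "%x. ent (p x) i k"]) (use assms in \<open>auto simp: fsf_def\<close>)
 thus ?thesis using assms unfolding fsf_def by blast
qed

lemma fsf_cong: "fsf X p ==> (!!x. x : X ==> p x = q x) ==> fsf X q"
 unfolding fsf_def by (metis (no_types, lifting) continuous_on_cong)

text \<open>The inverse is required to be a family of the same kind, so continuity of inversion
  never has to be proved; it is supplied by an explicit formula or a series wherever a family is
  produced.\<close>

definition GLfam :: "'x::topological_space set => ('x => 'i lop) => bool" where
 "GLfam X a \<longleftrightarrow> fsf X (%x. a x - 1) \<and>
   (EX b. fsf X (%x. b x - 1) & (ALL x:X. a x * b x = 1 & b x * a x = 1))"

lemma GLfamI: "fsf X (%x. a x - 1) ==> fsf X (%x. b x - 1) ==>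
  (!!x. x : X ==> a x * b x = 1) ==> (!!x. x : X ==> b x * a x = 1) ==> GLfam X a"
 unfolding GLfam_def by blast

lemma GLfam_1: "GLfam X (%x. 1)"
 by (rule GLfamI[of _ _ "%x. 1"]) (auto intro: fsf_0)

lemma fsf1_mult:
 assumes "fsf X (%x. a x - 1)" "fsf X (%x. b x - 1)"
 shows "fsf X (%x. a x * b x - 1)"
proof -
 have "fsf X (%x. (a x - 1) * (b x - 1) + (a x - 1) + (b x - 1))"
  by (intro fsf_add fsf_mult assms)
 thus ?thesis by (rule fsf_cong) (simp add: algebra_simps)
qed

lemma unit_mult:
 fixes a :: "'a::ring_1"
 assumes "a * a' = 1" "b * b' = 1" shows "a * b * (b' * a') = 1"
proof -
 have "a * b * (b' * a') = a * (b * b') * a'" by (simp add: mult.assoc)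
 thus ?thesis using assms by simp
qed

lemma GLfam_mult: assumes "GLfam X a" "GLfam X b" shows "GLfam X (%x. a x * b x)"
proof -
 obtain a' b' where *: "fsf X (%x. a' x - 1)" "ALL x:X. a x * a' x = 1 & a' x * a x = 1"
  "fsf X (%x. b' x - 1)" "ALL x:X. b x * b' x = 1 & b' x * b x = 1"
  using assms unfolding GLfam_def by blast
 show ?thesis
  by (rule GLfamI[of _ _ "%x. b' x * a' x"])
    (use * assms in \<open>auto simp: GLfam_def intro!: fsf1_mult unit_mult\<close>)
qed

lemma GLfam_compose: assumes "GLfam X p" "continuous_on Y g" "g ` Y <= X" shows "GLfam Y (%y. p (g y))"
proof -
 obtain b where b: "fsf X (%x. b x - 1)" "ALL x:X. p x * b x = 1 & b x * p x = 1"
  using assms unfolding GLfam_def by blast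
 show ?thesis
  by (rule GLfamI[of _ _ "%y. b (g y)"])
    (use b assms in \<open>auto simp: GLfam_def image_subset_iff intro: fsf_compose[of X "%x. p x - 1"] fsf_compose[of X "%x. b x - 1"]\<close>)
qed

lemma GLfam_cong: assumes "GLfam X p" "!!x. x : X ==> p x = q x" shows "GLfam X q"
proof -
 obtain b where b: "fsf X (%x. b x - 1)" "ALL x:X. p x * b x = 1 & b x * p x = 1"
  using assms unfolding GLfam_def by blast
 show ?thesis
  by (rule GLfamI[OF _ b(1)]) (use b assms in \<open>auto simp: GLfam_def intro: fsf_cong\<close>)
qed

text \<open>A pointwise right inverse must coincide with the continuous two-sided inverse contained
  in the definition.\<close>

lemma GLfam_inv: assumes "GLfam X a" "!!x. x : X ==> a x * b x = 1" shows "GLfam X b"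
proof -
 obtain c where c: "fsf X (%x. c x - 1)" "ALL x:X. a x * c x = 1 & c x * a x = 1"
  using assms unfolding GLfam_def by blast
 have "c x = b x" if "x : X" for x
 proof -
  have "c x = c x * (a x * b x)" using assms that by simp
  also have "... = b x" using c that by (simp add: mult.assoc[symmetric])
  finally show ?thesis .
 qed
 moreover have "GLfam X c" by (rule GLfamI[OF c(1), of a]) (use c assms in \<open>auto simp: GLfam_def\<close>)
 ultimately show ?thesis by (rule GLfam_cong[rotated])
qed

section \<open>The relative stable K-group of a pair\<close>

definition null_fam :: "'x::topological_space set => 'x set => ('x => 'i lop) => bool" where
 "null_fam X D a \<longleftrightarrow> (EX h. GLfam ({0..1::real} \<times> X) h & (ALL x:X. h (0, x) = a x & h (1, x) = 1) \<and>
   (ALL s:{0..1}. ALL x:D. h (s, x) = 1))"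

text \<open>For \<open>D <= X\<close> the quotient by \<open>Nul X D\<close> consists of the
  homotopy classes, relative to \<open>D\<close>, of maps into the stable linear group: a relative
  K-group of degree -1. Values outside \<open>X\<close> are normalized to 1 so that families that
  agree on \<open>X\<close> are equal as functions.\<close>

definition Gam :: "'x::topological_space set => 'x set => ('x => 'i lop) monoid" where
 "Gam X D = \<lparr>carrier = {a. GLfam X a & (ALL x. x : D \<or> x ~: X --> a x = 1)},
   mult = (%a b x. a x * b x), one = (%x. 1)\<rparr>"

definition Nul :: "'x::topological_space set => 'x set => ('x => 'i lop) set" where
 "Nul X D = {a : carrier (Gam X D). null_fam X D a}"

lemma group_Gam: "group (Gam X D)"
proof (rule groupI)
 fix a assume a: "a : carrier (Gam X D)"
 then obtain c where c: "ALL x:X. a x * c x = 1 & c x * a x = 1"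
  by (auto simp: Gam_def GLfam_def)
 define b where "b x = (if x : D \<or> x ~: X then 1 else c x)" for x
 have b: "a x * b x = 1 & b x * a x = 1" for x using c a by (auto simp: b_def Gam_def)
 moreover have "GLfam X b" by (rule GLfam_inv[of X a]) (use a b in \<open>auto simp: Gam_def\<close>)
 ultimately show "EX y:carrier (Gam X D). y \<otimes>\<^bsub>Gam X D\<^esub> a = \<one>\<^bsub>Gam X D\<^esub>"
  by (intro bexI[of _ b]) (auto simp: Gam_def b_def)
qed (auto simp: Gam_def GLfam_1 mult.assoc intro: GLfam_mult)

lemma Gam_inv: assumes "a : carrier (Gam X D)"
 shows "a x * (inv\<^bsub>Gam X D\<^esub> a) x = 1" "(inv\<^bsub>Gam X D\<^esub> a) x * a x = 1"
 using group.r_inv[OF group_Gam assms] group.l_inv[OF group_Gam assms]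
 by (auto simp: Gam_def fun_eq_iff)

lemma null_fam_mult: assumes "null_fam X D a" "null_fam X D b" shows "null_fam X D (%x. a x * b x)"
proof -
 obtain h k where *: "GLfam ({0..1::real} \<times> X) h" "ALL x:X. h (0, x) = a x & h (1, x) = 1"
   "ALL s:{0..1}. ALL x:D. h (s, x) = 1" "GLfam ({0..1::real} \<times> X) k" "ALL x:X. k (0, x) = b x & k (1, x) = 1"
   "ALL s:{0..1}. ALL x:D. k (s, x) = 1"
  using assms unfolding null_fam_def by blast
 thus ?thesis unfolding null_fam_def
  by (intro exI[of _ "%t. h t * k t"]) (auto intro: GLfam_mult)
qed

lemma null_fam_conj:
 assumes "null_fam X D a" "c : carrier (Gam X D)" "D <= X"
 shows "null_fam X D (%x. c x * a x * (inv\<^bsub>Gam X D\<^esub> c) x)"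
proof -
 let ?c' = "inv\<^bsub>Gam X D\<^esub> c"
 obtain h where *: "GLfam ({0..1::real} \<times> X) h" "ALL x:X. h (0, x) = a x & h (1, x) = 1"
   "ALL s:{0..1}. ALL x:D. h (s, x) = 1" 
  using assms unfolding null_fam_def by blast
 have c': "?c' : carrier (Gam X D)" using group.inv_closed[OF group_Gam assms(2)] .
 have "GLfam ({0..1::real} \<times> X) (%t. c (snd t))" "GLfam ({0..1::real} \<times> X) (%t. ?c' (snd t))"
  using assms(2) c' by (auto simp: Gam_def intro!: GLfam_compose[of X] continuous_intros)
 hence "GLfam ({0..1::real} \<times> X) (%t. c (snd t) * h t * ?c' (snd t))"
  by (intro GLfam_mult *)
 thus ?thesis unfolding null_fam_def using * Gam_inv[OF assms(2)]
  by (intro exI[of _ "%t. c (snd t) * h t * ?c' (snd t)"]) auto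
qed

lemma null_fam_inv:
 assumes "null_fam X D a" "D <= X" "!!x. x : X ==> a x * b x = 1" "!!x. x : X ==> b x * a x = 1"
 shows "null_fam X D b"
proof -
 obtain h where *: "GLfam ({0..1::real} \<times> X) h" "ALL x:X. h (0, x) = a x & h (1, x) = 1"
   "ALL s:{0..1}. ALL x:D. h (s, x) = 1" 
  using assms unfolding null_fam_def by blast
 then obtain k where k: "ALL t:{0..1::real} \<times> X. h t * k t = 1 & k t * h t = 1"
  unfolding GLfam_def by blast
 have "GLfam ({0..1::real} \<times> X) k" by (rule GLfam_inv[OF *(1)]) (use k in auto)
 moreover have "k (0, x) = b x" if "x : X" for x
 proof -
  have "k (0,x) * (a x * b x) = b x" using k * that by (force simp: mult.assoc[symmetric])
  thus ?thesis using assms that by simp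
 qed
 moreover have "k (1, x) = 1" if "x : X" for x
 proof -
  have "h (1, x) * k (1, x) = 1" using k that by simp
  thus ?thesis using *(2) that by simp
 qed
 moreover have "k (s, x) = 1" if "x : D" "s : {0..1}" for s x
  using k *(3) that assms(2) by (metis SigmaI mult_1 subsetD)
 ultimately show ?thesis unfolding null_fam_def by blast
qed

text \<open>Conjugating a null homotopy by a family that is constant in time gives a null homotopy
  of the conjugate, and on \<open>D\<close> the conjugating family is 1.\<close>

lemma normal_Nul:
 fixes X D :: "'x::topological_space set"
 assumes "D <= X" shows "(Nul X D :: ('x => 'i lop) set) \<lhd> Gam X D"
proof -
 let ?N = "Nul X D :: ('x => 'i lop) set"
 interpret group "Gam X D :: ('x => 'i lop) monoid" by (rule group_Gam)
 have one: "null_fam X D (%x. 1 :: 'i lop)" unfolding null_fam_def by (intro exI[of _ "%x. 1"]) (auto intro: GLfam_1)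
 have sub: "subgroup ?N (Gam X D)"
 proof (rule subgroupI)
  show "?N ~= {}" using one GLfam_1 by (auto simp: Nul_def Gam_def)
  fix a assume a: "a : ?N"
  thus "inv\<^bsub>Gam X D\<^esub> a : Nul X D" using null_fam_inv[OF _ assms] Gam_inv[of a X D]
   by (auto simp: Nul_def)
  fix b assume b: "b : ?N"
  show "a \<otimes>\<^bsub>Gam X D\<^esub> b : Nul X D" 
   using a b m_closed null_fam_mult[of X D a b] by (auto simp: Nul_def) (auto simp: Gam_def)
 qed (auto simp: Nul_def)
 show ?thesis unfolding normal_inv_iff
 proof (intro conjI sub ballI)
  fix c a :: "'x => 'i lop" assume c: "c : carrier (Gam X D)" and a: "a : ?N"
  have "null_fam X D (%x. c x * a x * (inv\<^bsub>Gam X D\<^esub> c) x)"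
   using null_fam_conj a c assms by (auto simp: Nul_def)
  moreover have "c \<otimes>\<^bsub>Gam X D\<^esub> a \<otimes>\<^bsub>Gam X D\<^esub> inv\<^bsub>Gam X D\<^esub> c : carrier (Gam X D)"
   using a c by (auto simp: Nul_def)
  ultimately show "c \<otimes>\<^bsub>Gam X D\<^esub> a \<otimes>\<^bsub>Gam X D\<^esub> inv\<^bsub>Gam X D\<^esub> c : Nul X D"
   unfolding Nul_def by (simp add: Gam_def)
 qed
qed


definition cls :: "'x::topological_space set => 'x set => ('x => 'i lop) => ('x => 'i lop) set" where
 "cls X D a = Nul X D #>\<^bsub>Gam X D\<^esub> a"

definition Kgrp :: "'x::topological_space set => 'x set => ('x => 'i lop) set monoid" where
 "Kgrp X D = Gam X D Mod Nul X D"

lemma group_Kgrp: "D <= X ==> group (Kgrp X D)"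
 unfolding Kgrp_def by (rule normal.factorgroup_is_group[OF normal_Nul])

lemma cls_closed: "a : carrier (Gam X D) ==> cls X D a : carrier (Kgrp X D)"
 by (auto simp: Kgrp_def cls_def FactGroup_def RCOSETS_def)

lemma cls_mult:
 assumes "D <= X" "a : carrier (Gam X D)" "b : carrier (Gam X D)"
 shows "cls X D (%x. a x * b x) = cls X D a \<otimes>\<^bsub>Kgrp X D\<^esub> cls X D b"
proof -
 have "cls X D a \<otimes>\<^bsub>Kgrp X D\<^esub> cls X D b = cls X D (a \<otimes>\<^bsub>Gam X D\<^esub> b)"
  unfolding cls_def Kgrp_def FactGroup_def using normal.rcos_sum[OF normal_Nul[OF assms(1)] assms(2,3)] by simp
 thus ?thesis by (simp add: Gam_def)
qed

lemma cls_one: "D <= X ==> cls X D (%x. 1) = \<one>\<^bsub>Kgrp X D\<^esub>"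
 unfolding cls_def Kgrp_def FactGroup_def
 using group.coset_mult_one[OF group_Gam normal_imp_subgroup[OF normal_Nul, THEN subgroup.subset], of D X]
 by (simp add: Gam_def)

lemma cls_one_iff:
 assumes "D <= X" "a : carrier (Gam X D)"
 shows "cls X D a = \<one>\<^bsub>Kgrp X D\<^esub> \<longleftrightarrow> null_fam X D a"
proof -
 have sub: "subgroup (Nul X D) (Gam X D)" by (rule normal_imp_subgroup[OF normal_Nul[OF assms(1)]])
 have "cls X D a = \<one>\<^bsub>Kgrp X D\<^esub> \<longleftrightarrow> a : Nul X D"
  unfolding cls_def Kgrp_def FactGroup_def
  using group.coset_join1[OF group_Gam _ assms(2) sub] group.coset_join2[OF group_Gam assms(2) sub] assms(2) by auto
 thus ?thesis using assms by (simp add: Nul_def)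
qed

lemma carrier_Kgrp: "c : carrier (Kgrp X D) ==> EX a:carrier (Gam X D). c = cls X D a"
 by (auto simp: Kgrp_def cls_def FactGroup_def RCOSETS_def)

text \<open>Multiplied by the inverse of its end, a homotopy becomes a null homotopy of the quotient
  of the two families.\<close>

lemma cls_eqI:
 assumes "D <= X" "a : carrier (Gam X D)" "b : carrier (Gam X D)"
  and "GLfam ({0..1::real} \<times> X) h" "!!x. x : X ==> h (0, x) = a x" "!!x. x : X ==> h (1, x) = b x"
   "!!s x. s : {0..1} ==> x : D ==> h (s, x) = 1"
 shows "cls X D a = cls X D b"
proof -
 interpret K: group "Kgrp X D" by (rule group_Kgrp[OF assms(1)])
 let ?b' = "inv\<^bsub>Gam X D\<^esub> b"
 have b': "?b' : carrier (Gam X D)" using group.inv_closed[OF group_Gam assms(3)] .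
 have "GLfam ({0..1::real} \<times> X) (%t. ?b' (snd t))"
  using b' by (auto simp: Gam_def intro!: GLfam_compose[of X] continuous_intros)
 hence g: "GLfam ({0..1::real} \<times> X) (%t. h t * ?b' (snd t))" by (intro GLfam_mult assms)
 have n: "null_fam X D (%x. a x * ?b' x)" unfolding null_fam_def
 proof (intro exI[of _ "%t. h t * ?b' (snd t)"] conjI g ballI, goal_cases)
  case (3 s x)
  hence "?b' x = 1" using b' by (simp add: Gam_def)
  thus ?case using assms(7) 3 by simp
 qed (use assms Gam_inv[OF assms(3)] in auto)
 have c: "(%x. a x * ?b' x) : carrier (Gam X D)" 
  using monoid.m_closed[OF group.is_monoid[OF group_Gam] assms(2) b'] by (simp add: Gam_def)
 have "cls X D a \<otimes>\<^bsub>Kgrp X D\<^esub> cls X D ?b' = \<one>\<^bsub>Kgrp X D\<^esub>"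
  using cls_one_iff[OF assms(1) c] n cls_mult[OF assms(1,2) b'] by simp
 moreover have "cls X D b \<otimes>\<^bsub>Kgrp X D\<^esub> cls X D ?b' = \<one>\<^bsub>Kgrp X D\<^esub>"
  unfolding cls_mult[OF assms(1,3) b', symmetric] Gam_inv[OF assms(3)] by (rule cls_one[OF assms(1)])
 ultimately show ?thesis using cls_closed assms b' by (metis K.right_cancel)
qed

text \<open>The path \<open>w s = (1 - s r)(1 + s q)(1 - s r)\<close> joins 1 to an invertible element that
  conjugates the corner of \<open>e\<close> to the corner of \<open>e'\<close>.\<close>

lemma cls_transport:
 fixes e e' q r :: "'i lop" and a :: "'x::topological_space => 'i lop"
 assumes DX: "D <= X" and a: "a : carrier (Gam X D)"
  and fin: "finite S" "supported S q" "supported S r"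
  and qr: "q * r = e'" "r * q = e" "q * q = 0" "r * r = 0" and ee: "q * e = q" "e * r = r"
  and ae: "!!x. x : X ==> e * (a x - 1) = a x - 1" "!!x. x : X ==> (a x - 1) * e = a x - 1"
 shows "(%x. 1 + q * (a x - 1) * r) : carrier (Gam X D)"
  and "cls X D a = cls X D (%x. 1 + q * (a x - 1) * r)"
proof -
 define w where "w s = (1 - scal s * r) * (1 + scal s * q) * (1 - scal s * r)" for s :: complex
 define w' where "w' s = (1 + scal s * r) * (1 - scal s * q) * (1 + scal s * r)" for s :: complex
 have p1: "(1 - scal s * r) * (1 + scal s * r) = 1" "(1 + scal s * r) * (1 - scal s * r) = 1"
   "(1 - scal s * q) * (1 + scal s * q) = 1" "(1 + scal s * q) * (1 - scal s * q) = 1" for s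
 proof -
  have z: "scal s * r * (scal s * r) = 0" "scal s * q * (scal s * q) = 0"
   using qr by (metis (no_types, lifting) mult.assoc mult_zero_right scal_commute)+
  show "(1 - scal s * r) * (1 + scal s * r) = 1" "(1 + scal s * r) * (1 - scal s * r) = 1"
   "(1 - scal s * q) * (1 + scal s * q) = 1" "(1 + scal s * q) * (1 - scal s * q) = 1"
   by (simp_all only: ring_distribs z) simp_all
 qed
 have ww': "w s * w' s = 1" "w' s * w s = 1" for s
 proof -
  have "w s * w' s = (1 - scal s * r) * (1 + scal s * q) * (1 - scal s * r) * ((1 + scal s * r) * ((1 - scal s * q) * (1 + scal s * r)))"
   by (simp only: w_def w'_def mult.assoc)
  also have "... = 1" by (intro unit_mult p1)
  finally show "w s * w' s = 1" .
  have "w' s * w s = (1 + scal s * r) * (1 - scal s * q) * (1 + scal s * r) * ((1 - scal s * r) * ((1 + scal s * q) * (1 - scal s * r)))"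
   by (simp only: w_def w'_def mult.assoc)
  also have "... = 1" by (intro unit_mult p1)
  finally show "w' s * w s = 1" .
 qed
 have fsq: "fsf Z (%t. q)" "fsf Z (%t. r)" for Z :: "(real \<times> 'x) set"
  using fin fsf_const by blast+
 let ?Z = "{0..1::real} \<times> X"
 have cs: "continuous_on ?Z (%t. complex_of_real (fst t))" by (intro continuous_intros)
 have sq: "fsf ?Z (%t. (1 + scal (of_real (fst t)) * q) - 1)" "fsf ?Z (%t. (1 + scal (of_real (fst t)) * r) - 1)"
   "fsf ?Z (%t. (1 - scal (of_real (fst t)) * q) - 1)" "fsf ?Z (%t. (1 - scal (of_real (fst t)) * r) - 1)"
  using fsf_scal[OF fsq(1) cs] fsf_scal[OF fsq(2) cs] fsf_uminus[OF fsf_scal[OF fsq(1) cs]] 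
   fsf_uminus[OF fsf_scal[OF fsq(2) cs]] by simp_all
 have GLw: "GLfam ?Z (%t. w (of_real (fst t)))" 
  by (rule GLfamI[of _ _ "%t. w' (of_real (fst t))"]) (simp_all only: ww', auto simp only: w_def w'_def intro!: fsf1_mult sq)
 have GLw': "GLfam ?Z (%t. w' (of_real (fst t)))" 
  by (rule GLfam_inv[OF GLw]) (simp add: ww')
 have GLa: "GLfam ?Z (%t. a (snd t))" using a by (auto simp: Gam_def intro!: GLfam_compose[of X] continuous_intros)
 define h where "h t = w (of_real (fst t)) * a (snd t) * w' (of_real (fst t))" for t
 have GLh: "GLfam ?Z h" unfolding h_def by (intro GLfam_mult GLw GLw' GLa)
 have w0: "w 0 = 1" "w' 0 = 1" by (simp_all add: w_def w'_def scal_simps)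
 have h0: "h (0, x) = a x" for x by (simp add: h_def w0)
 have h1: "h (1, x) = 1 + q * (a x - 1) * r" if "x : X" for x
 proof -
  define b where "b = a x - 1"
  have be: "e * b = b" "b * e = b" using ae that by (simp_all add: b_def)
  \<comment> \<open>Here \<open>b * q = b * r * q * q\<close> and
    \<open>r * b = r * r * q * b\<close>, and the squares vanish: \<open>b\<close> acts in the
    corner of \<open>e\<close>, which is orthogonal to the corner of \<open>e'\<close>.\<close>
  have b2: "b * q = 0" "r * b = 0" using be ee qr
   by (metis mult.assoc mult_zero_left mult_zero_right)+
  have rqb: "r * (q * b) = b" "b * r * q = b" "b * r * r = 0"
   by (simp_all only: mult.assoc[symmetric] qr be) (simp_all only: mult.assoc qr be mult_zero_right)
  have W: "w 1 * b = q * b" 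
  proof -
   have "(1 - r) * b = b" using b2 by (simp add: left_diff_distrib)
   moreover have "(1 - r) * (b + q * b) = q * b"
    by (simp add: left_diff_distrib distrib_left b2 rqb)
   ultimately show ?thesis by (simp add: w_def scal_simps mult.assoc distrib_right)
  qed
  have W': "b * w' 1 = b * r"
  proof -
   have "b * (1 + r) * (1 - q) = b * r"
    by (simp add: distrib_left distrib_right right_diff_distrib b2 rqb)
   hence "b * (1 + r) * (1 - q) * (1 + r) = b * r" by (simp add: distrib_left rqb)
   thus ?thesis by (simp add: w'_def scal_simps mult.assoc)
  qed
  have "h (1, x) = w 1 * (1 + b) * w' 1" by (simp add: h_def b_def)
  also have "... = w 1 * w' 1 + w 1 * b * w' 1" by (simp add: distrib_left distrib_right)
  also have "... = 1 + q * (b * w' 1)" by (simp add: ww' W mult.assoc)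
  finally have "h (1, x) = 1 + q * (b * r)" by (simp only: W')
  thus ?thesis by (simp add: b_def mult.assoc)
 qed
 have hD: "h (s, x) = 1" if "x : D" for s x using a that by (simp add: h_def Gam_def ww')
 let ?b = "%x. 1 + q * (a x - 1) * r"
 have "GLfam X (%x. h (1, x))" by (rule GLfam_compose[OF GLh]) (auto intro!: continuous_intros)
 hence "GLfam X ?b" by (rule GLfam_cong) (rule h1)
 thus b: "?b : carrier (Gam X D)" using a by (auto simp: Gam_def)
 show "cls X D a = cls X D ?b"
  by (rule cls_eqI[OF DX a b GLh h0 h1 hD])
qed


lift_definition pull_lop :: "'i set => ('i => 'i) => 'i lop" is
 "%S f u i. if i : S then u (f i) else 0"
proof (intro conjI CollectI allI, goal_cases)
 case (3 S f i)
 show ?case by (intro exI[of _ "{f i}"]) simp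
qed (simp_all add: fun_eq_iff)

lemma app_pull_lop [simp]: "app (pull_lop S f) u = (%i. if i : S then u (f i) else 0)"
 by (simp add: pull_lop.rep_eq)

lemma supported_pull_lop: assumes "S <= T" "f ` S <= T" shows "supported T (pull_lop S f)"
proof (rule supportedI)
 show "app (pull_lop S f) u = app (pull_lop S f) v" if "!!k. k : T ==> u k = v k" for u v
  using that assms by (auto simp: fun_eq_iff image_subset_iff)
qed (use assms in auto)

lemma supported_proj:
 assumes "supported S f" shows "pull_lop S id * f = f" "f * pull_lop S id = f"
proof -
 show "pull_lop S id * f = f"
  by (rule lop_appI) (use supported_outside[OF assms] in auto)
 show "f * pull_lop S id = f"
  by (rule lop_appI) (auto intro!: fun_cong[OF supported_dep[OF assms]])
qed

text \<open>In an infinite index set one factor can be transported to a finite block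
  \<open>T\<close> disjoint from a common support \<open>S\<close> of both, and operators living in
  disjoint blocks commute.\<close>

lemma comm_group_Kgrp:
 fixes X D :: "'x::topological_space set"
 assumes DX: "D <= X" and inf: "infinite (UNIV :: 'i set)"
 shows "comm_group (Kgrp X D :: ('x => 'i lop) set monoid)"
proof -
 interpret K: group "Kgrp X D :: ('x => 'i lop) set monoid" by (rule group_Kgrp[OF DX])
 show ?thesis
 proof (rule K.group_comm_groupI)
  fix A B :: "('x => 'i lop) set" assume "A : carrier (Kgrp X D)" "B : carrier (Kgrp X D)"
  then obtain a b where a: "a : carrier (Gam X D)" "A = cls X D a"
   and b: "b : carrier (Gam X D)" "B = cls X D b" using carrier_Kgrp by metis
  obtain S where S: "finite S" "!!x. x : X ==> supported S (a x - 1)" "!!x. x : X ==> supported S (b x - 1)"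
   using fsf_common[of X "%x. a x - 1" "%x. b x - 1"] a b by (auto simp: Gam_def GLfam_def)
  have "infinite (UNIV - S)" using S(1) inf by simp
  then obtain T where T: "T <= UNIV - S" "finite T" "card T = card S"
   by (meson infinite_arbitrarily_large)
  then obtain \<phi> where phi: "bij_betw \<phi> S T" using S(1) by (metis finite_same_card_bij)
  define \<psi> where "\<psi> = inv_into S \<phi>"
  have ps: "!!i. i : S ==> \<psi> (\<phi> i) = i" "!!i. i : T ==> \<phi> (\<psi> i) = i" 
   "!!i. i : S ==> \<phi> i : T" "!!i. i : T ==> \<psi> i : S" "!!i. i : T ==> i ~: S" "!!i. i : S ==> i ~: T"
   using phi T(1) bij_betw_inv_into_left[OF phi] bij_betw_inv_into_right[OF phi] bij_betwE[OF phi] bij_betwE[OF bij_betw_inv_into[OF phi]]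
   by (auto simp: \<psi>_def)
  define q r e e' where "q = pull_lop T \<psi>" and "r = pull_lop S \<phi>" and "e = pull_lop S id" and "e' = pull_lop T id"
  note qd = q_def r_def e_def e'_def
  have al: "q * r = e'" "r * q = e" "q * q = 0" "r * r = 0" "q * e = q" "e * r = r" "e * q = 0" "r * e = 0"
   by (rule lop_appI; use ps in \<open>simp add: qd\<close>)+
  have fin: "finite (S \<union> T)" "supported (S \<union> T) q" "supported (S \<union> T) r"
   using S T ps by (auto simp: qd intro!: supported_pull_lop)
  have ae: "e * (a x - 1) = a x - 1" "(a x - 1) * e = a x - 1" "e * (b x - 1) = b x - 1" "(b x - 1) * e = b x - 1"
   if "x : X" for x using supported_proj[OF S(2)[OF that]] supported_proj[OF S(3)[OF that]] by (simp_all add: qd)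
  let ?b = "%x. 1 + q * (b x - 1) * r"
  have b': "?b : carrier (Gam X D)" "cls X D b = cls X D ?b"
   by (rule cls_transport[OF DX b(1) fin al(1-6) ae(3,4)]; assumption)+
  have comm: "a x * ?b x = ?b x * a x" for x
  proof (cases "x : X")
   case True
   have z: "(a x - 1) * q = 0" "r * (a x - 1) = 0"
    using ae(1,2)[OF True] al(7,8) by (metis mult.assoc mult_zero_right mult_zero_left)+
   define M where "M = q * (b x - 1) * r"
   have "(a x - 1) * M = 0" "M * (a x - 1) = 0"
    unfolding M_def by (simp_all only: mult.assoc z mult_zero_right) (simp only: mult.assoc[symmetric] z mult_zero_left)
   hence "a x * M = M" "M * a x = M"
    by (simp_all add: left_diff_distrib right_diff_distrib)
   hence "a x * (1 + M) = (1 + M) * a x" by (simp add: distrib_left distrib_right)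
   thus ?thesis by (simp only: M_def)
  qed (use a in \<open>simp add: Gam_def\<close>)
  show "A \<otimes>\<^bsub>Kgrp X D\<^esub> B = B \<otimes>\<^bsub>Kgrp X D\<^esub> A"
   using cls_mult[OF DX a(1) b'(1)] cls_mult[OF DX b'(1) a(1)] by (simp add: a b b'(2) comm)
 qed
qed

section \<open>Operators on a product index set\<close>

text \<open>Acts on the second component of a pair and treats the first as a parameter, whereas
  \<open>rf\<close> does the opposite; thus \<open>rf f * lf X\<close> is the tensor product of
  \<open>f\<close> and \<open>X\<close>. In the applications the first component is a sample point
  of the sphere and the second a list of tensor indices.\<close>

lift_definition lf :: "'b lop => ('a \<times> 'b) lop" is
 "%X u w. X (%l. u (fst w, l)) (snd w)"
proof (intro conjI CollectI allI, goal_cases)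
 case (3 X w)
 then obtain S where S: "finite S" "!!u v. (ALL k:S. u k = v k) ==> X u (snd w) = X v (snd w)" by blast
 show ?case
  by (intro exI[of _ "{fst w} \<times> S"] conjI allI impI S(2)) (use S(1) in auto)
qed auto

lift_definition rf :: "'a lop => ('a \<times> 'b) lop" is
 "%X u w. X (%l. u (l, snd w)) (fst w)"
proof (intro conjI CollectI allI, goal_cases)
 case (3 X w)
 then obtain S where S: "finite S" "!!u v. (ALL k:S. u k = v k) ==> X u (fst w) = X v (fst w)" by blast
 show ?case
  by (intro exI[of _ "S \<times> {snd w}"] conjI allI impI S(2)) (use S(1) in auto)
qed auto

lemma app_lf [simp]: "app (lf X) u w = app X (%l. u (fst w, l)) (snd w)"
 by (simp add: lf.rep_eq)

lemma app_rf [simp]: "app (rf X) u w = app X (%l. u (l, snd w)) (fst w)"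
 by (simp add: rf.rep_eq)

lemma lf_ring: "lf 0 = 0" "lf 1 = 1" "lf (f + g) = lf f + lf g" "lf (f - g) = lf f - lf g" "lf (- f) = - lf f"
 "lf (f * g) = lf f * lf g" "lf (scal c) = scal c"
 by (rule lop_appI; simp)+

lemma rf_ring: "rf 0 = 0" "rf 1 = 1" "rf (f + g) = rf f + rf g" "rf (f - g) = rf f - rf g" "rf (- f) = - rf f"
 "rf (f * g) = rf f * rf g" "rf (scal c) = scal c"
 by (rule lop_appI; simp)+

lemma lf_sum: "lf (SUM j:J. f j) = (SUM j:J. lf (f j))"
 by (induction J rule: infinite_finite_induct) (auto simp: lf_ring)

lemma rf_sum: "rf (SUM j:J. f j) = (SUM j:J. rf (f j))"
 by (induction J rule: infinite_finite_induct) (auto simp: rf_ring)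

text \<open>A row of \<open>X\<close> is a finite combination of inputs, and \<open>f\<close> is
  linear.\<close>

lemma lf_rf_commute: "lf (X :: 'a lop) * rf (f :: 'b lop) = rf f * lf X"
proof (rule lop_appI)
 fix u :: "'b \<times> 'a => complex" and w :: "'b \<times> 'a"
 obtain S where S: "finite S" "ALL u v. (ALL k:S. u k = v k) --> app X u (snd w) = app X v (snd w)"
  using app_finite_dep[of X "snd w"] by (elim exE conjE)
 have e: "app X v (snd w) = (SUM k:S. ent X (snd w) k * v k)" for v
  by (rule app_expand[OF S(1)]) (rule S(2)[THEN spec, THEN spec, THEN mp])
 show "app (lf X * rf f) u w = app (rf f * lf X) u w"
  by (simp add: e app_sum app_scale)
qed

lemma ent_rf_lf: "ent (rf f * lf X) w w' = ent f (fst w) (fst w') * ent X (snd w) (snd w')"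
proof -
 have 1: "(%l. delta w' (p, l)) = (%l. delta (fst w') p * delta (snd w') l)" for p
  by (auto simp: delta_def fun_eq_iff prod_eq_iff)
 have "ent (rf f * lf X) w w' = app f (%p. delta (fst w') p * ent X (snd w) (snd w')) (fst w)"
  by (simp add: ent_def 1 app_scale)
 also have "... = app f (%p. ent X (snd w) (snd w') * delta (fst w') p) (fst w)" by (simp add: mult.commute)
 finally show ?thesis by (simp add: app_scale ent_def)
qed

lemma supported_rf_lf:
 assumes "finite W" "supported W f" "finite L" "supported L X"
 shows "supported (W \<times> L) (rf f * lf X)"
 unfolding supported_iff_ent[OF finite_cartesian_product[OF assms(1,3)]] ent_rf_lf
 using ent_unsupported[OF assms(2)] ent_unsupported[OF assms(4)] by (auto simp: mem_Times_iff)

lemma fsf_rf_lf: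
 assumes "fsf T f" "fsf T X" shows "fsf T (%t. rf (f t) * lf (X t))"
proof -
 obtain W L where "finite W" "ALL t:T. supported W (f t)" "finite L" "ALL t:T. supported L (X t)"
  using assms unfolding fsf_def by blast
 thus ?thesis using assms unfolding fsf_def ent_rf_lf
  by (auto intro!: continuous_intros exI[of _ "W \<times> L"] supported_rf_lf)
qed

section \<open>Exterior powers as antisymmetric functions on lists\<close>

text \<open>Unfolded, the recursion is the alternating sum, over all positions of the list that hold
  \<open>i\<close>, of \<open>u\<close> at the list with that position deleted. This is exterior
  multiplication by the \<open>i\<close>-th basis vector without a normalizing factorial, and it
  makes sense on all tensors, antisymmetric or not.\<close>

primrec creF :: "'m list => 'm => ('m list => complex) => complex" where
 "creF [] i u = 0"
| "creF (j # l) i u = (if i = j then u l else 0) - creF l i (%l'. u (j # l'))"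

lift_definition cre :: "'m => 'm list lop" is "%i u l. creF l i u"
proof (intro conjI CollectI allI, goal_cases)
 case (1 i u v)
 have "creF l i (%k. u k + v k) = creF l i u + creF l i v" for l
  by (induction l arbitrary: u v) auto
 thus ?case by simp
next
 case (2 i c u)
 have "creF l i (%k. c * u k) = c * creF l i u" for l
  by (induction l arbitrary: u) (auto simp: algebra_simps)
 thus ?case by simp
next
 case (3 i l)
 show ?case
 proof (induction l)
  case (Cons j l)
  then obtain S where S: "finite S" "!!u v. (ALL k:S. u k = v k) ==> creF l i u = creF l i v" by blast
  show ?case
  proof (intro exI[of _ "insert l (Cons j ` S)"] conjI allI impI)
   fix u v :: "'m list => complex" assume *: "ALL k:insert l (Cons j ` S). u k = v k"
   have "creF l i (%l'. u (j # l')) = creF l i (%l'. v (j # l'))" by (rule S(2)) (use * in auto)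
   thus "creF (j # l) i u = creF (j # l) i v" using * by simp
  qed (use S in auto)
 qed auto
qed

lift_definition ann :: "'m => 'm list lop" is "%i u l. u (i # l)"
proof (intro conjI CollectI allI, goal_cases)
 case (3 i l)
 show ?case by (intro exI[of _ "{i # l}"]) simp
qed auto

text \<open>All tensor powers of \<open>A\<close> at once, one for each list length.\<close>

primrec tensF :: "'m::finite list => complex ^ 'm ^ 'm => ('m list => complex) => complex" where
 "tensF [] A u = u []"
| "tensF (j # l) A u = (SUM i:UNIV. A $ j $ i * tensF l A (%l'. u (i # l')))"

lift_definition tens :: "complex ^ 'm ^ 'm => 'm::finite list lop" is "%A u l. tensF l A u"
proof (intro conjI CollectI allI, goal_cases)
 case (1 A u v)
 have "tensF l A (%k. u k + v k) = tensF l A u + tensF l A v" for l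
  by (induction l arbitrary: u v) (auto simp: algebra_simps sum.distrib)
 thus ?case by simp
next
 case (2 A c u)
 have "tensF l A (%k. c * u k) = c * tensF l A u" for l
  by (induction l arbitrary: u) (auto simp: sum_distrib_left mult.left_commute)
 thus ?case by simp
next
 case (3 A l)
 show ?case
 proof (induction l)
  case (Cons j l)
  then obtain S where S: "finite S" "!!u v. (ALL k:S. u k = v k) ==> tensF l A u = tensF l A v" by blast
  show ?case
  proof (intro exI[of _ "\<Union>i. Cons i ` S"] conjI allI impI)
   fix u v :: "'m list => complex" assume *: "ALL k:(\<Union>i. Cons i ` S). u k = v k"
   have "tensF l A (%l'. u (i # l')) = tensF l A (%l'. v (i # l'))" for i by (rule S(2)) (use * in auto)
   thus "tensF (j # l) A u = tensF (j # l) A v" by simp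
  qed (use S in auto)
 qed (auto intro: exI[of _ "{[]}"])
qed

lemma app_ann [simp]: "app (ann i) u = (%l. u (i # l))" by (simp add: ann.rep_eq)
lemma app_cre [simp]: "app (cre i) u [] = 0"
 "app (cre i) u (j # l) = (if i = j then u l else 0) - app (cre i) (%l. u (j # l)) l"
 by (simp_all add: cre.rep_eq)
lemma app_tens [simp]: "app (tens A) u [] = u []"
 "app (tens A) u (j # l) = (SUM i:UNIV. A $ j $ i * app (tens A) (%l. u (i # l)) l)"
 by (simp_all add: tens.rep_eq)

lemma app_Cons: "app X u (j # l) = app (ann j * X) u l" by simp

text \<open>A tensor is known from its scalar part and its contractions. Together with the rules for
  moving \<open>ann j\<close> to the right this turns operator identities into inductions on the
  list.\<close>

lemma list_lop_eqI:
 assumes "!!u. app X u [] = app Y u []" "!!u j l. app (ann j * X) u l = app (ann j * Y) u l"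
 shows "X = Y"
proof (rule lop_appI)
 fix u l show "app X u l = app Y u l"
  by (cases l) (use assms in auto)
qed

text \<open>The canonical anticommutation relation. It holds on all tensors, being nothing but the
  recursion of \<open>creF\<close> read at the head of a list.\<close>

lemma ann_cre: "ann j * cre i = (if i = j then 1 else 0) - cre i * ann j"
 by (rule lop_appI) simp

lemma ann_cre_left: "ann j * (cre i * X) = (if i = j then X else 0) - cre i * (ann j * X)"
proof -
 have "ann j * (cre i * X) = (ann j * cre i) * X" by (simp only: mult.assoc)
 thus ?thesis by (simp add: ann_cre left_diff_distrib mult.assoc)
qed

lemma ann_tens: "ann j * tens A = (SUM i:UNIV. scal (A $ j $ i) * (tens A * ann i))"
 by (rule lop_appI) simp

text \<open>The delta terms cancel, so the anticommutator of two creations commutes with every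
  \<open>ann j\<close>; on the empty list it is zero.\<close>

lemma cre_anticommute: "cre i * cre k + cre k * cre i = 0"
proof (rule lop_appI)
 fix u l show "app (cre i * cre k + cre k * cre i) u l = app 0 u l"
 proof (induction l arbitrary: u)
  case (Cons j l)
  have "ann j * (cre i * cre k + cre k * cre i) = (ann j * cre i) * cre k + (ann j * cre k) * cre i"
   by (simp add: distrib_left mult.assoc)
  also have "... = (if i = j then cre k else 0) - cre i * (ann j * cre k)
    + ((if k = j then cre i else 0) - cre k * (ann j * cre i))"
   by (simp add: ann_cre left_diff_distrib mult.assoc)
  also have "... = (cre i * cre k + cre k * cre i) * ann j"
   by (simp add: ann_cre right_diff_distrib distrib_right mult.assoc)
  finally have *: "ann j * (cre i * cre k + cre k * cre i) = (cre i * cre k + cre k * cre i) * ann j" .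
  show ?case unfolding app_Cons * using Cons[of "app (ann j) u"] by simp
 qed auto
qed

text \<open>Naturality of exterior multiplication: the \<open>k\<close>-th basis vector goes to
  column \<open>k\<close> of \<open>A\<close>. Both sides obey the same rule for moving
  \<open>ann j\<close> to the right, so the list induction closes.\<close>

lemma tens_cre: "tens A * cre k = (SUM i:UNIV. scal (A $ i $ k) * (cre i * tens A))"
proof (rule lop_appI)
 fix u l show "app (tens A * cre k) u l = app (SUM i:UNIV. scal (A $ i $ k) * (cre i * tens A)) u l"
 proof (induction l arbitrary: u)
  case (Cons j l)
  have "ann j * (tens A * cre k) = (SUM i:UNIV. scal (A $ j $ i) * (tens A * (ann i * cre k)))"
   by (simp add: mult.assoc[symmetric] ann_tens sum_distrib_right)
  also have "... = (SUM i:UNIV. (if i = k then scal (A $ j $ k) * tens A else 0) - scal (A $ j $ i) * (tens A * cre k * ann i))"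
  proof (rule sum.cong[OF refl])
   fix i show "scal (A $ j $ i) * (tens A * (ann i * cre k)) = 
     (if i = k then scal (A $ j $ k) * tens A else 0) - scal (A $ j $ i) * (tens A * cre k * ann i)"
    by (cases "i = k") (simp_all add: ann_cre right_diff_distrib mult.assoc)
  qed
  finally have 1: "ann j * (tens A * cre k) = scal (A $ j $ k) * tens A -
    (SUM i:UNIV. scal (A $ j $ i) * (tens A * cre k * ann i))" by (simp add: sum_subtractf)
  have "ann j * (SUM i:UNIV. scal (A $ i $ k) * (cre i * tens A))
    = (SUM i:UNIV. scal (A $ i $ k) * (ann j * (cre i * tens A)))"
   by (simp add: sum_distrib_left scal_left_commute)
  also have "... = (SUM i:UNIV. (if i = j then scal (A $ j $ k) * tens A else 0) -
    scal (A $ i $ k) * (cre i * (ann j * tens A)))"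
  proof (rule sum.cong[OF refl])
   fix i show "scal (A $ i $ k) * (ann j * (cre i * tens A)) = 
     (if i = j then scal (A $ j $ k) * tens A else 0) - scal (A $ i $ k) * (cre i * (ann j * tens A))"
    by (cases "i = j") (simp_all add: ann_cre_left right_diff_distrib)
  qed
  finally have 2: "ann j * (SUM i:UNIV. scal (A $ i $ k) * (cre i * tens A)) = scal (A $ j $ k) * tens A
    - (SUM i:UNIV. scal (A $ i $ k) * (cre i * (ann j * tens A)))" by (simp add: sum_subtractf)
  have "(SUM i:UNIV. A $ j $ i * app (tens A * cre k) (app (ann i) u) l)
    = (SUM i:UNIV. A $ j $ i * (SUM i':UNIV. A $ i' $ k * app (cre i' * tens A) (app (ann i) u) l))"
   unfolding Cons by simp
  also have "... = (SUM i':UNIV. A $ i' $ k * (SUM i:UNIV. A $ j $ i * app (cre i' * tens A) (app (ann i) u) l))"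
   unfolding sum_distrib_left by (subst sum.swap) (simp add: mult.left_commute)
  also have "... = (SUM i':UNIV. A $ i' $ k * app (cre i' * (ann j * tens A)) u l)"
   unfolding ann_tens by (simp add: app_sum app_scale del: app_ann)
  finally show ?case unfolding app_Cons 1 2 by (simp del: app_ann)
 qed auto
qed

lemma tens_mult: "tens (A ** B) = tens A * tens B"
proof (rule lop_appI)
 fix u l show "app (tens (A ** B)) u l = app (tens A * tens B) u l"
 proof (induction l arbitrary: u)
  case (Cons j l)
  have tt: "tens A * (ann i * tens B) = (SUM k:UNIV. scal (B $ i $ k) * (tens A * tens B * ann k))" for i
   by (simp add: ann_tens sum_distrib_left scal_left_commute mult.assoc)
  have tt': "app (tens A) (%l. app (tens B) u (i # l)) l = (SUM k:UNIV. B $ i $ k * app (tens A * tens B) (app (ann k) u) l)" for i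
   using arg_cong[OF tt[of i], of "%X. app X u l"] by simp
  have "app (tens (A ** B)) u (j # l) = (SUM k:UNIV. (SUM i:UNIV. A $ j $ i * B $ i $ k) * app (tens A * tens B) (app (ann k) u) l)"
   using Cons by (simp add: matrix_matrix_mult_def)
  also have "... = (SUM i:UNIV. A $ j $ i * (SUM k:UNIV. B $ i $ k * app (tens A * tens B) (app (ann k) u) l))"
   unfolding sum_distrib_left sum_distrib_right by (subst sum.swap) (simp add: mult.assoc)
  also have "... = (SUM i:UNIV. A $ j $ i * app (tens A) (%l. app (tens B) u (i # l)) l)"
   unfolding tt' ..
  finally show ?case by (simp only: app_tens app_ring)
 qed auto
qed

lemma tens_mat_1: "tens (mat 1 :: complex^'a::finite^'a) = 1"
proof (rule lop_appI)
 fix u :: "'a list => complex" and l show "app (tens (mat 1)) u l = app 1 u l"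
 proof (induction l arbitrary: u)
  case (Cons j l)
  have "(mat 1 :: complex^'a^'a) $ j $ i * c = (if j = i then c else 0)" for i c by (simp add: mat_def)
  thus ?case using Cons by simp
 qed auto
qed

section \<open>Degrees, antisymmetric tensors and the projections onto them\<close>

definition degp :: "nat => 'm list lop" where "degp p = pull_lop {l. length l = p} id"

lemma app_degp [simp]: "app (degp p) u = (%l. if length l = p then u l else 0)"
 by (simp add: degp_def cong: if_cong)

lemma degp_mult: "degp p * degp q = (if p = q then degp p else 0)"
 by (rule lop_appI) auto

lemma ann_degp: "ann i * degp (Suc p) = degp p * ann i" "ann i * degp 0 = 0"
 by (rule lop_appI; simp)+

lemma cre_degp: "cre i * degp p = degp (Suc p) * cre i"
proof (rule lop_appI)
 fix u l show "app (cre i * degp p) u l = app (degp (Suc p) * cre i) u l"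
 proof (induction l arbitrary: u p)
  case (Cons j l)
  show ?case
  proof (cases p)
   case 0
   thus ?thesis by (cases l) simp_all
  next
   case (Suc q)
   show ?thesis using Cons[of q "%l. u (j # l)"] by (simp add: Suc)
  qed
 qed auto
qed

lemma tens_degp: "tens A * degp p = degp p * tens A"
proof (rule lop_appI)
 fix u l show "app (tens A * degp p) u l = app (degp p * tens A) u l"
 proof (induction l arbitrary: u p)
  case (Cons j l)
  show ?case
  proof (cases p)
   case (Suc q)
   show ?thesis using Cons[of q "%l. u (_ # l)"] by (simp add: Suc)
  qed simp
 qed auto
qed

text \<open>Says that the range of \<open>X\<close> consists of antisymmetric tensors of degree
  \<open>p\<close>: antisymmetry in the first two slots, demanded again after every contraction,
  covers all adjacent transpositions. As a property of an operator's range it is inherited by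
  products \<open>X * Y\<close>.\<close>

primrec alternating :: "nat => 'm list lop => bool" where
 "alternating 0 X \<longleftrightarrow> degp 0 * X = X"
| "alternating (Suc p) X \<longleftrightarrow> degp (Suc p) * X = X & (ALL i k. ann i * (ann k * X) + ann k * (ann i * X) = 0) & (ALL i. alternating p (ann i * X))"

lemma alternating_degp: "alternating p X ==> degp p * X = X" by (cases p) auto

lemma alternating_ann_0: assumes "alternating 0 X" shows "ann i * X = 0"
proof -
 have "ann i * X = ann i * degp 0 * X" using alternating_degp[OF assms] by (simp add: mult.assoc)
 thus ?thesis by (simp add: ann_degp)
qed

lemma alternating_ann_ann: assumes "alternating p X" shows "ann i * (ann k * X) + ann k * (ann i * X) = 0"
proof (cases p)
 case 0
 show ?thesis by (simp add: alternating_ann_0[OF assms[unfolded 0]])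
qed (use assms in simp)

lemma alternating_ann: assumes "alternating p X" shows "ann i * (ann k * X) = - (ann k * (ann i * X))"
 using alternating_ann_ann[OF assms, of i k] by (simp only: eq_neg_iff_add_eq_0)

lemma alternating_SucD: "alternating (Suc p) X ==> alternating p (ann i * X)" by simp

lemma alternating_add: "alternating p X ==> alternating p Y ==> alternating p (X + Y)"
proof (induction p arbitrary: X Y)
 case (Suc p)
 have "ann i * (ann k * (X + Y)) + ann k * (ann i * (X + Y)) =
   (ann i * (ann k * X) + ann k * (ann i * X)) + (ann i * (ann k * Y) + ann k * (ann i * Y))" for i k
  by (simp add: distrib_left)
 hence "ann i * (ann k * (X + Y)) + ann k * (ann i * (X + Y)) = 0" for i k
  by (simp only: alternating_ann_ann[OF Suc.prems(1)] alternating_ann_ann[OF Suc.prems(2)] add_0)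
 moreover have "alternating p (ann i * (X + Y))" for i
  unfolding distrib_left by (intro Suc.IH alternating_SucD Suc.prems)
 moreover have "degp (Suc p) * (X + Y) = X + Y"
  by (simp only: distrib_left alternating_degp[OF Suc.prems(1)] alternating_degp[OF Suc.prems(2)])
 ultimately show ?case unfolding alternating.simps(2) by blast
qed (simp add: distrib_left)

lemma alternating_0: "alternating p 0" by (induction p) auto

lemma alternating_mult: "alternating p X ==> alternating p (X * Y)"
proof (induction p arbitrary: X)
 case (Suc p)
 have "ann i * (ann k * (X * Y)) + ann k * (ann i * (X * Y)) = (ann i * (ann k * X) + ann k * (ann i * X)) * Y" for i k
  by (simp only: mult.assoc distrib_right)
 moreover have "alternating p (ann i * (X * Y))" for i using Suc.IH[OF alternating_SucD[OF Suc.prems, of i]] by (simp only: mult.assoc)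
 moreover have "degp (Suc p) * (X * Y) = degp (Suc p) * X * Y" by (simp only: mult.assoc)
 ultimately show ?case using Suc.prems by simp
next
 case 0
 have "degp 0 * (X * Y) = degp 0 * X * Y" by (simp only: mult.assoc)
 thus ?case using 0 by simp
qed

lemma alternating_uminus: assumes "alternating p X" shows "alternating p (- X)"
 using alternating_mult[OF assms, of "- 1"] by simp

lemma alternating_diff: assumes "alternating p X" "alternating p Y" shows "alternating p (X - Y)"
 using alternating_add[OF assms(1) alternating_uminus[OF assms(2)]] by simp

lemma alternating_scal: "alternating p X ==> alternating p (scal c * X)"
 using alternating_mult[of p X "scal c"] by (simp only: scal_commute)

lemma alternating_sum: "(!!j. j : J ==> alternating p (X j)) ==> alternating p (SUM j:J. X j)"
 by (induction J rule: infinite_finite_induct) (auto intro: alternating_add alternating_0)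

lemma alternating_cre: "alternating p X ==> alternating (Suc p) (cre i * X)"
proof (induction p arbitrary: X)
 case (0 X)
 have a0: "ann j * X = 0" for j using alternating_ann_0[OF 0] .
 have "degp (Suc 0) * (cre i * X) = cre i * (degp 0 * X)" by (simp only: mult.assoc[symmetric] cre_degp[symmetric])
 thus ?case using 0 by (simp add: ann_cre_left a0)
next
 case (Suc p X)
 have "degp (Suc (Suc p)) * (cre i * X) = cre i * (degp (Suc p) * X)" by (simp only: mult.assoc[symmetric] cre_degp[symmetric])
 hence "degp (Suc (Suc p)) * (cre i * X) = cre i * X" by (simp only: alternating_degp[OF Suc.prems])
 moreover have "ann k * (ann j * (cre i * X)) + ann j * (ann k * (cre i * X)) = 0" for j k
 proof -
  have "ann k * (ann j * (cre i * X)) + ann j * (ann k * (cre i * X)) = cre i * (ann k * (ann j * X) + ann j * (ann k * X))"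
   by (simp add: ann_cre_left right_diff_distrib distrib_left)
  thus ?thesis by (simp only: alternating_ann_ann[OF Suc.prems] mult_zero_right)
 qed
 moreover have "alternating (Suc p) (ann j * (cre i * X))" for j
 proof -
  have "alternating (Suc p) (if i = j then X else 0)" using Suc.prems alternating_0[of "Suc p"]
   by (cases "i = j") (simp_all del: alternating.simps)
  thus ?thesis unfolding ann_cre_left by (rule alternating_diff) (rule Suc.IH[OF alternating_SucD[OF Suc.prems]])
 qed
 ultimately show ?case unfolding alternating.simps(2)[of "Suc p"] by blast
qed

text \<open>The number operator returns the degree. In the induction, moving \<open>ann j\<close>
  across the sum leaves one copy of \<open>ann j * X\<close>, from the anticommutation relation, and
  the same sum for \<open>ann j * X\<close>, whose degree is one lower.\<close>

lemma alternating_number: "alternating p X ==> (SUM i:(UNIV::'m::finite set). cre i * (ann i * X)) = scal (of_nat p) * X"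
proof (induction p arbitrary: X)
 case (0 X)
 show ?case using alternating_ann_0[OF 0] by (simp add: scal_simps)
next
 case (Suc p X)
 let ?L = "SUM i:(UNIV::'m set). cre i * (ann i * X)"
 have l: "ann j * ?L = ann j * (scal (of_nat (Suc p)) * X)" for j
 proof -
  have 1: "ann j * (cre i * (ann i * X)) = (if i = j then ann j * X else 0) + cre i * (ann i * (ann j * X))" for i
  proof -
   have e: "ann j * (ann i * X) = - (ann i * (ann j * X))" by (rule alternating_ann[OF Suc.prems])
   show ?thesis unfolding ann_cre_left e by simp
  qed
  have "ann j * ?L = ann j * X + (SUM i:UNIV. cre i * (ann i * (ann j * X)))"
   unfolding sum_distrib_left 1 sum.distrib by simp
  also have "... = ann j * X + scal (of_nat p) * (ann j * X)" by (simp only: Suc.IH[OF alternating_SucD[OF Suc.prems]])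
  finally show ?thesis by (simp add: scal_simps distrib_right distrib_left scal_left_commute)
 qed
 have "app X u [] = 0" for u
 proof -
  have "app X u [] = app (degp (Suc p) * X) u []" by (simp only: alternating_degp[OF Suc.prems])
  thus ?thesis by simp
 qed
 thus ?case by (intro list_lop_eqI) (simp, simp only: l)
qed

lemma alternating_deg0: assumes "alternating 0 X" shows "app X u (a # l) = 0"
proof -
 have "app X u (a # l) = app (degp 0 * X) u (a # l)" by (simp only: alternating_degp[OF assms])
 thus ?thesis by simp
qed

lemma alternating_not_distinct_aux: "alternating p X ==> a : set l ==> app X u (a # l) = 0"
proof (induction l arbitrary: p X)
 case (Cons b l)
 have "app X u (a # b # l) = app (ann b * (ann a * X)) u l" by simp
 also have "... = - app (ann b * X) u (a # l)" unfolding alternating_ann[OF Cons.prems(1), of b a] by simp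
 finally have *: "app X u (a # b # l) = - app (ann b * X) u (a # l)" .
 show ?case
 proof (cases p)
  case 0
  show ?thesis by (rule alternating_deg0[OF Cons.prems(1)[unfolded 0]])
 next
  case (Suc q)
  have "app (ann b * X) u (a # l) = 0" if "a ~= b"
   by (rule Cons.IH[OF alternating_SucD]) (use Cons.prems Suc that in auto)
  thus ?thesis using * by (cases "a = b") auto
 qed
qed auto

lemma alternating_not_distinct: "alternating p X ==> ~ distinct l ==> app X u l = 0"
proof (induction l arbitrary: p X)
 case (Cons a l)
 show ?case
 proof (cases "a : set l")
  case True
  show ?thesis by (rule alternating_not_distinct_aux[OF Cons.prems(1) True])
 next
  case False
  show ?thesis
  proof (cases p)
   case 0
   show ?thesis by (rule alternating_deg0[OF Cons.prems(1)[unfolded 0]])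
  next
   case (Suc q)
   have "app (ann a * X) u l = 0"
    by (rule Cons.IH[OF alternating_SucD]) (use Cons.prems Suc False in auto)
   thus ?thesis by simp
  qed
 qed
qed auto

text \<open>A list longer than the number of indices repeats one of them, and antisymmetric tensors
  vanish at repeated indices.\<close>

lemma alternating_too_long:
 fixes X :: "'m::finite list lop"
 assumes "alternating p X" "CARD('m) < p" shows "X = 0"
proof (rule lop_appI)
 fix u l
 show "app X u l = app 0 u l"
 proof (cases "length l = p")
  case True
  have "~ distinct l"
  proof
   assume "distinct l"
   hence "length l <= CARD('m)" using distinct_card[of l] card_mono[of UNIV "set l"] by simp
   thus False using True assms by simp
  qed
  thus ?thesis using alternating_not_distinct[OF assms(1)] by simp
 next
  case False
  have "app X u l = app (degp p * X) u l" using alternating_degp[OF assms(1)] by simp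
  thus ?thesis using False by simp
 qed
qed

text \<open>The number operator divided by the degree, with the projection of lower degree inserted.
  By \<open>alternating_number\<close> it fixes antisymmetric tensors, and by
  \<open>alternating_cre\<close> its range is antisymmetric, so it is the antisymmetrization without
  any sum over permutations.\<close>

primrec alt :: "nat => 'm::finite list lop" where
 "alt 0 = degp 0"
| "alt (Suc p) = scal (1 / of_nat (Suc p)) * (SUM i:UNIV. cre i * (alt p * ann i))"

lemma alternating_alt: "alternating p (alt p :: 'm::finite list lop)"
proof (induction p)
 case (Suc p)
 have "alternating (Suc p) (cre i * ((alt p :: 'm list lop) * ann i))" for i by (intro alternating_cre alternating_mult Suc)
 thus ?case unfolding alt.simps by (intro alternating_scal alternating_sum)
qed (simp add: degp_mult)

lemma alt_alternating: "alternating p X ==> alt p * X = X"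
proof (induction p arbitrary: X)
 case (Suc p)
 have "alt (Suc p) * X = scal (1 / of_nat (Suc p)) * (SUM i:UNIV. cre i * (alt p * (ann i * X)))"
  by (simp add: mult.assoc sum_distrib_right)
 also have "... = scal (1 / of_nat (Suc p)) * (scal (of_nat (Suc p)) * X)"
  using Suc alternating_number[OF Suc.prems] by simp
 also have "... = scal (1 / of_nat (Suc p) * of_nat (Suc p)) * X" by (simp only: scal_simps mult.assoc)
 also have "1 / of_nat (Suc p) * of_nat (Suc p) = (1::complex)" using of_nat_neq_0[of p] by (simp del: of_nat_Suc)
 finally show ?case by (simp add: scal_simps)
qed simp

lemma alt_degp: "degp p * (alt p :: 'm::finite list lop) = alt p" "alt p * degp p = (alt p :: 'm::finite list lop)"
proof -
 show "degp p * (alt p :: 'm list lop) = alt p" by (rule alternating_degp[OF alternating_alt])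
 show "alt p * degp p = (alt p :: 'm list lop)"
 proof (induction p)
  case (Suc p)
  have "alt (Suc p) * degp (Suc p) = scal (1 / of_nat (Suc p)) * (SUM i:(UNIV::'m set). cre i * (alt p * degp p * ann i))"
   unfolding alt.simps by (simp only: mult.assoc sum_distrib_right ann_degp)
  also have "... = alt (Suc p)" unfolding Suc alt.simps ..
  finally show ?case .
 qed (simp add: degp_mult)
qed

lemma alt_mult: "alt p * alt q = (if p = q then alt p else 0)"
proof (cases "p = q")
 case False
 have "alt p * alt q = alt p * (degp p * degp q) * alt q" 
  using alt_degp by (metis mult.assoc)
 thus ?thesis using False by (simp add: degp_mult)
qed (simp add: alt_alternating alternating_alt)

lemma alt_cre: "alt (Suc p) * (cre i * alt p) = cre i * alt p"
 by (intro alt_alternating alternating_cre alternating_alt)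

lemma alt_ann: "alt p * (ann i * alt (Suc p)) = ann i * alt (Suc p)" "ann i * alt 0 = 0"
proof -
 show "alt p * (ann i * alt (Suc p)) = ann i * alt (Suc p)"
  by (rule alt_alternating[OF alternating_SucD[OF alternating_alt]])
qed (simp add: ann_degp)

lemma ann_ann_alt: "ann i * (ann k * alt p) = - (ann k * (ann i * alt p))"
 by (rule alternating_ann[OF alternating_alt])

lemma tens_alt: "tens A * alt p = alt p * tens A"
proof (induction p)
 case (Suc p)
 have "tens A * alt (Suc p) = scal (1 / of_nat (Suc p)) * (SUM i:UNIV. tens A * cre i * (alt p * ann i))"
  by (simp add: mult.assoc[symmetric] sum_distrib_left scal_commute)
 also have "(SUM i:UNIV. tens A * cre i * (alt p * ann i)) =
   (SUM i:UNIV. SUM k:UNIV. scal (A $ k $ i) * (cre k * (alt p * (tens A * ann i))))"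
  unfolding tens_cre sum_distrib_right
  by (intro sum.cong refl) (metis (no_types, lifting) Suc mult.assoc)
 also have "... = (SUM k:UNIV. cre k * (alt p * (SUM i:UNIV. scal (A $ k $ i) * (tens A * ann i))))"
  unfolding sum_distrib_left
  by (subst sum.swap) (intro sum.cong refl, metis (no_types, lifting) scal_commute mult.assoc)
 also have "... = (SUM k:UNIV. cre k * (alt p * (ann k * tens A)))" unfolding ann_tens ..
 finally show ?case by (simp add: mult.assoc sum_distrib_right)
qed (simp add: tens_degp)

lemma alt_1: "alt 1 = (degp 1 :: 'a::finite list lop)"
proof -
 have "alternating (Suc 0) (degp (Suc 0) :: 'a list lop)"
 proof -
  have 1: "ann i * (degp 0 * X) = 0" for i :: 'a and X by (simp only: mult.assoc[symmetric] ann_degp mult_zero_left)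
  have "degp 0 * (degp 0 * X) = degp 0 * X" for X :: "'a list lop" by (simp add: mult.assoc[symmetric] degp_mult)
  thus ?thesis by (simp add: degp_mult ann_degp 1)
 qed
 hence "alt (Suc 0) * degp (Suc 0) = (degp (Suc 0) :: 'a list lop)" by (rule alt_alternating)
 hence "alt (Suc 0) = (degp (Suc 0) :: 'a list lop)" by (simp only: alt_degp(2))
 thus ?thesis by simp
qed

lemma finite_lists_length: "finite {l :: 'm::finite list. length l = p}"
 using finite_lists_length_eq[of "UNIV :: 'm set" p] by simp

lemma supported_degp: "supported {l. length l = p} (degp p)"
 unfolding degp_def by (rule supported_pull_lop) auto

lemma supported_alt: "supported {l. length l = p} (alt p :: 'm::finite list lop)"
proof (rule supportedI)
 fix u :: "'m list => complex" and i :: "'m list" assume "i ~: {l. length l = p}"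
 hence "app (degp p * (alt p :: 'm list lop)) u i = 0" by simp
 thus "app (alt p) u i = 0" by (simp only: alt_degp)
next
 fix u v :: "'m list => complex" assume *: "!!k. k : {l. length l = p} ==> u k = v k"
 have "app (degp p) u = app (degp p) v" using * by auto
 hence "app ((alt p :: 'm list lop) * degp p) u = app (alt p * degp p) v" by simp
 thus "app (alt p) u = app (alt p) v" by (simp only: alt_degp)
qed

lemma continuous_tens:
 assumes "continuous_on T A" shows "continuous_on T (%t. app (tens (A t)) u l)"
proof (induction l arbitrary: u)
 case (Cons j l)
 show ?case using assms Cons by (simp, intro continuous_intros)
qed auto

lemma fsf_tens_alt:
 fixes A :: "'t::topological_space => complex ^ 'a::finite ^ 'a"
 assumes "continuous_on T A" shows "fsf T (%t. tens (A t) * alt p)"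
proof -
 have "supported {l. length l = p} (tens (A t) * alt p)" for t
 proof -
  have "tens (A t) * alt p = degp p * (tens (A t) * degp p) * alt p"
   by (metis alt_degp(1) mult.assoc tens_degp)
  moreover have "supported {l. length l = p} (degp p * (tens (A t) * degp p))"
  proof (rule supportedI)
   fix u v :: "'a list => complex" assume *: "!!k. k : {l. length l = p} ==> u k = v k"
   have "app (degp p) u = app (degp p) v" using * by auto
   thus "app (degp p * (tens (A t) * degp p)) u = app (degp p * (tens (A t) * degp p)) v" by simp
  qed simp
  ultimately show ?thesis by (metis supported_mult supported_alt)
 qed
 moreover have "continuous_on T (%t. ent (tens (A t) * alt p) i k)" for i k
  unfolding ent_def app_ring by (rule continuous_tens[OF assms])
 ultimately show ?thesis unfolding fsf_def using finite_lists_length by blast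
qed

section \<open>Sums over lattice simplices\<close>

text \<open>Serves twice: as the set of exponents of monomials of degree \<open>D\<close>, and as
  the lattice points of a dilated simplex at which the squared moduli of the coordinates are
  sampled.\<close>

definition lsimp :: "'m set => nat => ('m => nat) set" where
 "lsimp I D = {bt. (ALL i. i ~: I --> bt i = 0) & sum bt I = D}"

lemma lsimp_insert:
 assumes "finite I" "i ~: I"
 shows "bij_betw (%(a, bt). bt(i := a)) (SIGMA a:{..D}. lsimp I (D - a)) (lsimp (insert i I) D)"
proof (rule bij_betw_byWitness[where f' = "%bt. (bt i, bt(i := 0))"])
 have eq: "sum (bt(i := a)) I = sum bt I" for bt :: "'a => nat" and a
  by (rule sum.cong) (use assms in auto)
 show "(%(a, bt). bt(i := a)) ` (SIGMA a:{..D}. lsimp I (D - a)) <= lsimp (insert i I) D"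
  using assms by (auto simp: lsimp_def eq simp del: fun_upd_apply) auto
 show "(%bt. (bt i, bt(i := 0))) ` lsimp (insert i I) D <= (SIGMA a:{..D}. lsimp I (D - a))"
  using assms by (auto simp: lsimp_def eq simp del: fun_upd_apply) auto
qed (use assms in \<open>auto simp: lsimp_def fun_eq_iff\<close>)

lemma lsimp_empty: "lsimp {} D = (if D = 0 then {%_. 0} else {})"
 by (auto simp: lsimp_def)

lemma finite_lsimp: "finite I ==> finite (lsimp I D)"
proof (induction I arbitrary: D rule: finite_induct)
 case (insert i I)
 have "finite (SIGMA a:{..D}. lsimp I (D - a))" using insert by auto
 thus ?case using bij_betw_finite[OF lsimp_insert[OF insert(1,2)]] by blast
qed (auto simp: lsimp_empty)

lemma sum_lsimp_insert:
 assumes "finite I" "i ~: I"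
 shows "(SUM bt:lsimp (insert i I) D. f bt) = (SUM a<=D. SUM bt:lsimp I (D - a). f (bt(i := a)))"
 using sum.reindex_bij_betw[OF lsimp_insert[OF assms], of f]
 by (subst sum.Sigma) (auto simp: finite_lsimp[OF assms(1)] case_prod_unfold)

text \<open>Compares coefficients in the product of the series of \<open>(1 - x)\<close> to the
  powers \<open>- (k + 1)\<close> and \<open>- (l + 1)\<close>; the proof uses Pascal's rule, by
  induction on \<open>l\<close> and then on \<open>D\<close>.\<close>

lemma binomial_convolution:
 "(SUM a<=D. ((a + k) choose k) * ((D - a + l) choose l)) = (D + k + l + 1) choose (k + l + 1)"
proof (induction l arbitrary: D)
 case 0
 show ?case using choose_rising_sum(1)[of k D] by (simp add: add.commute)
next
 case (Suc l)
 show ?case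
 proof (induction D)
  case (Suc D)
  have "(SUM a<=Suc D. ((a + k) choose k) * ((Suc D - a + Suc l) choose Suc l)) =
   (SUM a<=Suc D. ((a + k) choose k) * ((Suc D - a + l) choose l)) +
   (SUM a<=Suc D. ((a + k) choose k) * ((Suc D - a + l) choose Suc l))"
   by (simp add: sum.distrib[symmetric] distrib_left)
  also have "(SUM a<=Suc D. ((a + k) choose k) * ((Suc D - a + l) choose Suc l)) =
   (SUM a<=D. ((a + k) choose k) * ((D - a + Suc l) choose Suc l))"
  proof -
   have "(SUM a<=Suc D. ((a + k) choose k) * ((Suc D - a + l) choose Suc l)) =
    (SUM a<=D. ((a + k) choose k) * ((Suc D - a + l) choose Suc l))" by simp
   also have "... = (SUM a<=D. ((a + k) choose k) * ((D - a + Suc l) choose Suc l))"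
    by (rule sum.cong) (auto simp: Suc_diff_le)
   finally show ?thesis .
  qed
  finally show ?case using Suc \<open>!!D. (SUM a<=D. ((a + k) choose k) * ((D - a + l) choose l)) = _ D\<close>[of "Suc D"]
   by simp
 qed simp
qed

text \<open>A discrete Dirichlet integral, obtained by convolving one coordinate at a time. With
  \<open>k = 0\<close> it counts monomials, which is the source of the binomials in the final
  relations.\<close>

lemma sum_lsimp_binomial:
 assumes "finite I" "I ~= {}"
 shows "(SUM bt:lsimp I D. PROD i:I. ((bt i + k i) choose k i)) = (D + sum k I + card I - 1) choose (sum k I + card I - 1)"
 using assms
proof (induction I arbitrary: D rule: finite_ne_induct)
 case (singleton i)
 have "lsimp {i} D = {(%_. 0)(i := D)}" by (auto simp: lsimp_def fun_eq_iff)
 thus ?case by simp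
next
 case (insert i I)
 obtain c where c: "card I = Suc c" using insert by (metis card_eq_0_iff not0_implies_Suc)
 have step: "(PROD j:insert i I. (((bt(i := a)) j + k j) choose k j)) = ((a + k i) choose k i) * (PROD j:I. ((bt j + k j) choose k j))" for bt a
 proof -
  have "(PROD j:I. (((bt(i := a)) j + k j) choose k j)) = (PROD j:I. ((bt j + k j) choose k j))"
   by (rule prod.cong) (use insert in auto)
  thus ?thesis using insert by (simp del: fun_upd_apply add: fun_upd_same)
 qed
 have IH': "(SUM bt:lsimp I (D - a). PROD i:I. ((bt i + k i) choose k i)) = (D - a + (sum k I + c)) choose (sum k I + c)" for a
  using insert.IH[of "D - a"] unfolding c by (simp add: add.assoc)
 show ?case
  unfolding sum_lsimp_insert[OF insert(1,3)] step sum_distrib_left[symmetric] IH' binomial_convolution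
  using insert c by (simp add: ac_simps)
qed

lemma card_lsimp:
 assumes "finite I" "I ~= {}" shows "card (lsimp I D) = (D + card I - 1) choose (card I - 1)"
 using sum_lsimp_binomial[OF assms, of "%_. 0" D] by simp

section \<open>Moments\<close>

lemma fact_choose_le: "fact k * ((n + k) choose k) <= (n + k) ^ k"
proof -
 have "fact k * ((n + k) choose k) = (PROD i<k. (n + k - i))"
 proof (induction k)
  case (Suc k)
  have "fact (Suc k) * ((n + Suc k) choose Suc k) = fact k * (Suc k * (Suc (n + k) choose Suc k))"
   by (simp only: fact_Suc of_nat_id add_Suc_right mult.assoc mult.commute mult.left_commute)
  also have "... = fact k * (Suc (n + k) * ((n + k) choose k))" by (simp only: Suc_times_binomial)
  also have "... = Suc (n + k) * (fact k * ((n + k) choose k))" by (simp only: mult.left_commute)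
  also have "... = Suc (n + k) * (PROD i<k. (n + k - i))" by (simp only: Suc)
  also have "... = (PROD i<Suc k. (n + Suc k - i))"
   by (simp add: prod.lessThan_Suc_shift del: prod.lessThan_Suc mult_Suc)
  finally show ?case .
 qed simp
 also have "... <= (PROD i<k. (n + k))" by (rule prod_mono) auto
 finally show ?thesis by simp
qed

lemma fact_choose_ge: "n ^ k <= fact k * ((n + k) choose k)"
proof (induction k)
 case (Suc k)
 have "fact (Suc k) * ((n + Suc k) choose Suc k) = fact k * (Suc k * (Suc (n + k) choose Suc k))"
   by (simp only: fact_Suc of_nat_id add_Suc_right mult.assoc mult.commute mult.left_commute)
 also have "... = (fact k * ((n + k) choose k)) * Suc (n + k)" by (simp only: Suc_times_binomial ac_simps)
 also have "... >= n ^ k * n" by (rule mult_mono[OF Suc]) auto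
 finally show ?case by (simp add: mult.commute)
qed simp

text \<open>These power sums are squeezed between sums of rising factorials, which
  \<open>sum_lsimp_binomial\<close> evaluates in closed form: from above term by term
  (\<open>pmom_le\<close>), from below after shifting the lattice points by \<open>k\<close>
  (\<open>pmom_ge\<close>).\<close>

definition pmom :: "nat => ('m::finite => nat) => nat" where
 "pmom D k = (SUM bt:lsimp UNIV D. PROD i:UNIV. bt i ^ k i)"

lemma pmom_le:
 "pmom D (k::'m::finite => nat) <= (PROD i:UNIV. fact (k i)) * ((D + sum k UNIV + CARD('m) - 1) choose (sum k UNIV + CARD('m) - 1))"
proof -
 have "pmom D k <= (SUM bt:lsimp UNIV D. PROD i:UNIV. fact (k i) * ((bt i + k i) choose k i))"
  unfolding pmom_def by (intro sum_mono prod_mono) (auto intro: fact_choose_ge)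
 also have "... = (PROD i:UNIV. fact (k i)) * (SUM bt:lsimp UNIV D. PROD i:UNIV. ((bt i + k i) choose k i))"
  by (simp add: prod.distrib sum_distrib_left)
 finally show ?thesis by (simp add: sum_lsimp_binomial)
qed

lemma pmom_ge:
 fixes k :: "'m::finite => nat"
 assumes "sum k UNIV <= D"
 shows "(PROD i:UNIV. fact (k i)) * ((D + CARD('m) - 1) choose (sum k UNIV + CARD('m) - 1)) <= pmom D k"
proof -
 let ?D = "D - sum k UNIV"
 let ?s = "%ga i. ga i + k i"
 have "(SUM bt:lsimp UNIV ?D. PROD i:UNIV. ((bt i + k i) choose k i)) = (D + CARD('m) - 1) choose (sum k UNIV + CARD('m) - 1)"
  using assms by (simp add: sum_lsimp_binomial)
 hence "(PROD i:UNIV. fact (k i)) * ((D + CARD('m) - 1) choose (sum k UNIV + CARD('m) - 1)) =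
   (SUM bt:lsimp UNIV ?D. PROD i:UNIV. fact (k i) * ((bt i + k i) choose k i))"
  by (simp only: prod.distrib sum_distrib_left[symmetric])
 also have "... <= (SUM bt:lsimp UNIV ?D. PROD i:UNIV. (bt i + k i) ^ k i)"
  by (intro sum_mono prod_mono) (auto intro: fact_choose_le)
 also have "... = (SUM bt:?s ` lsimp UNIV ?D. PROD i:UNIV. bt i ^ k i)"
  by (subst sum.reindex) (auto simp: inj_on_def fun_eq_iff)
 also have "... <= pmom D k" unfolding pmom_def
  by (rule sum_mono2[OF finite_lsimp]) (use assms in \<open>auto simp: lsimp_def sum.distrib\<close>)
 finally show ?thesis .
qed

lemma binomial_over_power_limit:
 "(%D. real ((D + a) choose b) / real D ^ b) \<longlonglongrightarrow> 1 / fact b"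
proof -
 have l: "(%D. (real D + real a - real i) / real D) \<longlonglongrightarrow> 1" for i
  by real_asymp
 have "(%D. (PROD i:{0..<b}. (real D + real a - real i) / real D) / fact b) \<longlonglongrightarrow> (PROD i:{0..<b}. 1) / fact b"
  by (intro tendsto_intros l) simp
 moreover have "(PROD i:{0..<b}. (real D + real a - real i) / real D) / fact b = real ((D + a) choose b) / real D ^ b" for D
  by (simp add: binomial_gbinomial gbinomial_prod_rev prod_dividef)
 ultimately show ?thesis by simp
qed

definition nmom :: "nat => ('m::finite => nat) => real" where
 "nmom D k = (SUM bt:lsimp UNIV D. PROD i:UNIV. (real (bt i) / real D) ^ k i)"

lemma nmom_pmom: "nmom D k = real (pmom D k) / real D ^ sum k UNIV"
 by (simp add: nmom_def pmom_def power_divide prod_dividef sum_divide_distrib[symmetric] power_sum)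

text \<open>Both bounds have the same leading term in \<open>D\<close>. The limit is a Dirichlet
  moment, which up to a factor independent of \<open>k\<close> is the squared norm of the monomial
  with exponent \<open>k\<close> on the unit sphere.\<close>

lemma nmom_limit:
 fixes k :: "'m::finite => nat"
 shows "(%D. nmom D k / real D ^ (CARD('m) - 1)) \<longlonglongrightarrow>
   (PROD i:UNIV. fact (k i)) / fact (sum k UNIV + CARD('m) - 1)"
proof -
 let ?K = "sum k UNIV" and ?m = "CARD('m) - 1" and ?F = "(PROD i:UNIV. fact (k i)) :: real"
 have m: "CARD('m) > 0" by simp
 have e: "?K + CARD('m) - 1 = ?K + ?m" "D + ?K + CARD('m) - 1 = D + (?K + ?m)" "D + CARD('m) - 1 = D + ?m" for D
  using m by linarith+
 have q: "nmom D k / real D ^ ?m = real (pmom D k) / real D ^ (?K + ?m)" for D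
  unfolding nmom_pmom divide_divide_eq_left power_add ..
 have low: "\<forall>\<^sub>F D in sequentially. ?F * (real ((D + ?m) choose (?K + ?m)) / real D ^ (?K + ?m)) <= nmom D k / real D ^ ?m"
  using eventually_ge_at_top[of ?K]
 proof eventually_elim
  case (elim D)
  have "real ((PROD i:UNIV. fact (k i)) * ((D + ?m) choose (?K + ?m))) <= real (pmom D k)"
   using pmom_ge[OF elim] unfolding e of_nat_le_iff .
  thus ?case unfolding q times_divide_eq_right by (intro divide_right_mono) (auto simp: of_nat_prod)
 qed
 have up: "\<forall>\<^sub>F D in sequentially. nmom D k / real D ^ ?m <= ?F * (real ((D + (?K + ?m)) choose (?K + ?m)) / real D ^ (?K + ?m))"
 proof (rule always_eventually, rule allI)
  fix D
  have "real (pmom D k) <= real ((PROD i:UNIV. fact (k i)) * ((D + (?K + ?m)) choose (?K + ?m)))"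
   using pmom_le[of D k] unfolding e of_nat_le_iff by (simp only: add.assoc)
  thus "nmom D k / real D ^ ?m <= ?F * (real ((D + (?K + ?m)) choose (?K + ?m)) / real D ^ (?K + ?m))"
   unfolding q times_divide_eq_right by (intro divide_right_mono) (auto simp: of_nat_prod)
 qed
 have "(%D. nmom D k / real D ^ ?m) \<longlonglongrightarrow> ?F * (1 / fact (?K + ?m))"
  by (rule tendsto_sandwich[OF low up]) (intro tendsto_mult tendsto_const binomial_over_power_limit)+
 thus ?thesis unfolding e by simp
qed

lemma nmom_ratio_limit:
 fixes k :: "'m::finite => nat"
 shows "(%D. nmom D (k(i := Suc (k i))) / nmom D k) \<longlonglongrightarrow> (real (k i) + 1) / (real (sum k UNIV) + real CARD('m))"
proof -
 let ?k = "k(i := Suc (k i))"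
 have s: "sum ?k UNIV = Suc (sum k UNIV)"
  by (simp add: sum.remove[of UNIV i])
 have p: "(PROD j:UNIV. fact (?k j)) = (real (k i) + 1) * (PROD j:UNIV. fact (k j))"
  by (simp add: prod.remove[of UNIV i] algebra_simps)
 have f: "fact (sum ?k UNIV + CARD('m) - 1) = (real (sum k UNIV) + real CARD('m)) * fact (sum k UNIV + CARD('m) - 1)"
 proof -
  have "sum ?k UNIV + CARD('m) - 1 = Suc (sum k UNIV + CARD('m) - 1)" "sum k UNIV + CARD('m) - 1 + 1 = sum k UNIV + CARD('m)"
   unfolding s using zero_less_card_finite[where 'a='m] by linarith+
  thus ?thesis by (metis Suc_eq_plus1 fact_Suc of_nat_add)
 qed
 have "(%D. (nmom D ?k / real D ^ (CARD('m) - 1)) / (nmom D k / real D ^ (CARD('m) - 1))) \<longlonglongrightarrow>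
   ((PROD i:UNIV. fact (?k i)) / fact (sum ?k UNIV + CARD('m) - 1)) / ((PROD i:UNIV. fact (k i)) / fact (sum k UNIV + CARD('m) - 1))"
  by (intro tendsto_divide nmom_limit) simp
 also have "((PROD i:UNIV. fact (?k i)) / fact (sum ?k UNIV + CARD('m) - 1)) / ((PROD i:UNIV. fact (k i)) / fact (sum k UNIV + CARD('m) - 1))
   = (real (k i) + 1) / (real (sum k UNIV) + real CARD('m))"
  unfolding p f by simp
 finally show ?thesis
  by (rule Lim_transform_eventually)
    (use eventually_gt_at_top[of 0] in eventually_elim, simp del: fun_upd_apply)
qed

section \<open>A discrete Hardy space on the sphere\<close>

definition mnl :: "('m::finite => nat) => complex ^ 'm => complex" where
 "mnl apz z = (PROD i:UNIV. z $ i ^ apz i)"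

text \<open>A finite sample of the sphere that imitates the Hardy space up to degree
  \<open>Suc L\<close>. \<open>N\<close> holds the squared norms of monomials. In \<open>gap\<close>
  the first term is the squared norm of a monomial times a conjugate coordinate, and the subtracted
  term that of its projection onto the monomial lowered in that coordinate, so \<open>gap\<close>
  bounds the defect of a Toeplitz operator. Rotation by \<open>c\<close> samples the circle action
  finely enough to tell the degrees apart.\<close>

locale hardy =
 fixes L :: nat and Om :: "'w set" and ze :: "'w => complex ^ 'm::finite"
  and N :: "('m => nat) => real" and rh :: "'w => 'w" and c :: complex
 assumes finite_points: "finite Om"
  and on_sphere: "!!og. og : Om ==> norm (ze og) = 1"
  and orth: "!!apz bt. sum apz UNIV <= Suc L ==> sum bt UNIV <= Suc L ==>
   (SUM og:Om. mnl apz (ze og) * cnj (mnl bt (ze og))) = (if apz = bt then of_real (N apz) else 0)"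
  and N_pos: "!!apz. sum apz UNIV <= Suc L ==> N apz > 0"
  and gap: "!!apz i. sum apz UNIV <= L ==> 
    N (apz(i := Suc (apz i))) - (if apz i = 0 then 0 else (N apz)\<^sup>2 / N (apz(i := apz i - 1))) <= 2 / (real (sum apz UNIV) + 1) * N apz"
  and rot: "bij_betw rh Om Om" "!!og. og : Om ==> ze (rh og) = c *s ze og" "norm c = 1"
  and rot_inj: "!!a b. a <= Suc L ==> b <= Suc L ==> c ^ a = c ^ b ==> a = b"

lemma root_of_unity:
 assumes "M > (0::nat)"
 obtains x :: complex where "norm x = 1" "x ^ M = 1" "!!a b. a < M ==> b < M ==> x ^ a = x ^ b ==> a = b"
proof -
 define x where "x = exp (2 * of_real pi * \<i> * of_nat 1 / of_nat M)"
 have xp: "x ^ j = exp (2 * of_real pi * \<i> * of_nat j / of_nat M)" for j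
  by (simp add: x_def exp_of_nat_mult[symmetric] algebra_simps)
 have "norm x = 1" by (simp add: x_def norm_exp_eq_Re)
 moreover have "x ^ M = 1" unfolding xp using complex_root_unity_eq_1[of M M] assms by simp
 moreover have "a = b" if "a < M" "b < M" "x ^ a = x ^ b" for a b
  using that complex_root_unity_eq[of M a b] assms unfolding xp by simp
 ultimately show ?thesis by (rule that)
qed

lemma root_sum:
 fixes x :: complex
 assumes "norm x = 1" "x ^ M = 1" "!!a b. a < M ==> b < M ==> x ^ a = x ^ b ==> a = b" "a < M" "b < M"
 shows "(SUM k<M. (x ^ k) ^ a * cnj ((x ^ k) ^ b)) = (if a = b then of_nat M else 0)"
proof -
 define r where "r = x ^ a * cnj (x ^ b)"
 have x1: "x * cnj x = 1" using assms(1) by (metis complex_norm_square mult.commute of_real_1 one_power2)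
 have rr: "r * x ^ b = x ^ a"
  using x1 by (simp add: r_def) (metis (no_types, lifting) mult.assoc mult.commute mult.right_neutral power_mult_distrib power_one)
 have "(SUM k<M. (x ^ k) ^ a * cnj ((x ^ k) ^ b)) = (SUM k<M. r ^ k)"
  by (simp add: r_def power_mult_distrib power_mult[symmetric] mult.commute)
 also have "... = (if a = b then of_nat M else 0)"
 proof (cases "a = b")
  case True
  have "r = (x * cnj x) ^ a" by (simp add: r_def True power_mult_distrib)
  hence "r = 1" by (simp add: x1)
  thus ?thesis using True by simp
 next
  case False
  hence "r ~= 1" using rr assms(3)[OF assms(4,5)] by auto
  moreover have "r ^ M = 1"
  proof -
   have "r ^ M = (x ^ M) ^ a * cnj ((x ^ M) ^ b)"
    by (simp add: r_def power_mult_distrib power_mult[symmetric] mult.commute)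
   thus ?thesis by (simp add: assms(2))
  qed
  ultimately show ?thesis using False by (simp add: geometric_sum)
 qed
 finally show ?thesis .
qed

text \<open>Moduli come from the lattice points of a large simplex, phases from roots of unity. The
  phases give exact orthogonality; the moduli give squared norms whose ratios converge to those on
  the sphere, where the required inequalities are strict. Only finitely many exponents matter, so
  one \<open>D\<close> serves them all. The point kept out of \<open>Om\<close> will be the spare
  index to which all classes are transported.\<close>

theorem hardy_exists:
 "EX (Om :: (('m => nat) \<times> ('m => nat)) set) (ze :: _ => complex ^ 'm::finite) N rh c. hardy L Om ze N rh c & (%_. 0, %_. 0) ~: Om"
proof -
 let ?m = "CARD('m)"
 have fin: "finite {apz :: 'm => nat. sum apz UNIV <= Suc L}"
 proof -
  have "{apz :: 'm => nat. sum apz UNIV <= Suc L} = (UN D<=Suc L. lsimp UNIV D)" by (auto simp: lsimp_def)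
  thus ?thesis by (simp add: finite_lsimp)
 qed
 have "ALL apz:{apz :: 'm => nat. sum apz UNIV <= Suc L}. \<forall>\<^sub>F D in sequentially. nmom D apz > 0"
 proof
  fix apz :: "'m => nat"
  have "\<forall>\<^sub>F D in sequentially. nmom D apz / real D ^ (?m - 1) > 0"
   by (rule order_tendstoD(1)[OF nmom_limit]) (auto intro!: divide_pos_pos prod_pos)
  thus "\<forall>\<^sub>F D in sequentially. nmom D apz > 0"
   using eventually_gt_at_top[of 0] by eventually_elim (simp add: zero_less_divide_iff zero_less_power)
 qed
 hence ev1: "\<forall>\<^sub>F D in sequentially. ALL apz:{apz :: 'm => nat. sum apz UNIV <= Suc L}. nmom D apz > 0"
  by (rule eventually_ball_finite[OF fin])
 \<comment> \<open>The limit of the left side is at most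
   \<open>1 / (real (sum apz UNIV) + 1)\<close>. The factor 2 is the slack that makes the inequality
   strict and therefore true for finite \<open>D\<close>.\<close>
 have "ALL apz:{apz :: 'm => nat. sum apz UNIV <= Suc L}. \<forall>\<^sub>F D in sequentially. ALL i.
   nmom D (apz(i := Suc (apz i))) / nmom D apz - (if apz i = 0 then 0 else nmom D apz / nmom D (apz(i := apz i - 1)))
    < 2 / (real (sum apz UNIV) + 1)"
 proof
  fix apz :: "'m => nat"
  have "\<forall>\<^sub>F D in sequentially. nmom D (apz(i := Suc (apz i))) / nmom D apz - (if apz i = 0 then 0 else nmom D apz / nmom D (apz(i := apz i - 1)))
    < 2 / (real (sum apz UNIV) + 1)" for i
  proof (cases "apz i")
   case 0
   have "(%D. nmom D (apz(i := Suc (apz i))) / nmom D apz) \<longlonglongrightarrow> (real (apz i) + 1) / (real (sum apz UNIV) + real ?m)"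
    by (rule nmom_ratio_limit)
   moreover have "(real (apz i) + 1) / (real (sum apz UNIV) + real ?m) < 2 / (real (sum apz UNIV) + 1)"
   proof -
    have "real ?m >= 1" using zero_less_card_finite[where 'a='m] by (simp add: Suc_leI)
    hence "1 / (real (sum apz UNIV) + real ?m) <= 1 / (real (sum apz UNIV) + 1)"
     by (intro frac_le) (auto simp del: of_nat_sum intro!: add_nonneg_pos sum_nonneg)
    moreover have "0 < (SUM x:UNIV. real (apz x)) + 1" by (intro add_nonneg_pos sum_nonneg) auto
    hence "1 / (real (sum apz UNIV) + 1) < 2 / (real (sum apz UNIV) + 1)"
     by (intro divide_strict_right_mono) auto
    ultimately have "1 / (real (sum apz UNIV) + real ?m) < 2 / (real (sum apz UNIV) + 1)" by (rule le_less_trans)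
    thus ?thesis using 0 by simp
   qed
   ultimately show ?thesis using 0 by (auto dest: order_tendstoD(2))
  next
   case (Suc a)
   let ?b = "apz(i := a)"
   have b: "?b(i := Suc (?b i)) = apz" using Suc by auto
   have s: "sum apz UNIV = Suc (sum ?b UNIV)" using Suc by (simp add: sum.remove[of UNIV i])
   have "(%D. nmom D (apz(i := Suc (apz i))) / nmom D apz - nmom D (?b(i := Suc (?b i))) / nmom D ?b) \<longlonglongrightarrow>
    (real (apz i) + 1) / (real (sum apz UNIV) + real ?m) - (real (?b i) + 1) / (real (sum ?b UNIV) + real ?m)"
    by (intro tendsto_diff nmom_ratio_limit)
   moreover have "(real (apz i) + 1) / (real (sum apz UNIV) + real ?m) - (real (?b i) + 1) / (real (sum ?b UNIV) + real ?m) < 2 / (real (sum apz UNIV) + 1)"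
   proof -
    have S0: "0 < (SUM x:UNIV. real (apz x)) + 1" by (intro add_nonneg_pos sum_nonneg) auto
    have m1: "real ?m >= 1" using zero_less_card_finite[where 'a='m] by (simp add: Suc_leI)
    have "(real (apz i) + 1) / (real (sum apz UNIV) + real ?m) - (real (?b i) + 1) / (real (sum ?b UNIV) + real ?m)
      <= (real (apz i) + 1) / (real (sum apz UNIV) + real ?m) - (real (?b i) + 1) / (real (sum apz UNIV) + real ?m)"
     using m1 S0 s by (intro diff_left_mono frac_le) (auto simp del: of_nat_sum intro!: add_nonneg_pos sum_nonneg)
    also have "... = 1 / (real (sum apz UNIV) + real ?m)" using Suc by (simp add: diff_divide_distrib[symmetric])
    also have "1 / (real (sum apz UNIV) + real ?m) <= 1 / (real (sum apz UNIV) + 1)"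
     using m1 S0 by (intro frac_le) (auto simp del: of_nat_sum intro!: add_nonneg_pos sum_nonneg)
    also have "... < 2 / (real (sum apz UNIV) + 1)" using S0 by (intro divide_strict_right_mono) auto
    finally show ?thesis .
   qed
   ultimately have "\<forall>\<^sub>F D in sequentially. nmom D (apz(i := Suc (apz i))) / nmom D apz - nmom D (?b(i := Suc (?b i))) / nmom D ?b < 2 / (real (sum apz UNIV) + 1)"
    by (rule order_tendstoD(2))
   thus ?thesis unfolding b using Suc by simp
  qed
  thus "\<forall>\<^sub>F D in sequentially. ALL i. nmom D (apz(i := Suc (apz i))) / nmom D apz - (if apz i = 0 then 0 else nmom D apz / nmom D (apz(i := apz i - 1)))
    < 2 / (real (sum apz UNIV) + 1)" by (rule eventually_all_finite)
 qed
 hence ev2: "\<forall>\<^sub>F D in sequentially. ALL apz:{apz :: 'm => nat. sum apz UNIV <= Suc L}. ALL i.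
   nmom D (apz(i := Suc (apz i))) / nmom D apz - (if apz i = 0 then 0 else nmom D apz / nmom D (apz(i := apz i - 1)))
    < 2 / (real (sum apz UNIV) + 1)"
  by (rule eventually_ball_finite[OF fin])
 obtain D where D: "D > 0" "!!apz :: 'm => nat. sum apz UNIV <= Suc L ==> nmom D apz > 0"
  "!!(apz :: 'm => nat) i. sum apz UNIV <= Suc L ==> nmom D (apz(i := Suc (apz i))) / nmom D apz - (if apz i = 0 then 0 else nmom D apz / nmom D (apz(i := apz i - 1)))
    < 2 / (real (sum apz UNIV) + 1)"
  using eventually_happens'[OF _ eventually_conj[OF eventually_gt_at_top[of 0] eventually_conj[OF ev1 ev2]]] by auto
 \<comment> \<open>Exponents up to \<open>Suc L\<close> are distinct modulo \<open>L + 2\<close>, so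
   the phase sums separate all monomials in range.\<close>
 define M where "M = L + 2"
 obtain x :: complex where x: "norm x = 1" "x ^ M = 1" "!!a b. a < M ==> b < M ==> x ^ a = x ^ b ==> a = b"
  using root_of_unity[of M] by (auto simp: M_def)
 define K :: "('m => nat) set" where "K = PiE UNIV (%_. {..<M})"
 define Om where "Om = lsimp (UNIV :: 'm set) D \<times> K"
 define ze :: "('m => nat) \<times> ('m => nat) => complex ^ 'm" 
  where "ze og = (\<chi> i. of_real (sqrt (real (fst og i) / real D)) * x ^ (snd og i))" for og
 define N :: "('m => nat) => real" where "N apz = real M ^ ?m * nmom D apz" for apz
 define rh :: "('m => nat) \<times> ('m => nat) => _" where "rh og = (fst og, %i. (snd og i + 1) mod M)" for og
 have finK: "finite K" unfolding K_def by (intro finite_PiE) auto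
 have "hardy L Om ze N rh x"
 proof
  show "finite Om" unfolding Om_def using finK by (simp add: finite_lsimp)
  show "norm (ze og) = 1" if "og : Om" for og
  proof -
   have "(norm (ze og))\<^sup>2 = (SUM i:UNIV. real (fst og i) / real D)"
    by (simp add: norm_vec_def L2_set_def sum_nonneg ze_def norm_mult norm_power x(1) abs_of_nonneg)
   also have "... = real (sum (fst og) UNIV) / real D" by (simp add: sum_divide_distrib[symmetric])
   also have "... = 1" using that D(1) by (auto simp: Om_def lsimp_def)
   finally show ?thesis by (metis abs_norm_cancel power2_eq_1_iff abs_1 abs_neg_one)
  qed
  fix apz :: "'m => nat" assume al: "sum apz UNIV <= Suc L"
  show "N apz > 0" using D(2)[OF al] by (simp add: N_def M_def)
  have a1: "apz i < M" for i using al member_le_sum[of i UNIV apz] by (simp add: M_def)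
  fix bt :: "'m => nat" assume be: "sum bt UNIV <= Suc L"
  have b1: "bt i < M" for i using be member_le_sum[of i UNIV bt] by (simp add: M_def)
  have "(SUM og:Om. mnl apz (ze og) * cnj (mnl bt (ze og))) =
   (SUM ga:lsimp UNIV D. SUM ka:K. (PROD i:UNIV. of_real (sqrt (real (ga i) / real D)) ^ (apz i + bt i)) * 
     (PROD i:UNIV. (x ^ ka i) ^ apz i * cnj ((x ^ ka i) ^ bt i)))"
   unfolding Om_def by (simp add: sum.cartesian_product mnl_def ze_def prod.distrib[symmetric] power_mult_distrib power_add ac_simps case_prod_unfold)
  also have "... = (SUM ga:lsimp UNIV D. (PROD i:UNIV. of_real (sqrt (real (ga i) / real D)) ^ (apz i + bt i))) *
    (SUM ka:K. PROD i:UNIV. (x ^ ka i) ^ apz i * cnj ((x ^ ka i) ^ bt i))"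
   by (simp only: sum_product)
  also have "(SUM ka:K. PROD i:UNIV. (x ^ ka i) ^ apz i * cnj ((x ^ ka i) ^ bt i)) = 
    (PROD i:UNIV. SUM k<M. (x ^ k) ^ apz i * cnj ((x ^ k) ^ bt i))"
   unfolding K_def by (rule prod_sum_PiE[symmetric]) auto
  also have "... = (PROD i:UNIV. if apz i = bt i then of_nat M else 0)"
   by (simp only: root_sum[OF x a1 b1])
  also have "... = (if apz = bt then of_nat M ^ ?m else 0)"
  proof (cases "apz = bt")
   case False
   then obtain i where "apz i ~= bt i" by auto
   thus ?thesis using False by (simp only: if_False) (rule prod_zero, auto)
  qed simp
  also have "(SUM ga:lsimp UNIV D. (PROD i:UNIV. of_real (sqrt (real (ga i) / real D)) ^ (apz i + bt i))) * (if apz = bt then of_nat M ^ ?m else 0)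
   = (if apz = bt then complex_of_real (N apz) else 0)"
  proof (cases "apz = bt")
   case True
   have "complex_of_real (sqrt (real g / real D)) ^ (a + a) = of_real ((real g / real D) ^ a)" for g a
   proof -
    have "sqrt (real g / real D) ^ (a + a) = (real g / real D) ^ a"
     by (simp add: mult_2[symmetric] power_mult)
    thus ?thesis by (simp only: of_real_power[symmetric])
   qed
   thus ?thesis using True by (simp add: N_def nmom_def)
  qed simp
  finally show "(SUM og:Om. mnl apz (ze og) * cnj (mnl bt (ze og))) = (if apz = bt then of_real (N apz) else 0)" .
 next
  fix apz :: "'m => nat" and i assume "sum apz UNIV <= L"
  hence al: "sum apz UNIV <= Suc L" by simp
  let ?M = "real M ^ ?m"
  have M: "?M > 0" by (simp add: M_def)
  have p: "nmom D apz > 0" by (rule D(2)[OF al])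
  have "nmom D (apz(i := Suc (apz i))) - (if apz i = 0 then 0 else (nmom D apz)\<^sup>2 / nmom D (apz(i := apz i - 1))) =
   nmom D apz * (nmom D (apz(i := Suc (apz i))) / nmom D apz - (if apz i = 0 then 0 else nmom D apz / nmom D (apz(i := apz i - 1))))"
   using p by (simp add: right_diff_distrib power2_eq_square)
  also have "... <= nmom D apz * (2 / (real (sum apz UNIV) + 1))"
   using D(3)[OF al, of i] p by (intro mult_left_mono) auto
  finally have "?M * (nmom D (apz(i := Suc (apz i))) - (if apz i = 0 then 0 else (nmom D apz)\<^sup>2 / nmom D (apz(i := apz i - 1)))) <= ?M * (nmom D apz * (2 / (real (sum apz UNIV) + 1)))"
   using M by (intro mult_left_mono) auto
  moreover have R: "(?M * a)\<^sup>2 / (?M * b) = ?M * (a\<^sup>2 / b)" for a b using M by (simp add: power2_eq_square)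
  moreover have "2 / (real (sum apz UNIV) + 1) * (?M * nmom D apz) = ?M * (nmom D apz * (2 / (real (sum apz UNIV) + 1)))"
   by (simp only: ac_simps)
  ultimately show "N (apz(i := Suc (apz i))) - (if apz i = 0 then 0 else (N apz)\<^sup>2 / N (apz(i := apz i - 1))) <= 2 / (real (sum apz UNIV) + 1) * N apz"
   unfolding N_def by (cases "apz i = 0") (simp_all only: if_True if_False R right_diff_distrib[symmetric] diff_zero simp_thms)
 next
  show "bij_betw rh Om Om"
  proof (rule bij_betwI)
   have M0: "M > 0" by (simp add: M_def)
   show "rh : Om \<rightarrow> Om" "(%og. (fst og, %i. (snd og i + (M - 1)) mod M)) : Om \<rightarrow> Om"
    using M0 by (auto simp: Om_def rh_def K_def)
   fix og assume "og : Om"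
   hence s: "snd og i < M" for i by (auto simp: Om_def K_def PiE_def Pi_def)
   have "((a + 1) mod M + (M - 1)) mod M = a" "((a + (M - 1)) mod M + 1) mod M = a" if "a < M" for a
   proof -
    have "((a + 1) mod M + (M - 1)) mod M = (a + 1 + (M - 1)) mod M" by (rule mod_add_left_eq)
    also have "a + 1 + (M - 1) = a + M" using M0 by simp
    finally show "((a + 1) mod M + (M - 1)) mod M = a" using that by simp
    have "((a + (M - 1)) mod M + 1) mod M = (a + (M - 1) + 1) mod M" by (rule mod_add_left_eq)
    also have "a + (M - 1) + 1 = a + M" using M0 by simp
    finally show "((a + (M - 1)) mod M + 1) mod M = a" using that by simp
   qed
   thus "(fst (rh og), %i. (snd (rh og) i + (M - 1)) mod M) = og"
     "rh (fst og, %i. (snd og i + (M - 1)) mod M) = og"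
    using s by (auto simp: rh_def prod_eq_iff fun_eq_iff simp del: Nat.add_diff_assoc Nat.add_0_right)
  qed
  have xm: "x ^ (a mod M) = x ^ a" for a
  proof -
   have "x ^ a = x ^ (M * (a div M) + a mod M)" by simp
   also have "... = x ^ (a mod M)" by (simp only: power_add power_mult x(2)) simp
   finally show ?thesis by simp
  qed
  show "ze (rh og) = x *s ze og" for og
   unfolding vec_eq_iff by (simp add: ze_def rh_def xm mult.left_commute)
  show "norm x = 1" by (rule x(1))
  show "a = b" if "a <= Suc L" "b <= Suc L" "x ^ a = x ^ b" for a b
   using x(3)[of a b] that by (simp add: M_def)
 qed
 moreover have "(%_. 0, %_. 0) ~: Om" using D(1) by (simp add: Om_def lsimp_def)
 ultimately show ?thesis by (intro exI conjI)
qed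

section \<open>Asymptotic Toeplitz calculus\<close>

definition nr :: "'w set => ('w => complex) => real" where
 "nr Om u = L2_set (%og. cmod (u og)) Om"

definition ip :: "'w set => ('w => complex) => ('w => complex) => complex" where
 "ip Om u v = (SUM og:Om. u og * cnj (v og))"

text \<open>Homogeneous polynomials of degree \<open>e\<close> as functions on the sample.
  Membership constrains a function only on \<open>Om\<close>; elsewhere it is arbitrary.\<close>

definition Hs :: "'w set => ('w => complex ^ 'm::finite) => nat => ('w => complex) set" where
 "Hs Om ze e = {u. EX a. ALL og:Om. u og = (SUM apz:lsimp UNIV e. a apz * mnl apz (ze og))}"

lemma nr_nonneg [simp]: "nr Om u >= 0" by (simp add: nr_def)

lemma nr_power2: "complex_of_real ((nr Om u)\<^sup>2) = ip Om u u"
 by (simp add: nr_def ip_def L2_set_def sum_nonneg complex_norm_square[symmetric] del: of_real_power)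

lemma nr_cong: "(!!og. og : Om ==> u og = v og) ==> nr Om u = nr Om v"
 unfolding nr_def by (rule L2_set_cong) auto

lemma nr_mono: "(!!og. og : Om ==> cmod (u og) <= cmod (v og)) ==> nr Om u <= nr Om v"
 unfolding nr_def by (rule L2_set_mono) auto

lemma nr_scale: "nr Om (%og. a * u og) = cmod a * nr Om u"
 by (simp add: nr_def norm_mult L2_set_right_distrib)

lemma nr_add: "nr Om (%og. u og + v og) <= nr Om u + nr Om v"
proof -
 have "nr Om (%og. u og + v og) <= L2_set (%og. cmod (u og) + cmod (v og)) Om"
  unfolding nr_def by (rule L2_set_mono) (auto intro: norm_triangle_ineq)
 also have "... <= nr Om u + nr Om v" unfolding nr_def by (rule L2_set_triangle_ineq)
 finally show ?thesis .
qed

lemma nr_uminus: "nr Om (%og. - u og) = nr Om u" by (simp add: nr_def)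

lemma nr_diff: "nr Om (%og. u og - v og) <= nr Om u + nr Om v"
 using nr_add[of Om u "%og. - v og"] by (simp add: nr_uminus)

lemma nr_bound_mult:
 assumes "!!og. og : Om ==> cmod (f og) <= B" "B >= 0"
 shows "nr Om (%og. f og * u og) <= B * nr Om u"
proof -
 have "nr Om (%og. f og * u og) <= nr Om (%og. of_real B * u og)"
  by (rule nr_mono) (use assms in \<open>auto simp: norm_mult intro: mult_right_mono\<close>)
 thus ?thesis unfolding nr_scale using assms by simp
qed

lemma nr_sum: "nr Om (%og. SUM j:J. u j og) <= (SUM j:J. nr Om (u j))"
proof (induction J rule: infinite_finite_induct)
 case (insert j J)
 thus ?case using nr_add[of Om "u j" "%og. SUM j:J. u j og"] by simp
qed (auto simp: nr_def L2_set_def)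

lemma nr_pythagoras:
 assumes "ip Om u v = 0"
 shows "(nr Om (%og. u og - v og))\<^sup>2 = (nr Om u)\<^sup>2 + (nr Om v)\<^sup>2"
proof -
 have "ip Om v u = cnj (ip Om u v)" by (simp add: ip_def mult.commute)
 hence vu: "ip Om v u = 0" by (simp only: assms complex_cnj_zero)
 have "ip Om (%og. u og - v og) (%og. u og - v og) = ip Om u u - ip Om u v - ip Om v u + ip Om v v"
  by (simp add: ip_def algebra_simps sum.distrib sum_subtractf)
 hence "complex_of_real ((nr Om (%og. u og - v og))\<^sup>2) = of_real ((nr Om u)\<^sup>2 + (nr Om v)\<^sup>2)"
  unfolding of_real_add nr_power2 by (simp only: assms vu diff_zero)
 thus ?thesis by (simp only: of_real_eq_iff)
qed

lemma nr_le_orth: assumes "ip Om u v = 0" shows "nr Om u <= nr Om (%og. u og - v og)"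
 by (rule power2_le_imp_le) (simp_all add: nr_pythagoras[OF assms])

lemma nr_orth_sum:
 assumes "finite I" "!!i j. i : I ==> j : I ==> i ~= j ==> ip Om (g i) (g j) = 0"
 shows "(nr Om (%og. SUM i:I. a i * g i og))\<^sup>2 = (SUM i:I. (cmod (a i))\<^sup>2 * (nr Om (g i))\<^sup>2)"
proof -
 have "complex_of_real ((nr Om (%og. SUM i:I. a i * g i og))\<^sup>2) =
   (SUM og:Om. SUM i:I. SUM j:I. a i * cnj (a j) * (g i og * cnj (g j og)))"
  unfolding nr_power2 ip_def by (simp add: sum_product ac_simps)
 also have "... = (SUM i:I. SUM og:Om. SUM j:I. a i * cnj (a j) * (g i og * cnj (g j og)))" by (rule sum.swap)
 also have "... = (SUM i:I. SUM j:I. SUM og:Om. a i * cnj (a j) * (g i og * cnj (g j og)))"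
  by (intro sum.cong refl sum.swap)
 also have "... = (SUM i:I. SUM j:I. a i * cnj (a j) * ip Om (g i) (g j))"
  by (simp add: ip_def sum_distrib_left)
 also have "... = (SUM i:I. SUM j:I. if j = i then a i * cnj (a i) * ip Om (g i) (g i) else 0)"
  by (intro sum.cong refl) (use assms(2) in auto)
 also have "... = (SUM i:I. of_real ((cmod (a i))\<^sup>2 * (nr Om (g i))\<^sup>2))"
  using assms(1) by (simp add: complex_norm_square[symmetric] nr_power2[symmetric] del: of_real_power)
 finally show ?thesis by (simp only: of_real_sum[symmetric] of_real_eq_iff)
qed

lemma Hs_0: "(%og. 0) : Hs Om ze e"
 unfolding Hs_def by (intro CollectI exI[of _ "%_. 0"]) simp

lemma Hs_add: assumes "u : Hs Om ze e" "v : Hs Om ze e" shows "(%og. u og + v og) : Hs Om ze e"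
proof -
 obtain a b where "ALL og:Om. u og = (SUM apz:lsimp UNIV e. a apz * mnl apz (ze og))"
  "ALL og:Om. v og = (SUM apz:lsimp UNIV e. b apz * mnl apz (ze og))" using assms unfolding Hs_def by blast
 thus ?thesis unfolding Hs_def
  by (intro CollectI exI[of _ "%apz. a apz + b apz"]) (simp add: algebra_simps sum.distrib)
qed

lemma Hs_scale: assumes "u : Hs Om ze e" shows "(%og. b * u og) : Hs Om ze e"
proof -
 obtain a where "ALL og:Om. u og = (SUM apz:lsimp UNIV e. a apz * mnl apz (ze og))"
  using assms unfolding Hs_def by blast
 thus ?thesis unfolding Hs_def
  by (intro CollectI exI[of _ "%apz. b * a apz"]) (simp add: sum_distrib_left mult.assoc)
qed

lemma Hs_diff: assumes "u : Hs Om ze e" "v : Hs Om ze e" shows "(%og. u og - v og) : Hs Om ze e"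
 using Hs_add[OF assms(1) Hs_scale[OF assms(2), of "-1"]] by simp

lemma Hs_sum: "(!!j. j : J ==> u j : Hs Om ze e) ==> (%og. SUM j:J. u j og) : Hs Om ze e"
 by (induction J rule: infinite_finite_induct) (auto intro: Hs_0 Hs_add)

lemma Hs_mono:
 fixes ze :: "'w => complex ^ 'm::finite"
 assumes "sum apz UNIV = e" shows "(%og. mnl apz (ze og)) : Hs Om ze e"
proof -
 have "mnl apz z = (SUM bt:lsimp UNIV e. (if bt = apz then 1 else 0) * mnl bt z)" for z :: "complex ^ 'm"
 proof -
  have "(SUM bt:lsimp UNIV e. (if bt = apz then 1 else 0) * mnl bt z) = (SUM bt:lsimp UNIV e. if bt = apz then mnl bt z else 0)"
   by (rule sum.cong) auto
  thus ?thesis using assms by (simp add: finite_lsimp) (simp add: lsimp_def)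
 qed
 thus ?thesis unfolding Hs_def
  by (intro CollectI exI[of _ "%bt. if bt = apz then 1 else 0"] ballI)
qed

lemma Hs_cong: "u : Hs Om ze e ==> (!!og. og : Om ==> v og = u og) ==> v : Hs Om ze e"
 unfolding Hs_def by simp

lemma HsE:
 assumes "u : Hs Om ze e"
 obtains a where "!!og. og : Om ==> u og = (SUM apz:lsimp UNIV e. a apz * mnl apz (ze og))"
 using assms unfolding Hs_def by blast

lemma mnl_Suc: "mnl (apz(i := Suc (apz i))) z = z $ i * mnl apz z"
proof -
 have "mnl (apz(i := Suc (apz i))) z = z $ i ^ Suc (apz i) * (PROD j:UNIV - {i}. z $ j ^ apz j)"
  unfolding mnl_def by (subst prod.remove[of _ i]) auto
 also have "... = z $ i * (z $ i ^ apz i * (PROD j:UNIV - {i}. z $ j ^ apz j))" by simp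
 also have "z $ i ^ apz i * (PROD j:UNIV - {i}. z $ j ^ apz j) = mnl apz z"
  unfolding mnl_def by (subst prod.remove[of _ i]) auto
 finally show ?thesis .
qed

lemma sum_upd_Suc: "sum (apz(i := Suc (apz i))) (UNIV :: 'm::finite set) = Suc (sum apz UNIV)"
 by (simp add: sum.remove[of UNIV i])

lemma sum_upd_pred: "apz i ~= 0 ==> Suc (sum (apz(i := apz i - 1)) (UNIV :: 'm::finite set)) = sum apz UNIV"
 by (simp add: sum.remove[of UNIV i])

lemma Hs_mult_coord: assumes "u : Hs Om ze e" shows "(%og. ze og $ i * u og) : Hs Om ze (Suc e)"
proof -
 obtain a where a: "!!og. og : Om ==> u og = (SUM apz:lsimp UNIV e. a apz * mnl apz (ze og))"
  using assms by (rule HsE) blast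
 have "(%og. SUM apz:lsimp UNIV e. a apz * mnl (apz(i := Suc (apz i))) (ze og)) : Hs Om ze (Suc e)"
  by (intro Hs_sum Hs_scale Hs_mono) (simp add: sum_upd_Suc lsimp_def del: fun_upd_apply)
 thus ?thesis
  by (rule Hs_cong) (simp add: a mnl_Suc sum_distrib_left mult.left_commute)
qed

context hardy
begin

lemma coord_le: "og : Om ==> cmod (ze og $ i) <= 1"
 using Finite_Cartesian_Product.norm_nth_le[of "ze og" i] on_sphere[of og] by simp

lemma ip_mono: "sum apz UNIV <= Suc L ==> sum bt UNIV <= Suc L ==>
  ip Om (%og. mnl apz (ze og)) (%og. mnl bt (ze og)) = (if apz = bt then of_real (N apz) else 0)"
 unfolding ip_def by (rule orth)

lemma nr_mono_power2: "sum apz UNIV <= Suc L ==> (nr Om (%og. mnl apz (ze og)))\<^sup>2 = N apz"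
 using nr_power2[of Om "%og. mnl apz (ze og)"] ip_mono[of apz apz] by (simp only: of_real_eq_iff if_True refl)

lemma nr_hom:
 assumes "e <= Suc L"
 shows "(nr Om (%og. SUM apz:lsimp UNIV e. a apz * mnl apz (ze og)))\<^sup>2 = (SUM apz:lsimp UNIV e. (cmod (a apz))\<^sup>2 * N apz)"
proof -
 have "(nr Om (%og. SUM apz:lsimp UNIV e. a apz * mnl apz (ze og)))\<^sup>2
   = (SUM apz:lsimp UNIV e. (cmod (a apz))\<^sup>2 * (nr Om (%og. mnl apz (ze og)))\<^sup>2)"
  by (rule nr_orth_sum[OF finite_lsimp[OF finite]]) (use assms ip_mono in \<open>auto simp: lsimp_def\<close>)
 thus ?thesis using assms by (simp add: nr_mono_power2 lsimp_def)
qed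

lemma Hs_orth: assumes "u : Hs Om ze e" "v : Hs Om ze e'" "e <= Suc L" "e' <= Suc L" "e ~= e'"
 shows "ip Om u v = 0"
proof -
 obtain a where a: "!!og. og : Om ==> u og = (SUM apz:lsimp UNIV e. a apz * mnl apz (ze og))"
  using assms(1) by (rule HsE) blast
 obtain b where b: "!!og. og : Om ==> v og = (SUM apz:lsimp UNIV e'. b apz * mnl apz (ze og))"
  using assms(2) by (rule HsE) blast
 have "ip Om u v = (SUM og:Om. SUM apz:lsimp UNIV e. SUM bt:lsimp UNIV e'. a apz * cnj (b bt) * (mnl apz (ze og) * cnj (mnl bt (ze og))))"
  unfolding ip_def by (rule sum.cong[OF refl]) (simp add: a b sum_product ac_simps)
 also have "... = (SUM apz:lsimp UNIV e. SUM bt:lsimp UNIV e'. a apz * cnj (b bt) * (SUM og:Om. mnl apz (ze og) * cnj (mnl bt (ze og))))"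
  unfolding sum_distrib_left by (subst sum.swap, rule sum.cong[OF refl], subst sum.swap) simp
 also have "... = 0"
  using assms(3-5) by (intro sum.neutral ballI) (auto simp: orth lsimp_def)
 finally show ?thesis .
qed

text \<open>On a monomial, multiplication by the conjugate coordinate is a lowering operator up to
  the defect \<open>g apz\<close>. The defects for different exponents are mutually orthogonal, so
  the bounds from \<open>gap\<close> add up without any factor for the dimension.\<close>

lemma Hs_mult_cnj:
 assumes u: "u : Hs Om ze e" and e: "0 < e" "e <= L"
 obtains v where "v : Hs Om ze (e - 1)" 
  "nr Om (%og. cnj (ze og $ i) * u og - v og) <= sqrt (2 / (real e + 1)) * nr Om u" "nr Om v <= 3 * nr Om u"
proof -
 obtain a where a: "!!og. og : Om ==> u og = (SUM apz:lsimp UNIV e. a apz * mnl apz (ze og))"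
  using u by (rule HsE) blast
 \<comment> \<open>The coefficient of the orthogonal projection onto the lowered monomial. If
   \<open>apz i = 0\<close>, truncated subtraction would return \<open>apz\<close> itself, so the
   coefficient is set to 0.\<close>
 define r where "r apz = (if apz i = 0 then 0 else N apz / N (apz(i := apz i - 1)))" for apz
 define v where "v og = (SUM apz:lsimp UNIV e. (a apz * of_real (r apz)) * mnl (apz(i := apz i - 1)) (ze og))" for og
 define g where "g apz og = cnj (ze og $ i) * mnl apz (ze og) - of_real (r apz) * mnl (apz(i := apz i - 1)) (ze og)" for apz og
 let ?S = "lsimp (UNIV :: 'm set) e" and ?p = "%apz. apz(i := apz i - 1)" and ?s = "%apz. apz(i := Suc (apz i))"
 have sS: "sum apz UNIV = e" if "apz : ?S" for apz using that by (simp add: lsimp_def)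
 have v1: "v : Hs Om ze (e - 1)" unfolding v_def
 proof (rule Hs_sum)
  fix apz assume al: "apz : ?S"
  show "(%og. a apz * complex_of_real (r apz) * mnl (?p apz) (ze og)) : Hs Om ze (e - 1)"
  proof (cases "apz i = 0")
   case True
   thus ?thesis using Hs_0 by (simp add: r_def)
  next
   case False
   thus ?thesis using sum_upd_pred[of apz i] sS[OF al] by (intro Hs_scale Hs_mono) linarith
  qed
 qed
 have ips: "(SUM og:Om. cnj (ze og $ i) * mnl apz (ze og) * cnj (cnj (ze og $ i) * mnl bt (ze og))) = (if apz = bt then of_real (N (?s apz)) else 0)"
  if "apz : ?S" "bt : ?S" for apz bt
 proof -
  have "(SUM og:Om. cnj (ze og $ i) * mnl apz (ze og) * cnj (cnj (ze og $ i) * mnl bt (ze og)))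
   = (SUM og:Om. mnl (?s apz) (ze og) * cnj (mnl (?s bt) (ze og)))"
   unfolding mnl_Suc by (simp add: ac_simps)
  also have "... = (if ?s apz = ?s bt then of_real (N (?s apz)) else 0)"
   by (rule orth) (use sS[OF that(1)] sS[OF that(2)] e in \<open>simp_all add: sum_upd_Suc del: fun_upd_apply\<close>)
  also have "?s apz = ?s bt \<longleftrightarrow> apz = bt" by (metis fun_upd_same fun_upd_triv fun_upd_upd nat.inject)
  finally show ?thesis .
 qed
 have ipm: "(SUM og:Om. cnj (ze og $ i) * mnl apz (ze og) * cnj (mnl (?p bt) (ze og))) = (if apz = bt then of_real (N apz) else 0)"
  if "apz : ?S" "bt : ?S" "bt i ~= 0" for apz bt
 proof -
  have b: "?s (?p bt) = bt" using that(3) by auto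
  have "(SUM og:Om. cnj (ze og $ i) * mnl apz (ze og) * cnj (mnl (?p bt) (ze og))) = (SUM og:Om. mnl apz (ze og) * cnj (mnl bt (ze og)))"
   by (rule sum.cong[OF refl], subst (2) b[symmetric], subst mnl_Suc) (simp add: ac_simps)
  thus ?thesis using orth[of apz bt] sS[OF that(1)] sS[OF that(2)] e by simp
 qed
 have ippp: "(SUM og:Om. mnl (?p apz) (ze og) * cnj (mnl (?p bt) (ze og))) = (if apz = bt then of_real (N (?p apz)) else 0)"
  if "apz : ?S" "bt : ?S" "apz i ~= 0" "bt i ~= 0" for apz bt
 proof -
  have b: "?s (?p bt) = bt" "?s (?p apz) = apz" using that(3,4) by auto
  have "(SUM og:Om. mnl (?p apz) (ze og) * cnj (mnl (?p bt) (ze og))) = (if ?p apz = ?p bt then of_real (N (?p apz)) else 0)"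
   by (rule orth) (use sS[OF that(1)] sS[OF that(2)] sum_upd_pred[of apz i] sum_upd_pred[of bt i] that(3,4) e in linarith)+
  moreover have "?p apz = ?p bt \<longleftrightarrow> apz = bt" using b by metis
  ultimately show ?thesis by simp
 qed
 have ipg: "ip Om (g apz) (g bt) = (if apz = bt then of_real (N (?s apz) - (if apz i = 0 then 0 else (N apz)\<^sup>2 / N (?p apz))) else 0)"
  if "apz : ?S" "bt : ?S" for apz bt
 proof -
  let ?A = "SUM og:Om. cnj (ze og $ i) * mnl apz (ze og) * cnj (cnj (ze og $ i) * mnl bt (ze og))"
  let ?B = "SUM og:Om. cnj (ze og $ i) * mnl apz (ze og) * cnj (mnl (?p bt) (ze og))"
  let ?C = "SUM og:Om. cnj (ze og $ i) * mnl bt (ze og) * cnj (mnl (?p apz) (ze og))"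
  let ?E = "SUM og:Om. mnl (?p apz) (ze og) * cnj (mnl (?p bt) (ze og))"
  have ex: "ip Om (g apz) (g bt) = ?A - of_real (r bt) * ?B - of_real (r apz) * cnj ?C + of_real (r apz * r bt) * ?E"
   unfolding ip_def g_def by (simp add: algebra_simps sum.distrib sum_subtractf sum_distrib_left del: fun_upd_apply)
  have rB: "of_real (r bt) * ?B = (if apz = bt then of_real (r apz * N apz) else 0)"
   using ipm[OF that] by (cases "bt i = 0") (auto simp: r_def)
  have rC: "of_real (r apz) * cnj ?C = (if apz = bt then of_real (r apz * N apz) else 0)"
   using ipm[OF that(2,1)] by (cases "apz i = 0") (auto simp: r_def)
  have rE: "of_real (r apz * r bt) * ?E = (if apz = bt then of_real (r apz * r apz * N (?p apz)) else 0)"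
  proof (cases "apz i = 0 \<or> bt i = 0")
   case True
   hence "r apz = 0 \<or> r bt = 0" by (auto simp: r_def)
   thus ?thesis by auto
  next
   case False
   thus ?thesis using ippp[OF that] by (simp del: fun_upd_apply)
  qed
  have rr: "r apz * N apz = (if apz i = 0 then 0 else (N apz)\<^sup>2 / N (?p apz))" 
   by (simp add: r_def power2_eq_square del: fun_upd_apply)
  have rr2: "r apz * r apz * N (?p apz) = r apz * N apz"
  proof (cases "apz i = 0")
   case False
   have "N (?p apz) > 0" by (rule N_pos) (use sS[OF that(1)] sum_upd_pred[of apz i] False e in linarith)
   thus ?thesis using False by (simp add: r_def del: fun_upd_apply)
  qed (simp add: r_def)
  show ?thesis unfolding ex ips[OF that] rB rC rE rr2 rr[symmetric] by simp
 qed
 have uu: "(nr Om u)\<^sup>2 = (SUM apz:?S. (cmod (a apz))\<^sup>2 * N apz)"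
  using nr_hom[of e a] e nr_cong[of Om u, OF a] by simp
 have d: "cnj (ze og $ i) * u og - v og = (SUM apz:?S. a apz * g apz og)" if "og : Om" for og
  unfolding g_def v_def a[OF that] by (simp add: sum_distrib_left sum_subtractf[symmetric] algebra_simps del: fun_upd_apply)
 have "(nr Om (%og. cnj (ze og $ i) * u og - v og))\<^sup>2 = (nr Om (%og. SUM apz:?S. a apz * g apz og))\<^sup>2"
  using nr_cong[OF d] by simp
 also have "... = (SUM apz:?S. (cmod (a apz))\<^sup>2 * (nr Om (g apz))\<^sup>2)"
  by (rule nr_orth_sum) (auto simp: finite_lsimp ipg)
 also have "... <= (SUM apz:?S. (cmod (a apz))\<^sup>2 * (2 / (real e + 1) * N apz))"
 proof (intro sum_mono mult_left_mono)
  fix apz assume al: "apz : ?S"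
  have "complex_of_real ((nr Om (g apz))\<^sup>2) = of_real (N (?s apz) - (if apz i = 0 then 0 else (N apz)\<^sup>2 / N (?p apz)))"
   unfolding nr_power2 ipg[OF al al] by simp
  hence "(nr Om (g apz))\<^sup>2 = N (?s apz) - (if apz i = 0 then 0 else (N apz)\<^sup>2 / N (?p apz))" by (simp only: of_real_eq_iff)
  also have "... <= 2 / (real (sum apz UNIV) + 1) * N apz" by (rule gap) (use sS[OF al] e in simp)
  finally show "(nr Om (g apz))\<^sup>2 <= 2 / (real e + 1) * N apz" using sS[OF al] by simp
 qed simp
 also have "... = 2 / (real e + 1) * (nr Om u)\<^sup>2" unfolding uu by (simp add: sum_distrib_left ac_simps)
 finally have sq: "(nr Om (%og. cnj (ze og $ i) * u og - v og))\<^sup>2 <= 2 / (real e + 1) * (nr Om u)\<^sup>2" .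
 have n1: "nr Om (%og. cnj (ze og $ i) * u og - v og) <= sqrt (2 / (real e + 1)) * nr Om u"
  by (rule power2_le_imp_le) (use sq in \<open>simp_all add: power_mult_distrib\<close>)
 \<comment> \<open>A crude bound; adding the 1 for the multiplication itself gives the factor 3 in
   the norm estimate.\<close>
 have "sqrt (2 / (real e + 1)) <= 2"
  by (rule real_le_lsqrt) (simp_all add: divide_le_eq)
 hence "nr Om (%og. cnj (ze og $ i) * u og - v og) <= 2 * nr Om u"
  using n1 by (meson mult_right_mono nr_nonneg order_trans)
 moreover have "nr Om (%og. cnj (ze og $ i) * u og) <= 1 * nr Om u"
  by (rule nr_bound_mult) (use coord_le in auto)
 moreover have "nr Om v <= nr Om (%og. cnj (ze og $ i) * u og) + nr Om (%og. cnj (ze og $ i) * u og - v og)"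
  using nr_diff[of Om "%og. cnj (ze og $ i) * u og" "%og. cnj (ze og $ i) * u og - v og"] by simp
 ultimately have "nr Om v <= 3 * nr Om u" by simp
 thus ?thesis using that[OF v1 n1] by blast
qed

end

text \<open>Words in the coordinates (\<open>True\<close>) and their conjugates (\<open>False\<close>).\<close>

primrec wd :: "(bool \<times> 'm::finite) list => complex ^ 'm => complex" where
 "wd [] z = 1"
| "wd (x # g) z = (if fst x then z $ snd x else cnj (z $ snd x)) * wd g z"

text \<open>The predecessor truncates at 0; where the function is used the word is not longer than
  \<open>e\<close>, so this does not happen.\<close>

primrec tgt :: "(bool \<times> 'm) list => nat => nat" where
 "tgt [] e = e"
| "tgt (x # g) e = (if fst x then Suc (tgt g e) else tgt g e - 1)"

lemma tgt_bounds: "e - length g <= tgt g e" "tgt g e <= e + length g"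
 by (induction g) auto

lemma wd_append: "wd (g @ h) z = wd g z * wd h z"
 by (induction g) auto

text \<open>Letters act starting from the end of the list. A coordinate is exact and does not
  increase norms; a conjugate coordinate adds an error of order \<open>1 / sqrt e\<close> and at
  most triples the norm, which explains the constant.\<close>

lemma (in hardy) word_approx:
 assumes "u : Hs Om ze e" "length g <= e" "e + length g <= L"
 shows "EX v:Hs Om ze (tgt g e). nr Om (%og. wd g (ze og) * u og - v og)
   <= real (length g) * 3 ^ length g * sqrt (2 / (real (e - length g) + 1)) * nr Om u & nr Om v <= 3 ^ length g * nr Om u"
 using assms
proof (induction g)
 case Nil
 thus ?case by (intro bexI[of _ u]) (auto simp: nr_def L2_set_def)
next
 case (Cons x g)
 let ?k = "length g"
 let ?s = "sqrt (2 / (real (e - ?k) + 1))" and ?s' = "sqrt (2 / (real (e - Suc ?k) + 1))"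
 have ss: "?s <= ?s'" using Cons.prems by (intro real_sqrt_le_mono divide_left_mono) auto
 obtain v where v: "v : Hs Om ze (tgt g e)" "nr Om (%og. wd g (ze og) * u og - v og) <= real ?k * 3 ^ ?k * ?s * nr Om u"
  "nr Om v <= 3 ^ ?k * nr Om u" using Cons by auto
 have v2: "nr Om (%og. wd g (ze og) * u og - v og) <= real ?k * 3 ^ ?k * ?s' * nr Om u"
  by (rule order_trans[OF v(2)]) (use ss in \<open>intro mult_right_mono mult_left_mono, auto\<close>)
 have big: "real ?k * 3 ^ ?k * ?s' * nr Om u + ?s' * (3 ^ ?k * nr Om u) <= real (Suc ?k) * 3 ^ Suc ?k * ?s' * nr Om u"
 proof -
  have "real ?k * 3 ^ ?k * ?s' * nr Om u + ?s' * (3 ^ ?k * nr Om u) = (real (Suc ?k) * 3 ^ ?k) * (?s' * nr Om u)"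
   by (simp add: algebra_simps)
  also have "... <= (real (Suc ?k) * 3 ^ Suc ?k) * (?s' * nr Om u)"
   by (intro mult_right_mono mult_left_mono) auto
  finally show ?thesis by (simp add: mult.assoc)
 qed
 have nn: "0 <= ?s' * (3 ^ ?k * nr Om u)" by simp
 show ?case
 proof (cases "fst x")
  case True
  let ?i = "snd x"
  have "nr Om (%og. ze og $ ?i * (wd g (ze og) * u og - v og)) <= 1 * nr Om (%og. wd g (ze og) * u og - v og)"
   by (rule nr_bound_mult) (auto intro: coord_le)
  hence "nr Om (%og. wd (x # g) (ze og) * u og - ze og $ ?i * v og) <= real ?k * 3 ^ ?k * ?s' * nr Om u"
   using v2 True by (simp add: right_diff_distrib mult.assoc)
  hence "nr Om (%og. wd (x # g) (ze og) * u og - ze og $ ?i * v og) <= real (Suc ?k) * 3 ^ Suc ?k * ?s' * nr Om u"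
   using big nn by linarith
  moreover have "nr Om (%og. ze og $ ?i * v og) <= 1 * nr Om v" by (rule nr_bound_mult) (auto intro: coord_le)
  hence "nr Om (%og. ze og $ ?i * v og) <= 3 ^ Suc ?k * nr Om u" using v(3) 
   by (simp only: power_Suc mult.assoc) (use nr_nonneg[of Om v] in linarith)
  moreover have "(%og. ze og $ ?i * v og) : Hs Om ze (tgt (x # g) e)" using Hs_mult_coord[OF v(1)] True by simp
  ultimately show ?thesis by (intro bexI[of _ "%og. ze og $ ?i * v og"]) simp_all
 next
  case False
  let ?i = "snd x" and ?t = "tgt g e"
  have t: "0 < ?t" "?t <= L" "e - Suc ?k <= ?t" using tgt_bounds[where g=g and e=e] Cons.prems by auto
  obtain w where w: "w : Hs Om ze (?t - 1)" "nr Om (%og. cnj (ze og $ ?i) * v og - w og) <= sqrt (2 / (real ?t + 1)) * nr Om v"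
   "nr Om w <= 3 * nr Om v" using Hs_mult_cnj[OF v(1) t(1,2)] by blast
  have "nr Om (%og. cnj (ze og $ ?i) * (wd g (ze og) * u og - v og)) <= 1 * nr Om (%og. wd g (ze og) * u og - v og)"
   by (rule nr_bound_mult) (auto intro: coord_le)
  moreover have "sqrt (2 / (real ?t + 1)) * nr Om v <= ?s' * (3 ^ ?k * nr Om u)"
   by (intro mult_mono real_sqrt_le_mono divide_left_mono v(3)) (use t in auto)
  moreover have "nr Om (%og. wd (x # g) (ze og) * u og - w og) <= nr Om (%og. cnj (ze og $ ?i) * (wd g (ze og) * u og - v og))
    + nr Om (%og. cnj (ze og $ ?i) * v og - w og)"
   using nr_add[of Om "%og. cnj (ze og $ ?i) * (wd g (ze og) * u og - v og)" "%og. cnj (ze og $ ?i) * v og - w og"] False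
   by (simp add: algebra_simps)
  ultimately have "nr Om (%og. wd (x # g) (ze og) * u og - w og) <= real (Suc ?k) * 3 ^ Suc ?k * ?s' * nr Om u"
   using v2 w(2) big by linarith
  moreover have "nr Om w <= 3 ^ Suc ?k * nr Om u" using w(3) v(3) by simp
  ultimately show ?thesis using w(1) False by (intro bexI[of _ w]) simp_all
 qed
qed

text \<open>Polynomials in the coordinates and their conjugates with coefficients continuous in
  \<open>t\<close>. Their terms are words, each of which shifts the degree by a definite
  amount.\<close>

inductive wpoly :: "('t::topological_space => complex ^ 'm::finite => complex) => bool" where
 wpoly_word: "continuous_on UNIV c ==> wpoly (%t z. c t * wd g z)"
| wpoly_add: "wpoly f ==> wpoly h ==> wpoly (%t z. f t z + h t z)"

lemma wpoly_mult: "wpoly f ==> wpoly h ==> wpoly (%t z. f t z * h t z)"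
proof (induction f rule: wpoly.induct)
 case (wpoly_word c g)
 from wpoly_word(2) show ?case
 proof (induction h rule: wpoly.induct)
  case (wpoly_word c' g')
  have "wpoly (%t z. (c t * c' t) * wd (g @ g') z)"
   by (intro wpoly.wpoly_word continuous_intros wpoly_word \<open>continuous_on UNIV c\<close>)
  thus ?case by (simp add: wd_append ac_simps)
 next
  case (wpoly_add f h)
  thus ?case using wpoly.wpoly_add by (fastforce simp: distrib_left)
 qed
next
 case (wpoly_add f1 f2)
 thus ?case using wpoly.wpoly_add by (fastforce simp: distrib_right)
qed

lemma wpoly_sum: "finite J ==> (!!j. j : J ==> wpoly (f j)) ==> wpoly (%t z. SUM j:J. f j t z)"
proof (induction J rule: finite_induct)
 case empty
 have "wpoly (%t z. 0 * wd [] z)" by (rule wpoly_word) auto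
 thus ?case by simp
next
 case (insert x F)
 thus ?case by (simp add: wpoly_add)
qed

text \<open>Real linear functionals generate the real polynomial functions. In \<open>z\<close> they
  are combinations of words of length at most one, because real and imaginary parts are combinations
  of a coordinate and its conjugate.\<close>

lemma wpoly_of_real_linear:
 fixes f :: "'t::real_normed_vector \<times> (complex ^ 'm::finite) => real"
 assumes "bounded_linear f"
 shows "wpoly (%t z. complex_of_real (f (t, z)))"
proof -
 interpret bounded_linear f by fact
 have z: "z = (SUM i:UNIV. Re (z $ i) *\<^sub>R axis i 1 + Im (z $ i) *\<^sub>R axis i \<i>)" for z :: "complex ^ 'm"
  unfolding vec_eq_iff
 proof
  fix k
  have "(SUM i:UNIV. Re (z $ i) *\<^sub>R axis i 1 + Im (z $ i) *\<^sub>R axis i \<i>) $ k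
    = (SUM i:UNIV. if k = i then Re (z $ i) *\<^sub>R 1 + Im (z $ i) *\<^sub>R \<i> else 0)"
   unfolding sum_component by (rule sum.cong[OF refl]) (simp add: axis_def)
  also have "... = z $ k" by (simp add: complex_eq_iff)
  finally show "z $ k = (SUM i:UNIV. Re (z $ i) *\<^sub>R axis i 1 + Im (z $ i) *\<^sub>R axis i \<i>) $ k" by simp
 qed
 have eq: "f (t, z) = f (t, 0) + (SUM i:UNIV. Re (z $ i) * f (0, axis i 1) + Im (z $ i) * f (0, axis i \<i>))" for t z
 proof -
  have "f (t, z) = f (t, 0) + f (0, z)" by (simp add: add[symmetric])
  also have "f (0, z) = f (0, SUM i:UNIV. Re (z $ i) *\<^sub>R axis i 1 + Im (z $ i) *\<^sub>R axis i \<i>)"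
   by (rule arg_cong[where f = "%x. f (0, x)", OF z])
  also have "... = f (SUM i:UNIV. (0, Re (z $ i) *\<^sub>R axis i 1 + Im (z $ i) *\<^sub>R axis i \<i>))"
   by (rule arg_cong[where f = f]) (simp add: prod_eq_iff fst_sum snd_sum)
  also have "... = (SUM i:UNIV. f (0, Re (z $ i) *\<^sub>R axis i 1) + f (0, Im (z $ i) *\<^sub>R axis i \<i>))"
   by (simp add: sum add[symmetric])
  also have "... = (SUM i:UNIV. Re (z $ i) * f (0, axis i 1) + Im (z $ i) * f (0, axis i \<i>))"
  proof -
   have "f (0, r *\<^sub>R x) = r * f (0, x)" for r x using scale[of r "(0, x)"] by simp
   thus ?thesis by simp
  qed
  finally show ?thesis .
 qed
 have re: "wpoly (%(t::'t) (z::complex^'m). complex_of_real (Re (z $ i) * c))" for i c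
 proof -
  have "wpoly (%(t::'t) z. (of_real c / 2) * wd [(True, i)] z + (of_real c / 2) * wd [(False, i)] z)"
   by (intro wpoly.intros continuous_intros)
  moreover have "(of_real c / 2) * wd [(True, i)] z + (of_real c / 2) * wd [(False, i)] z = complex_of_real (Re (z $ i) * c)" for z
   by (simp add: complex_eq_iff)
  ultimately show ?thesis by simp
 qed
 have im: "wpoly (%(t::'t) (z::complex^'m). complex_of_real (Im (z $ i) * c))" for i c
 proof -
  have "wpoly (%(t::'t) z. (- \<i> * of_real c / 2) * wd [(True, i)] z + (\<i> * of_real c / 2) * wd [(False, i)] z)"
   by (intro wpoly.intros continuous_intros)
  moreover have "(- \<i> * of_real c / 2) * wd [(True, i)] z + (\<i> * of_real c / 2) * wd [(False, i)] z = complex_of_real (Im (z $ i) * c)" for z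
   by (simp add: complex_eq_iff)
  ultimately show ?thesis by simp
 qed
 have c0: "continuous_on UNIV (%t. complex_of_real (f (t, 0)))"
  by (intro continuous_intros linear_continuous_on[OF bounded_linear_axioms, THEN continuous_on_compose2]) auto
 have "wpoly (%(t::'t) (z::complex^'m). complex_of_real (f (t, 0)) * wd [] z)" by (rule wpoly_word[OF c0])
 hence "wpoly (%t z. complex_of_real (f (t, 0)) * wd [] z + (SUM i:UNIV. complex_of_real (Re (z $ i) * f (0, axis i 1)) + complex_of_real (Im (z $ i) * f (0, axis i \<i>))))"
  by (intro wpoly_add wpoly_sum re im) auto
 moreover have "complex_of_real (f (t, z)) = complex_of_real (f (t, 0)) * wd [] z + (SUM i:UNIV. complex_of_real (Re (z $ i) * f (0, axis i 1)) + complex_of_real (Im (z $ i) * f (0, axis i \<i>)))" for t z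
  by (subst eq) (simp only: of_real_add of_real_sum wd.simps mult_1_right)
 hence "(%t z. complex_of_real (f (t, z))) = (%t z. complex_of_real (f (t, 0)) * wd [] z + (SUM i:UNIV. complex_of_real (Re (z $ i) * f (0, axis i 1)) + complex_of_real (Im (z $ i) * f (0, axis i \<i>))))"
  by (intro ext)
 ultimately show ?thesis by (rule ssubst[rotated])
qed

lemma wpoly_real_polynomial:
 fixes f :: "'t::real_normed_vector \<times> (complex ^ 'm::finite) => real"
 assumes "real_polynomial_function f"
 shows "wpoly (%t z. complex_of_real (f (t, z)))"
 using assms
proof (induction f rule: real_polynomial_function.induct)
 case (linear f) thus ?case by (rule wpoly_of_real_linear)
next
 case (const c)
 have "wpoly (%(t::'t) z. of_real c * wd [] z)" by (rule wpoly_word) auto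
 thus ?case by simp
next
 case (add f g) thus ?case by (simp add: wpoly_add)
next
 case (mult f g) thus ?case by (simp add: wpoly_mult)
qed

lemma wpoly_dense:
 fixes F :: "'t::euclidean_space \<times> (complex ^ 'm::finite) => complex"
 assumes "compact K" "continuous_on K F" "ep > 0"
 obtains f where "wpoly f" "!!t z. (t, z) : K ==> cmod (F (t, z) - f t z) < ep"
proof -
 have "continuous_on K (%x. Re (F x))" "continuous_on K (%x. Im (F x))" using assms by (auto intro: continuous_intros)
 then obtain p q where p: "real_polynomial_function p" "!!x. x : K ==> \<bar>Re (F x) - p x\<bar> < ep / 2"
  and q: "real_polynomial_function q" "!!x. x : K ==> \<bar>Im (F x) - q x\<bar> < ep / 2"
  using Stone_Weierstrass_real_polynomial_function[OF assms(1), of _ "ep / 2"] assms(3) by (metis half_gt_zero)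
 have i: "wpoly (%(t::'t) (z::complex^'m). \<i> * wd [] z)" by (rule wpoly_word) auto
 show ?thesis
 proof (rule that)
  show "wpoly (%t z. complex_of_real (p (t, z)) + (\<i> * wd [] z) * complex_of_real (q (t, z)))"
   by (intro wpoly_add wpoly_mult wpoly_real_polynomial p q i)
  fix t z assume "(t, z) : K"
  hence "\<bar>Re (F (t, z)) - p (t, z)\<bar> + \<bar>Im (F (t, z)) - q (t, z)\<bar> < ep" using p(2) q(2) by fastforce
  moreover have "cmod (F (t, z) - (complex_of_real (p (t, z)) + (\<i> * wd [] z) * complex_of_real (q (t, z))))
    <= \<bar>Re (F (t, z)) - p (t, z)\<bar> + \<bar>Im (F (t, z)) - q (t, z)\<bar>"
   using cmod_le[of "F (t, z) - (complex_of_real (p (t, z)) + (\<i> * wd [] z) * complex_of_real (q (t, z)))"] by simp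
  ultimately show "cmod (F (t, z) - (complex_of_real (p (t, z)) + (\<i> * wd [] z) * complex_of_real (q (t, z)))) < ep"
   by linarith
 qed
qed


text \<open>The words of \<open>f\<close> shift the degree differently, so the product is close only
  to a sum of homogeneous polynomials of several degrees. The order of quantifiers matters:
  \<open>k\<close> does not depend on the accuracy, and \<open>D\<close> does not depend on
  \<open>L\<close> or the sample, so the sample can be chosen last.\<close>

lemma wpoly_almost_invariant:
 fixes f :: "'t::topological_space => complex ^ 'm::finite => complex"
 assumes "wpoly f" "compact T"
 shows "EX k. ALL de>0. EX D. ALL e>=D. ALL L (Om :: 'w set) ze N rh c. hardy L Om ze N rh c --> e + k <= L -->
  (ALL t:T. ALL u:Hs Om ze e. EX y. (ALL j. y j : Hs Om ze j) \<and>
    nr Om (%og. f t (ze og) * u og - (SUM j<=L. y j og)) <= de * nr Om u)"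
 using assms(1)
proof (induction f rule: wpoly.induct)
 case (wpoly_word c g)
 have "compact (c ` T)" using wpoly_word assms(2) by (meson compact_continuous_image continuous_on_subset subset_UNIV)
 then obtain B where B: "!!t. t : T ==> cmod (c t) <= B" "B > 0"
  using compact_imp_bounded bounded_pos by (metis imageI)
 let ?k = "length g"
 show ?case
 proof (rule exI[of _ ?k], intro allI impI)
  fix de :: real assume de: "de > 0"
  let ?C = "B * (real ?k * 3 ^ ?k)"
  have "(%e. ?C * sqrt (2 / (real e + 1))) \<longlonglongrightarrow> ?C * sqrt 0"
   by (intro tendsto_intros) real_asymp
  hence "\<forall>\<^sub>F e in sequentially. ?C * sqrt (2 / (real e + 1)) < de"
   using de by (intro order_tendstoD) auto
  then obtain D where D: "!!e. e >= D ==> ?C * sqrt (2 / (real e + 1)) < de" by (auto simp: eventually_sequentially)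
  show "EX D. ALL e>=D. ALL L (Om :: 'w set) ze N rh c'. hardy L Om ze N rh c' --> e + ?k <= L -->
   (ALL t:T. ALL u:Hs Om ze e. EX y. (ALL j. y j : Hs Om ze j) \<and>
    nr Om (%og. c t * wd g (ze og) * u og - (SUM j<=L. y j og)) <= de * nr Om u)"
  proof (intro exI[of _ "D + ?k"] allI impI ballI)
   fix e L and Om :: "'w set" and ze :: "'w => complex ^ 'm" and N rh c' t u
   assume e: "D + ?k <= e" "e + ?k <= L" and H: "hardy L Om ze N rh c'" and t: "t : T" and u: "u : Hs Om ze e"
   interpret hardy L Om ze N rh c' by (rule H)
   obtain v where v: "v : Hs Om ze (tgt g e)" "nr Om (%og. wd g (ze og) * u og - v og)
    <= real ?k * 3 ^ ?k * sqrt (2 / (real (e - ?k) + 1)) * nr Om u"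
    using word_approx[OF u, of g] e by auto
   define y where "y j = (if j = tgt g e then (%og. c t * v og) else (%og. 0))" for j
   have y: "y j : Hs Om ze j" for j by (cases "j = tgt g e") (auto simp: y_def intro: Hs_scale[OF v(1)] Hs_0)
   have ys: "(SUM j<=L. y j og) = c t * v og" for og
   proof -
    have "(SUM j<=L. y j og) = (SUM j<=L. if j = tgt g e then c t * v og else 0)"
     by (rule sum.cong) (auto simp: y_def)
    thus ?thesis using tgt_bounds(2)[of g e] e by simp
   qed
   have "nr Om (%og. c t * wd g (ze og) * u og - (SUM j<=L. y j og)) = nr Om (%og. c t * (wd g (ze og) * u og - v og))"
    unfolding ys by (simp add: algebra_simps)
   also have "... <= B * (real ?k * 3 ^ ?k * sqrt (2 / (real (e - ?k) + 1)) * nr Om u)"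
    unfolding nr_scale by (rule mult_mono[OF B(1)[OF t] v(2)]) (use B in auto)
   also have "... = (?C * sqrt (2 / (real (e - ?k) + 1))) * nr Om u" by (simp only: mult.assoc)
   also have "... <= de * nr Om u" by (rule mult_right_mono[OF less_imp_le[OF D]]) (use e in auto)
   finally show "EX y. (ALL j. y j : Hs Om ze j) & nr Om (%og. c t * wd g (ze og) * u og - (SUM j<=L. y j og)) <= de * nr Om u"
    using y by blast
  qed
 qed
next
 case (wpoly_add f h)
 from wpoly_add.IH(1) obtain k1 where k1: "ALL de>0. EX D. ALL e>=D. ALL L (Om :: 'w set) ze N rh c. hardy L Om ze N rh c --> e + k1 <= L -->
  (ALL t:T. ALL u:Hs Om ze e. EX y. (ALL j. y j : Hs Om ze j) \<and>
    nr Om (%og. f t (ze og) * u og - (SUM j<=L. y j og)) <= de * nr Om u)" ..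
 from wpoly_add.IH(2) obtain k2 where k2: "ALL de>0. EX D. ALL e>=D. ALL L (Om :: 'w set) ze N rh c. hardy L Om ze N rh c --> e + k2 <= L -->
  (ALL t:T. ALL u:Hs Om ze e. EX y. (ALL j. y j : Hs Om ze j) \<and>
    nr Om (%og. h t (ze og) * u og - (SUM j<=L. y j og)) <= de * nr Om u)" ..
 show ?case
 proof (rule exI[of _ "k1 + k2"], intro allI impI)
  fix de :: real assume "de > 0"
  hence d2: "de / 2 > 0" by simp
  from k1[THEN spec, THEN mp, OF d2] obtain D1 where D1: "ALL e>=D1. ALL L (Om :: 'w set) ze N rh c. hardy L Om ze N rh c --> e + k1 <= L -->
  (ALL t:T. ALL u:Hs Om ze e. EX y. (ALL j. y j : Hs Om ze j) \<and>
    nr Om (%og. f t (ze og) * u og - (SUM j<=L. y j og)) <= de / 2 * nr Om u)" ..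
  from k2[THEN spec, THEN mp, OF d2] obtain D2 where D2: "ALL e>=D2. ALL L (Om :: 'w set) ze N rh c. hardy L Om ze N rh c --> e + k2 <= L -->
  (ALL t:T. ALL u:Hs Om ze e. EX y. (ALL j. y j : Hs Om ze j) \<and>
    nr Om (%og. h t (ze og) * u og - (SUM j<=L. y j og)) <= de / 2 * nr Om u)" ..
  show "EX D. ALL e>=D. ALL L (Om :: 'w set) ze N rh c. hardy L Om ze N rh c --> e + (k1 + k2) <= L -->
   (ALL t:T. ALL u:Hs Om ze e. EX y. (ALL j. y j : Hs Om ze j) \<and>
    nr Om (%og. (f t (ze og) + h t (ze og)) * u og - (SUM j<=L. y j og)) <= de * nr Om u)"
  proof (intro exI[of _ "D1 + D2"] allI impI ballI)
   fix e L and Om :: "'w set" and ze :: "'w => complex ^ 'm" and N rh c t u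
   assume e: "D1 + D2 <= e" "e + (k1 + k2) <= L" and H: "hardy L Om ze N rh c" and t: "t : T" and u: "u : Hs Om ze e"
   have e1: "D1 <= e" "e + k1 <= L" "D2 <= e" "e + k2 <= L" using e by auto
   obtain y1 where y1: "!!j. y1 j : Hs Om ze j"
    "nr Om (%og. f t (ze og) * u og - (SUM j<=L. y1 j og)) <= de / 2 * nr Om u" using D1[rule_format, OF e1(1) H e1(2) t u] by blast
   obtain y2 where y2: "!!j. y2 j : Hs Om ze j"
    "nr Om (%og. h t (ze og) * u og - (SUM j<=L. y2 j og)) <= de / 2 * nr Om u" using D2[rule_format, OF e1(3) H e1(4) t u] by blast
   have "nr Om (%og. (f t (ze og) + h t (ze og)) * u og - (SUM j<=L. y1 j og + y2 j og))
    = nr Om (%og. (f t (ze og) * u og - (SUM j<=L. y1 j og)) + (h t (ze og) * u og - (SUM j<=L. y2 j og)))"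
    by (simp add: sum.distrib algebra_simps)
   also have "... <= de / 2 * nr Om u + de / 2 * nr Om u"
    by (rule order_trans[OF nr_add add_mono[OF y1(2) y2(2)]])
   finally have "nr Om (%og. (f t (ze og) + h t (ze og)) * u og - (SUM j<=L. y1 j og + y2 j og)) <= de * nr Om u" by simp
   moreover have "ALL j. (%og. y1 j og + y2 j og) : Hs Om ze j" using Hs_add y1 y2 by blast
   ultimately show "EX y. (ALL j. y j : Hs Om ze j) \<and>
    nr Om (%og. (f t (ze og) + h t (ze og)) * u og - (SUM j<=L. y j og)) <= de * nr Om u"
    by (intro exI[of _ "%j og. y1 j og + y2 j og"] conjI)
  qed
 qed
qed

lemma ip_sum_right: "ip Om u (%og. SUM j:J. v j og) = (SUM j:J. ip Om u (v j))"
 unfolding ip_def by (simp add: sum_distrib_left) (rule sum.swap)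

lemma ip_diff_left: "ip Om (%og. u og - v og) w = ip Om u w - ip Om v w"
 by (simp add: ip_def left_diff_distrib sum_subtractf)

lemma (in hardy) Hs_rot: assumes "u : Hs Om ze e" "og : Om" shows "u (rh og) = c ^ e * u og"
proof -
 obtain a where a: "!!og. og : Om ==> u og = (SUM apz:lsimp UNIV e. a apz * mnl apz (ze og))"
  using assms(1) by (rule HsE) blast
 have r: "rh og : Om" using rot(1) assms(2) by (auto dest: bij_betwE)
 have "mnl apz (c *s ze og) = c ^ e * mnl apz (ze og)" if "apz : lsimp UNIV e" for apz
  using that by (simp add: mnl_def power_mult_distrib prod.distrib power_sum[symmetric] lsimp_def)
 thus ?thesis using assms(2) by (simp add: a r rot(2) sum_distrib_left mult.left_commute)
qed

text \<open>A word polynomial that approximates \<open>F\<close> need not be equivariant and yields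
  components in all degrees. Those of degree other than \<open>e'\<close> are orthogonal to
  \<open>F u\<close> and to the component of degree \<open>e'\<close>; dropping them does not
  increase the error.\<close>

theorem hankel_small:
 fixes F :: "'t::euclidean_space \<times> (complex ^ 'm::finite) => complex"
 assumes "compact T" "continuous_on (T \<times> sphere 0 1) F" "ep > 0"
 shows "EX k D. ALL e>=D. ALL L (Om :: 'w set) ze N rh c. hardy L Om ze N rh c --> e + k <= L -->
  (ALL t:T. ALL e'<=L. (ALL z:sphere 0 1. ALL b. norm b = 1 --> F (t, b *s z) * b ^ e = b ^ e' * F (t, z)) -->
   (ALL u:Hs Om ze e. EX v:Hs Om ze e'. nr Om (%og. F (t, ze og) * u og - v og) <= ep * nr Om u))"
proof -
 have e2: "ep / 2 > 0" using assms(3) by simp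
 have "compact (T \<times> sphere (0::complex^'m) 1)" using assms(1) by (intro compact_Times) auto
 then obtain f where f: "wpoly f" "!!t z. (t, z) : T \<times> sphere 0 1 ==> cmod (F (t, z) - f t z) < ep / 2"
  using wpoly_dense[OF _ assms(2) e2] by blast
 from wpoly_almost_invariant[OF f(1) assms(1), where 'w = 'w]
 obtain k where k: "ALL de>0. EX D. ALL e>=D. ALL L (Om :: 'w set) ze N rh c. hardy L Om ze N rh c --> e + k <= L -->
  (ALL t:T. ALL u:Hs Om ze e. EX y. (ALL j. y j : Hs Om ze j) \<and>
    nr Om (%og. f t (ze og) * u og - (SUM j<=L. y j og)) <= de * nr Om u)" ..
 from k[THEN spec, THEN mp, OF e2] obtain D where D: "ALL e>=D. ALL L (Om :: 'w set) ze N rh c. hardy L Om ze N rh c --> e + k <= L -->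
  (ALL t:T. ALL u:Hs Om ze e. EX y. (ALL j. y j : Hs Om ze j) \<and>
    nr Om (%og. f t (ze og) * u og - (SUM j<=L. y j og)) <= ep / 2 * nr Om u)" ..
 show ?thesis
 proof (rule exI[of _ k], rule exI[of _ D], intro allI impI ballI)
  fix e L and Om :: "'w set" and ze :: "'w => complex ^ 'm" and N rh c t e' u
  assume e: "D <= e" "e + k <= L" "e' <= L" and H: "hardy L Om ze N rh c" and t: "t : T" and u: "u : Hs Om ze e"
   and eq: "ALL z:sphere 0 1. ALL b. norm b = 1 --> F (t, b *s z) * b ^ e = b ^ e' * F (t, z)"
  interpret hardy L Om ze N rh c by (rule H)
  obtain y where y: "!!j. y j : Hs Om ze j"
    "nr Om (%og. f t (ze og) * u og - (SUM j<=L. y j og)) <= ep / 2 * nr Om u" using D[rule_format, OF e(1) H e(2) t u] by blast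
  let ?Fu = "%og. F (t, ze og) * u og"
  have "nr Om (%og. (F (t, ze og) - f t (ze og)) * u og) <= ep / 2 * nr Om u"
  proof (rule nr_bound_mult)
   show "cmod (F (t, ze og) - f t (ze og)) <= ep / 2" if "og : Om" for og
    using f(2)[of t "ze og"] t on_sphere[OF that] by simp
  qed (use e2 in simp)
  moreover have "nr Om (%og. ?Fu og - (SUM j<=L. y j og)) <= nr Om (%og. (F (t, ze og) - f t (ze og)) * u og)
    + nr Om (%og. f t (ze og) * u og - (SUM j<=L. y j og))"
   using nr_add[of Om "%og. (F (t, ze og) - f t (ze og)) * u og" "%og. f t (ze og) * u og - (SUM j<=L. y j og)"]
   by (simp add: algebra_simps)
  ultimately have n: "nr Om (%og. ?Fu og - (SUM j<=L. y j og)) <= ep * nr Om u" using y(2) by linarith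
  \<comment> \<open>Rotating the sample points multiplies this inner product by
    \<open>c ^ e' * cnj (c ^ j)\<close>, which differs from 1 by \<open>rot_inj\<close>; hence it is
    0.\<close>
  have orthF: "ip Om ?Fu (y j) = 0" if "j <= L" "j ~= e'" for j
  proof -
   have "ip Om ?Fu (y j) = (SUM og:Om. ?Fu (rh og) * cnj (y j (rh og)))"
    unfolding ip_def by (rule sum.reindex_bij_betw[OF rot(1), symmetric])
   also have "... = (SUM og:Om. (c ^ e' * cnj (c ^ j)) * (?Fu og * cnj (y j og)))"
   proof (rule sum.cong[OF refl])
    fix og assume om: "og : Om"
    have "?Fu (rh og) = (F (t, c *s ze og) * c ^ e) * u og" using om by (simp add: rot(2) Hs_rot[OF u])
    also have "F (t, c *s ze og) * c ^ e = c ^ e' * F (t, ze og)" using eq rot(3) on_sphere[OF om] by simp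
    finally have "?Fu (rh og) = c ^ e' * ?Fu og" by simp
    thus "?Fu (rh og) * cnj (y j (rh og)) = (c ^ e' * cnj (c ^ j)) * (?Fu og * cnj (y j og))"
     by (simp only: Hs_rot[OF y(1) om] complex_cnj_mult ac_simps)
   qed
   also have "... = (c ^ e' * cnj (c ^ j)) * ip Om ?Fu (y j)" by (simp only: ip_def sum_distrib_left)
   finally have "ip Om ?Fu (y j) = (c ^ e' * cnj (c ^ j)) * ip Om ?Fu (y j)" .
   moreover have "c ^ e' * cnj (c ^ j) ~= 1"
   proof
    assume *: "c ^ e' * cnj (c ^ j) = 1"
    have "cmod (c ^ j) = 1" by (simp add: norm_power rot(3))
    hence "cnj (c ^ j) * c ^ j = 1" by (metis complex_norm_square mult.commute of_real_1 one_power2)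
    hence "c ^ e' = c ^ j" using * by (metis mult.assoc mult.left_neutral mult.right_neutral)
    thus False using rot_inj[of e' j] that e by simp
   qed
   moreover have "x = 0" if "x = a * x" "a ~= 1" for a x :: complex using that by simp
   ultimately show ?thesis by blast
  qed
  have fin: "finite {..L}" by simp
  have sp: "(SUM j<=L. y j og) = y e' og + (SUM j:{..L} - {e'}. y j og)" for og
   using e(3) by (subst sum.remove[of _ e']) auto
  have "ip Om (%og. ?Fu og - y e' og) (%og. SUM j:{..L} - {e'}. y j og) = 0"
   unfolding ip_sum_right
  proof (rule sum.neutral, rule ballI)
   fix j assume j: "j : {..L} - {e'}"
   hence "ip Om (y e') (y j) = 0" using e(3) by (intro Hs_orth[OF y(1) y(1)]) auto
   thus "ip Om (%og. ?Fu og - y e' og) (y j) = 0" using orthF[of j] j by (simp add: ip_diff_left)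
  qed
  from nr_le_orth[OF this] have "nr Om (%og. ?Fu og - y e' og) <= nr Om (%og. ?Fu og - (SUM j<=L. y j og))"
   unfolding sp by (simp add: diff_diff_eq)
  thus "EX v:Hs Om ze e'. nr Om (%og. ?Fu og - v og) <= ep * nr Om u"
   using n y(1) by (intro bexI[of _ "y e'"]) auto
 qed
qed

section \<open>Projections onto homogeneous polynomials\<close>

context hardy
begin

definition mproj :: "('m => nat) => 'w lop" where
 "mproj apz = mk_lop Om (%og og'. mnl apz (ze og) * cnj (mnl apz (ze og')) / of_real (N apz))"

definition hproj :: "nat => 'w lop" where
 "hproj e = (SUM apz:lsimp UNIV e. mproj apz)"

lemma app_mproj: "app (mproj apz) u og = (if og : Om then ip Om u (%og. mnl apz (ze og)) / of_real (N apz) * mnl apz (ze og) else 0)"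
 by (simp add: mproj_def app_mk_lop finite_points ip_def sum_distrib_left sum_divide_distrib ac_simps)

lemma supported_mproj: "supported Om (mproj apz)"
 unfolding mproj_def by (rule supported_mk_lop)

lemma supported_hproj: "supported Om (hproj e)"
 unfolding hproj_def by (intro supported_sum supported_mproj)

lemma mproj_mult: assumes "sum apz UNIV <= Suc L" "sum bt UNIV <= Suc L"
 shows "mproj apz * mproj bt = (if apz = bt then mproj apz else 0)"
proof (rule lop_appI)
 fix u og
 have 1: "ip Om (app (mproj bt) u) (%og. mnl apz (ze og)) = ip Om u (%og. mnl bt (ze og)) / of_real (N bt) * ip Om (%og. mnl bt (ze og)) (%og. mnl apz (ze og))"
  by (simp add: ip_def[of _ "app _ _"] ip_def[of _ _ "%og. mnl apz (ze og)"] app_mproj sum_distrib_left mult.assoc)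
 show "app (mproj apz * mproj bt) u og = app (if apz = bt then mproj apz else 0) u og"
  using N_pos[OF assms(1)] by (auto simp: app_mproj 1 ip_mono[OF assms(2,1)])
qed

lemma hproj_mult: assumes "e <= Suc L" "e' <= Suc L"
 shows "hproj e * hproj e' = (if e = e' then hproj e else 0)"
proof -
 have s: "sum apz UNIV <= Suc L" if "apz : lsimp UNIV e" for apz :: "'m => nat" using that assms by (simp add: lsimp_def)
 have s': "sum apz UNIV <= Suc L" if "apz : lsimp UNIV e'" for apz using that assms by (simp add: lsimp_def)
 have "hproj e * hproj e' = (SUM apz:lsimp UNIV e. SUM bt:lsimp UNIV e'. mproj apz * mproj bt)"
  unfolding hproj_def by (rule sum_product)
 also have "... = (SUM apz:lsimp UNIV e. SUM bt:lsimp UNIV e'. if bt = apz then mproj apz else 0)"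
  by (intro sum.cong refl) (auto simp: mproj_mult s s')
 also have "... = (SUM apz:lsimp UNIV e. if apz : lsimp UNIV e' then mproj apz else 0)"
  by (simp add: finite_lsimp[OF finite])
 also have "... = (if e = e' then hproj e else 0)"
  unfolding hproj_def by (auto simp: lsimp_def intro!: sum.neutral)
 finally show ?thesis .
qed

lemma hproj_in_Hs: "app (hproj e) u : Hs Om ze e"
 unfolding Hs_def
 by (intro CollectI exI[of _ "%apz. ip Om u (%og. mnl apz (ze og)) / of_real (N apz)"] ballI) (simp add: hproj_def app_mproj)

lemma hproj_best: assumes "v : Hs Om ze e" "e <= Suc L"
 shows "nr Om (%og. u og - app (hproj e) u og) <= nr Om (%og. u og - v og)"
proof -
 let ?w = "%og. v og - app (hproj e) u og" and ?d = "%og. u og - app (hproj e) u og"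
 have w: "?w : Hs Om ze e" by (rule Hs_diff[OF assms(1) hproj_in_Hs])
 have s: "sum apz UNIV <= Suc L" if "apz : lsimp UNIV e" for apz :: "'m => nat" using that assms by (simp add: lsimp_def)
 have om: "ip Om ?d (%og. mnl bt (ze og)) = 0" if b: "bt : lsimp UNIV e" for bt :: "'m => nat"
 proof -
  have "ip Om (app (hproj e) u) (%og. mnl bt (ze og)) = (SUM apz:lsimp (UNIV :: 'm set) e. ip Om (app (mproj apz) u) (%og. mnl bt (ze og)))"
   unfolding ip_def hproj_def by (simp add: sum_distrib_right) (rule sum.swap)
  also have "... = (SUM apz:lsimp (UNIV :: 'm set) e. if apz = bt then ip Om u (%og. mnl bt (ze og)) else 0)"
  proof (rule sum.cong[OF refl])
   fix apz :: "'m => nat" assume a: "apz : lsimp UNIV e"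
   have "ip Om (app (mproj apz) u) (%og. mnl bt (ze og)) = ip Om u (%og. mnl apz (ze og)) / of_real (N apz) * ip Om (%og. mnl apz (ze og)) (%og. mnl bt (ze og))"
    by (simp add: ip_def[of _ "app _ _"] ip_def[of _ _ "%og. mnl bt (ze og)"] app_mproj sum_distrib_left mult.assoc)
   thus "ip Om (app (mproj apz) u) (%og. mnl bt (ze og)) = (if apz = bt then ip Om u (%og. mnl bt (ze og)) else 0)"
    using N_pos[OF s[OF a]] by (cases "apz = bt") (simp_all add: ip_mono s a b)
  qed
  also have "... = ip Om u (%og. mnl bt (ze og))" using b by (simp add: finite_lsimp[OF finite])
  finally show ?thesis by (simp add: ip_diff_left)
 qed
 obtain a where a: "!!og. og : Om ==> ?w og = (SUM apz:lsimp UNIV e. a apz * mnl apz (ze og))"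
  using w by (rule HsE) blast
 have "ip Om ?d ?w = ip Om ?d (%og. SUM apz:lsimp UNIV e. a apz * mnl apz (ze og))"
  unfolding ip_def by (rule sum.cong[OF refl]) (simp only: a)
 also have "... = (SUM apz:lsimp UNIV e. cnj (a apz) * ip Om ?d (%og. mnl apz (ze og)))"
  unfolding ip_sum_right by (simp add: ip_def sum_distrib_left ac_simps)
 also have "... = 0" by (rule sum.neutral) (simp add: om)
 finally have "nr Om ?d <= nr Om (%og. ?d og - ?w og)" by (rule nr_le_orth)
 thus ?thesis by simp
qed

end

section \<open>Binomial relations in an abelian group\<close>

text \<open>The binomial coefficient as a polynomial in its upper argument, so that Pascal's rule
  holds over all integers.\<close>

definition zchoose :: "int => nat => int" where
 "zchoose a k = (if 0 <= a then int (nat a choose k) else (- 1) ^ k * int ((k + nat (- a) - 1) choose k))"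

lemma zchoose_0: "zchoose a 0 = 1" by (simp add: zchoose_def)

lemma zchoose_Suc_Suc: "zchoose (x + 1) (Suc k) = zchoose x k + zchoose x (Suc k)"
 using gbinomial_int_Suc_Suc[of x k] unfolding gbinomial_int_binomial zchoose_def[symmetric] .

text \<open>Taking differences in \<open>d\<close> lowers the degree of the binomials and gives
  \<open>R k d\<close> for every \<open>k <= m - 1\<close> and large \<open>d\<close>. Pascal's rule
  then carries these relations down to all smaller integers. At \<open>d = - m - 1\<close> and
  \<open>k = m - 1\<close> the coefficient at \<open>p\<close> is the binomial of
  \<open>p - 2\<close> over \<open>m - 1\<close>, which vanishes for \<open>2 <= p <= m\<close> and
  is a sign for \<open>p = 1\<close>.\<close>

lemma (in comm_group) binomial_relations_imp_trivial:
 assumes y: "!!p. y p : carrier G" and m: "m >= 1"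
  and rel: "!!d. d >= d0 ==> finprod G (%p. y p [^] ((-1) ^ p * int ((d + p + (m - 1)) choose (m - 1)))) {1..m} = \<one>"
 shows "y 1 = \<one>"
proof -
 define rel' where "rel' c \<longleftrightarrow> finprod G (%p. y p [^] (c p :: int)) {1..m} = \<one>" for c
 have c: "(%p. y p [^] (c p :: int)) : {1..m} \<rightarrow> carrier G" for c using y int_pow_closed by blast
 have diff: "rel' (%p. a p - b p)" if "rel' a" "rel' b" for a b
 proof -
  have "finprod G (%p. y p [^] (a p - b p)) {1..m} \<otimes> finprod G (%p. y p [^] b p) {1..m}
   = finprod G (%p. y p [^] (a p - b p) \<otimes> y p [^] b p) {1..m}"
   by (rule finprod_multf[symmetric]) (rule c)+
  also have "... = finprod G (%p. y p [^] a p) {1..m}"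
   by (simp add: int_pow_mult[OF y, symmetric])
  finally have e: "finprod G (%p. y p [^] (a p - b p)) {1..m} \<otimes> finprod G (%p. y p [^] b p) {1..m} = finprod G (%p. y p [^] a p) {1..m}" .
  have cl: "finprod G (%p. y p [^] (a p - b p)) {1..m} : carrier G" by (rule finprod_closed) (rule c)
  show ?thesis using e that cl unfolding rel'_def by simp
 qed
 define R where "R k d \<longleftrightarrow> rel' (%p. (-1) ^ p * zchoose (d + int p + int k) k)" for k and d :: int
 have pascal: "zchoose (d + 1 + int p + int (Suc k)) (Suc k) - zchoose (d + int p + int (Suc k)) (Suc k) = zchoose (d + 1 + int p + int k) k" for d :: int and p k
  using zchoose_Suc_Suc[of "d + int p + int (Suc k)" k] by (simp add: algebra_simps)
 have down: "R k (d + 1)" if "R (Suc k) (d + 1)" "R (Suc k) d" for k d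
  using diff[OF that[unfolded R_def]] unfolding right_diff_distrib[symmetric] pascal R_def .
 have top: "R (m - 1) d" if "d >= int d0" for d
 proof -
  define n where "n = nat d"
  have n: "d = int n" using that by (simp add: n_def)
  have "zchoose (d + int p + int (m - 1)) (m - 1) = int ((n + p + (m - 1)) choose (m - 1))" for p
   by (simp add: n zchoose_def nat_add_distrib)
  thus ?thesis using rel[of n] that n by (simp add: R_def rel'_def)
 qed
 have all: "!!d. d >= int d0 + int j ==> R (m - 1 - j) d" if "j <= m - 1" for j
  using that
 proof (induction j)
  case 0 thus ?case using top by simp
 next
  case (Suc j)
  have e: "m - 1 - j = Suc (m - 1 - Suc j)" using Suc.prems by simp
  show ?case using down[of "m - 1 - Suc j" "d - 1"] Suc.IH[of d] Suc.IH[of "d - 1"] Suc.prems unfolding e by simp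
 qed
 \<comment> \<open>Descent in \<open>d\<close> for all \<open>k\<close> simultaneously, since
   \<open>R k d\<close> follows from \<open>R k (d + 1)\<close> and
   \<open>R (k - 1) (d + 1)\<close>. For \<open>k = 0\<close> the coefficients do not involve
   \<open>d\<close>.\<close>
 have ext: "ALL k<=m - 1. R k (int d0 + int m - int i)" for i
 proof (induction i)
  case 0
  show ?case
  proof (intro allI impI)
   fix k assume k: "k <= m - 1"
   hence "m - 1 - (m - 1 - k) = k" by simp
   thus "R k (int d0 + int m - int 0)" using all[of "m - 1 - k" "int d0 + int m"] by simp
  qed
 next
  case (Suc i)
  show ?case
  proof (intro allI impI)
   fix k assume k: "k <= m - 1"
   let ?d = "int d0 + int m - int (Suc i)"
   have d1: "?d + 1 = int d0 + int m - int i" by simp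
   show "R k ?d"
   proof (cases k)
    case 0
    thus ?thesis using Suc[THEN spec, of 0] by (simp add: R_def zchoose_0)
   next
    case (Suc k')
    have "R k (?d + 1)" "R k' (?d + 1)" using \<open>ALL k<=m - 1. R k (int d0 + int m - int i)\<close> k Suc unfolding d1 by auto
    from diff[OF this[unfolded R_def]] 
    have "rel' (%p. (-1) ^ p * (zchoose (?d + 1 + int p + int k) k - zchoose (?d + 1 + int p + int k') k'))"
     unfolding right_diff_distrib[symmetric] .
    moreover have "zchoose (?d + 1 + int p + int k) k - zchoose (?d + 1 + int p + int k') k' = zchoose (?d + int p + int k) k" for p
     using pascal[of ?d p k'] Suc by simp
    ultimately show ?thesis unfolding R_def by simp
   qed
  qed
 qed
 have "R (m - 1) (- int m - 1)"
 proof -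
  have "- int m - 1 = int d0 + int m - int (d0 + m + m + 1)" by simp
  thus ?thesis using ext[of "d0 + m + m + 1"] by simp
 qed
 moreover have "zchoose (- int m - 1 + int p + int (m - 1)) (m - 1) = (if p = 1 then (-1) ^ (m - 1) else 0)" if "p : {1..m}" for p
 proof (cases "p = 1")
  case True
  have "- int m - 1 + int p + int (m - 1) = - 1" using True m by simp
  thus ?thesis using True by (simp add: zchoose_def)
 next
  case False
  hence e: "- int m - 1 + int p + int (m - 1) = int (p - 2)" and lt: "p - 2 < m - 1" using that m by auto
  show ?thesis unfolding e using False lt by (simp add: zchoose_def)
 qed
 ultimately have "finprod G (%p. y p [^] (if p = 1 then (-1) ^ p * (-1) ^ (m - 1) else 0 :: int)) {1..m} = \<one>"
  unfolding R_def rel'_def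
  by (subst finprod_cong') (use y in \<open>auto simp: int_pow_closed\<close>)
 moreover have "finprod G (%p. y p [^] (if p = 1 then (-1) ^ p * (-1) ^ (m - 1) else 0 :: int)) {1..m}
   = finprod G (%p. if p = 1 then y 1 [^] ((-1) ^ 1 * (-1) ^ (m - 1) :: int) else \<one>) {1..m}"
  by (rule finprod_cong') (use y in \<open>auto simp: int_pow_closed\<close>)
 moreover have "... = y 1 [^] ((-1) ^ 1 * (-1) ^ (m - 1) :: int)"
  by (rule finprod_singleton_swap) (use m y in \<open>auto simp: int_pow_closed\<close>)
 ultimately have "y 1 [^] ((-1) ^ 1 * (-1) ^ (m - 1) :: int) = \<one>" by simp
 moreover have "(-1) ^ 1 * (-1) ^ (m - 1) = (1::int) \<or> (-1) ^ 1 * (-1) ^ (m - 1) = (-1::int)"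
  by (cases "even (m - 1)") auto
 ultimately show ?thesis using y[of 1] by (auto simp: int_pow_neg inv_eq_1_iff)
qed

section \<open>Neumann series\<close>

text \<open>In place of an operator norm, geometric decay is demanded of the entries of the powers;
  on the common finite support this gives entrywise convergence, uniformly in the parameter. The
  bounded powers start with the first one, so the sum \<open>Z\<close> is again finitely
  supported.\<close>

lemma neumann:
 fixes ka :: "'t::topological_space => 'i lop"
 assumes ka: "fsf T ka"
  and bd: "!!n t i k. t : T ==> cmod (ent (ka t ^ Suc n) i k) <= C * (1/2) ^ n"
 obtains Z where "fsf T Z" "!!t. t : T ==> (1 - ka t) * (1 + Z t) = 1" "!!t. t : T ==> (1 + Z t) * (1 - ka t) = 1"
proof -
 obtain S where S: "finite S" "!!t. t : T ==> supported S (ka t)" using ka unfolding fsf_def by blast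
 have Sn: "supported S (ka t ^ Suc n)" if "t : T" for n t
  by (induction n) (use S(2)[OF that] in \<open>auto intro: supported_mult simp del: power_Suc simp: power_Suc[of _ "Suc _"]\<close>)
 define z where "z t i k = (\<Sum>n. ent (ka t ^ Suc n) i k)" for t i k
 define Z where "Z t = mk_lop S (z t)" for t
 have sm: "summable (%n. ent (ka t ^ Suc n) i k)" if "t : T" for t i k
 proof (rule summable_comparison_test)
  show "EX N. ALL n>=N. norm (ent (ka t ^ Suc n) i k) <= C * (1/2) ^ n" using bd[OF that] by blast
  show "summable (%n. C * (1/2) ^ n :: real)" by (intro summable_mult summable_geometric) simp
 qed
 have entZ: "ent (Z t) i k = z t i k" if "t : T" for t i k
  unfolding Z_def ent_mk_lop[OF S(1)] z_def using ent_unsupported[OF Sn[OF that]] by auto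
 have split: "z t i k = ent (ka t) i k + (\<Sum>n. ent (ka t ^ Suc (Suc n)) i k)" if "t : T" for t i k
  using suminf_split_head[OF sm[OF that, of i k]] by (simp add: z_def)
 have kz: "ka t * Z t = Z t - ka t" if t: "t : T" for t
 proof (rule lop_eqI)
  fix i k
  have "ent (ka t * Z t) i k = (SUM l:S. ent (ka t) i l * z t l k)"
   by (simp add: ent_mult[OF S(1) S(2)[OF t]] entZ t)
  also have "... = (SUM l:S. \<Sum>n. ent (ka t) i l * ent (ka t ^ Suc n) l k)"
   unfolding z_def by (intro sum.cong refl suminf_mult[symmetric] sm t)
  also have "... = (\<Sum>n. SUM l:S. ent (ka t) i l * ent (ka t ^ Suc n) l k)"
   by (rule suminf_sum[symmetric]) (intro summable_mult sm t)
  also have "... = (\<Sum>n. ent (ka t ^ Suc (Suc n)) i k)"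
   by (simp add: ent_mult[OF S(1) S(2)[OF t], symmetric])
  finally show "ent (ka t * Z t) i k = ent (Z t - ka t) i k" using split[OF t, of i k] entZ[OF t] by simp
 qed
 have zk: "Z t * ka t = Z t - ka t" if t: "t : T" for t
 proof (rule lop_eqI)
  fix i k
  have "ent (Z t * ka t) i k = (SUM l:S. z t i l * ent (ka t) l k)"
   by (simp add: ent_mult[OF S(1) supported_mk_lop[of S "z t", folded Z_def]] entZ t)
  also have "... = (SUM l:S. \<Sum>n. ent (ka t ^ Suc n) i l * ent (ka t) l k)"
   unfolding z_def by (intro sum.cong refl suminf_mult2 sm t)
  also have "... = (\<Sum>n. SUM l:S. ent (ka t ^ Suc n) i l * ent (ka t) l k)"
   by (rule suminf_sum[symmetric]) (intro summable_mult2 sm t)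
  also have "... = (\<Sum>n. ent (ka t ^ Suc (Suc n)) i k)"
   by (simp add: ent_mult[OF S(1) Sn[OF t], symmetric] power_Suc2[symmetric] del: power_Suc)
  finally show "ent (Z t * ka t) i k = ent (Z t - ka t) i k" using split[OF t, of i k] entZ[OF t] by simp
 qed
 have contn: "continuous_on T (%t. ent (ka t ^ Suc n) i k)" for n i k
 proof -
  have "fsf T (%t. ka t ^ Suc n)"
  proof (induction n)
   case (Suc n)
   show ?case using fsf_mult[OF ka Suc] by simp
  qed (use ka in simp)
  thus ?thesis unfolding fsf_def by blast
 qed
 have "continuous_on T (%t. z t i k)" for i k
 proof (rule uniform_limit_theorem)
  show "uniform_limit T (%N t. SUM n<N. ent (ka t ^ Suc n) i k) (%t. z t i k) sequentially"
   unfolding z_def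
   by (rule Weierstrass_m_test[of _ _ "%n. C * (1/2) ^ n"]) (use bd in \<open>auto intro!: summable_mult summable_geometric\<close>)
  show "\<forall>\<^sub>F N in sequentially. continuous_on T (%t. SUM n<N. ent (ka t ^ Suc n) i k)"
   by (intro always_eventually allI continuous_on_sum contn)
 qed simp
 hence "continuous_on T (%t. ent (Z t) i k)" for i k
  by (rule continuous_on_eq) (simp add: entZ)
 hence "fsf T Z" unfolding fsf_def using S(1) by (auto intro!: exI[of _ S] simp: Z_def supported_mk_lop)
 thus ?thesis
  by (rule that) (simp_all add: left_diff_distrib right_diff_distrib distrib_left distrib_right kz zk)
qed

section \<open>Clifford multiplication\<close>

lemma scal_sum: "scal (SUM j:J. f j) = (SUM j:J. scal (f j))"
 by (induction J rule: infinite_finite_induct) (auto simp: scal_simps)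

definition mulop :: "'w set => ('w => complex) => 'w lop" where
 "mulop Om g = mk_lop Om (%og og'. if og = og' then g og else 0)"

lemma app_mulop: assumes "finite Om" shows "app (mulop Om g) u og = (if og : Om then g og * u og else 0)"
proof -
 have "(SUM k:Om. (if og = k then g og else 0) * u k) = (SUM k:Om. if og = k then g og * u k else 0)"
  by (rule sum.cong) auto
 thus ?thesis using assms by (simp add: mulop_def app_mk_lop)
qed

lemma mulop_mult: assumes "finite Om" shows "mulop Om g * mulop Om h = mulop Om (%og. g og * h og)"
 by (rule lop_appI) (simp add: app_mulop[OF assms])

lemma mulop_sum: assumes "finite Om" shows "mulop Om (%og. SUM j:J. g j og) = (SUM j:J. mulop Om (g j))"
 by (rule lop_appI) (auto simp: app_mulop[OF assms] sum_distrib_right)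

lemma mulop_scale: assumes "finite Om" shows "mulop Om (%og. a * g og) = scal a * mulop Om g"
 by (rule lop_appI) (simp add: app_mulop[OF assms])

lemma mulop_cong: assumes "finite Om" "!!og. og : Om ==> g og = h og" shows "mulop Om g = mulop Om h"
 by (rule lop_appI) (use assms in \<open>simp add: app_mulop\<close>)

definition cliff :: "'w set => ('w => complex ^ 'm::finite) => ('w \<times> 'm list) lop" where
 "cliff Om v = (SUM i:UNIV. rf (mulop Om (%og. v og $ i)) * lf (cre i) + rf (mulop Om (%og. cnj (v og $ i))) * lf (ann i))"

definition falt :: "'w set => ('w \<times> 'm::finite list) lop" where
 "falt Om = (SUM p<=CARD('m). rf (mulop Om (%_. 1)) * lf (alt p))"

lemma rl_mult: "(rf f * lf X) * (rf g * lf Y) = rf (f * g) * lf (X * Y)"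
proof -
 have "(rf f * lf X) * (rf g * lf Y) = rf f * (lf X * rf g) * lf Y" by (simp only: mult.assoc)
 also have "... = rf f * (rf g * lf X) * lf Y" by (simp only: lf_rf_commute)
 finally show ?thesis by (simp only: rf_ring lf_ring mult.assoc)
qed

lemma sum_if_alt:
 fixes X :: "nat => 'm::finite list lop"
 shows "(SUM p<=n. rf (g p) * lf (if p = q then X p else 0)) = (if q <= n then rf (g q) * lf (X q) else 0)"
proof -
 have "(SUM p<=n. rf (g p) * lf (if p = q then X p else 0)) = (SUM p<=n. if p = q then rf (g p) * lf (X p) else 0)"
  by (rule sum.cong) (auto simp: lf_ring)
 thus ?thesis by simp
qed

text \<open>Pairs of creations cancel on all tensors, pairs of annihilations only on antisymmetric
  ones, which is why \<open>falt Om\<close> appears. The mixed terms add up to the squared length of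
  the vector field.\<close>

lemma cliff_square:
 fixes v :: "'w => complex ^ 'm::finite"
 assumes fin: "finite Om" and v: "!!og. og : Om ==> norm (v og) = 1"
 shows "cliff Om v * (cliff Om v * falt Om) = falt Om"
proof -
 let ?M = "%g. rf (mulop Om g) :: ('w \<times> 'm list) lop"
 let ?a = "%i og. v og $ i" and ?b = "%i og. cnj (v og $ i)"
 define P where "P = (SUM i:UNIV. SUM k:UNIV. ?M (%og. ?a i og * ?a k og) * lf (cre i * cre k))"
 define Q where "Q = (SUM i:UNIV. SUM k:UNIV. ?M (%og. ?a i og * ?b k og) * lf (cre i * ann k))"
 define R where "R = (SUM i:UNIV. SUM k:UNIV. ?M (%og. ?b i og * ?a k og) * lf (ann i * cre k))"
 define U where "U = (SUM i:UNIV. SUM k:UNIV. ?M (%og. ?b i og * ?b k og) * lf (ann i * ann k))"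
 have "cliff Om v * cliff Om v = P + Q + (R + U)"
  unfolding cliff_def sum_product P_def Q_def R_def U_def
  by (simp only: distrib_left distrib_right rl_mult mulop_mult[OF fin] sum.distrib) (simp only: ac_simps)
 moreover have "P = 0"
 proof -
  have "P = (SUM k:UNIV. SUM i:UNIV. ?M (%og. ?a i og * ?a k og) * lf (cre i * cre k))" unfolding P_def by (rule sum.swap)
  also have "... = (SUM k:UNIV. SUM i:UNIV. - (?M (%og. ?a k og * ?a i og) * lf (cre k * cre i)))"
  proof (intro sum.cong refl)
   fix i k :: 'm
   have "cre i * cre k = - (cre k * cre i)" using cre_anticommute[of i k] by (simp only: eq_neg_iff_add_eq_0)
   thus "?M (%og. ?a i og * ?a k og) * lf (cre i * cre k) = - (?M (%og. ?a k og * ?a i og) * lf (cre k * cre i))"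
    by (simp add: lf_ring mult.commute[of "v _ $ i"])
  qed
  also have "... = - P" unfolding P_def by (simp add: sum_negf)
  finally have "P + P = 0" by (simp only: eq_neg_iff_add_eq_0)
  hence "scal (1/2) * (P + P) = 0" by simp
  hence "scal (1/2 + 1/2) * P = 0" by (simp only: scal_simps distrib_right distrib_left)
  thus ?thesis by (simp add: scal_simps)
 qed
 moreover have "U * falt Om = 0"
 proof -
  have "?M (%og. ?b i og * ?b k og) * lf (ann i * ann k) * falt Om = 
    - (?M (%og. ?b k og * ?b i og) * lf (ann k * ann i) * falt Om)" for i k
  proof -
   have aa: "ann i * ann k * alt p = - (ann k * ann i * (alt p :: 'm list lop))" for p
    using ann_ann_alt[of i k p] by (simp only: mult.assoc)
   show ?thesis
    unfolding falt_def sum_distrib_left rl_mult aa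
    by (simp add: lf_ring sum_negf mult.commute[of "cnj (v _ $ i)"])
  qed
  note sw = this
  have "U * falt Om = (SUM k:UNIV. SUM i:UNIV. ?M (%og. ?b i og * ?b k og) * lf (ann i * ann k) * falt Om)"
   unfolding U_def sum_distrib_right by (rule sum.swap)
  also have "... = (SUM k:UNIV. SUM i:UNIV. - (?M (%og. ?b k og * ?b i og) * lf (ann k * ann i) * falt Om))"
   by (intro sum.cong refl sw)
  also have "... = - (U * falt Om)" unfolding U_def sum_distrib_right by (simp add: sum_negf)
  finally have "U * falt Om + U * falt Om = 0" by (simp only: eq_neg_iff_add_eq_0)
  hence "scal (1/2) * (U * falt Om + U * falt Om) = 0" by simp
  hence "scal (1/2 + 1/2) * (U * falt Om) = 0" by (simp only: scal_simps distrib_right distrib_left)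
  thus ?thesis by (simp add: scal_simps)
 qed
 moreover have "Q + R = ?M (%_. 1)"
 proof -
  have "R = (SUM i:UNIV. SUM k:UNIV. ?M (%og. ?b k og * ?a i og) * lf (ann k * cre i))" unfolding R_def by (rule sum.swap)
  hence "Q + R = (SUM i:UNIV. SUM k:UNIV. ?M (%og. ?a i og * ?b k og) * lf (cre i * ann k + ann k * cre i))"
   by (simp add: Q_def sum.distrib[symmetric] lf_ring distrib_left mult.commute)
  also have "... = (SUM i:UNIV. SUM k:UNIV. if k = i then ?M (%og. ?a i og * ?b i og) else 0)"
   by (intro sum.cong refl) (simp add: ann_cre lf_ring)
  also have "... = ?M (%og. SUM i:UNIV. ?a i og * ?b i og)" by (simp add: mulop_sum[OF fin] rf_sum)
  also have "... = ?M (%_. 1)"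
  proof -
   have "(SUM i:UNIV. ?a i og * ?b i og) = 1" if "og : Om" for og
    using herm_self[of "v og"] v[OF that] by (simp add: herm_def)
   thus ?thesis by (simp add: mulop_cong[OF fin, of "%og. SUM i:UNIV. ?a i og * ?b i og" "%_. 1"])
  qed
  finally show ?thesis .
 qed
 moreover have "?M (%_. 1) * falt Om = falt Om"
  unfolding falt_def sum_distrib_left mult.assoc[symmetric] rf_ring(6)[symmetric] mulop_mult[OF fin] by simp
 ultimately have "cliff Om v * cliff Om v * falt Om = falt Om"
  by (simp add: distrib_right add.assoc[symmetric])
 thus ?thesis by (simp only: mult.assoc)
qed

lemma falt_alt:
 "falt Om * (rf f * lf (alt p)) = (if p <= CARD('m) then rf (mulop Om (%_. 1) * f) * lf (alt p :: 'm::finite list lop) else 0)"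
proof -
 have "falt Om * (rf f * lf (alt p)) = (SUM q<=CARD('m). rf (mulop Om (%_. 1) * f) * lf (if q = p then alt q :: 'm list lop else 0))"
  unfolding falt_def sum_distrib_right rl_mult by (intro sum.cong refl) (auto simp: alt_mult)
 thus ?thesis by (simp only: sum_if_alt)
qed

text \<open>Creations transform by \<open>A\<close>, annihilations by the inverse of
  \<open>A\<close> on the dual side; unitarity makes both agree with the rotated vector and its
  conjugate.\<close>

lemma cliff_tens:
 fixes v :: "'w => complex ^ 'm::finite"
 assumes fin: "finite Om" and A: "map_matrix cnj (transpose A) ** A = mat 1"
 shows "lf (tens A) * cliff Om v = cliff Om (%og. A *v v og) * lf (tens A)"
proof -
 let ?M = "%g. rf (mulop Om g) :: ('w \<times> 'm list) lop"
 have un: "(SUM i:UNIV. cnj (A $ i $ j) * A $ i $ k) = (if j = k then 1 else 0)" for j k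
  using arg_cong[OF A, of "%B. B $ j $ k"] by (simp add: matrix_matrix_mult_def transpose_def mat_def map_matrix_def)
 have Mv: "?M (%og. (A *v v og) $ i) = (SUM k:UNIV. scal (A $ i $ k) * ?M (%og. v og $ k))" for i
  by (simp add: matrix_vector_mult_def mulop_sum[OF fin] mulop_scale[OF fin] rf_sum rf_ring)
 have Mc: "?M (%og. cnj ((A *v v og) $ i)) = (SUM k:UNIV. scal (cnj (A $ i $ k)) * ?M (%og. cnj (v og $ k)))" for i
  by (simp add: matrix_vector_mult_def mulop_sum[OF fin] mulop_scale[OF fin] rf_sum rf_ring)
 have 1: "(SUM i:UNIV. ?M (%og. (A *v v og) $ i) * lf (cre i * tens A)) = (SUM k:UNIV. ?M (%og. v og $ k) * lf (tens A * cre k))"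
 proof -
  have "(SUM i:UNIV. ?M (%og. (A *v v og) $ i) * lf (cre i * tens A)) =
   (SUM i:UNIV. SUM k:UNIV. scal (A $ i $ k) * (?M (%og. v og $ k) * lf (cre i * tens A)))"
   by (simp only: Mv sum_distrib_right mult.assoc)
  also have "... = (SUM k:UNIV. SUM i:UNIV. scal (A $ i $ k) * (?M (%og. v og $ k) * lf (cre i * tens A)))" by (rule sum.swap)
  also have "... = (SUM k:UNIV. ?M (%og. v og $ k) * lf (tens A * cre k))"
   unfolding tens_cre lf_sum sum_distrib_left
   by (intro sum.cong refl) (simp only: lf_ring scal_left_commute[of "?M _"])
  finally show ?thesis .
 qed
 have 2: "(SUM j:UNIV. ?M (%og. cnj ((A *v v og) $ j)) * lf (ann j * tens A)) = (SUM i:UNIV. ?M (%og. cnj (v og $ i)) * lf (tens A * ann i))"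
 proof -
  have "(SUM j:UNIV. ?M (%og. cnj ((A *v v og) $ j)) * lf (ann j * tens A)) =
   (SUM j:UNIV. SUM k:UNIV. scal (cnj (A $ j $ k)) * (?M (%og. cnj (v og $ k)) * lf (ann j * tens A)))"
   by (simp only: Mc sum_distrib_right mult.assoc)
  also have "... = (SUM j:UNIV. SUM k:UNIV. SUM i:UNIV. scal (cnj (A $ j $ k) * A $ j $ i) * (?M (%og. cnj (v og $ k)) * lf (tens A * ann i)))"
  proof (intro sum.cong refl)
   fix j k :: 'm
   have "lf (ann j * tens A) = (SUM i:UNIV. scal (A $ j $ i) * (lf (tens A * ann i) :: ('w \<times> 'm list) lop))"
    unfolding ann_tens lf_sum by (intro sum.cong refl) (simp only: lf_ring)
   thus "scal (cnj (A $ j $ k)) * (?M (%og. cnj (v og $ k)) * lf (ann j * tens A)) =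
    (SUM i:UNIV. scal (cnj (A $ j $ k) * A $ j $ i) * (?M (%og. cnj (v og $ k)) * lf (tens A * ann i)))"
    by (simp only: sum_distrib_left) (intro sum.cong refl, simp only: scal_left_commute[of "?M _"] scal_simps(4) mult.assoc)
  qed
  also have "... = (SUM k:UNIV. SUM i:UNIV. SUM j:UNIV. scal (cnj (A $ j $ k) * A $ j $ i) * (?M (%og. cnj (v og $ k)) * lf (tens A * ann i)))"
   by (subst sum.swap, rule sum.cong[OF refl], rule sum.swap)
  also have "... = (SUM k:UNIV. SUM i:UNIV. scal (SUM j:UNIV. cnj (A $ j $ k) * A $ j $ i) * (?M (%og. cnj (v og $ k)) * lf (tens A * ann i)))"
   by (simp only: scal_sum sum_distrib_right)
  also have "... = (SUM k:UNIV. SUM i:UNIV. if i = k then ?M (%og. cnj (v og $ k)) * lf (tens A * ann k) else 0)"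
   unfolding un by (intro sum.cong refl) (auto simp: scal_simps)
  finally show ?thesis by simp
 qed
 have lr: "lf (tens A) * (rf f * lf X) = rf f * lf (tens A * X)" for f X
  by (simp only: mult.assoc[symmetric] lf_rf_commute lf_ring)
 have "lf (tens A) * cliff Om v = (SUM i:UNIV. ?M (%og. v og $ i) * lf (tens A * cre i)) + (SUM i:UNIV. ?M (%og. cnj (v og $ i)) * lf (tens A * ann i))"
  unfolding cliff_def sum_distrib_left distrib_left lr sum.distrib ..
 also have "... = cliff Om (%og. A *v v og) * lf (tens A)"
  unfolding 1[symmetric] 2[symmetric] cliff_def sum_distrib_right distrib_right sum.distrib by (simp only: lf_ring mult.assoc)
 finally show ?thesis .
qed

lemma ip_scale_left: "ip Om (%og. a * u og) v = a * ip Om u v"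
 by (simp add: ip_def sum_distrib_left mult.assoc)

lemma ip_scale_right: "ip Om u (%og. a * v og) = cnj a * ip Om u v"
 by (simp add: ip_def sum_distrib_left mult.left_commute)

text \<open>Creation and annihilation preserve antisymmetry, and creation out of the top degree
  gives 0 by \<open>alternating_too_long\<close>, so nothing leaves the range of
  \<open>falt Om\<close>.\<close>

lemma falt_cliff: 
 fixes v :: "'w => complex ^ 'm::finite"
 assumes fin: "finite Om"
 shows "falt Om * (cliff Om v * falt Om) = cliff Om v * falt Om"
proof -
 let ?m = "CARD('m)"
 let ?I = "mulop Om (%_. 1)"
 have s: "rf (?I * (f * ?I)) * lf X = rf (f * ?I) * lf X" if "?I * f = f" for f and X :: "'m list lop"
  using that by (simp only: mult.assoc[symmetric])
 have sumalt: "(SUM q<=?m. rf f * lf (alt q * X)) = rf f * lf X" if "alternating p X" for p f and X :: "'m list lop"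
 proof (cases "p <= ?m")
  case True
  have "alt q * X = (if q = p then X else 0)" for q
  proof -
   have "alt q * X = alt q * alt p * X" by (simp only: alt_alternating[OF that] mult.assoc)
   thus ?thesis by (simp add: alt_mult alt_alternating[OF that])
  qed
  hence "(SUM q<=?m. rf f * lf (alt q * X)) = (SUM q<=?m. if q = p then rf f * lf X else 0)"
   by (intro sum.cong) (auto simp: lf_ring)
  thus ?thesis using True by simp
 next
  case False
  hence "X = 0" using alternating_too_long[OF that] by simp
  thus ?thesis by (simp add: lf_ring)
 qed
 have tm: "falt Om * (rf f * lf Y * falt Om) = rf f * lf Y * falt Om"
  if f: "?I * f = f" and Y: "!!p. EX q. alternating q (Y * (alt p :: 'm list lop))" for f Y
 proof -
  have "falt Om * (rf f * lf Y * falt Om) = (SUM p<=?m. SUM q<=?m. rf (?I * (f * ?I)) * lf (alt q * (Y * alt p)))"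
  proof -
   have U: "rf f * lf Y * falt Om = (SUM p<=?m. rf (f * ?I) * lf (Y * alt p))"
    unfolding falt_def sum_distrib_left rl_mult ..
   have V: "falt Om * (rf g * lf X) = (SUM q<=?m. rf (?I * g) * lf (alt q * X))" for g and X :: "'m list lop"
    unfolding falt_def sum_distrib_right rl_mult ..
   show ?thesis unfolding U sum_distrib_left V ..
  qed
  also have "... = (SUM p<=?m. rf (f * ?I) * lf (Y * alt p))"
  proof (intro sum.cong refl)
   fix p
   obtain q where "alternating q (Y * (alt p :: 'm list lop))" using Y by blast
   from sumalt[OF this] show "(SUM q<=?m. rf (?I * (f * ?I)) * lf (alt q * (Y * alt p))) = rf (f * ?I) * lf (Y * alt p)"
    unfolding s[OF f] .
  qed
  also have "... = rf f * lf Y * falt Om" unfolding falt_def sum_distrib_left rl_mult ..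
  finally show ?thesis .
 qed
 have I: "?I * mulop Om g = mulop Om g" for g by (simp add: mulop_mult[OF fin])
 have Yc: "EX q. alternating q (cre i * (alt p :: 'm list lop))" for i p using alternating_cre[OF alternating_alt] by blast
 have Ya: "EX q. alternating q (ann i * (alt p :: 'm list lop))" for i p
 proof (cases p)
  case 0
  thus ?thesis using alt_ann(2)[of i] alternating_0 by metis
 next
  case (Suc q)
  thus ?thesis using alternating_SucD[of q "alt (Suc q)" i] alternating_alt by blast
 qed
 show ?thesis unfolding cliff_def sum_distrib_left sum_distrib_right distrib_left distrib_right
  by (intro sum.cong refl arg_cong2[where f = plus] tm I Yc Ya)
qed

lemma fsf_mulop:
 assumes "finite Om" "!!og. og : Om ==> continuous_on T (%t. g t og)"
 shows "fsf T (%t. mulop Om (g t))"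
proof -
 have "continuous_on T (%t. ent (mulop Om (g t)) i k)" for i k
  using assms by (cases "i : Om"; cases "k : Om"; cases "i = k") (simp_all add: mulop_def ent_mk_lop)
 thus ?thesis unfolding fsf_def mulop_def using assms(1) by (auto intro!: exI[of _ Om] supported_mk_lop)
qed

lemma supported_sandwich: "supported {l :: 'm list. length l = a \<or> length l = b} (degp a * X * degp b)"
proof (rule supportedI)
 fix u v :: "'m list => complex" assume *: "!!k. k : {l. length l = a \<or> length l = b} ==> u k = v k"
 have "app (degp b) u = app (degp b) v" using * by auto
 thus "app (degp a * X * degp b) u = app (degp a * X * degp b) v" by simp
qed simp

lemma fsf_const_sandwich:
 fixes X :: "'m::finite list lop"
 assumes "degp a * X * degp b = X" shows "fsf T (%t. X)"
proof (rule fsf_const[of "{l. length l = a \<or> length l = b}"])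
 show "finite {l :: 'm list. length l = a \<or> length l = b}" using finite_lists_length[where 'm = 'm] by (simp add: Collect_disj_eq)
 show "supported {l. length l = a \<or> length l = b} X" using supported_sandwich[of a b X] assms by simp
qed

lemma fsf_cre_alt: "fsf T (%t. cre i * (alt p :: 'm::finite list lop))"
proof (rule fsf_const_sandwich)
 have "degp (Suc p) * (cre i * alt p) * degp p = cre i * (degp p * alt p * degp p :: 'm list lop)"
  by (simp only: mult.assoc[symmetric] cre_degp[symmetric])
 thus "degp (Suc p) * (cre i * alt p) * degp p = cre i * (alt p :: 'm list lop)" by (simp only: alt_degp)
qed

lemma fsf_ann_alt: "fsf T (%t. ann i * (alt p :: 'm::finite list lop))"
proof (cases p)
 case 0
 thus ?thesis using fsf_0 by (simp only: alt_ann)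
next
 case (Suc q)
 show ?thesis
 proof (rule fsf_const_sandwich)
  have "degp q * (ann i * alt p) * degp p = ann i * (degp p * alt p * degp p :: 'm list lop)"
   by (simp only: mult.assoc[symmetric] ann_degp Suc)
  thus "degp q * (ann i * alt p) * degp p = ann i * (alt p :: 'm list lop)" by (simp only: alt_degp)
 qed
qed

text \<open>A sum, instead of a Euclidean norm, over the tensor indices; estimating it component by
  component costs only a factor that depends on the dimension.\<close>

definition NN :: "'w set => ('w \<times> 'm::finite list => complex) => real" where
 "NN Om u = (SUM l:{l. length l <= CARD('m)}. nr Om (%og. u (og, l)))"

lemma finite_Phi: "finite {l :: 'm::finite list. length l <= n}"
 using finite_lists_length_le[of "UNIV :: 'm set" n] by simp

lemma NN_nonneg: "NN Om u >= 0" unfolding NN_def by (intro sum_nonneg) auto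

lemma nr_le_NN: "length l <= CARD('m) ==> nr Om (%og. u (og, l :: 'm::finite list)) <= NN Om u"
 unfolding NN_def by (rule member_le_sum) (auto simp: finite_Phi)

lemma cre_bound:
 assumes "!!l'. length l' = p ==> nr Om (%og. u (og, l')) <= B" "length l = Suc p"
 shows "nr Om (%og. app (cre i) (%l'. u (og, l')) l) <= real (Suc p) * B"
 using assms
proof (induction l arbitrary: u p)
 case (Cons j l)
 have l: "length l = p" using Cons.prems by simp
 have B0: "B >= 0" using order_trans[OF nr_nonneg Cons.prems(1)[OF l]] .
 have 1: "nr Om (%og. if i = j then u (og, l) else 0) <= B"
 proof (cases "i = j")
  case True
  thus ?thesis using Cons.prems(1)[OF l] by simp
 qed (use B0 in \<open>simp add: nr_def L2_set_def\<close>)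
 have 2: "nr Om (%og. app (cre i) (%l'. u (og, j # l')) l) <= real p * B"
 proof (cases p)
  case 0
  thus ?thesis using l by (simp add: nr_def L2_set_def)
 next
  case (Suc q)
  have "nr Om (%og. app (cre i) (%l'. (%x. u (fst x, j # snd x)) (og, l')) l) <= real (Suc q) * B"
   by (rule Cons.IH) (use Cons.prems Suc in auto)
  thus ?thesis by (simp add: Suc)
 qed
 have "nr Om (%og. app (cre i) (%l'. u (og, l')) (j # l)) <= B + real p * B"
  using order_trans[OF nr_diff add_mono[OF 1 2]] by simp
 thus ?case by (simp add: algebra_simps)
qed simp

lemma cre_Hs:
 assumes "!!l'. length l' = p ==> (%og. u (og, l')) : Hs Om ze e" "length l = Suc p"
 shows "(%og. app (cre i) (%l'. u (og, l')) l) : Hs Om ze e"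
 using assms
proof (induction l arbitrary: u p)
 case (Cons j l)
 have l: "length l = p" using Cons.prems by simp
 have 1: "(%og. if i = j then u (og, l) else 0) : Hs Om ze e"
  by (cases "i = j") (use Cons.prems(1)[OF l] Hs_0 in auto)
 have 2: "(%og. app (cre i) (%l'. u (og, j # l')) l) : Hs Om ze e"
 proof (cases p)
  case 0
  thus ?thesis using l Hs_0 by simp
 next
  case (Suc q)
  show ?thesis
   by (rule Cons.IH[where u = "%x. u (fst x, j # snd x)", simplified]) (use Cons.prems Suc in auto)
 qed
 show ?case using Hs_diff[OF 1 2] by simp
qed simp

lemma app_cliff:
 fixes u :: "'w \<times> 'm::finite list => complex"
 assumes "finite Om" "og : Om"
 shows "app (cliff Om v) u (og, l) = (SUM i:UNIV. v og $ i * app (cre i) (%l'. u (og, l')) l + cnj (v og $ i) * u (og, i # l))"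
 unfolding cliff_def by (simp add: app_mulop[OF assms(1)] assms(2))

lemma app_falt:
 fixes u :: "'w \<times> 'm::finite list => complex"
 assumes "finite Om" "og : Om"
 shows "app (falt Om) u (og, l) = (if length l <= CARD('m) then app (alt (length l)) (%l'. u (og, l')) l else 0)"
proof -
 have z: "app (alt p) x l = 0" if "p ~= length l" for p and x :: "'m list => complex"
 proof -
  have "app (alt p) x l = app (degp p * alt p) x l" by (simp only: alt_degp)
  thus ?thesis using that by simp
 qed
 have "app (falt Om) u (og, l) = (SUM p<=CARD('m). app (alt p) (%l'. u (og, l')) l)"
  unfolding falt_def by (simp add: app_mulop[OF assms(1)] assms(2))
 also have "... = (SUM p<=CARD('m). if p = length l then app (alt (length l)) (%l'. u (og, l')) l else 0)"
  by (intro sum.cong refl) (auto simp: z)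
 finally show ?thesis by simp
qed

section \<open>Clifford multiplication compressed to polynomials\<close>

context hardy
begin

lemma fin: "finite Om" by (rule finite_points)

text \<open>Projection onto polynomials of degree \<open>d + p\<close> with values in the
  \<open>p\<close>-th exterior power, for \<open>p\<close> in \<open>P\<close>. The polynomial
  degree rises together with the exterior degree because creation is paired with \<open>v\<close>
  and annihilation with its conjugate.\<close>

definition EE :: "nat => nat set => ('w \<times> 'm list) lop" where
 "EE d P = (SUM p:P. rf (hproj (d + p)) * lf (alt p))"

abbreviation "Em d \<equiv> EE d {..CARD('m)}"

lemma mulop_hproj: "mulop Om (%_. 1) * hproj e = hproj e"
 by (rule lop_appI) (simp add: app_mulop[OF fin] supported_outside[OF supported_hproj])

lemma hproj_mulop: "hproj e * mulop Om (%_. 1) = hproj e"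
proof (rule lop_appI)
 fix u i
 have "app (hproj e) (app (mulop Om (%_. 1)) u) = app (hproj e) u"
  by (rule supported_dep[OF supported_hproj]) (simp add: app_mulop[OF fin])
 thus "app (hproj e * mulop Om (%_. 1)) u i = app (hproj e) u i" by simp
qed

lemma EE_mult:
 assumes "P <= {..CARD('m)}" "P' <= {..CARD('m)}" "d + CARD('m) <= Suc L"
 shows "EE d P * EE d P' = EE d (P \<inter> P')"
proof -
 have fP: "finite P" "finite P'" using assms finite_subset by blast+
 have "EE d P * EE d P' = (SUM p:P. SUM q:P'. rf (hproj (d + p) * hproj (d + q)) * lf (alt p * alt q))"
  unfolding EE_def sum_product rl_mult ..
 also have "... = (SUM p:P. SUM q:P'. if q = p then rf (hproj (d + p)) * lf (alt p) else 0)"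
 proof (intro sum.cong refl)
  fix p q assume "p : P" "q : P'"
  hence "d + p <= Suc L" using assms by auto
  thus "rf (hproj (d + p) * hproj (d + q)) * lf (alt p * alt q) = (if q = p then rf (hproj (d + p)) * lf (alt p) else 0)"
   by (cases "q = p") (auto simp: hproj_mult alt_mult lf_ring)
 qed
 also have "... = (SUM p:P. if p : P' then rf (hproj (d + p)) * lf (alt p) else 0)" using fP by simp
 also have "... = EE d (P \<inter> P')" unfolding EE_def using fP by (simp add: sum.inter_restrict)
 finally show ?thesis .
qed

lemma falt_EE: assumes "P <= {..CARD('m)}" shows "falt Om * EE d P = EE d P" "EE d P * falt Om = EE d P"
proof -
 show "falt Om * EE d P = EE d P"
  unfolding EE_def sum_distrib_left by (intro sum.cong refl) (use assms in \<open>auto simp: falt_alt mulop_hproj\<close>)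
 have "rf (hproj (d + p)) * lf (alt p) * falt Om = rf (hproj (d + p)) * lf (alt p :: 'm list lop)" if "p : P" for p
 proof -
  have "rf (hproj (d + p)) * lf (alt p) * falt Om = (SUM q<=CARD('m). rf (hproj (d + p)) * lf (if q = p then alt q :: 'm list lop else 0))"
   unfolding falt_def sum_distrib_left rl_mult hproj_mulop by (intro sum.cong refl) (auto simp: alt_mult)
  thus ?thesis using that assms by (simp only: sum_if_alt) auto
 qed
 thus "EE d P * falt Om = EE d P" unfolding EE_def sum_distrib_right by (intro sum.cong refl)
qed

text \<open>Every term of Clifford multiplication changes the exterior degree by exactly
  one.\<close>

lemma EE_parity:
 assumes "!!p q. p : P ==> q : P' ==> even p = even q"
 shows "EE d P * cliff Om v * EE d P' = 0"
proof -
 have c0: "alt p * (cre i * alt q) = 0" if "p ~= Suc q" for p q and i :: 'm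
 proof -
  have "alt p * (cre i * alt q) = alt p * alt (Suc q) * (cre i * (alt q :: 'm list lop))" by (simp only: mult.assoc alt_cre)
  thus ?thesis using that by (simp add: alt_mult del: alt.simps)
 qed
 have a0: "alt p * (ann i * alt q) = 0" if "Suc p ~= q" for p q and i :: 'm
 proof (cases q)
  case 0
  thus ?thesis by (simp only: alt_ann mult_zero_right)
 next
  case (Suc q')
  have "alt p * (ann i * alt q) = alt p * alt q' * (ann i * (alt q :: 'm list lop))" by (simp only: mult.assoc alt_ann Suc)
  thus ?thesis using that Suc by (simp add: alt_mult del: alt.simps)
 qed
 have z: "rf f * lf (alt p) * (rf g * lf Y) * (rf h * lf (alt q)) = rf (f * g * h) * lf (alt p * (Y * alt q))"
  for f g h :: "'w lop" and p q and Y :: "'m list lop"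
  by (simp only: rl_mult) (simp only: mult.assoc)
 have "EE d P * cliff Om v * EE d P' = (SUM p:P. SUM q:P'. SUM i:UNIV.
   rf (hproj (d + p)) * lf (alt p) * (rf (mulop Om (%og. v og $ i)) * lf (cre i)) * (rf (hproj (d + q)) * lf (alt q)) +
   rf (hproj (d + p)) * lf (alt p) * (rf (mulop Om (%og. cnj (v og $ i))) * lf (ann i)) * (rf (hproj (d + q)) * lf (alt q)))"
 proof -
  have 1: "EE d P * cliff Om v = (SUM p:P. rf (hproj (d + p)) * lf (alt p) * cliff Om v)"
   unfolding EE_def by (rule sum_distrib_right)
  have "EE d P * cliff Om v * EE d P' = (SUM p:P. SUM q:P'. rf (hproj (d + p)) * lf (alt p) * cliff Om v * (rf (hproj (d + q)) * lf (alt q)))"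
   unfolding 1 EE_def[of d P'] by (rule sum_product)
  thus ?thesis unfolding cliff_def sum_distrib_left sum_distrib_right distrib_left distrib_right .
 qed
 also have "... = 0"
  unfolding z
 proof (intro sum.neutral ballI)
  fix p q i assume "p : P" "q : P'"
  hence pq: "p ~= Suc q" "Suc p ~= q" using assms by (metis even_Suc)+
  show "rf (hproj (d + p) * mulop Om (%og. v og $ i) * hproj (d + q)) * lf (alt p * (cre i * alt q)) +
    rf (hproj (d + p) * mulop Om (%og. cnj (v og $ i)) * hproj (d + q)) * lf (alt p * (ann i * alt q)) = 0"
   by (simp only: c0[OF pq(1)] a0[OF pq(2)] lf_ring(1) mult_zero_right add_0_left)
 qed
 finally show ?thesis .
qed

lemma fsf_EE: "fsf T (%t. EE d P)"
 unfolding EE_def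
 by (intro fsf_sum fsf_rf_lf fsf_const[OF fin supported_hproj] fsf_const[OF finite_lists_length supported_alt])

lemma fsf_cliff_EE:
 assumes "!!og. og : Om ==> continuous_on T (%t. v t og)"
 shows "fsf T (%t. cliff Om (v t) * EE d P)"
 unfolding cliff_def EE_def sum_distrib_left sum_distrib_right distrib_right rl_mult
 by (intro fsf_sum fsf_add fsf_rf_lf fsf_mult fsf_mulop fin fsf_const[OF fin supported_hproj] fsf_cre_alt fsf_ann_alt)
   (use assms in \<open>auto intro!: continuous_intros\<close>)

definition Qop :: "nat => ('w => complex ^ 'm) => ('w \<times> 'm list) lop" where
 "Qop d v = Em d * cliff Om v * Em d"

definition kap :: "nat => ('w => complex ^ 'm) => ('w \<times> 'm list) lop" where
 "kap d v = Em d - Qop d v * Qop d v"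

text \<open>Uncompressed Clifford multiplication is an exact involution on antisymmetric tensors, so
  the defect of the compression is what leaks out of the range of \<open>Em d\<close> and is carried
  back.\<close>

lemma kap_eq:
 assumes "d + CARD('m) <= Suc L" "!!og. og : Om ==> norm (v og) = 1"
 shows "kap d v = Em d * cliff Om v * ((falt Om - Em d) * cliff Om v * Em d)"
proof -
 let ?E = "Em d" and ?c = "cliff Om v"
 have EE: "?E * ?E = ?E" using EE_mult[of "{..CARD('m)}" "{..CARD('m)}" d] assms(1) by simp
 have fE: "falt Om * ?E = ?E" using falt_EE(1)[of "{..CARD('m)}" d] by simp
 have "?c * (?c * ?E) = ?c * (?c * falt Om) * ?E" by (simp only: fE mult.assoc)
 hence cc: "?c * (?c * ?E) = ?E" by (simp only: cliff_square[OF fin assms(2)] fE)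
 have "falt Om * (?c * ?E) = falt Om * (?c * falt Om) * ?E" by (simp only: fE mult.assoc)
 hence fc: "falt Om * (?c * ?E) = ?c * ?E" by (simp only: falt_cliff[OF fin] fE mult.assoc)
 have "?E * ?c * ((falt Om - ?E) * ?c * ?E) = ?E * (?c * (falt Om * (?c * ?E))) - ?E * (?c * (?E * (?c * ?E)))"
  by (simp add: left_diff_distrib right_diff_distrib mult.assoc)
 also have "... = ?E - ?E * (?c * (?E * (?c * ?E)))" by (simp only: fc cc EE)
 also have "?E * (?c * (?E * (?c * ?E))) = Qop d v * Qop d v"
  unfolding Qop_def by (simp only: mult.assoc) (simp only: mult.assoc[symmetric] EE)
 finally show ?thesis unfolding kap_def ..
qed

text \<open>What \<open>hankel_small\<close> provides for the components of an equivariant unit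
  vector field, for just those degrees that occur in \<open>Em d\<close>.\<close>

definition almost_hom :: "nat => real => ('w => complex ^ 'm) => bool" where
 "almost_hom d ep v \<longleftrightarrow> (ALL i e. d <= e & e < d + CARD('m) -->
   (ALL h:Hs Om ze e. EX y:Hs Om ze (Suc e). nr Om (%og. v og $ i * h og - y og) <= ep * nr Om h) \<and>
   (ALL h:Hs Om ze (Suc e). EX y:Hs Om ze e. nr Om (%og. cnj (v og $ i) * h og - y og) <= ep * nr Om h))"

lemma app_Em:
 fixes y :: "'w \<times> 'm list => complex"
 assumes y: "!!og l. og : Om ==> app (falt Om) y (og, l) = y (og, l)" and l: "length l <= CARD('m)"
 shows "app (Em d) y (og, l) = app (hproj (d + length l)) (%og. y (og, l)) og"
proof -
 have ya: "app (alt (length l)) (%l'. y (og, l')) l = y (og, l)" if "og : Om" for og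
  using app_falt[OF fin that, of y l] y[OF that, of l] l by simp
 have z: "app (alt p) x l = 0" if "p ~= length l" for p and x :: "'m list => complex"
 proof -
  have "app (alt p) x l = app (degp p * alt p) x l" by (simp only: alt_degp)
  thus ?thesis using that by simp
 qed
 have "app (Em d) y (og, l) = (SUM p<=CARD('m). app (hproj (d + p)) (%og'. app (alt p) (%l'. y (og', l')) l) og)"
  unfolding EE_def by simp
 also have "... = (SUM p<=CARD('m). if p = length l then app (hproj (d + length l)) (%og'. app (alt (length l)) (%l'. y (og', l')) l) og else 0)"
  by (intro sum.cong refl) (auto simp: z)
 also have "... = app (hproj (d + length l)) (%og'. app (alt (length l)) (%l'. y (og', l')) l) og" using l by simp
 also have "... = app (hproj (d + length l)) (%og. y (og, l)) og"
  by (rule fun_cong[OF supported_dep[OF supported_hproj]]) (rule ya)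
 finally show ?thesis .
qed

text \<open>Deduced from best approximation by a variation: if the residual were not orthogonal to
  the projected vector, adding the multiple \<open>s\<close> of that vector would give a strictly
  better approximation.\<close>

lemma nr_hproj_le: assumes "e <= Suc L" shows "nr Om (app (hproj e) u) <= nr Om u"
proof -
 have b: "nr Om (%og. u og - app (hproj e) u og) <= nr Om (%og. u og - v og)" if "v : Hs Om ze e" for v
  by (rule hproj_best[OF that assms])
 let ?p = "app (hproj e) u"
 have "ip Om (%og. u og - ?p og) ?p = 0"
 proof -
  let ?d = "%og. u og - ?p og"
  let ?c = "ip Om ?d ?p"
  show ?thesis
  proof (cases "nr Om ?p = 0")
   case True
   hence "ip Om ?p ?p = 0" using nr_power2[of Om ?p] by simp
   hence "(SUM og:Om. (cmod (?p og))\<^sup>2) = 0"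
    using True by (simp add: nr_def L2_set_def)
   hence "ALL og:Om. ?p og = 0" using fin by (simp add: sum_nonneg_eq_0_iff)
   thus ?thesis by (simp add: ip_def)
  next
   case False
   define s where "s = ?c / of_real ((nr Om ?p)\<^sup>2)"
   have n0: "(nr Om ?p)\<^sup>2 ~= 0" using False by simp
   have pp: "ip Om ?p ?p = of_real ((nr Om ?p)\<^sup>2)" by (simp only: nr_power2)
   have orth: "ip Om (%og. ?d og - s * ?p og) (%og. - s * ?p og) = 0"
   proof -
    have "ip Om (%og. ?d og - s * ?p og) (%og. - s * ?p og) = cnj (- s) * (?c - s * ip Om ?p ?p)"
     by (simp only: ip_scale_right ip_diff_left[of _ ?d] ip_scale_left)
    thus ?thesis using n0 unfolding pp by (simp add: s_def)
   qed
   have eq: "(nr Om ?d)\<^sup>2 = (nr Om (%og. ?d og - s * ?p og))\<^sup>2 + (nr Om (%og. - s * ?p og))\<^sup>2"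
    using nr_pythagoras[OF orth] by simp
   have "(%og. (1 + s) * ?p og) : Hs Om ze e" by (intro Hs_scale hproj_in_Hs)
   from b[OF this] have "nr Om ?d <= nr Om (%og. ?d og - s * ?p og)" by (simp add: algebra_simps)
   hence "(nr Om ?d)\<^sup>2 <= (nr Om (%og. ?d og - s * ?p og))\<^sup>2" by (intro power_mono) auto
   hence "(nr Om (%og. - s * ?p og))\<^sup>2 <= 0" using eq by linarith
   hence "nr Om (%og. - s * ?p og) = 0" by simp
   hence "s = 0" unfolding nr_scale using False by simp
   thus ?thesis using n0 by (simp add: s_def)
  qed
 qed
 hence "ip Om ?p (%og. ?p og - u og) = 0"
 proof -
  assume "ip Om (%og. u og - ?p og) ?p = 0"
  moreover have "ip Om ?p (%og. ?p og - u og) = - cnj (ip Om (%og. u og - ?p og) ?p)"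
   by (simp add: ip_def sum_negf[symmetric] algebra_simps)
  ultimately show ?thesis by simp
 qed
 from nr_le_orth[OF this] show ?thesis by simp
qed

lemma cliff_bound:
 fixes w :: "'w \<times> 'm list => complex"
 assumes v: "!!og. og : Om ==> norm (v og) = 1"
  and w: "!!og l. og : Om ==> app (falt Om) w (og, l) = w (og, l)" and l: "length l <= CARD('m)"
 shows "nr Om (%og. app (cliff Om v) w (og, l)) <= real CARD('m) * (real CARD('m) + 1) * NN Om w"
proof -
 let ?m = "CARD('m)"
 have vi: "cmod (v og $ i) <= 1" if "og : Om" for og i
  using Finite_Cartesian_Product.norm_nth_le[of "v og" i] v[OF that] by simp
 have c: "nr Om (%og. app (cre i) (%l'. w (og, l')) l) <= real ?m * NN Om w" for i
 proof (cases "length l")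
  case 0
  thus ?thesis using NN_nonneg[of Om w] by (simp add: nr_def L2_set_def)
 next
  case (Suc p)
  have "nr Om (%og. app (cre i) (%l'. w (og, l')) l) <= real (Suc p) * NN Om w"
   by (rule cre_bound[OF _ Suc]) (rule nr_le_NN, use Suc l in simp)
  also have "... <= real ?m * NN Om w" using l Suc by (intro mult_right_mono NN_nonneg) auto
  finally show ?thesis .
 qed
 have a: "nr Om (%og. w (og, i # l)) <= NN Om w" for i
 proof (cases "length l = ?m")
  case True
  have "w (og, i # l) = 0" if "og : Om" for og using w[OF that, of "i # l"] app_falt[OF fin that, of w "i # l"] True by simp
  hence "nr Om (%og. w (og, i # l)) = nr Om (%og. 0)" by (rule nr_cong)
  thus ?thesis using NN_nonneg[of Om w] by (simp add: nr_def L2_set_def)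
 qed (use l in \<open>intro nr_le_NN, auto\<close>)
 have "nr Om (%og. app (cliff Om v) w (og, l)) = nr Om (%og. SUM i:UNIV. v og $ i * app (cre i) (%l'. w (og, l')) l + cnj (v og $ i) * w (og, i # l))"
  by (rule nr_cong) (rule app_cliff[OF fin])
 also have "... <= (SUM i:(UNIV :: 'm set). (real ?m + 1) * NN Om w)"
 proof (rule order_trans[OF nr_sum sum_mono])
  fix i :: 'm
  have "nr Om (%og. v og $ i * app (cre i) (%l'. w (og, l')) l) <= 1 * nr Om (%og. app (cre i) (%l'. w (og, l')) l)"
   "nr Om (%og. cnj (v og $ i) * w (og, i # l)) <= 1 * nr Om (%og. w (og, i # l))"
   by (rule nr_bound_mult; use vi in simp)+
  thus "nr Om (%og. v og $ i * app (cre i) (%l'. w (og, l')) l + cnj (v og $ i) * w (og, i # l)) <= (real ?m + 1) * NN Om w"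
   using c[of i] a[of i] nr_add[of Om "%og. v og $ i * app (cre i) (%l'. w (og, l')) l" "%og. cnj (v og $ i) * w (og, i # l)"]
   by (simp add: algebra_simps)
 qed
 finally show ?thesis by simp
qed

text \<open>Each term of the Clifford action is close to the right degree, and \<open>hproj\<close>
  does at least as well as the sum of these approximants. The extreme lengths need no hypothesis on
  \<open>v\<close>: nothing is created onto the empty list, and nothing lies above the top degree to
  be annihilated.\<close>

lemma almost_hom_bound:
 fixes u :: "'w \<times> 'm list => complex"
 assumes v: "almost_hom d ep v" and eps: "ep >= 0" and dL: "d + CARD('m) <= Suc L"
  and u: "!!og l. og : Om ==> app (falt Om) u (og, l) = u (og, l)"
  and uH: "!!l. length l <= CARD('m) ==> (%og. u (og, l)) : Hs Om ze (d + length l)"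
  and l: "length l <= CARD('m)"
 shows "nr Om (%og. app (cliff Om v) u (og, l) - app (hproj (d + length l)) (%og. app (cliff Om v) u (og, l)) og)
   <= ep * (real CARD('m) * (real CARD('m) + 1)) * NN Om u"
proof -
 let ?m = "CARD('m)" and ?e = "d + length l"
 have c: "EX y:Hs Om ze ?e. nr Om (%og. v og $ i * app (cre i) (%l'. u (og, l')) l - y og) <= ep * (real ?m * NN Om u)" for i
 proof (cases "length l")
  case 0
  thus ?thesis using NN_nonneg[of Om u] eps by (intro bexI[OF _ Hs_0]) (simp add: nr_def L2_set_def)
 next
  case (Suc p)
  let ?h = "%og. app (cre i) (%l'. u (og, l')) l"
  have hin: "?h : Hs Om ze (d + p)"
  proof (rule cre_Hs[OF _ Suc])
   fix l' :: "'m list" assume "length l' = p"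
   thus "(%og. u (og, l')) : Hs Om ze (d + p)" using uH[of l'] Suc l by simp
  qed
  have "d <= d + p & d + p < d + ?m" using Suc l by simp
  hence "ALL h:Hs Om ze (d + p). EX y:Hs Om ze (Suc (d + p)). nr Om (%og. v og $ i * h og - y og) <= ep * nr Om h"
   by (rule v[unfolded almost_hom_def, THEN spec, THEN spec, THEN mp, THEN conjunct1])
  from bspec[OF this hin] obtain y where y: "y : Hs Om ze (Suc (d + p))" "nr Om (%og. v og $ i * ?h og - y og) <= ep * nr Om ?h"
   by (elim bexE)
  have "nr Om ?h <= real (Suc p) * NN Om u"
   by (rule cre_bound[OF _ Suc]) (rule nr_le_NN, use Suc l in simp)
  also have "... <= real ?m * NN Om u" using l Suc by (intro mult_right_mono NN_nonneg) auto
  finally have "ep * nr Om ?h <= ep * (real ?m * NN Om u)" using eps by (intro mult_left_mono)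
  thus ?thesis using y Suc by (intro bexI[of _ y]) auto
 qed
 have a: "EX y:Hs Om ze ?e. nr Om (%og. cnj (v og $ i) * u (og, i # l) - y og) <= ep * NN Om u" for i
 proof (cases "length l = ?m")
  case True
  have "u (og, i # l) = 0" if "og : Om" for og using u[OF that, of "i # l"] app_falt[OF fin that, of u "i # l"] True by simp
  hence "nr Om (%og. cnj (v og $ i) * u (og, i # l) - 0) = nr Om (%og. 0)" by (intro nr_cong) simp
  thus ?thesis using NN_nonneg[of Om u] eps by (intro bexI[OF _ Hs_0]) (simp add: nr_def L2_set_def)
 next
  case False
  hence ll: "length (i # l) <= ?m" "?e < d + ?m" using l by auto
  have h: "(%og. u (og, i # l)) : Hs Om ze (Suc ?e)" using uH[OF ll(1)] by simp
  obtain y where y: "y : Hs Om ze ?e" "nr Om (%og. cnj (v og $ i) * u (og, i # l) - y og) <= ep * nr Om (%og. u (og, i # l))"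
   using v[unfolded almost_hom_def, rule_format, of ?e i] ll h by auto
  have "ep * nr Om (%og. u (og, i # l)) <= ep * NN Om u" using eps nr_le_NN[OF ll(1)] by (intro mult_left_mono)
  thus ?thesis using y by (intro bexI[of _ y]) auto
 qed
 have "ALL i. EX y. y : Hs Om ze ?e & nr Om (%og. v og $ i * app (cre i) (%l'. u (og, l')) l - y og) <= ep * (real ?m * NN Om u)"
  using c unfolding Bex_def by (rule allI)
 from choice[OF this] obtain yc where yc': "ALL i. yc i : Hs Om ze ?e & nr Om (%og. v og $ i * app (cre i) (%l'. u (og, l')) l - yc i og) <= ep * (real ?m * NN Om u)" ..
 have "ALL i. EX y. y : Hs Om ze ?e & nr Om (%og. cnj (v og $ i) * u (og, i # l) - y og) <= ep * NN Om u"
  using a unfolding Bex_def by (rule allI)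
 from choice[OF this] obtain ya where ya': "ALL i. ya i : Hs Om ze ?e & nr Om (%og. cnj (v og $ i) * u (og, i # l) - ya i og) <= ep * NN Om u" ..
 note yc = yc'[THEN spec, THEN conjunct1] yc'[THEN spec, THEN conjunct2] and ya = ya'[THEN spec, THEN conjunct1] ya'[THEN spec, THEN conjunct2]
 have Y: "(%og. SUM i:UNIV. yc i og + ya i og) : Hs Om ze ?e" by (intro Hs_sum Hs_add yc ya)
 have "nr Om (%og. app (cliff Om v) u (og, l) - app (hproj ?e) (%og. app (cliff Om v) u (og, l)) og)
   <= nr Om (%og. app (cliff Om v) u (og, l) - (SUM i:UNIV. yc i og + ya i og))"
  by (rule hproj_best[OF Y]) (use dL l in simp)
 also have "... = nr Om (%og. SUM i:UNIV. (v og $ i * app (cre i) (%l'. u (og, l')) l - yc i og) + (cnj (v og $ i) * u (og, i # l) - ya i og))"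
  by (rule nr_cong) (simp add: app_cliff[OF fin] sum.distrib sum_subtractf)
 also have "... <= (SUM i:(UNIV :: 'm set). ep * (real ?m * NN Om u) + ep * NN Om u)"
  by (rule order_trans[OF nr_sum sum_mono]) (rule order_trans[OF nr_add add_mono[OF yc(2) ya(2)]])
 also have "... = ep * (real ?m * (real ?m + 1)) * NN Om u" by (simp add: algebra_simps)
 finally show ?thesis .
qed

text \<open>The number of tensor indices, lost in passing to \<open>NN\<close>, times a bound for
  Clifford multiplication: each of the \<open>CARD('m)\<close> summands has a creation part bounded
  by \<open>CARD('m)\<close> and an annihilation part bounded by 1.\<close>

definition cst :: real where
 "cst = real (card {l :: 'm list. length l <= CARD('m)}) * (real CARD('m) * (real CARD('m) + 1))"

lemma NN_le: assumes "!!l. length l <= CARD('m) ==> nr Om (%og. w (og, l :: 'm list)) <= B"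
 shows "NN Om w <= real (card {l :: 'm list. length l <= CARD('m)}) * B"
 unfolding NN_def using sum_bounded_above[of "{l :: 'm list. length l <= CARD('m)}" "%l. nr Om (%og. w (og, l))" B] assms by simp

text \<open>In \<open>kap_eq\<close> the leakage contributes \<open>cst * ep\<close>, while carrying
  it back contributes only the bounded factor \<open>cst\<close>.\<close>

lemma kap_contract:
 assumes v: "almost_hom d ep v" and eps: "ep >= 0" and dL: "d + CARD('m) <= Suc L" and v1: "!!og. og : Om ==> norm (v og) = 1"
 shows "NN Om (app (kap d v * Em d) u) <= cst * cst * ep * NN Om (app (Em d) u)"
proof -
 let ?m = "CARD('m)" and ?E = "Em d" and ?c = "cliff Om v"
 define x where "x = app ?E u"
 define w where "w = app ((falt Om - ?E) * ?c * ?E) u"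
 have EE: "?E * ?E = ?E" using EE_mult[of "{..?m}" "{..?m}" d] dL by simp
 have fE: "falt Om * ?E = ?E" using falt_EE(1)[of "{..?m}" d] by simp
 have Ef: "?E * falt Om = ?E" using falt_EE(2)[of "{..?m}" d] by simp
 have "falt Om * (?c * ?E) = falt Om * (?c * falt Om) * ?E" by (simp only: fE mult.assoc)
 hence fc: "falt Om * (?c * ?E) = ?c * ?E" by (simp only: falt_cliff[OF fin] fE mult.assoc)
 have ap: "app X u = app Y u" if "X = Y" for X Y using that by simp
 have fx: "app (falt Om) x = x" using ap[OF fE] by (simp add: x_def)
 have xH: "(%og. x (og, l)) : Hs Om ze (d + length l)" if "length l <= ?m" for l
 proof -
  have "app ?E x = x" using ap[OF EE] by (simp add: x_def)
  hence "x (og, l) = app (hproj (d + length l)) (%og. x (og, l)) og" for og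
   using app_Em[of x l d og] fx that by simp
  thus ?thesis by (rule Hs_cong[OF hproj_in_Hs])
 qed
 define y where "y = app ?c x"
 have fy: "app (falt Om) y = y" using ap[OF fc] by (simp add: y_def x_def)
 have wy: "w (og, l) = y (og, l) - app (hproj (d + length l)) (%og. y (og, l)) og" if "length l <= ?m" for og l
  using app_Em[of y l d og] fy that by (simp add: w_def y_def x_def)
 have "nr Om (%og. w (og, l)) <= ep * (real ?m * (real ?m + 1)) * NN Om x" if "length l <= ?m" for l
  unfolding wy[OF that] y_def
  by (rule almost_hom_bound[OF v eps dL _ xH that]) (simp_all add: fx)
 from NN_le[OF this] have NNw: "NN Om w <= cst * ep * NN Om x" by (simp add: cst_def mult_ac)
 have "falt Om * ((falt Om - ?E) * ?c * ?E) = falt Om * (falt Om * (?c * ?E)) - falt Om * ?E * (?c * ?E)"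
  by (simp only: left_diff_distrib right_diff_distrib mult.assoc)
 also have "... = falt Om * (?c * ?E) - ?E * (?c * ?E)" by (simp only: fc fE)
 also have "... = (falt Om - ?E) * ?c * ?E" by (simp only: left_diff_distrib mult.assoc)
 finally have fw: "app (falt Om) w = w" using ap[of "falt Om * ((falt Om - ?E) * ?c * ?E)"] by (simp add: w_def)
 define z where "z = app ?c w"
 have fz: "app (falt Om) z = z"
 proof -
  have "app (falt Om) (app ?c (app (falt Om) w)) = app (falt Om * (?c * falt Om)) w" by simp
  also have "... = app ?c (app (falt Om) w)" unfolding falt_cliff[OF fin] by simp
  finally show ?thesis by (simp add: fw z_def)
 qed
 have k: "app (kap d v * ?E) u = app ?E z"
 proof -
  have kk: "kap d v = ?E * ?c * ((falt Om - ?E) * ?c * ?E)" by (rule kap_eq[OF dL v1])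
  have "kap d v * ?E = ?E * ?c * ((falt Om - ?E) * ?c * (?E * ?E))" unfolding kk by (simp only: mult.assoc)
  thus ?thesis unfolding EE by (simp add: z_def w_def)
 qed
 have "nr Om (%og. app ?E z (og, l)) <= real ?m * (real ?m + 1) * NN Om w" if l: "length l <= ?m" for l
 proof -
  have "nr Om (%og. app ?E z (og, l)) = nr Om (app (hproj (d + length l)) (%og. z (og, l)))"
   using app_Em[of z l d] fz l by (intro nr_cong) simp
  also have "... <= nr Om (%og. z (og, l))" by (rule nr_hproj_le) (use dL l in simp)
  also have "... <= real ?m * (real ?m + 1) * NN Om w" unfolding z_def
   by (rule cliff_bound[OF v1 _ l]) (simp_all add: fw)
  finally show ?thesis .
 qed
 from NN_le[OF this] have "NN Om (app ?E z) <= cst * NN Om w" by (simp add: cst_def mult_ac)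
 also have "... <= cst * (cst * ep * NN Om x)" using NNw by (intro mult_left_mono) (simp_all add: cst_def)
 finally show ?thesis unfolding k by (simp add: x_def mult_ac)
qed

end

text \<open>In the corner of \<open>E\<close> the square \<open>E - k\<close> of \<open>Q\<close> is
  inverted by \<open>W\<close>; as \<open>Q\<close> commutes with \<open>k\<close>, it commutes with
  \<open>W\<close>, and \<open>Q * W\<close> is a two-sided inverse of \<open>Q\<close>.\<close>

lemma ring_square_root_inverse:
 fixes E Q k W :: "'a::ring_1"
 assumes "E * E = E" "E * Q = Q" "Q * E = Q" "k = E - Q * Q" "(1 - k) * W = 1" "W * (1 - k) = 1"
 shows "Q * (Q * W) = E" "(Q * W) * Q = E" "E * (Q * W) = Q * W" "(Q * W) * E = Q * W"
proof -
 have Ek: "E * k = k" using assms by (simp add: right_diff_distrib mult.assoc[symmetric])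
 have Qk: "Q * k = k * Q" by (simp add: assms(4) right_diff_distrib left_diff_distrib assms(2,3) mult.assoc)
 have QQ: "Q * Q = E * (1 - k)" using Ek by (simp add: right_diff_distrib) (simp add: assms(4))
 have 1: "Q * (Q * W) = E * ((1 - k) * W)" by (simp only: QQ mult.assoc[symmetric])
 thus q1: "Q * (Q * W) = E" by (simp only: assms(5) mult_1_right)
 have comm: "W * Q = Q * W"
 proof -
  have "W * Q = W * Q * ((1 - k) * W)" by (simp only: assms(5) mult_1_right)
  also have "... = W * (Q * (1 - k)) * W" by (simp only: mult.assoc)
  also have "Q * (1 - k) = (1 - k) * Q" by (simp add: right_diff_distrib left_diff_distrib Qk)
  also have "W * ((1 - k) * Q) * W = (W * (1 - k)) * (Q * W)" by (simp only: mult.assoc)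
  finally show ?thesis by (simp only: assms(6) mult_1_left)
 qed
 show "(Q * W) * Q = E" using q1 by (simp only: mult.assoc comm)
 show e: "E * (Q * W) = Q * W" by (simp only: mult.assoc[symmetric] assms)
 have "(Q * W) * E = W * (Q * E)" by (simp only: comm[symmetric] mult.assoc)
 thus "(Q * W) * E = Q * W" by (simp only: assms comm)
qed

lemma supported_corner: assumes "supported S E" shows "supported S (E * X * E)"
proof (rule supportedI)
 fix u i assume "i ~: S"
 thus "app (E * X * E) u i = 0" by (simp add: supported_outside[OF assms])
next
 fix u v :: "'a => complex" assume *: "!!k. k : S ==> u k = v k"
 have "app E u = app E v" by (rule supported_dep[OF assms *])
 thus "app (E * X * E) u = app (E * X * E) v" by simp
qed

context hardy
begin

lemma Em_idem: "d + CARD('m) <= Suc L ==> Em d * Em d = Em d"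
 using EE_mult[of "{..CARD('m)}" "{..CARD('m)}" d] by simp

lemma Em_Qop: assumes "d + CARD('m) <= Suc L" shows "Em d * Qop d v = Qop d v" "Qop d v * Em d = Qop d v"
proof -
 note E = Em_idem[OF assms]
 show "Em d * Qop d v = Qop d v" unfolding Qop_def by (simp only: mult.assoc[symmetric] E)
 show "Qop d v * Em d = Qop d v" unfolding Qop_def by (simp only: mult.assoc E)
qed

lemma supported_EE: assumes "P <= {..CARD('m)}" shows "supported (Om \<times> {l. length l <= CARD('m)}) (EE d P)"
 unfolding EE_def
proof (rule supported_sum)
 fix p assume "p : P"
 thus "supported (Om \<times> {l. length l <= CARD('m)}) (rf (hproj (d + p)) * lf (alt p))"
  using assms by (intro supported_mono[OF supported_rf_lf[OF fin supported_hproj finite_lists_length supported_alt]]) auto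
qed

lemma kap_power:
 assumes "d + CARD('m) <= Suc L"
 shows "Em d * kap d v ^ Suc n = kap d v ^ Suc n" "kap d v ^ Suc n * Em d = kap d v ^ Suc n"
proof -
 have 1: "Em d * kap d v = kap d v" "kap d v * Em d = kap d v"
  unfolding kap_def using Em_idem[OF assms] Em_Qop[OF assms, of v]
  by (simp_all add: right_diff_distrib left_diff_distrib mult.assoc) (simp add: mult.assoc[symmetric])
 show "Em d * kap d v ^ Suc n = kap d v ^ Suc n" by (simp add: mult.assoc[symmetric] 1)
 show "kap d v ^ Suc n * Em d = kap d v ^ Suc n" by (simp only: power_Suc2 mult.assoc 1)
qed

lemma kap_power_bound:
 assumes v: "almost_hom d ep v" and eps: "ep >= 0" "cst * cst * ep <= 1 / 2" and dL: "d + CARD('m) <= Suc L"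
  and v1: "!!og. og : Om ==> norm (v og) = 1"
 shows "NN Om (app (kap d v ^ n * Em d) u) <= (1/2) ^ n * NN Om (app (Em d) u)"
proof (induction n)
 case (Suc n)
 let ?w = "app (kap d v ^ n * Em d) u"
 have E: "Em d * (kap d v ^ n * Em d) = kap d v ^ n * Em d"
  using kap_power(1)[OF dL, of v] Em_idem[OF dL] by (cases n) (simp_all add: mult.assoc[symmetric] del: power_Suc)
 have "kap d v ^ Suc n * Em d = kap d v * Em d * (kap d v ^ n * Em d)" by (simp only: power_Suc mult.assoc E)
 hence "NN Om (app (kap d v ^ Suc n * Em d) u) = NN Om (app (kap d v * Em d) ?w)" by simp
 also have "... <= cst * cst * ep * NN Om (app (Em d) ?w)" by (rule kap_contract[OF v eps(1) dL v1])
 also have "... <= 1 / 2 * NN Om (app (Em d) ?w)" by (rule mult_right_mono[OF eps(2) NN_nonneg])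
 also have "app (Em d) ?w = ?w"
  using arg_cong[OF E, of "%X. app X u"] by simp
 also have "1 / 2 * NN Om ?w <= 1 / 2 * ((1/2) ^ n * NN Om (app (Em d) u))" using Suc by (intro mult_left_mono) auto
 finally show ?case by simp
qed simp

text \<open>The condition on \<open>ep\<close> makes \<open>kap\<close> halve \<open>NN\<close>, so
  the Neumann series applies. Decay in \<open>NN\<close> becomes decay of the matrix entries on
  applying it to the finitely many relevant \<open>delta k\<close>.\<close>

lemma Qop_inverse:
 fixes v :: "'t::topological_space => 'w => complex ^ 'm"
 assumes v: "!!t. t : T ==> almost_hom d ep (v t)" and eps: "ep >= 0" "cst * cst * ep <= 1 / 2"
  and dL: "d + CARD('m) <= Suc L"
  and v1: "!!t og. t : T ==> og : Om ==> norm (v t og) = 1"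
  and cv: "!!og. og : Om ==> continuous_on T (%t. v t og)"
 obtains R where "fsf T (%t. Qop d (v t))" "fsf T R" "!!t. t : T ==> Qop d (v t) * R t = Em d" "!!t. t : T ==> R t * Qop d (v t) = Em d"
  "!!t. t : T ==> Em d * R t = R t" "!!t. t : T ==> R t * Em d = R t"
proof -
 let ?S = "Om \<times> {l :: 'm list. length l <= CARD('m)}"
 have fQ: "fsf T (%t. Qop d (v t))" unfolding Qop_def mult.assoc
  by (intro fsf_mult fsf_EE fsf_cliff_EE cv)
 have fk: "fsf T (%t. kap d (v t))" unfolding kap_def by (intro fsf_diff fsf_mult fQ fsf_EE)
 have finS: "finite ?S" by (intro finite_cartesian_product fin finite_Phi)
 define C where "C = (SUM k:?S. NN Om (app (Em d) (delta k)))"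
 have C0: "C >= 0" unfolding C_def by (intro sum_nonneg NN_nonneg)
 have bd: "cmod (ent (kap d (v t) ^ Suc n) i k) <= C * (1/2) ^ n" if t: "t : T" for n t i k
 proof (cases "i : ?S & k : ?S")
  case True
  obtain og l where i: "i = (og, l)" "og : Om" "length l <= CARD('m)" using True by auto
  let ?u = "app (kap d (v t) ^ Suc n) (delta k)"
  have "cmod (?u (og, l)) <= nr Om (%og. ?u (og, l))"
   unfolding nr_def by (rule member_le_L2_set[OF fin i(2)])
  also have "... <= NN Om ?u" by (rule nr_le_NN[OF i(3)])
  also have "NN Om ?u <= (1/2) ^ Suc n * NN Om (app (Em d) (delta k))"
   using kap_power_bound[OF v[OF t] eps dL v1[OF t], of "Suc n" "delta k"] unfolding kap_power(2)[OF dL] .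
  also have "... <= (1/2) ^ n * C"
   unfolding C_def using True finS
   by (intro mult_mono member_le_sum) (auto intro: NN_nonneg sum_nonneg)
  finally show ?thesis by (simp add: ent_def i(1) mult.commute)
 next
  case False
  have "supported ?S (Em d * (kap d (v t) ^ Suc n) * Em d)" by (rule supported_corner[OF supported_EE]) simp
  hence "supported ?S (kap d (v t) ^ Suc n)" by (simp only: kap_power[OF dL])
  hence "ent (kap d (v t) ^ Suc n) i k = 0" by (rule ent_unsupported) (use False in blast)
  thus ?thesis using C0 by simp
 qed
 from neumann[OF fk bd] obtain Z where Z: "fsf T Z" "!!t. t : T ==> (1 - kap d (v t)) * (1 + Z t) = 1"
  "!!t. t : T ==> (1 + Z t) * (1 - kap d (v t)) = 1" by blast
 define R where "R t = Qop d (v t) * (1 + Z t)" for t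
 have "fsf T (%t. Qop d (v t) + Qop d (v t) * Z t)" by (intro fsf_add fsf_mult fQ Z)
 hence fR: "fsf T R" by (simp add: R_def[abs_def] distrib_left)
 note r = ring_square_root_inverse[OF Em_idem[OF dL] Em_Qop[OF dL] kap_def Z(2,3)]
 show ?thesis by (rule that[OF fQ fR]) (use r in \<open>auto simp: R_def\<close>)
qed

end

section \<open>Classes of exterior powers\<close>

text \<open>The corner of such an \<open>e\<close> carries a finite-dimensional representation of
  the matrices, through which continuous families of matrices act continuously.\<close>

definition cgood :: "'x::topological_space set => ('w \<times> 'm::finite list) lop => bool" where
 "cgood X e \<longleftrightarrow> e * e = e & (ALL B. lf (tens B) * e = e * lf (tens B)) & (EX S. finite S & supported S e) \<and>
   (ALL A. continuous_on X A --> fsf X (%x. lf (tens (A x)) * e))"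

text \<open>The action of \<open>A x\<close> on the corner of \<open>e\<close>, extended by the
  identity on the complement.\<close>

definition yel :: "('x => complex ^ 'm ^ 'm) => ('w \<times> 'm::finite list) lop => 'x => ('w \<times> 'm list) lop" where
 "yel A e x = 1 + (lf (tens (A x)) - 1) * e"

definition adj :: "complex ^ 'm ^ 'm => complex ^ 'm ^ 'm" where
 "adj A = map_matrix cnj (transpose A)"

lemmas adj_defs = adj_def map_matrix_def transpose_def

lemma continuous_adj: "continuous_on X A ==> continuous_on X (%x. adj (A x))"
 unfolding adj_defs
 by (auto intro!: continuous_intros)

lemma adj_right: "adj A ** A = mat 1 ==> A ** adj (A :: complex ^ 'm::finite ^ 'm) = mat 1"
 by (simp only: matrix_left_right_inverse)

locale unitary_family =
 fixes X D :: "'x::topological_space set" and A :: "'x => complex ^ 'm::finite ^ 'm"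
 assumes DX: "D <= X" and contA: "continuous_on X A"
  and uni: "!!x. adj (A x) ** A x = mat 1" and off: "!!x. x : D \<or> x ~: X ==> A x = mat 1"
begin

lemma uni_tens: "tens (adj (A x)) * tens (A x) = 1" "tens (A x) * tens (adj (A x)) = 1"
 using uni[of x] adj_right[OF uni[of x]] by (simp_all only: tens_mult[symmetric] tens_mat_1)

lemma yel_mult:
 assumes "e * e' = 0" "!!B. lf (tens B) * e = e * lf (tens B)"
 shows "yel A e x * yel A e' x = yel A (e + e') x"
proof -
 let ?l = "lf (tens (A x)) - 1"
 have "e * ?l = ?l * e" using assms(2) by (simp add: left_diff_distrib right_diff_distrib)
 hence "?l * e * (?l * e') = ?l * ?l * (e * e')" by (metis mult.assoc)
 hence z: "?l * e * (?l * e') = 0" by (simp add: assms)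
 have "yel A e x * yel A e' x = 1 + ?l * e + ?l * e' + ?l * e * (?l * e')"
  unfolding yel_def by (simp only: distrib_left distrib_right mult_1_left mult_1_right ac_simps)
 thus ?thesis unfolding z by (simp add: yel_def distrib_left add.assoc)
qed

lemma yel_adj:
 assumes "cgood X e"
 shows "yel A e x * yel (%x. adj (A x)) e x = 1" "yel (%x. adj (A x)) e x * yel A e x = 1"
proof -
 have e: "e * e = e" "lf (tens B) * e = e * lf (tens B)" for B using assms by (auto simp: cgood_def)
 have "(1 + (l - 1) * e) * (1 + (l' - 1) * e) = 1" if "l * l' = 1" "l * e = e * l" "l' * e = e * l'" for l l'
 proof -
  have "(l - 1) * e * ((l' - 1) * e) = (l - 1) * (l' - 1) * e"
  proof -
   have "e * (l' - 1) = (l' - 1) * e" using that by (simp add: left_diff_distrib right_diff_distrib)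
   hence "(l - 1) * e * ((l' - 1) * e) = (l - 1) * (l' - 1) * (e * e)" by (metis mult.assoc)
   thus ?thesis by (simp only: e)
  qed
  also have "(l - 1) * (l' - 1) = 1 - l - l' + 1" using that(1) by (simp add: left_diff_distrib right_diff_distrib)
  finally have "(l - 1) * e * ((l' - 1) * e) = (1 - l - l' + 1) * e" .
  thus ?thesis by (simp add: distrib_left distrib_right left_diff_distrib)
 qed
 note * = this
 show "yel A e x * yel (%x. adj (A x)) e x = 1" "yel (%x. adj (A x)) e x * yel A e x = 1"
  unfolding yel_def by (rule *; simp add: e uni_tens lf_ring[symmetric])+
qed

lemma yel_Gam: assumes "cgood X e" shows "yel A e : carrier (Gam X D)" "yel (%x. adj (A x)) e : carrier (Gam X D)"
proof -
 have f: "fsf X (%x. yel B e x - 1)" if "continuous_on X B" for B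
 proof -
  have "fsf X (%x. lf (tens (B x)) * e)" using assms that by (auto simp: cgood_def)
  moreover have "fsf X (%x. e)" using assms fsf_const by (auto simp: cgood_def)
  ultimately have "fsf X (%x. lf (tens (B x)) * e - e)" by (rule fsf_diff)
  thus ?thesis by (simp add: yel_def left_diff_distrib)
 qed
 have a1: "adj (mat 1 :: complex ^ 'm ^ 'm) = mat 1"
  by (simp add: adj_defs mat_def vec_eq_iff)
 have "GLfam X (yel A e)" "GLfam X (yel (%x. adj (A x)) e)"
  by (rule GLfamI[OF f[OF contA] f[OF continuous_adj[OF contA]]] GLfamI[OF f[OF continuous_adj[OF contA]] f[OF contA]]; rule yel_adj[OF assms])+
 thus "yel A e : carrier (Gam X D)" "yel (%x. adj (A x)) e : carrier (Gam X D)"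
  using off by (auto simp: Gam_def yel_def tens_mat_1 lf_ring a1)
qed

text \<open>Here \<open>q\<close> intertwines the representations on two orthogonal corners, so
  transport along \<open>q\<close> sends the family of \<open>A\<close> on one corner to its family
  on the other.\<close>

lemma cls_yel_transport:
 assumes e: "cgood X e" and fin: "finite S" "supported S q" "supported S r"
  and qr: "q * r = e'" "r * q = e" "q * q = 0" "r * r = 0" "q * e = q" "e * r = r"
  and comm: "!!B. lf (tens B) * q = q * lf (tens B)"
 shows "cls X D (yel A e) = cls X D (yel A e')"
proof -
 have "cls X D (yel A e) = cls X D (%x. 1 + q * (yel A e x - 1) * r)"
 proof (rule cls_transport[OF DX yel_Gam(1)[OF e] fin qr])
  have ee: "e * e = e" "lf (tens B) * e = e * lf (tens B)" for B using e by (auto simp: cgood_def)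
  fix x
  have "e * (lf (tens (A x)) - 1) = (lf (tens (A x)) - 1) * e" by (simp add: left_diff_distrib right_diff_distrib ee)
  thus "e * (yel A e x - 1) = yel A e x - 1" unfolding yel_def by (simp add: mult.assoc[symmetric]) (simp add: mult.assoc ee)
  show "(yel A e x - 1) * e = yel A e x - 1" unfolding yel_def by (simp add: mult.assoc ee)
 qed
 also have "(%x. 1 + q * (yel A e x - 1) * r) = yel A e'"
 proof
  fix x
  have c: "q * (lf (tens (A x)) - 1) = (lf (tens (A x)) - 1) * q" by (simp add: left_diff_distrib right_diff_distrib comm)
  have "q * (yel A e x - 1) * r = q * (lf (tens (A x)) - 1) * (e * r)" unfolding yel_def by (simp add: mult.assoc)
  also have "... = (lf (tens (A x)) - 1) * e'" unfolding c qr(6) by (simp only: mult.assoc qr(1))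
  finally show "1 + q * (yel A e x - 1) * r = yel A e' x" by (simp add: yel_def)
 qed
 finally show ?thesis .
qed

lemma cgood_add:
 assumes "cgood X e" "cgood X e'" "e * e' = 0" "e' * e = 0" shows "cgood X (e + e')"
proof -
 obtain S S' where "finite S" "supported S e" "finite S'" "supported S' e'" using assms by (auto simp: cgood_def)
 hence "finite (S \<union> S')" "supported (S \<union> S') (e + e')" by (auto intro: supported_add supported_mono)
 moreover have "fsf X (%x. lf (tens (A x)) * (e + e'))" if "continuous_on X A" for A
  using fsf_add[of X "%x. lf (tens (A x)) * e" "%x. lf (tens (A x)) * e'"] assms that by (auto simp: cgood_def distrib_left)
 ultimately show ?thesis using assms unfolding cgood_def by (auto simp: distrib_left distrib_right)
qed

lemma cgood_0: "cgood X 0"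
 unfolding cgood_def by (auto simp: fsf_0 intro: exI[of _ "{}"])

lemma cls_yel_sum:
 assumes inf: "infinite (UNIV :: ('w \<times> 'm list) set)"
  and J: "finite J" "!!j. j : J ==> cgood X (e j :: ('w \<times> 'm list) lop)" "!!i j. i : J ==> j : J ==> i ~= j ==> e i * e j = 0"
 shows "cgood X (SUM j:J. e j) & cls X D (yel A (SUM j:J. e j)) = finprod (Kgrp X D) (%j. cls X D (yel A (e j))) J"
 using J
proof (induction J rule: finite_induct)
 case empty
 interpret K: comm_group "Kgrp X D :: ('x => ('w \<times> 'm list) lop) set monoid" by (rule comm_group_Kgrp[OF DX inf])
 have "yel A (0 :: ('w \<times> 'm list) lop) = (%x. 1)" by (simp add: yel_def fun_eq_iff)
 thus ?case using cgood_0 cls_one[OF DX, where ?'b = "'w \<times> 'm list"] by simp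
next
 case (insert j J)
 interpret K: comm_group "Kgrp X D :: ('x => ('w \<times> 'm list) lop) set monoid" by (rule comm_group_Kgrp[OF DX inf])
 let ?E = "SUM j:J. e j"
 have IH: "cgood X ?E" "cls X D (yel A ?E) = finprod (Kgrp X D) (%j. cls X D (yel A (e j))) J"
  using insert by auto
 have z: "e j * ?E = 0" "?E * e j = 0" using insert by (auto simp: sum_distrib_left sum_distrib_right intro!: sum.neutral)
 have ej: "cgood X (e j)" using insert by simp
 have "yel A (e j + ?E) = (%x. yel A (e j) x * yel A ?E x)"
  by (rule ext, rule yel_mult[symmetric, OF z(1)]) (use ej in \<open>simp add: cgood_def\<close>)
 hence "cls X D (yel A (e j + ?E)) = cls X D (yel A (e j)) \<otimes>\<^bsub>Kgrp X D\<^esub> cls X D (yel A ?E)"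
  using cls_mult[OF DX yel_Gam(1)[OF ej] yel_Gam(1)[OF IH(1)]] by simp
 moreover have "(%j. cls X D (yel A (e j))) : J \<rightarrow> carrier (Kgrp X D)" "cls X D (yel A (e j)) : carrier (Kgrp X D)"
  using insert by (auto intro!: cls_closed yel_Gam)
 ultimately show ?case using insert(1,2) IH cgood_add[OF ej IH(1) z] by simp
qed

lemma cgood_rf_alt:
 assumes "f * f = f" "finite S" "supported S f" shows "cgood X (rf f * lf (alt p) :: ('w \<times> 'm list) lop)"
 unfolding cgood_def
proof (intro conjI allI impI)
 show "rf f * lf (alt p) * (rf f * lf (alt p)) = (rf f * lf (alt p) :: ('w \<times> 'm list) lop)" by (simp add: rl_mult assms alt_mult)
 show "lf (tens B) * (rf f * lf (alt p)) = (rf f * lf (alt p) :: ('w \<times> 'm list) lop) * lf (tens B)" for B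
 proof -
  have "lf (tens B) * (rf f * lf (alt p)) = rf f * lf (tens B * alt p)" by (simp only: mult.assoc[symmetric] lf_rf_commute lf_ring)
  thus ?thesis by (simp only: tens_alt lf_ring mult.assoc)
 qed
 show "EX S. finite S & supported S (rf f * lf (alt p) :: ('w \<times> 'm list) lop)"
  using supported_rf_lf[OF assms(2,3) finite_lists_length supported_alt] finite_cartesian_product[OF assms(2) finite_lists_length] by blast
 fix A :: "'x => complex ^ 'm ^ 'm" assume A: "continuous_on X A"
 have "fsf X (%x. rf f * lf (tens (A x) * alt p) :: ('w \<times> 'm list) lop)"
  by (intro fsf_rf_lf fsf_const[OF assms(2,3)] fsf_tens_alt A)
 thus "fsf X (%x. lf (tens (A x)) * (rf f * lf (alt p)) :: ('w \<times> 'm list) lop)"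
  by (rule fsf_cong) (simp only: mult.assoc[symmetric] lf_rf_commute lf_ring)
qed

end

context hardy
begin

text \<open>All rank one projections are equivalent: \<open>q\<close> and \<open>r\<close> exchange
  the line of the monomial with the point mass at \<open>og0\<close>. Taking \<open>og0\<close>
  outside \<open>Om\<close> makes the two lines orthogonal, as transport requires, and gives a
  target that does not depend on the sample.\<close>

lemma cls_mproj_alt:
 assumes U: "unitary_family X D A" and apz: "sum apz UNIV <= Suc L" and og0: "og0 ~: Om"
 shows "cls X D (yel A (rf (mproj apz) * lf (alt p))) = cls X D (yel A (rf (pull_lop {og0} id) * lf (alt p :: 'm list lop)))"
proof -
 interpret unitary_family X D A by (rule U)
 let ?S = "insert og0 Om"
 have fS: "finite ?S" using finite_points by simp
 define q where "q = mk_lop ?S (%og og'. if og = og0 & og' : Om then cnj (mnl apz (ze og')) / of_real (N apz) else 0)"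
 define r where "r = mk_lop ?S (%og og'. if og : Om & og' = og0 then mnl apz (ze og) else 0)"
 have aq: "app q u og = (if og = og0 then ip Om u (%og. mnl apz (ze og)) / of_real (N apz) else 0)" for u og
 proof -
  have "(SUM k:?S. (if og0 = og0 & k : Om then cnj (mnl apz (ze k)) / of_real (N apz) else 0) * u k) =
    (SUM k:Om. u k * cnj (mnl apz (ze k)) / of_real (N apz))"
   using og0 finite_points by (simp add: sum.insert) (rule sum.cong, auto)
  thus ?thesis using fS by (simp add: q_def app_mk_lop ip_def sum_divide_distrib)
 qed
 have ar: "app r u og = (if og : Om then mnl apz (ze og) * u og0 else 0)" for u og
 proof -
  have "(SUM k:?S. (if og : Om & k = og0 then mnl apz (ze og) else 0) * u k) =
    (SUM k:?S. if k = og0 then (if og : Om then mnl apz (ze og) * u k else 0) else 0)"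
   by (rule sum.cong) auto
  also have "... = (if og : Om then mnl apz (ze og) * u og0 else 0)" using fS by simp
  finally show ?thesis using fS by (auto simp: r_def app_mk_lop)
 qed
 have N0: "N apz ~= 0" using N_pos[OF apz] by simp
 have ipc: "ip Om (%og. if og : Om then mnl apz (ze og) * c else 0) (%og. mnl apz (ze og)) = of_real (N apz) * c" for c
 proof -
  have "ip Om (%og. if og : Om then mnl apz (ze og) * c else 0) (%og. mnl apz (ze og)) =
    (SUM og:Om. mnl apz (ze og) * cnj (mnl apz (ze og))) * c"
   unfolding ip_def sum_distrib_right by (rule sum.cong) auto
  thus ?thesis by (simp add: orth[OF apz apz])
 qed
 have qr: "q * r = pull_lop {og0} id"
  by (rule lop_appI) (use N0 in \<open>simp add: aq ext[OF ar] ipc\<close>)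
 have rq: "r * q = mproj apz"
  by (rule lop_appI) (simp add: aq ar app_mproj mult.commute)
 have qq: "q * q = 0"
 proof (rule lop_appI)
  fix u i
  have "ip Om (%og. if og = og0 then ip Om u (%og. mnl apz (ze og)) / of_real (N apz) else 0) (%og. mnl apz (ze og)) = 0"
   unfolding ip_def[of _ "%og. if og = og0 then _ og else _ og"] by (rule sum.neutral) (use og0 in auto)
  moreover have "app q u = (%og. if og = og0 then ip Om u (%og. mnl apz (ze og)) / of_real (N apz) else 0)"
   by (rule ext) (rule aq)
  ultimately show "app (q * q) u i = app 0 u i" by (simp add: aq[of _ i])
 qed
 have rr: "r * r = 0" by (rule lop_appI) (use og0 in \<open>simp add: ar\<close>)
 have pq: "pull_lop {og0} id * q = q" by (rule lop_appI) (simp add: aq)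
 have rp: "r * pull_lop {og0} id = r" by (rule lop_appI) (simp add: ar)
 have qm: "q * mproj apz = q" "mproj apz * r = r"
  by (simp_all only: rq[symmetric] mult.assoc[symmetric] qr pq) (simp only: mult.assoc qr rp)
 have mm: "mproj apz * mproj apz = mproj apz" by (simp add: mproj_mult apz)
 have sq: "supported ?S q" "supported ?S r" by (simp_all add: q_def r_def supported_mk_lop)
 have aa: "alt p * alt p = (alt p :: 'm list lop)" by (simp add: alt_mult)
 let ?q = "rf q * lf (alt p :: 'm list lop)" and ?r = "rf r * lf (alt p :: 'm list lop)"
 show ?thesis
 proof (rule cls_yel_transport[where q = ?q and r = ?r and S = "?S \<times> {l. length l = p}"])
  show "cgood X (rf (mproj apz) * lf (alt p :: 'm list lop))" by (rule cgood_rf_alt[OF mm finite_points supported_mproj])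
  show "finite (?S \<times> {l :: 'm list. length l = p})" by (intro finite_cartesian_product fS finite_lists_length)
  show "supported (?S \<times> {l. length l = p}) ?q" "supported (?S \<times> {l. length l = p}) ?r"
   by (intro supported_rf_lf fS sq finite_lists_length supported_alt)+
  show "?q * ?r = rf (pull_lop {og0} id) * lf (alt p)" "?r * ?q = rf (mproj apz) * lf (alt p)" "?q * ?q = 0" "?r * ?r = 0"
   "?q * (rf (mproj apz) * lf (alt p)) = ?q" "rf (mproj apz) * lf (alt p) * ?r = ?r"
   by (simp_all only: rl_mult aa qr rq qq rr qm rf_ring(1) mult_zero_left)
  show "lf (tens B) * ?q = ?q * lf (tens B)" for B
  proof -
   have "lf (tens B) * ?q = rf q * lf (tens B * alt p)" by (simp only: mult.assoc[symmetric] lf_rf_commute lf_ring)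
   thus ?thesis by (simp only: tens_alt lf_ring mult.assoc)
  qed
 qed
qed

text \<open>After splitting into monomials every summand contributes the same class, so the exponent
  is the dimension of the space of polynomials of degree \<open>d + p\<close>.\<close>

lemma cls_EE:
 assumes U: "unitary_family X D A" and dL: "d + CARD('m) <= Suc L" and og0: "og0 ~: Om" and P: "P <= {..CARD('m)}"
  and inf: "infinite (UNIV :: ('w \<times> 'm list) set)"
 shows "cgood X (EE d P) & cls X D (yel A (EE d P)) = finprod (Kgrp X D) (%p. cls X D (yel A (rf (pull_lop {og0} id) * lf (alt p :: 'm list lop)))
   [^]\<^bsub>Kgrp X D\<^esub> card (lsimp (UNIV :: 'm set) (d + p))) P"
proof -
 interpret unitary_family X D A by (rule U)
 interpret K: comm_group "Kgrp X D :: ('a => ('w \<times> 'm list) lop) set monoid" by (rule comm_group_Kgrp[OF DX inf])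
 let ?y = "%p. cls X D (yel A (rf (pull_lop {og0} id) * lf (alt p :: 'm list lop)))"
 have fP: "finite P" using P finite_subset by blast
 have pt: "pull_lop {og0} id * pull_lop {og0} id = pull_lop {og0} id" by (rule lop_appI) simp
 have yc: "?y p : carrier (Kgrp X D)" for p
  by (intro cls_closed yel_Gam cgood_rf_alt[OF pt, of "{og0}"] supported_pull_lop) auto
 have one: "cgood X (rf (hproj (d + p)) * lf (alt p :: 'm list lop)) \<and>
   cls X D (yel A (rf (hproj (d + p)) * lf (alt p :: 'm list lop))) = ?y p [^]\<^bsub>Kgrp X D\<^esub> card (lsimp (UNIV :: 'm set) (d + p))" if "p : P" for p
 proof -
  let ?e = "%apz. rf (mproj apz) * lf (alt p :: 'm list lop)"
  have s: "sum apz UNIV <= Suc L" if "apz : lsimp UNIV (d + p)" for apz :: "'m => nat"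
   using that \<open>p : P\<close> P dL by (auto simp: lsimp_def)
  have eq: "rf (hproj (d + p)) * lf (alt p) = (SUM apz:lsimp UNIV (d + p). ?e apz)"
   by (simp only: hproj_def rf_sum sum_distrib_right)
  have m: "mproj apz * mproj apz = mproj apz" if "apz : lsimp UNIV (d + p)" for apz using s[OF that] by (simp add: mproj_mult)
  have "cgood X (SUM apz:lsimp UNIV (d + p). ?e apz) \<and>
   cls X D (yel A (SUM apz:lsimp UNIV (d + p). ?e apz)) = finprod (Kgrp X D) (%apz. cls X D (yel A (?e apz))) (lsimp UNIV (d + p))"
  proof (rule cls_yel_sum[OF inf finite_lsimp[OF finite]])
   show "cgood X (?e apz)" if "apz : lsimp UNIV (d + p)" for apz
    by (rule cgood_rf_alt[OF m[OF that] finite_points supported_mproj])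
   show "?e apz * ?e bt = 0" if "apz : lsimp UNIV (d + p)" "bt : lsimp UNIV (d + p)" "apz ~= bt" for apz bt
    using that(3) by (simp only: rl_mult mproj_mult[OF s[OF that(1)] s[OF that(2)]]) (simp only: if_False rf_ring(1) mult_zero_left)
  qed
  moreover have "finprod (Kgrp X D) (%apz. cls X D (yel A (?e apz))) (lsimp UNIV (d + p)) = finprod (Kgrp X D) (%apz. ?y p) (lsimp (UNIV :: 'm set) (d + p))"
   by (rule K.finprod_cong') (use yc cls_mproj_alt[OF U s og0] in auto)
  ultimately show ?thesis unfolding eq by (simp only: K.finprod_const[OF yc])
 qed
 have "cgood X (EE d P) & cls X D (yel A (EE d P)) = finprod (Kgrp X D) (%p. cls X D (yel A (rf (hproj (d + p)) * lf (alt p)))) P"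
  unfolding EE_def
 proof (rule cls_yel_sum[OF inf fP])
  show "cgood X (rf (hproj (d + p)) * lf (alt p :: 'm list lop))" if "p : P" for p using one[OF that] ..
  show "rf (hproj (d + p)) * lf (alt p) * (rf (hproj (d + q)) * lf (alt q :: 'm list lop)) = 0" if "p ~= q" for p q
   using that by (simp only: rl_mult alt_mult) (simp only: if_False lf_ring(1) mult_zero_right)
 qed
 moreover have "finprod (Kgrp X D) (%p. cls X D (yel A (rf (hproj (d + p)) * lf (alt p)))) P =
   finprod (Kgrp X D) (%p. ?y p [^]\<^bsub>Kgrp X D\<^esub> card (lsimp (UNIV :: 'm set) (d + p))) P"
  by (rule K.finprod_cong') (use yc one in auto)
 ultimately show ?thesis by simp
qed

text \<open>The off-diagonal blocks of an odd operator \<open>Q\<close> and of its inverse exchange the two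
  summands; comparing them with the blocks at a base parameter produces an invertible family
  whose value at the start is the product of a family for \<open>A\<close> and a conjugate of one for its adjoint.\<close>

lemma cls_parity:
 fixes A :: "'x::topological_space => complex ^ 'm ^ 'm" and v :: "real \<times> 'x => 'w => complex ^ 'm"
 assumes U: "unitary_family X D A" and dL: "d + CARD('m) <= Suc L" and og0: "og0 ~: Om"
  and inf: "infinite (UNIV :: ('w \<times> 'm list) set)" and x0: "x0 : X"
  and ah: "!!t. t : {0..1} \<times> X ==> almost_hom d ep (v t)" and eps: "ep >= 0" "cst * cst * ep <= 1 / 2"
  and v1: "!!t og. t : {0..1} \<times> X ==> og : Om ==> norm (v t og) = 1"
  and cv: "!!og. og : Om ==> continuous_on ({0..1} \<times> X) (%t. v t og)"
  and v0: "!!x og. x : X ==> og : Om ==> v (0, x) og = A x *v ze og"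
  and ve: "!!x og. x : X ==> og : Om ==> v (1, x) og = ze og"
  and vD: "!!s x og. s : {0..1} ==> x : D ==> og : Om ==> v (s, x) og = ze og"
 shows "cls X D (yel A (EE d {p. p <= CARD('m) & odd p})) = cls X D (yel A (EE d {p. p <= CARD('m) & even p}))"
proof -
 interpret unitary_family X D A by (rule U)
 interpret K: comm_group "Kgrp X D :: ('x => ('w \<times> 'm list) lop) set monoid" by (rule comm_group_Kgrp[OF DX inf])
 let ?T = "{0..1::real} \<times> X"
 let ?O = "{p. p <= CARD('m) & odd p}" and ?V = "{p. p <= CARD('m) & even p}"
 let ?Eo = "EE d ?O" and ?Ee = "EE d ?V" and ?Q = "%t. Qop d (v t)"
 obtain R where R: "fsf ?T ?Q" "fsf ?T R" "!!t. t : ?T ==> ?Q t * R t = Em d" "!!t. t : ?T ==> R t * ?Q t = Em d"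
  "!!t. t : ?T ==> Em d * R t = R t" "!!t. t : ?T ==> R t * Em d = R t"
 proof (rule Qop_inverse[OF ah eps dL v1 cv])
  fix R assume *: "fsf ?T ?Q" "fsf ?T R" "!!t. t : ?T ==> ?Q t * R t = Em d" "!!t. t : ?T ==> R t * ?Q t = Em d"
  "!!t. t : ?T ==> Em d * R t = R t" "!!t. t : ?T ==> R t * Em d = R t"
  show thesis by (rule that[OF *])
 qed
 have OV: "?O <= {..CARD('m)}" "?V <= {..CARD('m)}" by auto
 have Eoo: "?Eo * ?Eo = ?Eo" "?Ee * ?Ee = ?Ee" using EE_mult[OF OV(1) OV(1) dL] EE_mult[OF OV(2) OV(2) dL] by simp_all
 have Eoe: "?Eo * ?Ee = 0" "?Ee * ?Eo = 0"
 proof -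
  have "?O \<inter> ?V = {}" "?V \<inter> ?O = {}" by auto
  thus "?Eo * ?Ee = 0" "?Ee * ?Eo = 0"
   unfolding EE_mult[OF OV dL] EE_mult[OF OV(2,1) dL] by (simp_all only: EE_def sum.empty)
 qed
 have Esum: "Em d = ?Eo + ?Ee"
 proof -
  have u: "{..CARD('m)} = ?O \<union> ?V" by auto
  show ?thesis unfolding EE_def u by (rule sum.union_disjoint) auto
 qed
 have Em: "?Eo * Em d = ?Eo" "Em d * ?Eo = ?Eo" "?Ee * Em d = ?Ee" "Em d * ?Ee = ?Ee"
  by (simp_all only: Esum distrib_left distrib_right Eoo Eoe add_0_left add_0_right)
 have Qoo: "?Eo * (?Q t * ?Eo) = 0" "?Ee * (?Q t * ?Ee) = 0" for t
 proof -
  have c: "?Eo * cliff Om (v t) * ?Eo = 0" "?Ee * cliff Om (v t) * ?Ee = 0" by (rule EE_parity; simp)+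
  have "?Eo * (?Q t * ?Eo) = (?Eo * Em d) * cliff Om (v t) * (Em d * ?Eo)" by (simp only: Qop_def mult.assoc)
  thus "?Eo * (?Q t * ?Eo) = 0" by (simp only: Em c)
  have "?Ee * (?Q t * ?Ee) = (?Ee * Em d) * cliff Om (v t) * (Em d * ?Ee)" by (simp only: Qop_def mult.assoc)
  thus "?Ee * (?Q t * ?Ee) = 0" by (simp only: Em c)
 qed
 define q where "q t = ?Eo * (?Q t * ?Ee)" for t
 define r where "r t = ?Ee * (R t * ?Eo)" for t
 have eq: "?Eo * q t = q t" "q t * ?Ee = q t" "?Ee * r t = r t" "r t * ?Eo = r t" for t
  unfolding q_def r_def by (simp_all only: mult.assoc Eoo) (simp_all only: mult.assoc[symmetric] Eoo)
 have qr: "q t * r t = ?Eo" "r t * q t = ?Ee" if t: "t : ?T" for t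
 proof -
  have "?Eo * (?Q t * (Em d * (R t * ?Eo))) = ?Eo * (?Q t * ?Eo) * (R t * ?Eo) + ?Eo * (?Q t * ?Ee) * (R t * ?Eo)"
   unfolding Esum by (simp only: distrib_left distrib_right mult.assoc)
  also have "... = ?Eo * (?Q t * ?Ee) * (R t * ?Eo)" by (simp only: Qoo mult_zero_left add_0_left)
  also have "... = q t * r t" unfolding q_def r_def by (simp only: mult.assoc) (simp only: mult.assoc[symmetric] Eoo)
  finally have "q t * r t = ?Eo * (?Q t * R t) * ?Eo" using R(5)[OF t] by (simp only: mult.assoc[symmetric])
  thus "q t * r t = ?Eo" by (simp only: R(3)[OF t] Em Eoo)
  have "?Ee * (R t * (Em d * (?Q t * ?Ee))) = ?Ee * (R t * ?Eo) * (?Q t * ?Ee) + ?Ee * R t * (?Ee * (?Q t * ?Ee))"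
   unfolding Esum by (simp only: distrib_left distrib_right mult.assoc)
  also have "... = ?Ee * (R t * ?Eo) * (?Q t * ?Ee)" by (simp only: Qoo mult_zero_right add_0_right)
  also have "... = r t * q t" unfolding q_def r_def by (simp only: mult.assoc) (simp only: mult.assoc[symmetric] Eoo)
  finally have "r t * q t = ?Ee * (R t * ?Q t) * ?Ee" using R(6)[OF t] by (simp only: mult.assoc[symmetric])
  thus "r t * q t = ?Ee" by (simp only: R(4)[OF t] Em Eoo)
 qed
 have qq: "q t * q t' = 0" "r t * r t' = 0" for t t'
 proof -
  have "q t * q t' = q t * (?Ee * ?Eo) * q t'" by (simp only: mult.assoc eq) (simp only: mult.assoc[symmetric] eq)
  thus "q t * q t' = 0" by (simp only: Eoe mult_zero_right mult_zero_left)
  have "r t * r t' = r t * (?Eo * ?Ee) * r t'" by (simp only: mult.assoc eq) (simp only: mult.assoc[symmetric] eq)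
  thus "r t * r t' = 0" by (simp only: Eoe mult_zero_right mult_zero_left)
 qed
 let ?b = "(1 :: real, x0)"
 have bT: "?b : ?T" using x0 by simp
 have q_cong: "q t = q t'" if "!!og. og : Om ==> v t og = v t' og" for t t'
 proof -
  have "cliff Om (v t) = cliff Om (v t')" unfolding cliff_def
   by (intro sum.cong refl arg_cong2[where f = "(+)"] arg_cong2[where f = "(*)"] arg_cong[where f = rf] mulop_cong[OF finite_points]) (simp_all add: that)
  thus ?thesis by (simp add: q_def Qop_def)
 qed
 \<comment> \<open>Since \<open>r ?b\<close> inverts the block at the base parameter,
   \<open>C\<close> is an automorphism of the odd corner extended by the identity. It equals 1
   wherever \<open>v\<close> is the tautological field \<open>ze\<close>, that is, at the end of the
   homotopy and on \<open>D\<close>.\<close>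
 define C where "C t = q t * r ?b + 1 - ?Eo" for t
 have Cinv: "C t * (q ?b * r t + 1 - ?Eo) = 1" "(q ?b * r t + 1 - ?Eo) * C t = 1" if t: "t : ?T" for t
 proof -
  have 1: "q t * r ?b * (q ?b * r t) = ?Eo" "q ?b * r t * (q t * r ?b) = ?Eo"
  proof -
   have "q t * r ?b * (q ?b * r t) = q t * (r ?b * q ?b) * r t" "q ?b * r t * (q t * r ?b) = q ?b * (r t * q t) * r ?b" by (simp_all only: mult.assoc)
   thus "q t * r ?b * (q ?b * r t) = ?Eo" "q ?b * r t * (q t * r ?b) = ?Eo"
    by (simp_all only: qr[OF t] qr[OF bT] eq)
  qed
  have 2: "?Eo * (q s * r s') = q s * r s'" "q s * r s' * ?Eo = q s * r s'" for s s'
   by (simp_all only: mult.assoc eq) (simp only: mult.assoc[symmetric] eq)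
  have *: "(a + 1 - E) * (b + 1 - E) = 1" if "a * b = E" "E * b = b" "a * E = a" "E * E = E" for a b E :: "('w \<times> 'm list) lop"
   using that by (simp add: ring_distribs)
  show "C t * (q ?b * r t + 1 - ?Eo) = 1" "(q ?b * r t + 1 - ?Eo) * C t = 1"
   unfolding C_def by (rule *; simp only: 1 2 Eoo)+
 qed
 have Cb: "C t = 1" if "!!og. og : Om ==> v t og = ze og" for t
 proof -
  have "q t = q ?b" by (rule q_cong) (use that ve[OF x0] in auto)
  thus ?thesis by (simp add: C_def qr[OF bT])
 qed
 have fq: "fsf ?T q" "fsf ?T r" unfolding q_def r_def by (intro fsf_mult fsf_EE R)+
 obtain S where S: "finite S" "!!t. t : ?T ==> supported S (q t)" "!!t. t : ?T ==> supported S (r t)"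
  using fsf_common[OF fq] by blast
 have fb: "fsf ?T (%t. r ?b)" "fsf ?T (%t. q ?b)"
  by (intro fsf_const[OF S(1)] S(2,3) bT)+
 have "GLfam ?T C"
 proof (rule GLfamI[OF _ _ Cinv])
  have "fsf ?T (%t. q t * r ?b - ?Eo)" "fsf ?T (%t. q ?b * r t - ?Eo)" by (intro fsf_diff fsf_mult fq fb fsf_EE)+
  thus "fsf ?T (%t. C t - 1)" "fsf ?T (%t. q ?b * r t + 1 - ?Eo - 1)" by (simp_all add: C_def)
 qed
 moreover have "C (1, x) = 1" if "x : X" for x by (rule Cb) (rule ve[OF that])
 moreover have "C (s, x) = 1" if "s : {0..1}" "x : D" for s x by (rule Cb) (rule vD[OF that])
 moreover have cg: "cgood X ?Eo" "cgood X ?Ee" using cls_EE[OF U dL og0 OV(1) inf] cls_EE[OF U dL og0 OV(2) inf] by blast+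
 let ?A' = "%x. adj (A x)"
 let ?c2 = "%x. 1 + q ?b * (yel ?A' ?Ee x - 1) * r ?b"
 note tr = cls_transport[OF DX yel_Gam(2)[OF cg(2)] S(1) S(2)[OF bT] S(3)[OF bT] qr[OF bT] qq eq(2) eq(3)]
 have lE: "lf (tens B) * EE d P = EE d P * lf (tens B)" for B and P
  unfolding EE_def sum_distrib_left sum_distrib_right
 proof (rule sum.cong[OF refl])
  fix p
  have "lf (tens B) * (rf (hproj (d + p)) * lf (alt p)) = rf (hproj (d + p)) * lf (tens B * alt p)"
   by (simp only: mult.assoc[symmetric] lf_rf_commute lf_ring)
  thus "lf (tens B) * (rf (hproj (d + p)) * lf (alt p)) = rf (hproj (d + p)) * lf (alt p) * lf (tens B)"
   by (simp only: tens_alt lf_ring mult.assoc)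
 qed
 have ye: "?Ee * (yel ?A' ?Ee x - 1) = yel ?A' ?Ee x - 1" "(yel ?A' ?Ee x - 1) * ?Ee = yel ?A' ?Ee x - 1" for x
 proof -
  have "?Ee * (lf (tens (?A' x)) - 1) = (lf (tens (?A' x)) - 1) * ?Ee" by (simp add: left_diff_distrib right_diff_distrib lE)
  thus "?Ee * (yel ?A' ?Ee x - 1) = yel ?A' ?Ee x - 1"
   unfolding yel_def by (simp add: mult.assoc[symmetric]) (simp add: mult.assoc Eoo)
  show "(yel ?A' ?Ee x - 1) * ?Ee = yel ?A' ?Ee x - 1" unfolding yel_def by (simp add: mult.assoc Eoo)
 qed
 have c2: "?c2 : carrier (Gam X D)" "cls X D (yel ?A' ?Ee) = cls X D ?c2"
  using tr ye by blast+
 \<comment> \<open>At the start Clifford multiplication is the base one conjugated by the tensor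
   powers of \<open>A x\<close>. The left factor acts on the odd corner; the right one acts on the
   even corner and is carried over by \<open>q ?b\<close>.\<close>
 have C0: "C (0, x) = yel A ?Eo x * ?c2 x" if x: "x : X" for x
 proof -
  let ?l = "lf (tens (A x)) :: ('w \<times> 'm list) lop" and ?l' = "lf (tens (?A' x)) :: ('w \<times> 'm list) lop"
  have ll: "?l * ?l' = 1" by (simp add: lf_ring[symmetric] uni_tens)
  have vb: "q ?b = ?Eo * (Em d * cliff Om ze * Em d * ?Ee)"
  proof -
   have "cliff Om (v ?b) = cliff Om ze" unfolding cliff_def
    by (intro sum.cong refl arg_cong2[where f = "(+)"] arg_cong2[where f = "(*)"] arg_cong[where f = rf] mulop_cong[OF finite_points]) (simp_all add: ve[OF x0])
   thus ?thesis by (simp only: q_def Qop_def)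
  qed
  have v0': "cliff Om (v (0, x)) = cliff Om (%og. A x *v ze og)" unfolding cliff_def
   by (intro sum.cong refl arg_cong2[where f = "(+)"] arg_cong2[where f = "(*)"] arg_cong[where f = rf] mulop_cong[OF finite_points]) (simp_all add: v0[OF x])
  have "cliff Om (v (0, x)) = cliff Om (v (0, x)) * (?l * ?l')" by (simp add: ll)
  also have "... = ?l * cliff Om ze * ?l'"
   using cliff_tens[OF finite_points uni[of x, unfolded adj_def], of ze] unfolding v0' by (simp only: mult.assoc)
  finally have cl: "cliff Om (v (0, x)) = ?l * cliff Om ze * ?l'" .
  have "q (0, x) = (?Eo * Em d) * ?l * cliff Om ze * (?l' * (Em d * ?Ee))"
   unfolding q_def Qop_def cl by (simp only: mult.assoc)
  also have "... = ?Eo * ?l * cliff Om ze * (?l' * ?Ee)" by (simp only: Em)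
  also have "... = ?l * ((?Eo * Em d) * cliff Om ze * (Em d * ?Ee)) * ?l'" by (simp only: Em lE[of "?A' x" ?V] lE[of "A x" ?O, symmetric]) (simp only: mult.assoc)
  also have "... = ?l * q ?b * ?l'" unfolding vb by (simp only: mult.assoc)
  finally have q0: "q (0, x) = ?l * q ?b * ?l'" .
  have m: "q ?b * (yel ?A' ?Ee x - 1) * r ?b = q ?b * ?l' * r ?b - ?Eo"
  proof -
   have "q ?b * (yel ?A' ?Ee x - 1) * r ?b = q ?b * (?l' - 1) * (?Ee * r ?b)" unfolding yel_def by (simp add: mult.assoc)
   thus ?thesis by (simp only: eq) (simp add: left_diff_distrib right_diff_distrib qr[OF bT])
  qed
  have 1: "?Eo * (q ?b * ?l' * r ?b) = q ?b * ?l' * r ?b" by (simp only: mult.assoc[symmetric] eq)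
  have "yel A ?Eo x * ?c2 x = (1 - ?Eo + ?l * ?Eo) * (1 - ?Eo + q ?b * ?l' * r ?b)"
   unfolding m by (rule arg_cong2[where f = "(*)"]) (simp_all add: yel_def left_diff_distrib)
  also have "... = 1 - ?Eo + ?l * (?Eo * (q ?b * ?l' * r ?b))"
   by (simp add: ring_distribs 1[unfolded mult.assoc] Eoo mult.assoc)
  also have "... = C (0, x)" unfolding C_def q0 1 by (simp add: mult.assoc)
  finally show ?thesis ..
 qed
 have cG: "(%x. yel A ?Eo x * ?c2 x) : carrier (Gam X D)"
  using group.subgroup_self[OF group_Gam[of X D], THEN subgroup.m_closed, OF yel_Gam(1)[OF cg(1)] c2(1)] by (simp add: Gam_def)
 ultimately have "null_fam X D (%x. yel A ?Eo x * ?c2 x)"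
  unfolding null_fam_def by (intro exI[of _ C]) (simp add: C0)
 hence "cls X D (%x. yel A ?Eo x * ?c2 x) = \<one>\<^bsub>Kgrp X D\<^esub>" using cls_one_iff[OF DX cG] by simp
 hence 1: "cls X D (yel A ?Eo) \<otimes>\<^bsub>Kgrp X D\<^esub> cls X D (yel ?A' ?Ee) = \<one>\<^bsub>Kgrp X D\<^esub>"
  by (simp only: cls_mult[OF DX yel_Gam(1)[OF cg(1)] c2(1)] c2(2))
 have "(%x. yel A ?Ee x * yel ?A' ?Ee x) = (%x. 1)" by (rule ext) (rule yel_adj(1)[OF cg(2)])
 hence 2: "cls X D (yel A ?Ee) \<otimes>\<^bsub>Kgrp X D\<^esub> cls X D (yel ?A' ?Ee) = \<one>\<^bsub>Kgrp X D\<^esub>"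
  using cls_mult[OF DX yel_Gam[OF cg(2)]] cls_one[OF DX, where ?'b = "'w \<times> 'm list"] by simp
 show ?thesis
  using K.right_cancel[OF cls_closed[OF yel_Gam(2)[OF cg(2)]] cls_closed[OF yel_Gam(1)[OF cg(1)]] cls_closed[OF yel_Gam(1)[OF cg(2)]]]
  unfolding 1 2 by (rule iffD1) (rule refl)
qed

end

text \<open>The choices are made in this order: \<open>ep\<close> from the dimension alone, then
  thresholds for the degrees from \<open>hankel_small\<close>, then for each large \<open>d\<close>
  a sample of its own. All samples avoid the same spare index, so the relations for different
  \<open>d\<close> concern the same classes \<open>y p\<close>.\<close>

theorem stable_null:
 fixes A :: "'x::euclidean_space => complex ^ 'm ^ 'm::finite" and F :: "(real \<times> 'x) \<times> (complex ^ 'm) => complex ^ 'm"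
 assumes U: "unitary_family X D A" and X: "compact X" "x0 : X"
  and contF: "continuous_on (({0..1} \<times> X) \<times> sphere 0 1) F"
  and F1: "!!t z. t : {0..1} \<times> X ==> norm z = 1 ==> norm (F (t, z)) = 1"
  and equi: "!!t z b. t : {0..1} \<times> X ==> norm z = 1 ==> norm b = 1 ==> F (t, b *s z) = b *s F (t, z)"
  and F_start: "!!x z. x : X ==> norm z = 1 ==> F ((0, x), z) = A x *v z"
  and F_end: "!!x z. x : X ==> norm z = 1 ==> F ((1, x), z) = z"
  and F_bd: "!!s x z. s : {0..1} ==> x : D ==> norm z = 1 ==> F ((s, x), z) = z"
 shows "null_fam X D (yel A (rf (pull_lop {(%_. 0, %_. 0) :: ('m => nat) \<times> ('m => nat)} id) * lf (degp 1)))"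
proof -
 interpret unitary_family X D A by (rule U)
 let ?m = "CARD('m)" and ?T = "{0..1::real} \<times> X"
 let ?w0 = "(%_. 0, %_. 0) :: ('m => nat) \<times> ('m => nat)"
 have inf: "infinite (UNIV :: ((('m => nat) \<times> ('m => nat)) \<times> 'm list) set)"
  by (simp add: finite_prod infinite_UNIV_listI)
 interpret K: comm_group "Kgrp X D :: ('x => ((('m => nat) \<times> ('m => nat)) \<times> 'm list) lop) set monoid"
  by (rule comm_group_Kgrp[OF DX inf])
 define y where "y p = cls X D (yel A (rf (pull_lop {?w0} id) * lf (alt p :: 'm list lop)))" for p
 define cs where "cs = real (card {l :: 'm list. length l <= ?m}) * (real ?m * (real ?m + 1))"
 \<comment> \<open>Chosen to make \<open>cs * cs * ep\<close> at most 1/2; the added 1 keeps the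
   denominator positive without an estimate of \<open>cs\<close>.\<close>
 define ep where "ep = 1 / (2 * (cs * cs + 1))"
 have eps: "ep > 0" unfolding ep_def by (simp add: add_nonneg_pos)
 have ceps: "cs * cs * ep <= 1 / 2"
 proof -
  have "cs * cs + 1 > 0" by (simp add: add_nonneg_pos)
  thus ?thesis by (simp add: ep_def field_simps)
 qed
 have cT: "compact ?T" using X by (intro compact_Times) auto
 let ?P = "%G k D. ALL e>=D. ALL L (Om :: (('m => nat) \<times> ('m => nat)) set) ze N rh c. hardy L Om ze N rh c --> e + k <= L -->
  (ALL t:?T. ALL e'<=L. (ALL z:sphere 0 1. ALL b. norm b = 1 --> G (t, b *s z) * b ^ e = b ^ e' * G (t, z)) -->
   (ALL u:Hs Om ze e. EX v:Hs Om ze e'. nr Om (%og. G (t, ze og) * u og - v og) <= ep * nr Om u))"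
 have "ALL i. EX kD. ?P (%p. F p $ i) (fst kD) (snd kD)"
 proof
  fix i
  have "continuous_on (?T \<times> sphere 0 1) (%p. F p $ i)" by (intro continuous_intros contF)
  from hankel_small[OF cT this eps, where ?'w = "('m => nat) \<times> ('m => nat)"] obtain k D where "?P (%p. F p $ i) k D" by (elim exE)
  thus "EX kD. ?P (%p. F p $ i) (fst kD) (snd kD)" by (intro exI[of _ "(k, D)"]) (simp only: fst_conv snd_conv)
 qed
 from choice[OF this] obtain kd where kd0: "ALL i. ?P (%p. F p $ i) (fst (kd i)) (snd (kd i))" by (elim exE)
 have "ALL i. EX kD. ?P (%p. cnj (F p $ i)) (fst kD) (snd kD)"
 proof
  fix i
  have "continuous_on (?T \<times> sphere 0 1) (%p. cnj (F p $ i))" by (intro continuous_intros contF)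
  from hankel_small[OF cT this eps, where ?'w = "('m => nat) \<times> ('m => nat)"] obtain k D where "?P (%p. cnj (F p $ i)) k D" by (elim exE)
  thus "EX kD. ?P (%p. cnj (F p $ i)) (fst kD) (snd kD)" by (intro exI[of _ "(k, D)"]) (simp only: fst_conv snd_conv)
 qed
 from choice[OF this] obtain kd' where kd0': "ALL i. ?P (%p. cnj (F p $ i)) (fst (kd' i)) (snd (kd' i))" by (elim exE)
 note kd = spec[OF kd0] and kd' = spec[OF kd0']
 define k where "k = (SUM i:UNIV. fst (kd i) + fst (kd' i))"
 define d0 where "d0 = (SUM i:UNIV. snd (kd i) + snd (kd' i))"
 have kle: "fst (kd i) <= k" "fst (kd' i) <= k" "snd (kd i) <= d0" "snd (kd' i) <= d0" for i
  using member_le_sum[of i UNIV "%i. fst (kd i) + fst (kd' i)"] member_le_sum[of i UNIV "%i. snd (kd i) + snd (kd' i)"]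
  by (simp_all add: k_def d0_def)
 have pt: "pull_lop {?w0} id * pull_lop {?w0} id = pull_lop {?w0} id" by (rule lop_appI) simp
 have yc: "y p : carrier (Kgrp X D)" for p
  unfolding y_def by (intro cls_closed yel_Gam cgood_rf_alt[OF pt, of "{?w0}"] supported_pull_lop) auto
 \<comment> \<open>Matrices act trivially on tensors of degree 0, which is why the relations only
   run from \<open>p = 1\<close>.\<close>
 have y0: "y 0 = \<one>\<^bsub>Kgrp X D\<^esub>"
 proof -
  have 0: "tens B * alt 0 = (alt 0 :: 'm list lop)" for B :: "complex ^ 'm ^ 'm"
  proof (rule lop_appI)
   show "app (tens B * alt 0) u l = app (alt 0) u l" for u and l :: "'m list"
    by (cases l) (simp_all only: tens_alt app_ring alt.simps app_degp app_tens, simp_all)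
  qed
  have "(lf (tens (A x)) - 1) * (rf (pull_lop {?w0} id) * lf (alt 0)) = rf (pull_lop {?w0} id) * lf (tens (A x) * alt 0 - alt 0)" for x
   by (simp only: left_diff_distrib mult.assoc[symmetric] lf_rf_commute lf_ring) (simp only: mult.assoc right_diff_distrib mult_1_left)
  hence "yel A (rf (pull_lop {?w0} id) * lf (alt 0 :: 'm list lop)) = (%x. 1)"
   by (simp add: yel_def fun_eq_iff 0 lf_ring del: alt.simps)
  thus ?thesis unfolding y_def using cls_one[OF DX] by simp
 qed
 have "y 1 = \<one>\<^bsub>Kgrp X D\<^esub>"
 proof (rule K.binomial_relations_imp_trivial[OF yc])
  show "?m >= 1" by (simp add: Suc_le_eq)
  fix d assume d: "d0 <= d"
  \<comment> \<open>Leaves room for the top degree \<open>d + CARD('m)\<close> and for the shift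
    \<open>k\<close> beyond it.\<close>
  define L where "L = d + ?m + k + 1"
  have mL: "d + ?m <= Suc L" by (simp add: L_def)
  from hardy_exists[of L, where ?'m = 'm] obtain Om :: "(('m => nat) \<times> ('m => nat)) set" and ze N rh c where
   "hardy L Om (ze :: _ => complex ^ 'm) N rh c & ?w0 ~: Om" by (elim exE)
  hence H: "hardy L Om ze N rh c" and w0: "?w0 ~: Om" by simp_all
  interpret hardy L Om ze N rh c by (rule H)
  have cst: "cst = cs" by (simp add: cst_def cs_def)
  define v where "v t og = F (t, ze og)" for t og
  have ah: "almost_hom d ep (v t)" if t: "t : ?T" for t
   unfolding almost_hom_def
  proof (intro allI impI conjI ballI)
   fix i e h assume e: "d <= e & e < d + ?m"
   have le: "snd (kd i) <= e" "e + fst (kd i) <= L" "Suc e <= L" "snd (kd' i) <= Suc e" "Suc e + fst (kd' i) <= L" "e <= L"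
    using kle[of i] d e by (simp_all add: L_def)
   \<comment> \<open>Equivariance by components: a component of \<open>F\<close> raises the degree
     by one and its conjugate lowers it by one.\<close>
   have eq: "F (t, b *s z) $ i * b ^ e = b ^ Suc e * F (t, z) $ i" "cnj (F (t, b *s z) $ i) * b ^ Suc e = b ^ e * cnj (F (t, z) $ i)"
    if "z : sphere 0 1" "norm b = 1" for z b
   proof -
    have "cnj b * b = 1" using that(2) complex_norm_square[of b] by (simp add: mult.commute)
    moreover have "cnj b * cnj (F (t, z) $ i) * (b * b ^ e) = cnj b * b * (b ^ e * cnj (F (t, z) $ i))" by (simp only: ac_simps)
    ultimately show "F (t, b *s z) $ i * b ^ e = b ^ Suc e * F (t, z) $ i" "cnj (F (t, b *s z) $ i) * b ^ Suc e = b ^ e * cnj (F (t, z) $ i)"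
     using equi[OF t _ that(2), of z] that(1) by simp_all
   qed
   show "EX y:Hs Om ze (Suc e). nr Om (%og. v t og $ i * h og - y og) <= ep * nr Om h" if "h : Hs Om ze e"
    unfolding v_def by (rule kd[rule_format, OF le(1) H le(2) t le(3) eq(1) that])
   show "EX y:Hs Om ze e. nr Om (%og. cnj (v t og $ i) * h og - y og) <= ep * nr Om h" if "h : Hs Om ze (Suc e)"
    unfolding v_def by (rule kd'[rule_format, OF le(4) H le(5) t le(6) eq(2) that])
  qed
  let ?O = "{p. p <= ?m & odd p}" and ?V = "{p. p <= ?m & even p}"
  have par: "cls X D (yel A (EE d ?O)) = cls X D (yel A (EE d ?V))"
  proof (rule cls_parity[OF U mL w0 inf X(2) ah])
   show "ep >= 0" using eps by simp
   show "cst * cst * ep <= 1 / 2" using ceps cst by simp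
   show "continuous_on ?T (%t. v t og)" if "og : Om" for og
    unfolding v_def by (rule continuous_on_compose2[OF contF]) (use on_sphere[OF that] in \<open>auto intro!: continuous_intros\<close>)
  qed (use on_sphere F1 F_start F_end F_bd in \<open>auto simp: v_def\<close>)
  let ?h = "%p. (d + p + (?m - 1)) choose (?m - 1)"
  have h: "card (lsimp (UNIV :: 'm set) (d + p)) = ?h p" for p
   by (simp add: card_lsimp add_diff_assoc Suc_le_eq)
  let ?f = "%p. y p [^]\<^bsub>Kgrp X D\<^esub> ?h p" and ?g = "%p. y p [^]\<^bsub>Kgrp X D\<^esub> ((-1) ^ p * int (?h p))"
  have fc: "?f p : carrier (Kgrp X D)" and gc: "?g p : carrier (Kgrp X D)" for p using yc by simp_all
  have OV: "?O <= {..?m}" "?V <= {..?m}" by auto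
  \<comment> \<open>The equality of the odd and the even product is rewritten below as one product
    with signed exponents, from which the trivial factor at \<open>p = 0\<close> is removed.\<close>
  have e0: "finprod (Kgrp X D) ?f ?O = finprod (Kgrp X D) ?f ?V"
   using par cls_EE[OF U mL w0 OV(1) inf] cls_EE[OF U mL w0 OV(2) inf] by (simp add: y_def h)
  have e1: "finprod (Kgrp X D) ?f ?V = finprod (Kgrp X D) ?g ?V"
   by (rule K.finprod_cong') (use gc in \<open>auto simp: int_pow_int\<close>)
  have e2: "finprod (Kgrp X D) ?f ?O \<otimes>\<^bsub>Kgrp X D\<^esub> finprod (Kgrp X D) ?g ?O = \<one>\<^bsub>Kgrp X D\<^esub>"
  proof -
   have "finprod (Kgrp X D) (%p. ?f p \<otimes>\<^bsub>Kgrp X D\<^esub> ?g p) ?O = finprod (Kgrp X D) (%p. \<one>\<^bsub>Kgrp X D\<^esub>) ?O"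
    by (rule K.finprod_cong') (use fc yc in \<open>auto simp: K.int_pow_neg_int\<close>)
    moreover have "?f : ?O \<rightarrow> carrier (Kgrp X D)" "?g : ?O \<rightarrow> carrier (Kgrp X D)" using fc gc by blast+
   ultimately show ?thesis by (simp only: K.finprod_multf[symmetric] K.finprod_one_eqI)
  qed
  have e3: "finprod (Kgrp X D) ?g (?V \<union> ?O) = finprod (Kgrp X D) ?g ?V \<otimes>\<^bsub>Kgrp X D\<^esub> finprod (Kgrp X D) ?g ?O"
   by (rule K.finprod_Un_disjoint) (use gc in auto)
  have e4: "?V \<union> ?O = insert 0 {1..?m}" by auto
  have e5: "finprod (Kgrp X D) ?g (insert 0 {1..?m}) = ?g 0 \<otimes>\<^bsub>Kgrp X D\<^esub> finprod (Kgrp X D) ?g {1..?m}"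
  proof (rule K.finprod_insert)
   show "?g 0 : carrier (Kgrp X D)" by (rule gc)
   show "?g : {1..?m} \<rightarrow> carrier (Kgrp X D)" using gc by blast
  qed auto
  have e6: "?g 0 = \<one>\<^bsub>Kgrp X D\<^esub>" unfolding y0 by simp
  have e7: "finprod (Kgrp X D) ?g {1..?m} : carrier (Kgrp X D)" using gc by (intro K.finprod_closed) auto
  have "finprod (Kgrp X D) ?g {1..?m} = finprod (Kgrp X D) ?g (?V \<union> ?O)"
   unfolding e4 e5 e6 using e7 by (rule K.l_one[symmetric])
  also have "... = \<one>\<^bsub>Kgrp X D\<^esub>" unfolding e3 e1[symmetric] e0[symmetric] by (rule e2)
  finally show "finprod (Kgrp X D) ?g {1..?m} = \<one>\<^bsub>Kgrp X D\<^esub>" .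
 qed
 thus ?thesis
  using cls_one_iff[OF DX yel_Gam(1)[OF cgood_rf_alt[OF pt, of "{?w0}" "Suc 0"]]] unfolding y_def One_nat_def[symmetric] alt_1
  by (simp add: supported_pull_lop)
qed

section \<open>Removing stabilization\<close>

lemma fsf_mk_lop:
 assumes "finite S" "!!i k. i : S ==> k : S ==> continuous_on T (%t. M t i k)"
 shows "fsf T (%t. mk_lop S (M t))"
 unfolding fsf_def
proof (intro conjI exI[of _ S] ballI allI)
 show "continuous_on T (%x. ent (mk_lop S (M x)) i k)" for i k
  by (cases "i : S & k : S") (auto simp: ent_mk_lop assms)
qed (auto simp: assms supported_mk_lop)

text \<open>If \<open>N N = c N\<close>, the inverse of \<open>1 + N\<close> is
  \<open>1 - N / (1 + c)\<close>. This covers shears, where \<open>c = 0\<close>, as well as the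
  replacement of a column.\<close>

lemma GLfam_rank_one:
 fixes N :: "'t::topological_space => 'b lop"
 assumes N: "fsf T N" "continuous_on T c" and sq: "!!t. t : T ==> N t * N t = scal (c t) * N t" "!!t. t : T ==> 1 + c t ~= 0"
 shows "GLfam T (%t. 1 + N t)"
proof (rule GLfamI[where b = "%t. 1 - scal (1 / (1 + c t)) * N t"])
 show "fsf T (%x. 1 + N x - 1)" using N by simp
 have "fsf T (%t. - (scal (1 / (1 + c t)) * N t))"
  by (intro fsf_uminus fsf_scal N continuous_intros) (use sq in auto)
 thus "fsf T (%x. 1 - scal (1 / (1 + c x)) * N x - 1)" by simp
 fix t assume t: "t : T"
 have s: "scal a * N t + scal b * N t = scal (a + b) * N t" for a b by (simp only: scal_simps distrib_right)
 have e: "N t = scal 1 * N t" by (simp add: scal_simps)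
 have z: "N t - scal (1 / (1 + c t)) * N t - scal (c t / (1 + c t)) * N t = 0"
 proof -
  have "scal (1 / (1 + c t)) * N t + scal (c t / (1 + c t)) * N t = scal 1 * N t"
   unfolding s using sq(2)[OF t] by (simp add: add_divide_distrib[symmetric])
  thus ?thesis by (simp add: scal_simps diff_diff_eq)
 qed
 have m: "scal a * (scal b * N t) = scal (a * b) * N t" for a b by (rule lop_appI) simp
 have 1: "N t * (scal (1 / (1 + c t)) * N t) = scal (c t / (1 + c t)) * N t" "scal (1 / (1 + c t)) * N t * N t = scal (c t / (1 + c t)) * N t"
  by (simp_all only: scal_left_commute[of "N t"] mult.assoc sq(1)[OF t] m) simp_all
 have alg: "(1 + x) * (1 - y) = 1 + (x - y - x * y)" "(1 - y) * (1 + x) = 1 + (x - y - y * x)" for x y :: "'b lop"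
  by (simp_all add: ring_distribs)
 show "(1 + N t) * (1 - scal (1 / (1 + c t)) * N t) = 1" "(1 - scal (1 / (1 + c t)) * N t) * (1 + N t) = 1"
  unfolding alg 1 z by simp_all
qed

text \<open>A polynomial map from a space of lower dimension has negligible image, so an arbitrarily
  small translation moves that image off the origin.\<close>

lemma dodge_origin:
 fixes f :: "'t::euclidean_space => 'b::euclidean_space"
 assumes "compact T" "continuous_on T f" "ep > 0" "DIM('t) < DIM('b)"
 obtains w where "continuous_on T w" "!!t. t : T ==> w t ~= 0" "!!t. t : T ==> norm (w t - f t) <= ep"
proof -
 obtain p where p: "polynomial_function p" "!!t. t : T ==> norm (f t - p t) < ep / 2"
  using Stone_Weierstrass_polynomial_function[OF assms(1,2), of "ep / 2"] assms(3) by auto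
 have "negligible (p ` T)"
  by (rule negligible_differentiable_image_lowdim[OF assms(4) differentiable_on_polynomial_function[OF p(1)]])
 moreover have "~ negligible (ball (0::'b) (ep / 2))" by (rule open_not_negligible) (use assms in auto)
 ultimately obtain c where c: "norm c < ep / 2" "c ~: p ` T" by (metis negligible_subset subsetI mem_ball_0)
 show ?thesis
 proof (rule that[of "%t. p t - c"])
  show "continuous_on T (%t. p t - c)" by (intro continuous_intros continuous_on_polymonial_function p)
  show "p t - c ~= 0" if "t : T" for t using c that by auto
  show "norm (p t - c - f t) <= ep" if "t : T" for t
   using norm_triangle_ineq[of "p t - f t" "- c"] p(2)[OF that] c(1) by (simp add: norm_minus_commute algebra_simps)
 qed
qed

text \<open>The first shear makes the pivot nonzero, whether the column is off the axis or its pivot is off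
  the negative half-line.\<close>

lemma pivot_nonzero:
 fixes a :: complex and bt :: real
 assumes "bt >= 0" "bt > 0 \<or> Im a ~= 0 \<or> Re a > 0"
 shows "bt + cmod a + Re a > 0" "a + (of_real (cmod a + bt) - a) / of_real (bt + cmod a + Re a) * of_real bt ~= 0"
proof -
 have r: "cmod a + Re a >= 0" using abs_Re_le_cmod[of a] by linarith
 have r0: "cmod a + Re a > 0" if "bt = 0"
 proof (rule ccontr)
  assume "~ ?thesis"
  hence "cmod a = - Re a" using r by linarith
  hence "(Re a)\<^sup>2 + (Im a)\<^sup>2 = (Re a)\<^sup>2" "Re a <= 0" using cmod_power2[of a] norm_ge_zero[of a] by simp_all
  thus False using assms that by simp
 qed
 show d: "bt + cmod a + Re a > 0" using r r0 assms(1) by (cases "bt = 0") auto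
 define de where "de = cmod a + Re a"
 have dd: "bt + de > 0" "de >= 0" using d r by (simp_all add: de_def)
 show "a + (of_real (cmod a + bt) - a) / of_real (bt + cmod a + Re a) * of_real bt ~= 0"
 proof
  assume e: "a + (of_real (cmod a + bt) - a) / of_real (bt + cmod a + Re a) * of_real bt = 0"
  have r: "bt + cmod a + Re a = bt + de" by (simp add: de_def)
  have "(a + Y / X * Z) * X = a * X + Y * Z" if "X ~= 0" for X Y Z :: complex using that by (simp add: field_simps)
  from this[of "of_real (bt + de)" "of_real (cmod a + bt) - a" "of_real bt"] e dd
  have "a * of_real (bt + de) + (of_real (cmod a + bt) - a) * of_real bt = 0"
   unfolding r by (simp del: of_real_add)
  hence "Re (a * of_real (bt + de) + (of_real (cmod a + bt) - a) * of_real bt) = 0"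
   "Im (a * of_real (bt + de) + (of_real (cmod a + bt) - a) * of_real bt) = 0" by (simp_all del: of_real_add)
  hence *: "de * Re a + bt * (cmod a + bt) = 0" "de * Im a = 0"
   by (simp_all del: of_real_add) (auto simp: algebra_simps)
  show False
  proof (cases "de = 0")
   case True
   hence "bt > 0" using dd by simp
   moreover have "bt * (cmod a + bt) > 0" using \<open>bt > 0\<close> by (simp add: add_nonneg_pos)
   ultimately show False using * True by simp
  next
   case False
   hence im: "Im a = 0" using * by simp
   hence "cmod a = \<bar>Re a\<bar>" by (simp add: cmod_eq_Re)
   hence "Re a > 0" using False dd by (auto simp: de_def abs_if split: if_splits)
   hence "de * Re a > 0" "bt * (cmod a + bt) >= 0" using False dd assms(1) by auto
   thus False using * by linarith
  qed
 qed
qed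

text \<open>Row and column operations turn column \<open>i0\<close> into a basis vector, after which
  this index is split off. The column must avoid the nonpositive multiples of that basis vector, and
  \<open>2 * CARD('m) + 1\<close> real coordinates are at hand for this, whence the dimension
  hypothesis. No path from \<open>H\<close> to \<open>H'\<close> is needed: \<open>H\<close> will
  itself be a homotopy, of which only the values on \<open>Z\<close> have to survive.\<close>

lemma destabilize_step:
 fixes io :: "'m::finite => 'j" and T :: "'t::euclidean_space set"
 assumes T: "compact T" "DIM('t) < 2 * CARD('m) + 1" and io: "inj io" and S: "finite S" "range io <= S" "i0 ~: S"
  and H: "GLfam T H" "!!t. t : T ==> supported (insert i0 S) (H t - 1)"
  and Z: "Z <= T" "!!t. t : Z ==> supported (range io) (H t - 1)"
 obtains H' where "GLfam T H'" "!!t. t : T ==> supported S (H' t - 1)" "!!t. t : Z ==> H' t = H t"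
proof -
 let ?S = "insert i0 S"
 have fS: "finite ?S" using S by simp
 have cH: "continuous_on T (%t. ent (H t) i k)" for i k
 proof -
  have "continuous_on T (%t. ent (H t - 1) i k + ent 1 i k)" using H(1) by (intro continuous_intros) (auto simp: GLfam_def fsf_def)
  thus ?thesis by simp
 qed
 obtain Hi where Hi: "fsf T (%t. Hi t - 1)" "!!t. t : T ==> H t * Hi t = 1" "!!t. t : T ==> Hi t * H t = 1"
  using H(1) unfolding GLfam_def by blast
 have cHi: "continuous_on T (%t. ent (Hi t) i k)" for i k
 proof -
  have "continuous_on T (%t. ent (Hi t - 1) i k + ent 1 i k)" using Hi(1) by (intro continuous_intros) (auto simp: fsf_def)
  thus ?thesis by simp
 qed
 have sHi: "supported ?S (Hi t - 1)" if t: "t : T" for t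
 proof -
  have K: "Hi t - 1 = - (H t - 1) - (H t - 1) * (Hi t - 1)" using Hi(2)[OF t] by (simp add: left_diff_distrib right_diff_distrib)
  have K': "Hi t - 1 = - (H t - 1) - (Hi t - 1) * (H t - 1)" using Hi(3)[OF t] by (simp add: left_diff_distrib right_diff_distrib)
  show ?thesis
  proof (rule supportedI)
   show "app (Hi t - 1) u i = 0" if "i ~: ?S" for u i
    by (subst K) (use supported_outside[OF H(2)[OF t] that] in simp)
   show "app (Hi t - 1) u = app (Hi t - 1) v" if uv: "!!k. k : ?S ==> u k = v k" for u v
   proof -
    have "app (H t - 1) u = app (H t - 1) v" by (rule supported_dep[OF H(2)[OF t] uv])
    thus ?thesis by (subst (1 2) K') (simp only: app_ring)
   qed
  qed
 qed
 define v where "v t k = ent (H t) k i0" for t k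
 have cv: "continuous_on T (%t. v t k)" for k unfolding v_def by (rule cH)
 have v_out: "v t k = 0" if "t : T" "k ~: ?S" for t k
  using ent_unsupported[OF H(2)[OF that(1)], of k i0] that S by (auto simp: v_def ent_one)
 have vZ: "v t k = (if k = i0 then 1 else 0)" if t: "t : Z" for t k
 proof -
  have "i0 ~: range io" using S by auto
  hence "ent (H t - 1) k i0 = 0" using ent_unsupported[OF Z(2)[OF t]] by blast
  thus ?thesis by (simp add: v_def ent_one)
 qed
 \<comment> \<open>Bounds row \<open>i0\<close> of the inverse; this decides how small a change of
   the column must be for \<open>1 + N0\<close> to stay invertible.\<close>
 define C where "C = (SOME C. C > 0 & (ALL t:T. ALL k:?S. cmod (ent (Hi t) i0 k) <= C))"
 have C: "C > 0" "!!t k. t : T ==> k : ?S ==> cmod (ent (Hi t) i0 k) <= C"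
 proof -
  have "ALL k:?S. EX B. ALL t:T. cmod (ent (Hi t) i0 k) <= B"
   using compact_imp_bounded[OF compact_continuous_image[OF cHi T(1)]] unfolding bounded_iff by fastforce
  then obtain B where B: "!!k t. k : ?S ==> t : T ==> cmod (ent (Hi t) i0 k) <= B k" by metis
  have "ALL t:T. ALL k:?S. cmod (ent (Hi t) i0 k) <= (SUM k:?S. \<bar>B k\<bar>) + 1"
  proof (intro ballI)
   fix t k assume tk: "t : T" "k : ?S"
   have "\<bar>B k\<bar> <= (SUM k:?S. \<bar>B k\<bar>)" using tk fS by (intro member_le_sum) auto
   thus "cmod (ent (Hi t) i0 k) <= (SUM k:?S. \<bar>B k\<bar>) + 1" using B[OF tk(2,1)] by linarith
  qed
  moreover have "(SUM k:?S. \<bar>B k\<bar>) + 1 > 0" by (intro add_nonneg_pos sum_nonneg) auto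
  ultimately have "EX C. C > 0 & (ALL t:T. ALL k:?S. cmod (ent (Hi t) i0 k) <= C)" by (intro exI[of _ "(SUM k:?S. \<bar>B k\<bar>) + 1"] conjI)
  from someI_ex[OF this] show "C > 0" "!!t k. t : T ==> k : ?S ==> cmod (ent (Hi t) i0 k) <= C" unfolding C_def by blast+
 qed
 define ep where "ep = 1 / (C * real (card ?S) * 2 + 1)"
 have "C * real (card ?S) >= 0" using C(1) by simp
 hence eps: "ep > 0" "C * real (card ?S) * ep < 1" by (simp_all add: ep_def field_simps)
 \<comment> \<open>A bad column has all these coordinates equal to 0, so it suffices to perturb
   \<open>f\<close> off the origin.\<close>
 define f where "f t = ((\<chi> i. v t (io i)) :: complex ^ 'm, Im (v t i0))" for t
 have "continuous_on T f" unfolding f_def by (intro continuous_intros cv)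
 moreover have "DIM('t) < DIM((complex ^ 'm) \<times> real)" using T(2) by simp
 ultimately obtain w where w: "continuous_on T w" "!!t. t : T ==> w t ~= 0" "!!t. t : T ==> norm (w t - f t) <= ep"
  using dodge_origin[OF T(1) _ eps(1)] by metis
 define cut where "cut t = min 1 (2 * (cmod (v t i0 - 1) + (SUM k:S. cmod (v t k))))" for t
 have ccut: "continuous_on T cut" unfolding cut_def by (intro continuous_intros cv)
 have cut01: "0 <= cut t" "cut t <= 1" for t unfolding cut_def by (auto intro!: add_nonneg_nonneg sum_nonneg)
 have cutZ: "cut t = 0" if "t : Z" for t
  unfolding cut_def vZ[OF that] using S by (subst sum.neutral) auto
 define z where "z t k = of_real (cut t) * (if k = i0 then \<i> * of_real (snd (w t) - Im (v t i0)) else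
   if k : range io then fst (w t) $ the_inv io k - v t k else 0)" for t k
 have cz: "continuous_on T (%t. z t k)" for k
  unfolding z_def by (cases "k = i0"; cases "k : range io") (auto intro!: continuous_intros cv ccut w(1))
 have zsmall: "cmod (z t k) <= ep" if t: "t : T" for t k
 proof -
  have p: "norm (fst (w t) - fst (f t), snd (w t) - snd (f t)) <= ep" using w(3)[OF t] by (simp add: minus_prod_def)
  have n: "cmod ((fst (w t) - fst (f t)) $ i) <= ep" "\<bar>snd (w t) - snd (f t)\<bar> <= ep" for i
   using p Finite_Cartesian_Product.norm_nth_le[of "fst (w t) - fst (f t)" i] norm_fst_le[of "fst (w t - f t)" "snd (w t - f t)"] norm_snd_le[of "snd (w t - f t)" "fst (w t - f t)"]
   by (simp_all del: vector_minus_component)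
  have "cmod (if k = i0 then \<i> * of_real (snd (w t) - Im (v t i0)) else if k : range io then fst (w t) $ the_inv io k - v t k else 0) <= ep"
   using n(1)[of "the_inv io k"] n(2) eps(1) by (auto simp: f_def norm_mult the_inv_f_f[OF io] simp del: of_real_diff)
  hence "cut t * cmod (if k = i0 then \<i> * of_real (snd (w t) - Im (v t i0)) else if k : range io then fst (w t) $ the_inv io k - v t k else 0) <= 1 * ep"
   by (intro mult_mono cut01) auto
  thus ?thesis unfolding z_def norm_mult using cut01[of t] by simp
 qed
 have zZ: "z t k = 0" if "t : Z" for t k by (simp add: z_def cutZ that)
 define a where "a t = v t i0 + z t i0" for t
 define b where "b t k = (if k : S then v t k + z t k else 0)" for t k
 define bt where "bt t = (SUM k:S. (cmod (b t k))\<^sup>2)" for t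
 have ca: "continuous_on T a" and cb: "continuous_on T (%t. b t k)" for k
  unfolding a_def b_def by (intro continuous_intros cv cz) (cases "k : S"; auto intro!: continuous_intros cv cz)
 have cbt: "continuous_on T bt" unfolding bt_def by (intro continuous_intros cb)
 have bt0: "bt t >= 0" for t unfolding bt_def by (intro sum_nonneg) auto
 have good: "bt t > 0 \<or> Im (a t) ~= 0 \<or> Re (a t) > 0" if t: "t : T" for t
 proof (cases "cut t = 1")
  case True
  show ?thesis
  proof (rule ccontr)
   assume n: "~ ?thesis"
   hence "bt t = 0" using bt0[of t] by linarith
   hence b0: "b t k = 0" if "k : S" for k using that S(1) by (simp add: bt_def sum_nonneg_eq_0_iff)
   have "fst (w t) $ i = 0" for i
   proof -
    have "io i : S" "io i ~= i0" using S by auto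
    thus ?thesis using b0[of "io i"] by (simp add: b_def z_def True the_inv_f_f[OF io])
   qed
   moreover have "snd (w t) = 0" using n by (simp add: a_def z_def True)
   ultimately have "w t = 0" by (simp add: prod_eq_iff vec_eq_iff)
   thus False using w(2)[OF t] by simp
  qed
 next
  case False
  hence "2 * (cmod (v t i0 - 1) + (SUM k:S. cmod (v t k))) < 1" unfolding cut_def by (simp add: min_def split: if_splits)
  moreover have "(SUM k:S. cmod (v t k)) >= 0" by (intro sum_nonneg) auto
  moreover have "p < 1" if "2 * (p + q) < 1" "0 <= q" for p q :: real using that by (linarith | argo | (smt (verit)))
  ultimately have "cmod (v t i0 - 1) < 1" by blast
  hence "Re (v t i0) > 0" using abs_Re_le_cmod[of "v t i0 - 1"] by simp
  thus ?thesis by (simp add: a_def z_def)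
 qed
 \<comment> \<open>The new pivot \<open>a + c * bt\<close> is \<open>a + l (|a| + bt - a)\<close>
   with \<open>l = bt / (bt + |a| + Re a)\<close> between 0 and 1: a point on the segment from
   \<open>a\<close> to a positive number. If \<open>a\<close> is on the negative half-line then
   \<open>l = 1\<close>, so the segment is traversed past the origin; if \<open>bt = 0\<close> the
   pivot is unchanged.\<close>
 define c where "c t = (of_real (cmod (a t) + bt t) - a t) / of_real (bt t + cmod (a t) + Re (a t))" for t
 define a' where "a' t = a t + c t * of_real (bt t)" for t
 note piv = pivot_nonzero[OF bt0 good]
 have cc: "continuous_on T c" unfolding c_def
  by (intro continuous_intros ca cbt) (use piv(1) in \<open>auto simp del: of_real_add dest: less_imp_neq[THEN not_sym]\<close>)
 have ca': "continuous_on T a'" unfolding a'_def by (intro continuous_intros ca cc cbt)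
 have a'0: "a' t ~= 0" if "t : T" for t unfolding a'_def c_def by (rule piv(2)[OF that])
 have aZ: "a t = 1" "b t k = 0" "c t = 0" "a' t = 1" if t: "t : Z" for t k
 proof -
  show a: "a t = 1" and b: "b t k = 0" for k using S by (auto simp: a_def b_def vZ[OF t] zZ[OF t])
  thus "c t = 0" "a' t = 1" by (simp_all add: c_def a'_def bt_def)
 qed
 \<comment> \<open>The factor \<open>1 + N0\<close>, on the right of \<open>H\<close>, adds the
   perturbation \<open>z\<close> to column \<open>i0\<close>. On the left, \<open>1 + N1\<close>
   shears the rest of the column into the pivot, and \<open>1 + N2\<close> then clears the column
   and normalizes the pivot.\<close>
 define N0 where "N0 t = Hi t * mk_lop ?S (%i k. if k = i0 then z t i else 0)" for t
 define N1 where "N1 t = mk_lop ?S (%i k. if i = i0 & k ~= i0 then c t * cnj (b t k) else 0)" for t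
 define N2 where "N2 t = mk_lop ?S (%i k. if k = i0 then (if i = i0 then 1 / a' t - 1 else - b t i / a' t) else 0)" for t
 have col: "app (mk_lop ?S (%i k. if k = i0 then g i else 0)) u = (%i. if i : ?S then g i * u i0 else 0)" for g u
 proof
  fix i
  have "(SUM k:?S. (if k = i0 then g i else 0) * u k) = (SUM k:?S. if k = i0 then g i * u k else 0)" by (rule sum.cong) auto
  thus "app (mk_lop ?S (%i k. if k = i0 then g i else 0)) u i = (if i : ?S then g i * u i0 else 0)"
   using fS by (simp add: app_mk_lop)
 qed
 define sg where "sg t = (SUM k:?S. ent (Hi t) i0 k * z t k)" for t
 have zout: "z t k = 0" if "k ~: ?S" for t k using that S by (auto simp: z_def)
 have appHiz: "app (Hi t) (%i. if i : ?S then z t i * x else 0) i0 = sg t * x" if t: "t : T" for t x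
 proof -
  have "app (Hi t) (%i. if i : ?S then z t i * x else 0) i0 = app (Hi t - 1) (%i. if i : ?S then z t i * x else 0) i0 + z t i0 * x" by simp
  also have "... = (SUM k:?S. ent (Hi t - 1) i0 k * (z t k * x)) + (SUM k:?S. ent 1 i0 k * (z t k * x))"
  proof -
   have "(SUM k:?S. ent 1 i0 k * (z t k * x)) = (SUM k:?S. if k = i0 then z t k * x else 0)" by (rule sum.cong) (auto simp: ent_one)
   hence "(SUM k:?S. ent 1 i0 k * (z t k * x)) = z t i0 * x" using fS by simp
   thus ?thesis by (subst supported_expand[OF fS sHi[OF t]]) (simp only:, rule arg_cong2[where f = "(+)"], rule sum.cong, auto simp del: ent_ring sum.insert)
  qed
  also have "... = sg t * x" unfolding sg_def sum_distrib_right sum.distrib[symmetric] by (rule sum.cong) (auto simp: algebra_simps)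
  finally show ?thesis .
 qed
 have g0: "GLfam T (%t. 1 + N0 t)"
 proof (rule GLfam_rank_one[where c = sg])
  have m: "fsf T (%t. mk_lop ?S (%i k. if k = i0 then z t i else 0))"
  proof (rule fsf_mk_lop[OF fS])
   show "continuous_on T (%t. if k = i0 then z t i else 0)" for i k
    by (cases "k = i0"; cases "i = i0") (auto intro!: continuous_intros cz)
  qed
  have "fsf T (%t. (Hi t - 1) * mk_lop ?S (%i k. if k = i0 then z t i else 0) + mk_lop ?S (%i k. if k = i0 then z t i else 0))"
   by (intro fsf_add fsf_mult Hi m)
  thus "fsf T N0" unfolding N0_def[abs_def] by (simp add: left_diff_distrib)
  show "continuous_on T sg" unfolding sg_def by (intro continuous_intros cHi cz)
  fix t assume t: "t : T"
  show "N0 t * N0 t = scal (sg t) * N0 t"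
  proof (rule lop_appI)
   fix u i
   have "app (N0 t * N0 t) u i = app (Hi t) (%i. if i : ?S then z t i * (sg t * u i0) else 0) i"
    unfolding N0_def by (simp only: app_ring col appHiz[OF t])
   also have "(%i. if i : ?S then z t i * (sg t * u i0) else 0) = (%i. sg t * (if i : ?S then z t i * u i0 else 0))" by auto
   finally show "app (N0 t * N0 t) u i = app (scal (sg t) * N0 t) u i"
    unfolding N0_def by (simp only: app_scale app_scal app_ring col)
  qed
  have "cmod (sg t) <= (SUM k:?S. C * ep)"
   unfolding sg_def by (intro sum_norm_le) (use C t zsmall in \<open>auto simp: norm_mult intro!: mult_mono\<close>)
  also have "... < 1" using eps(2) by (simp add: mult.commute mult.left_commute del: card.insert card_insert_disjoint)
  finally show "1 + sg t ~= 0" by (metis add.inverse_unique less_irrefl norm_minus_cancel norm_one)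
 qed
 have row: "app (N1 t) u = (%i. if i = i0 then c t * (SUM k:S. cnj (b t k) * u k) else 0)" for t u
 proof
  fix i
  have "(SUM k:?S. (if k ~= i0 then c t * cnj (b t k) else 0) * u k) = (SUM k:S. c t * (cnj (b t k) * u k))"
   using S by (simp add: sum.insert) (rule sum.cong, auto)
  thus "app (N1 t) u i = (if i = i0 then c t * (SUM k:S. cnj (b t k) * u k) else 0)"
   unfolding N1_def using fS by (cases "i = i0") (simp_all add: app_mk_lop sum_distrib_left del: sum.insert)
 qed
 have g1: "GLfam T (%t. 1 + N1 t)"
 proof (rule GLfam_rank_one[where c = "%t. 0"])
  show "fsf T N1" unfolding N1_def[abs_def]
  proof (rule fsf_mk_lop[OF fS])
   show "continuous_on T (%t. if i = i0 & k ~= i0 then c t * cnj (b t k) else 0)" for i k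
    by (cases "k = i0"; cases "i = i0") (auto intro!: continuous_intros cc cb)
  qed
  show "N1 t * N1 t = scal 0 * N1 t" for t
  proof (rule lop_appI)
   fix u i
   have "(SUM k:S. cnj (b t k) * (if k = i0 then x else 0)) = 0" for x using S by (intro sum.neutral) auto
   thus "app (N1 t * N1 t) u i = app (scal 0 * N1 t) u i" by (simp add: row)
  qed
 qed auto
 have g2: "GLfam T (%t. 1 + N2 t)"
 proof (rule GLfam_rank_one[where c = "%t. 1 / a' t - 1"])
  show "fsf T N2" unfolding N2_def[abs_def]
  proof (rule fsf_mk_lop[OF fS])
   show "continuous_on T (%t. if k = i0 then (if i = i0 then 1 / a' t - 1 else - b t i / a' t) else 0)" for i k
    by (cases "k = i0"; cases "i = i0") (auto intro!: continuous_intros ca' cb a'0)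
  qed
  show "continuous_on T (%t. 1 / a' t - 1)" by (intro continuous_intros ca') (use a'0 in auto)
  fix t assume t: "t : T"
  show "1 + (1 / a' t - 1) ~= 0" using a'0[OF t] by simp
  show "N2 t * N2 t = scal (1 / a' t - 1) * N2 t"
   by (rule lop_appI) (simp add: N2_def col del: mult_eq_0_iff)
 qed
 define H1 where "H1 t = (1 + N2 t) * ((1 + N1 t) * (H t * (1 + N0 t)))" for t
 have GH1: "GLfam T H1" unfolding H1_def[abs_def] by (intro GLfam_mult g0 g1 g2 H(1))
 then obtain Hj where Hj: "fsf T (%t. H1 t - 1)" "fsf T (%t. Hj t - 1)" "!!t. t : T ==> H1 t * Hj t = 1" "!!t. t : T ==> Hj t * H1 t = 1"
  unfolding GLfam_def by blast
 have H1e: "app (H1 t) (delta i0) = delta i0" if t: "t : T" for t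
 proof -
  have "H t * (1 + N0 t) = H t + (H t * Hi t) * mk_lop ?S (%i k. if k = i0 then z t i else 0)"
   unfolding N0_def by (simp only: distrib_left mult_1_right mult.assoc)
  hence "H t * (1 + N0 t) = H t + mk_lop ?S (%i k. if k = i0 then z t i else 0)" by (simp only: Hi(2)[OF t] mult_1_left)
  hence "app (H t * (1 + N0 t)) (delta i0) = (%k. v t k + z t k)"
   using zout by (simp add: col v_def ent_def delta_def fun_eq_iff)
  also have "... = (%k. if k = i0 then a t else b t k)"
   using v_out[OF t] zout S by (auto simp: a_def b_def)
  finally have 1: "app (H t * (1 + N0 t)) (delta i0) = (%k. if k = i0 then a t else b t k)" .
  have s: "(SUM k:S. cnj (b t k) * (if k = i0 then a t else b t k)) = of_real (bt t)"
   unfolding bt_def of_real_sum using S by (intro sum.cong) (auto simp: complex_norm_square mult.commute simp del: of_real_power)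
  have 2: "app ((1 + N1 t) * (H t * (1 + N0 t))) (delta i0) = (%k. if k = i0 then a' t else b t k)"
   unfolding app_ring(6)[of "1 + N1 t"] 1 by (simp add: row s a'_def fun_eq_iff)
  have "app (H1 t) (delta i0) = app (1 + N2 t) (%k. if k = i0 then a' t else b t k)"
   unfolding H1_def app_ring(6)[of "1 + N2 t"] 2 ..
  also have "... = delta i0"
   using a'0[OF t] S by (auto simp: N2_def col delta_def fun_eq_iff b_def field_simps)
  finally show ?thesis .
 qed
 have H1s: "supported ?S (H1 t - 1)" if t: "t : T" for t
 proof -
  have one: "supported ?S (X * Y - 1)" if "supported ?S (X - 1)" "supported ?S (Y - 1)" for X Y :: "'j lop"
  proof -
   have *: "X * Y - 1 = (X - 1) * (Y - 1) + (X - 1) + (Y - 1)" by (simp add: left_diff_distrib right_diff_distrib)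
   show ?thesis unfolding * using that by (intro supported_add supported_mult)
  qed
  have n: "supported ?S (1 + N1 t - 1)" "supported ?S (1 + N2 t - 1)" by (simp_all add: N1_def N2_def supported_mk_lop)
  have "N0 t = (Hi t - 1) * mk_lop ?S (%i k. if k = i0 then z t i else 0) + mk_lop ?S (%i k. if k = i0 then z t i else 0)"
   by (simp add: N0_def left_diff_distrib)
  hence "supported ?S (1 + N0 t - 1)" using sHi[OF t] by (auto intro!: supported_add supported_mult supported_mk_lop)
  thus ?thesis unfolding H1_def by (intro one n H(2)[OF t])
 qed
 let ?P = "pull_lop S id :: 'j lop"
 \<comment> \<open>Column \<open>i0\<close> of \<open>H1 t - 1\<close> is zero, so this operator
   ignores the input at \<open>i0\<close>. Deleting row \<open>i0\<close> is then compatible with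
   products, and invertibility survives.\<close>
 have KP: "(H1 t - 1) * ?P = H1 t - 1" if t: "t : T" for t
 proof (rule lop_appI)
  fix u i
  have e: "app (H1 t - 1) (delta i0) i = 0" by (simp add: H1e[OF t])
  have d: "app (H1 t - 1) u = app (H1 t - 1) (%k. app ?P u k + u i0 * delta i0 k)"
   by (rule supported_dep[OF H1s[OF t]]) (use S in \<open>auto simp: delta_def\<close>)
  show "app ((H1 t - 1) * ?P) u i = app (H1 t - 1) u i"
   unfolding d by (simp only: app_add app_scale e app_ring(6)) simp
 qed
 have KP': "(Hj t - 1) * ?P = Hj t - 1" if t: "t : T" for t
 proof -
  have "Hj t - 1 = - (H1 t - 1) - (Hj t - 1) * (H1 t - 1)" using Hj(4)[OF t] by (simp add: left_diff_distrib right_diff_distrib)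
  moreover have "(- K - J * K) * P = - K - J * K" if "K * P = K" for K J P :: "'j lop"
   using that by (simp add: left_diff_distrib mult.assoc)
  note this[OF KP[OF t], of "Hj t - 1"]
  ultimately show ?thesis by simp
 qed
 have fP: "fsf T (%t. ?P)" by (rule fsf_const[OF S(1) supported_pull_lop]) auto
 show ?thesis
 proof (rule that[of "%t. 1 + ?P * (H1 t - 1)"])
  have *: "(1 + P * (X - 1)) * (1 + P * (Y - 1)) = 1" if "X * Y = 1" "(X - 1) * P = X - 1" for X Y P :: "'j lop"
  proof -
   have "P * (X - 1) * (P * (Y - 1)) = P * ((X - 1) * (Y - 1))" using that(2) by (metis mult.assoc)
   hence "(1 + P * (X - 1)) * (1 + P * (Y - 1)) = 1 + P * ((X - 1) + (Y - 1) + (X - 1) * (Y - 1))"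
    by (simp only: distrib_left distrib_right mult_1_left mult_1_right ac_simps)
   also have "(X - 1) + (Y - 1) + (X - 1) * (Y - 1) = 0" using that(1) by (simp add: left_diff_distrib right_diff_distrib)
   finally show ?thesis by simp
  qed
  show "GLfam T (%t. 1 + ?P * (H1 t - 1))"
  proof (rule GLfamI[where b = "%t. 1 + ?P * (Hj t - 1)"])
   show "fsf T (%x. 1 + ?P * (H1 x - 1) - 1)" "fsf T (%x. 1 + ?P * (Hj x - 1) - 1)"
    using fsf_mult[OF fP Hj(1)] fsf_mult[OF fP Hj(2)] by simp_all
  qed (use * KP KP' Hj in auto)
  show "supported S (1 + ?P * (H1 t - 1) - 1)" if t: "t : T" for t
  proof -
   have "supported S (?P * (H1 t - 1) * ?P)" by (intro supported_corner supported_pull_lop) auto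
   thus ?thesis using KP[OF t] by (simp add: mult.assoc)
  qed
  show "1 + ?P * (H1 t - 1) = H t" if t: "t : Z" for t
  proof -
   have "N0 t = 0" "N1 t = 0" "N2 t = 0"
   proof -
    have m0: "mk_lop ?S (%i k. 0) = (0 :: 'j lop)" by (rule lop_appI) (simp add: app_mk_lop[OF fS] del: sum.insert)
    thus "N0 t = 0" "N1 t = 0" "N2 t = 0"
     unfolding N0_def N1_def N2_def by (simp_all add: aZ[OF t] zZ[OF t] if_cancel cong: if_cong)
   qed
   hence "H1 t = H t" by (simp add: H1_def)
   moreover have "?P * (H t - 1) = H t - 1" by (rule supported_proj(1)[OF supported_mono[OF Z(2)[OF t] S(2)]])
   ultimately show ?thesis by simp
  qed
 qed
qed

lemma destabilize:
 fixes io :: "'m::finite => 'j" and T :: "'t::euclidean_space set"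
 assumes T: "compact T" "DIM('t) < 2 * CARD('m) + 1" and io: "inj io" and Z: "Z <= T"
  and "finite F" "F \<inter> range io = {}"
  and "GLfam T H" "!!t. t : T ==> supported (F \<union> range io) (H t - 1)" "!!t. t : Z ==> supported (range io) (H t - 1)"
 shows "EX H'. GLfam T H' & (ALL t:T. supported (range io) (H' t - 1)) & (ALL t:Z. H' t = H t)"
 using assms(5-)
proof (induction F arbitrary: H rule: finite_induct)
 case empty
 thus ?case by auto
next
 case (insert i F)
 obtain H' where H': "GLfam T H'" "!!t. t : T ==> supported (F \<union> range io) (H' t - 1)" "!!t. t : Z ==> H' t = H t"
  by (rule destabilize_step[OF T io _ _ _ insert(5), of "F \<union> range io" i Z]) (use insert Z in auto)
 have "EX H''. GLfam T H'' & (ALL t:T. supported (range io) (H'' t - 1)) & (ALL t:Z. H'' t = H' t)"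
  by (rule insert(3)[OF _ H'(1,2)]) (use insert H' in auto)
 thus ?case using H'(3) by auto
qed

section \<open>Orthonormalization\<close>

text \<open>One column at a time, by induction over the columns already orthonormal. Injectivity is
  carried along, so no normalization divides by 0. Where the matrix is already unitary, every
  correction is trivial, which preserves the prescribed values on \<open>Z\<close>.\<close>

lemma gram_schmidt_family:
 fixes B :: "'t::topological_space => complex ^ 'm ^ 'm::finite"
 assumes B: "continuous_on T B" "!!t u. t : T ==> B t *v u = 0 ==> u = 0" and Z: "!!t. t : Z ==> adj (B t) ** B t = mat 1"
 shows "EX U. continuous_on T U & (ALL t:T. adj (U t) ** U t = mat 1) & (ALL t:Z. U t = B t)"
proof -
 have adj_mult: "(adj M ** M) $ i $ k = (SUM l:UNIV. cnj (M $ l $ i) * M $ l $ k)" for M :: "complex ^ 'm ^ 'm" and i k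
  by (simp add: adj_defs matrix_matrix_mult_def)
 define orth where "orth I M \<longleftrightarrow> (ALL i:I. ALL k:I. (SUM l:UNIV. cnj (M $ l $ i) * M $ l $ k) = (if i = k then 1 else 0))" for I and M :: "complex ^ 'm ^ 'm"
 have orth_UNIV: "orth UNIV M \<longleftrightarrow> adj M ** M = mat 1" for M
  unfolding orth_def vec_eq_iff adj_mult by (simp add: mat_def)
 have "finite I ==> EX U. continuous_on T U & (ALL t:T. orth I (U t) & (ALL u. U t *v u = 0 --> u = 0)) & (ALL t:Z. U t = B t)" for I
 proof (induction I rule: finite_induct)
  case empty
  thus ?case using B by (intro exI[of _ B]) (auto simp: orth_def)
 next
  case (insert k I)
  then obtain U where U: "continuous_on T U" "!!t. t : T ==> orth I (U t)" "!!t u. t : T ==> U t *v u = 0 ==> u = 0" "!!t. t : Z ==> U t = B t"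
   by auto
  define c where "c t i = (SUM l:UNIV. cnj (U t $ l $ i) * U t $ l $ k)" for t i
  define y where "y t l = U t $ l $ k - (SUM i:I. c t i * U t $ l $ i)" for t l
  define nu where "nu t = sqrt (SUM l:UNIV. (cmod (y t l))\<^sup>2)" for t
  define V where "V t = (\<chi> l i. if i = k then y t l / of_real (nu t) else U t $ l $ i)" for t
  have cU: "continuous_on T (%t. U t $ l $ i)" for l i by (intro continuous_intros U)
  have cy: "continuous_on T (%t. y t l)" for l unfolding y_def c_def by (intro continuous_intros cU)
  have cnu: "continuous_on T nu" unfolding nu_def by (intro continuous_intros cy)
  have yU: "y t l = (U t *v (\<chi> i. if i = k then 1 else if i : I then - c t i else 0)) $ l" for t l
  proof -
   have "(U t *v (\<chi> i. if i = k then 1 else if i : I then - c t i else 0)) $ l =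
     (SUM i:UNIV. (if i = k then U t $ l $ i else 0) - (if i : I then c t i * U t $ l $ i else 0))"
    unfolding matrix_vector_mult_def vec_lambda_beta by (rule sum.cong) (use insert in \<open>auto simp: mult.commute\<close>)
   thus ?thesis by (simp add: y_def sum_subtractf sum.If_cases)
  qed
  have nu: "nu t > 0" if t: "t : T" for t
  proof (rule ccontr)
   assume "~ ?thesis"
   moreover have "(SUM l:UNIV. (cmod (y t l))\<^sup>2) >= 0" by (intro sum_nonneg) auto
   ultimately have "(SUM l:UNIV. (cmod (y t l))\<^sup>2) = 0" unfolding nu_def by simp
   hence "y t l = 0" for l by (simp add: sum_nonneg_eq_0_iff)
   hence "U t *v (\<chi> i. if i = k then 1 else if i : I then - c t i else 0) = 0" unfolding vec_eq_iff yU by simp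
   from U(3)[OF t this] have "(\<chi> i. if i = k then 1 else if i : I then - c t i else 0) $ k = (0 :: complex)" by simp
   thus False by simp
  qed
  have cV: "continuous_on T V" unfolding V_def
  proof (intro continuous_on_vec_lambda)
   fix l i
   show "continuous_on T (%t. if i = k then y t l / of_real (nu t) else U t $ l $ i)"
    by (cases "i = k") (use nu in \<open>auto intro!: continuous_intros cy cnu cU dest: less_imp_neq[THEN not_sym]\<close>, fastforce)
  qed
  have oV: "orth (insert k I) (V t)" if t: "t : T" for t
  proof -
   have o: "(SUM l:UNIV. cnj (U t $ l $ i) * U t $ l $ j) = (if i = j then 1 else 0)" if "i : I" "j : I" for i j
    using U(2)[OF t] that unfolding orth_def by blast
   have yo: "(SUM l:UNIV. cnj (U t $ l $ i) * y t l) = 0" if i: "i : I" for i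
   proof -
    have "(SUM l:UNIV. cnj (U t $ l $ i) * y t l) = c t i - (SUM l:UNIV. SUM j:I. c t j * (cnj (U t $ l $ i) * U t $ l $ j))"
     unfolding y_def c_def by (simp add: right_diff_distrib sum_subtractf sum_distrib_left mult.left_commute)
    also have "(SUM l:UNIV. SUM j:I. c t j * (cnj (U t $ l $ i) * U t $ l $ j)) = (SUM j:I. c t j * (if i = j then 1 else 0))"
     by (subst sum.swap) (simp add: sum_distrib_left[symmetric] o[OF i] cong: sum.cong)
    also have "... = c t i" using i insert(1) by (simp add: if_distrib cong: if_cong)
    finally show ?thesis by simp
   qed
   have yo': "(SUM l:UNIV. cnj (y t l) * U t $ l $ i) = 0" if "i : I" for i
    using arg_cong[OF yo[OF that], of cnj] by (simp add: mult.commute)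
   have yy: "(SUM l:UNIV. cnj (y t l) * y t l) = of_real ((nu t)\<^sup>2)"
    unfolding nu_def by (simp add: sum_nonneg complex_norm_square mult.commute del: of_real_power)
   have n0: "complex_of_real (nu t) ~= 0" using nu[OF t] by simp
   show ?thesis
    unfolding orth_def
   proof (intro ballI)
    fix i j assume ij: "i : insert k I" "j : insert k I"
    consider "i = k" "j = k" | "i = k" "j ~= k" | "i ~= k" "j = k" | "i ~= k" "j ~= k" by blast
    thus "(SUM l:UNIV. cnj (V t $ l $ i) * V t $ l $ j) = (if i = j then 1 else 0)"
    proof cases
     case 1
     hence "(SUM l:UNIV. cnj (V t $ l $ i) * V t $ l $ j) = (SUM l:UNIV. cnj (y t l) * y t l) / of_real ((nu t)\<^sup>2)"
      by (simp add: V_def sum_divide_distrib power2_eq_square)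
     thus ?thesis using 1 n0 by (simp add: yy)
    next
     case 2
     hence "(SUM l:UNIV. cnj (V t $ l $ i) * V t $ l $ j) = (SUM l:UNIV. cnj (y t l) * U t $ l $ j) / of_real (nu t)"
      by (simp add: V_def sum_divide_distrib)
     thus ?thesis using 2 ij yo'[of j] by auto
    next
     case 3
     hence "(SUM l:UNIV. cnj (V t $ l $ i) * V t $ l $ j) = (SUM l:UNIV. cnj (U t $ l $ i) * y t l) / of_real (nu t)"
      by (simp add: V_def sum_divide_distrib)
     thus ?thesis using 3 ij yo[of i] by auto
    next
     case 4
     thus ?thesis using ij o[of i j] by (simp add: V_def)
    qed
   qed
  qed
  have iV: "u = 0" if t: "t : T" and u: "V t *v u = 0" for t u
  proof -
   \<comment> \<open>Undoes the change of column \<open>k\<close>: \<open>U t\<close> applied to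
     \<open>u'\<close> is \<open>V t\<close> applied to \<open>u\<close>, which transfers
     injectivity.\<close>
   define u' where "u' = (\<chi> i. if i = k then u $ k / of_real (nu t) else u $ i - (if i : I then c t i * u $ k / of_real (nu t) else 0))"
   have "(U t *v u') $ l = (V t *v u) $ l" for l
   proof -
    have "(V t *v u) $ l = y t l / of_real (nu t) * u $ k + (SUM i:UNIV - {k}. U t $ l $ i * u $ i)"
     unfolding matrix_vector_mult_def vec_lambda_beta V_def by (subst sum.remove[of _ k]) auto
    also have "... = U t $ l $ k * (u $ k / of_real (nu t)) + (SUM i:UNIV - {k}. U t $ l $ i * u $ i) - (SUM i:I. U t $ l $ i * (c t i * u $ k / of_real (nu t)))"
     unfolding y_def by (simp add: left_diff_distrib right_diff_distrib diff_divide_distrib sum_distrib_right sum_distrib_left sum_divide_distrib mult.commute mult.left_commute)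
    also have "(SUM i:I. U t $ l $ i * (c t i * u $ k / of_real (nu t))) = (SUM i:UNIV - {k}. U t $ l $ i * (if i : I then c t i * u $ k / of_real (nu t) else 0))"
     by (rule sum.mono_neutral_cong_left) (use insert in auto)
    also have "U t $ l $ k * (u $ k / of_real (nu t)) + (SUM i:UNIV - {k}. U t $ l $ i * u $ i) - ... = (U t *v u') $ l"
     unfolding matrix_vector_mult_def vec_lambda_beta u'_def by (subst sum.remove[of _ k]) (auto simp: sum_subtractf[symmetric] right_diff_distrib intro!: sum.cong)
    finally show ?thesis by simp
   qed
   hence "U t *v u' = 0" using u by (simp add: vec_eq_iff)
   from U(3)[OF t this] have u'0: "u' $ i = 0" for i by simp
   have uk: "u $ k = 0" using u'0[of k] nu[OF t] by (simp add: u'_def)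
   have "u $ i = 0" for i using u'0[of i] uk by (cases "i = k") (auto simp: u'_def)
   thus ?thesis by (simp add: vec_eq_iff)
  qed
  have "V t = B t" if t: "t : Z" for t
  proof -
   have "orth UNIV (U t)" unfolding orth_UNIV U(4)[OF t] by (rule Z[OF t])
   hence o: "(SUM l:UNIV. cnj (U t $ l $ i) * U t $ l $ j) = (if i = j then 1 else 0)" for i j unfolding orth_def by blast
   have "c t i = 0" if "i : I" for i using that insert(2) by (auto simp: c_def o)
   hence y: "y t l = U t $ l $ k" for l by (simp add: y_def)
   have "complex_of_real ((nu t)\<^sup>2) = (SUM l:UNIV. cnj (U t $ l $ k) * U t $ l $ k)"
    unfolding nu_def by (simp add: y sum_nonneg complex_norm_square mult.commute del: of_real_power)
   hence "(nu t)\<^sup>2 = 1" by (simp only: o simp_thms if_True of_real_eq_1_iff)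
   moreover have "nu t >= 0" unfolding nu_def by (simp add: sum_nonneg)
   ultimately have "nu t = 1" by (simp add: power2_eq_1_iff)
   thus ?thesis using U(4)[OF t] by (simp add: V_def y vec_eq_iff)
  qed
  thus ?case using cV oV iV by (intro exI[of _ V]) blast
 qed
 from this[of UNIV, OF finite] show ?thesis unfolding orth_UNIV by blast
qed

lemma ent_yel:
 "ent (yel A (rf (pull_lop {w0} id) * lf (degp 1)) x) (w0, [i]) (w0, [k]) = A x $ i $ k"
proof -
 have 1: "app (rf (pull_lop {w0} id) * lf (degp 1)) (delta (w0, [k])) = (delta (w0, [k]) :: _ => complex)"
  by (auto simp: fun_eq_iff delta_def)
 have "app (yel A (rf (pull_lop {w0} id) * lf (degp 1)) x) (delta (w0, [k])) (w0, [i]) =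
   delta (w0, [k]) (w0, [i]) + (app (lf (tens (A x))) (delta (w0, [k])) (w0, [i]) - delta (w0, [k]) (w0, [i]))"
  unfolding yel_def by (simp only: app_ring(2-4) app_ring(6)[of "lf (tens (A x)) - 1"] 1)
 also have "app (lf (tens (A x))) (delta (w0, [k])) (w0, [i]) = (SUM j:UNIV. A x $ i $ j * (if j = k then 1 else 0))"
  by (simp add: delta_def)
 also have "... = A x $ i $ k" by (simp add: if_distrib cong: if_cong)
 finally show ?thesis by (simp only: ent_def add_diff_eq add_diff_cancel_left')
qed

text \<open>The parameters \<open>{0..1} \<times> X\<close> lie in a space of dimension
  \<open>2 n + 2\<close>, just below the \<open>2 (n + 1) + 1\<close> needed to destabilize down to
  the block of lists of length one, where the tensor power is \<open>A\<close> itself.\<close>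

theorem unitary_null:
 fixes A :: "real \<times> (complex ^ 'n::finite) => complex ^ 'n option ^ 'n option"
  and F :: "(real \<times> (real \<times> (complex ^ 'n))) \<times> (complex ^ 'n option) => complex ^ 'n option"
 assumes U: "unitary_family X D A" and X: "compact X" "x0 : X"
  and contF: "continuous_on (({0..1} \<times> X) \<times> sphere 0 1) F"
  and F1: "!!t z. t : {0..1} \<times> X ==> norm z = 1 ==> norm (F (t, z)) = 1"
  and equi: "!!t z b. t : {0..1} \<times> X ==> norm z = 1 ==> norm b = 1 ==> F (t, b *s z) = b *s F (t, z)"
  and F_start: "!!x z. x : X ==> norm z = 1 ==> F ((0, x), z) = A x *v z"
  and F_end: "!!x z. x : X ==> norm z = 1 ==> F ((1, x), z) = z"
  and F_bd: "!!s x z. s : {0..1} ==> x : D ==> norm z = 1 ==> F ((s, x), z) = z"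
 shows "EX V. continuous_on ({0..1::real} \<times> X) V & (ALL t:{0..1} \<times> X. adj (V t) ** V t = mat 1) \<and>
   (ALL x:X. V (0, x) = A x & V (1, x) = mat 1) & (ALL s:{0..1}. ALL x:D. V (s, x) = mat 1)"
proof -
 interpret unitary_family X D A by (rule U)
 let ?w = "(%_. 0, %_. 0) :: ('n option => nat) \<times> ('n option => nat)"
 let ?e = "rf (pull_lop {?w} id) * lf (degp 1) :: (_ \<times> 'n option list) lop"
 let ?T = "{0..1::real} \<times> X" and ?io = "%i :: 'n option. (?w, [i])"
 have "null_fam X D (yel A ?e)" by (rule stable_null[OF U X contF F1 equi F_start F_end F_bd])
 then obtain H where H: "GLfam ?T H" "!!x. x : X ==> H (0, x) = yel A ?e x & H (1, x) = 1" "!!s x. s : {0..1} ==> x : D ==> H (s, x) = 1"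
  unfolding null_fam_def by blast
 let ?Z = "{0, 1 :: real} \<times> X \<union> {0..1} \<times> D"
 obtain S where S: "finite S" "!!t. t : ?T ==> supported S (H t - 1)"
  using H(1) unfolding GLfam_def fsf_def by blast
 have pt: "pull_lop {?w} id * pull_lop {?w} id = pull_lop {?w} id" by (rule lop_appI) simp
 have cg: "cgood X ?e"
  using cgood_rf_alt[OF pt, of "{?w}" "Suc 0"] unfolding One_nat_def[symmetric] alt_1 by (simp add: supported_pull_lop)
 have se: "supported (range ?io) ?e"
 proof -
  have "supported ({?w} \<times> {l :: 'n option list. length l = 1}) ?e"
   by (intro supported_rf_lf finite_lists_length supported_degp supported_pull_lop) auto
  moreover have "{?w} \<times> {l :: 'n option list. length l = 1} = range ?io" by (auto simp: length_Suc_conv)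
  ultimately show ?thesis by simp
 qed
 have sY: "supported (range ?io) (yel A ?e x - 1)" for x
 proof -
  have e: "?e * ?e = ?e" "lf (tens B) * ?e = ?e * lf (tens B)" for B using cg by (auto simp: cgood_def)
  have c: "?e * (lf (tens (A x)) - 1) = (lf (tens (A x)) - 1) * ?e"
   by (simp only: left_diff_distrib right_diff_distrib mult_1_left mult_1_right e(2))
  have "(lf (tens (A x)) - 1) * ?e = ?e * (lf (tens (A x)) - 1) * ?e"
   unfolding c by (simp only: mult.assoc[of _ ?e ?e] e(1))
  thus ?thesis using supported_corner[OF se] by (simp add: yel_def)
 qed
 have HZ: "supported (range ?io) (H t - 1)" if "t : ?Z" for t using that H sY by auto
 have cT: "compact ?T" using X by (intro compact_Times) auto
 have "EX H'. GLfam ?T H' & (ALL t:?T. supported (range ?io) (H' t - 1)) & (ALL t:?Z. H' t = H t)"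
 proof (rule destabilize[OF cT _ _ _ _ _ H(1), of ?io ?Z "S - range ?io"])
  show "supported (S - range ?io \<union> range ?io) (H t - 1)" if "t : ?T" for t by (rule supported_mono[OF S(2)[OF that]]) auto
 qed (use S DX HZ in \<open>auto simp: inj_on_def\<close>)
 then obtain H' where H': "GLfam ?T H'" "!!t. t : ?T ==> supported (range ?io) (H' t - 1)" "!!t. t : ?Z ==> H' t = H t"
  by blast
 define B where "B t = (\<chi> i k. ent (H' t) (?io i) (?io k))" for t
 have "continuous_on ?T (%t. ent (H' t - 1) i k + ent 1 i k)" for i k
 proof -
  have "fsf ?T (%t. H' t - 1)" using H'(1) unfolding GLfam_def by blast
  thus ?thesis unfolding fsf_def by (intro continuous_intros) blast
 qed
 hence cB: "continuous_on ?T B" unfolding B_def[abs_def] by (intro continuous_on_vec_lambda) simp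
 have app_B: "app (H' t) u (?io i) = (SUM k:UNIV. B t $ i $ k * u (?io k))" if t: "t : ?T" for t u i
 proof -
  have fi: "finite (range ?io)" by simp
  have inj: "inj ?io" by (simp add: inj_on_def)
  have "app (H' t - 1) u (?io i) = (SUM k:range ?io. ent (H' t - 1) (?io i) k * u k)"
   by (rule supported_expand[OF fi H'(2)[OF t]])
  also have "... = (SUM k:UNIV. ent (H' t - 1) (?io i) (?io k) * u (?io k))" by (subst sum.reindex[OF inj]) simp
  also have "... = (SUM k:UNIV. B t $ i $ k * u (?io k) - (if k = i then u (?io i) else 0))"
   by (rule sum.cong) (auto simp: B_def ent_one algebra_simps)
  also have "... = (SUM k:UNIV. B t $ i $ k * u (?io k)) - u (?io i)" by (simp add: sum_subtractf)
  finally show ?thesis by simp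
 qed
 have injB: "y = 0" if t: "t : ?T" and y: "B t *v y = 0" for t y
 proof -
  obtain Hi where Hi: "!!t. t : ?T ==> Hi t * H' t = 1" using H'(1) unfolding GLfam_def by blast
  \<comment> \<open>Extends \<open>y\<close> by 0 from the block. As \<open>H' t\<close> is the
    identity outside the block, a kernel vector of \<open>B t\<close> becomes one of
    \<open>H' t\<close>.\<close>
  define u where "u = (%p. if p : range ?io then y $ hd (snd p) else 0)"
  have "app (H' t) u p = 0" for p
  proof (cases "p : range ?io")
   case True
   then obtain i where p: "p = ?io i" by blast
   have "app (H' t) u p = (B t *v y) $ i" unfolding p app_B[OF t] matrix_vector_mult_def by (simp add: u_def)
   thus ?thesis by (simp add: y)
  next
   case False
   hence "app (H' t - 1) u p = 0" by (rule supported_outside[OF H'(2)[OF t]])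
   thus ?thesis using False by (simp add: u_def)
  qed
  hence "app (H' t) u = (%p. 0)" by (rule ext)
  moreover have "app (Hi t) (app (H' t) u) = u" using arg_cong[OF Hi[OF t], of "%f. app f u"] by simp
  ultimately have "u = (%p. 0)" by (metis app_zero ext)
  hence "u (?io i) = 0" for i by simp
  thus "y = 0" by (simp add: u_def vec_eq_iff)
 qed
 have B1: "B t = mat 1" if "t : ?Z" "H t = 1" for t :: "real \<times> (real \<times> (complex ^ 'n))"
  using H'(3)[OF that(1)] that(2) by (simp add: B_def ent_one mat_def vec_eq_iff)
 have B0: "B (0, x) = A x" if "x : X" for x
  using H'(3)[of "(0, x)"] that H(2) by (simp add: B_def ent_yel vec_eq_iff del: One_nat_def)
 have a1: "adj (mat 1 :: complex ^ 'n option ^ 'n option) = mat 1"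
  by (simp add: adj_defs mat_def vec_eq_iff)
 have "EX V. continuous_on ?T V & (ALL t:?T. adj (V t) ** V t = mat 1) & (ALL t:?Z. V t = B t)"
 proof (rule gram_schmidt_family[OF cB injB])
  fix t assume t: "t : ?Z"
  then consider x where "t = (0, x)" "x : X" | "H t = 1" using H by auto
  thus "adj (B t) ** B t = mat 1"
   by cases (use t B0 B1 uni a1 in auto)
 qed
 then obtain V where V: "continuous_on ?T V" "!!t. t : ?T ==> adj (V t) ** V t = mat 1" "!!t. t : ?Z ==> V t = B t"
  by blast
 have "V (1, x) = mat 1" if "x : X" for x using V(3)[of "(1, x)"] B1[of "(1, x)"] H(2) that by simp
 moreover have "V (s, x) = mat 1" if "s : {0..1}" "x : D" for s x using V(3)[of "(s, x)"] B1[of "(s, x)"] H(3) that by simp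
 moreover have "V (0, x) = A x" if "x : X" for x using V(3)[of "(0, x)"] B0[OF that] that by simp
 ultimately have "continuous_on ?T V & (ALL t:?T. adj (V t) ** V t = mat 1) \<and>
   (ALL x:X. V (0, x) = A x & V (1, x) = mat 1) & (ALL s:{0..1}. ALL x:D. V (s, x) = mat 1)"
  using V(1,2) by simp
 thus ?thesis by (rule exI[of _ V])
qed

section \<open>Lifting a homotopy of self-maps of projective space to the sphere\<close>

text \<open>For a unit vector this is the orthogonal projection onto its line, a description of a
  point of projective space that is free of phases.\<close>

definition outer :: "complex ^ 'm => complex ^ 'm ^ 'm" where
 "outer w = (\<chi> i j. w $ i * cnj (w $ j))"

lemma outer_mult: "outer w *v (u :: complex ^ 'm::finite) = herm u w *s w"
 by (simp add: outer_def matrix_vector_mult_def herm_def vec_eq_iff sum_distrib_right sum_distrib_left mult.assoc mult.left_commute)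
   (auto intro!: sum.cong simp: ac_simps)

lemma norm_scalar_mult: "norm (c *s w) = cmod c * norm (w :: complex ^ 'm::finite)"
proof -
 have "(norm (c *s w))\<^sup>2 = (cmod c * norm w)\<^sup>2"
 proof -
  have "complex_of_real ((norm (c *s w))\<^sup>2) = c * cnj c * herm w w" unfolding herm_self[symmetric] by (simp add: herm_simps)
  also have "... = of_real ((cmod c * norm w)\<^sup>2)" unfolding herm_self by (simp add: power_mult_distrib complex_norm_square[symmetric])
  finally show ?thesis by (simp only: of_real_eq_iff)
 qed
 thus ?thesis by (simp add: power2_eq_iff_nonneg)
qed

lemma outer_eq_imp:
 assumes "outer v = outer w" "norm w = 1" shows "v = herm v w *s w"
proof (cases "v = 0")
 case True thus ?thesis by (simp add: herm_def)
next
 case False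
 have "outer v *v v = outer w *v v" using assms by simp
 hence e: "of_real ((norm v)\<^sup>2) *s v = herm v w *s w" by (simp add: outer_mult herm_self)
 have "outer v *v w = outer w *v w" using assms by simp
 hence e2: "herm w v *s v = w" using assms(2) by (simp add: outer_mult herm_self)
 hence "norm w = cmod (herm w v) * norm v" by (metis norm_scalar_mult)
 moreover have "norm (of_real ((norm v)\<^sup>2) *s v) = norm (herm v w *s w)" using e by simp
 hence "(norm v)\<^sup>2 * norm v = cmod (herm v w)" using assms(2) by (simp add: norm_scalar_mult norm_power del: of_real_power)
 moreover have "cmod (herm w v) = cmod (herm v w)" by (metis herm_simps(5) complex_mod_cnj)
 ultimately have "(norm v) ^ 4 = 1" using assms(2) by (simp add: power2_eq_square power4_eq_xxxx mult.assoc)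
 hence "norm v = 1" using power_eq_imp_eq_base[of "norm v" 4 1] by simp
 thus ?thesis using e by simp
qed

text \<open>Such a function takes values in the discrete set of periods of the exponential.\<close>

lemma exp_one_const:
 fixes k :: "'a::topological_space => complex"
 assumes "connected S" "continuous_on S k" "!!x. x : S ==> exp (k x) = 1" "a : S" "k a = 0" "x : S"
 shows "k x = 0"
proof -
 have "k constant_on S"
 proof (rule continuous_discrete_range_constant[OF assms(1,2)])
  fix x assume x: "x : S"
  show "EX e>0. ALL y. y : S & k y ~= k x --> e <= norm (k y - k x)"
  proof (intro exI[of _ 1] conjI allI impI)
   fix y assume y: "y : S & k y ~= k x"
   hence "exp (k y - k x) = 1" using assms(3) x by (simp add: exp_diff)
   then obtain n :: int where n: "Re (k y - k x) = 0" "Im (k y - k x) = of_int (2 * n) * pi" using exp_eq_1 by blast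
   hence "n ~= 0" using y by (auto simp: complex_eq_iff)
   hence "\<bar>Im (k y - k x)\<bar> >= 2 * pi" unfolding n by (simp add: abs_mult)
   thus "1 <= norm (k y - k x)" using abs_Im_le_cmod[of "k y - k x"] pi_gt3 by linarith
  qed simp
 qed
 thus ?thesis using assms(4-6) unfolding constant_on_def by metis
qed

lemma norm_adj_invariant:
 assumes "adj A ** A = mat 1" shows "herm (A *v u) (A *v v) = herm u (v :: complex ^ 'm::finite)"
proof -
 have un: "(SUM l:UNIV. cnj (A $ l $ i) * A $ l $ k) = (if i = k then 1 else 0)" for i k
  using assms by (simp add: vec_eq_iff adj_defs matrix_matrix_mult_def mat_def)
 have "herm (A *v u) (A *v v) = (SUM l:UNIV. SUM k:UNIV. SUM i:UNIV. u $ k * cnj (v $ i) * (cnj (A $ l $ i) * A $ l $ k))"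
  unfolding herm_def matrix_vector_mult_def by (simp add: sum_product ac_simps)
 also have "... = (SUM k:UNIV. SUM i:UNIV. u $ k * cnj (v $ i) * (SUM l:UNIV. cnj (A $ l $ i) * A $ l $ k))"
  unfolding sum_distrib_left by (subst sum.swap, rule sum.cong[OF refl], rule sum.swap)
 also have "... = herm u v" unfolding un herm_def by (simp add: if_distrib cong: if_cong)
 finally show ?thesis .
qed

text \<open>The projections are lifted to unit vectors by a discrete parallel transport from
  \<open>s = 1\<close>, where the lift is the identity. At \<open>s = 0\<close> the lift agrees with
  \<open>V x\<close> up to a phase depending on \<open>x\<close> and \<open>z\<close>. Its value at
  a fixed base vector is absorbed into a matrix \<open>A x\<close>; what remains has a logarithm and
  can be contracted.\<close>

theorem evaluation_null:
 fixes V :: "real \<times> (complex ^ 'n::finite) => complex ^ 'n option ^ 'n option"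
  and Ps :: "(real \<times> (real \<times> (complex ^ 'n))) \<times> (complex ^ 'n option) => complex ^ 'n option ^ 'n option"
 assumes X: "compact X" "convex X" and D: "D <= X" "x0 : D"
  and cont: "continuous_on (({0..1} \<times> X) \<times> sphere 0 1) Ps"
  and rank: "!!t z. t : {0..1} \<times> X ==> norm z = 1 ==> EX w. norm w = 1 & Ps (t, z) = outer w"
  and circ: "!!t z b. t : {0..1} \<times> X ==> norm z = 1 ==> norm b = 1 ==> Ps (t, b *s z) = Ps (t, z)"
  and stop: "!!x z. x : X ==> norm z = 1 ==> Ps ((1, x), z) = outer z"
  and bd: "!!s x z. s : {0..1} ==> x : D ==> norm z = 1 ==> Ps ((s, x), z) = outer z"
  and start: "!!x z. x : X ==> norm z = 1 ==> Ps ((0, x), z) = outer (V x *v z)"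
  and V: "!!x. x : X ==> adj (V x) ** V x = mat 1" "!!x. x : D ==> EX v. V x = mat v"
  and contV: "!!i k l q. continuous_on X (%x. V x $ i $ k * cnj (V x $ l $ q))"
 shows "EX U. continuous_on ({0..1::real} \<times> X) U & (ALL t:{0..1} \<times> X. adj (U t) ** U t = mat 1) \<and>
   (ALL x:X. (EX c. norm c = 1 & U (0, x) = (\<chi> i k. c * V x $ i $ k)) & U (1, x) = mat 1) & (ALL s:{0..1}. ALL x:D. U (s, x) = mat 1)"
proof -
 let ?T = "{0..1::real} \<times> X" and ?S = "sphere (0 :: complex ^ 'n option) 1"
 have x0X: "x0 : X" using D by auto
 have herm1: "herm z z = 1" if "norm z = 1" for z :: "complex ^ 'n option" using that by (simp add: herm_self)
 have contI: "continuous_on Y (%y. Ps ((sg y, xi y), et y))"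
  if "continuous_on Y sg" "continuous_on Y xi" "continuous_on Y et" "!!y. y : Y ==> sg y : {0..1} & xi y : X & norm (et y) = 1"
  for Y :: "'y::topological_space set" and sg xi et
  by (rule continuous_on_compose2[OF cont]) (use that in \<open>auto intro!: continuous_intros\<close>)
 \<comment> \<open>The squared overlap of the lines at two times. It is 1 for equal times, so
   uniform continuity keeps it from vanishing over time steps shorter than \<open>de\<close>, and
   projecting to the next line never gives 0.\<close>
 define q where "q p = (SUM i:UNIV. SUM j:UNIV. Ps ((fst (fst p), fst (snd p)), snd (snd p)) $ i $ j * cnj (Ps ((snd (fst p), fst (snd p)), snd (snd p)) $ i $ j))" for p
 let ?K = "({0..1::real} \<times> {0..1::real}) \<times> (X \<times> ?S)"
 have "continuous_on ?K q" unfolding q_def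
  by (intro continuous_intros contI) (auto)
 moreover have "compact ?K" using X by (intro compact_Times) auto
 ultimately have uc: "uniformly_continuous_on ?K q" by (rule compact_uniformly_continuous)
 have q_outer: "q ((s, s'), (x, z)) = herm w w' * cnj (herm w w')"
  if "Ps ((s, x), z) = outer w" "Ps ((s', x), z) = outer w'" for s s' x z w w'
 proof -
  have "q ((s, s'), (x, z)) = (SUM i:UNIV. SUM j:UNIV. (w $ i * cnj (w' $ i)) * (cnj (w $ j) * w' $ j))"
   unfolding q_def using that by (simp add: outer_def ac_simps)
  thus ?thesis unfolding herm_def by (simp add: sum_product)
 qed
 obtain de where de: "de > 0" "!!p p'. p : ?K ==> p' : ?K ==> dist p' p < de ==> dist (q p') (q p) < 1"
  using uc unfolding uniformly_continuous_on_def by (meson zero_less_one)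
 have close: "herm w w' ~= 0" if s: "s : {0..1}" "s' : {0..1}" "\<bar>s - s'\<bar> < de" and xz: "x : X" "norm z = 1"
  and w: "Ps ((s, x), z) = outer w" "Ps ((s', x), z) = outer w'" "norm w = 1" for s s' x z w w'
 proof
  assume h: "herm w w' = 0"
  have "dist ((s, s'), (x, z)) ((s, s), (x, z)) < de" using s(3) by (simp add: dist_Pair_Pair dist_real_def abs_minus_commute)
  hence "dist (q ((s, s'), (x, z))) (q ((s, s), (x, z))) < 1" using s xz by (intro de(2)) auto
  thus False using q_outer[OF w(1,2)] q_outer[OF w(1,1)] h herm1[OF w(3)] by (simp add: dist_norm)
 qed
 obtain N :: nat where N: "N > 0" "1 / real N < de" using de(1) by (metis nat_approx_posE zero_less_Suc)
 \<comment> \<open>After \<open>k\<close> steps the lift at time \<open>s\<close> has been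
   transported from time 1 to \<open>max s (1 - k / N)\<close>; the maximum stops it at
   \<open>s\<close>, so \<open>G N\<close> is a lift for all times at once. Projecting and
   normalizing commute with multiplication by unit scalars, which gives equivariance.\<close>
 define G where "G = rec_nat (%p. snd p) (%k G p. (let v = Ps ((max (fst (fst p)) (1 - real (Suc k) / real N), snd (fst p)), snd p) *v G p in v /\<^sub>R norm v))"
 have G0: "G 0 p = snd p" for p by (simp add: G_def)
 have GS: "G (Suc k) p = (let v = Ps ((max (fst (fst p)) (1 - real (Suc k) / real N), snd (fst p)), snd p) *v G k p in v /\<^sub>R norm v)" for k p
  by (simp add: G_def)
 have scaleR_s: "r *\<^sub>R v = of_real r *s v" for r and v :: "complex ^ 'n option" by (simp add: vec_eq_iff scaleR_conv_of_real[where 'a = complex])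
 have mv_s: "M *v (c *s v) = c *s (M *v v)" for M :: "complex ^ 'n option ^ 'n option" and c v
  by (simp add: vector_scalar_commute)
 have Gline: "norm (G k ((s, x), z)) = 1 & (EX w c. norm w = 1 & Ps ((max s (1 - real k / real N), x), z) = outer w & G k ((s, x), z) = c *s w)
   & (ALL b. norm b = 1 --> G k ((s, x), b *s z) = b *s G k ((s, x), z)) & ((s = 1 \<or> x : D) --> G k ((s, x), z) = z)"
  if k: "k <= N" and sx: "s : {0..1}" "x : X" and z: "norm z = 1" for k s x z
  using k
 proof (induction k)
  case 0
  have "max s 1 = 1" using sx by auto
  hence "EX w c. norm w = 1 & Ps ((max s (1 - real 0 / real N), x), z) = outer w & G 0 ((s, x), z) = c *s w"
   using stop[OF sx(2) z] z by (intro exI[of _ z], intro exI[of _ 1]) (simp add: G0)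
  thus ?case using z by (intro conjI) (simp_all add: G0)
 next
  case (Suc k)
  let ?s = "max s (1 - real k / real N)" and ?s' = "max s (1 - real (Suc k) / real N)"
  have "real (Suc k) / real N <= 1" "real k / real N <= 1" using Suc.prems N(1) by (simp_all add: divide_simps)
  hence s01: "?s : {0..1}" "?s' : {0..1}" using sx by (auto simp: max_def)
  have "real (Suc k) / real N = real k / real N + 1 / real N" by (simp add: add_divide_distrib)
  hence d: "(1 - real k / real N) - (1 - real (Suc k) / real N) = 1 / real N" by simp
  have "\<bar>max s a - max s b\<bar> <= \<bar>a - b\<bar>" for a b by (auto simp: max_def abs_if)
  from this[of "1 - real k / real N" "1 - real (Suc k) / real N"] have ss: "\<bar>?s - ?s'\<bar> < de"
   unfolding d using N(2) by simp
  note IH = Suc.IH[OF Suc_leD[OF Suc.prems]]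
  from IH obtain w c where w: "norm w = 1" "Ps ((?s, x), z) = outer w" "G k ((s, x), z) = c *s w" by (elim conjE exE)
  have Gk: "norm (G k ((s, x), z)) = 1" using IH by (rule conjunct1)
  have eq: "G k ((s, x), b *s z) = b *s G k ((s, x), z)" if "norm b = 1" for b using IH that by simp
  have fx: "s = 1 \<or> x : D ==> G k ((s, x), z) = z" using IH by simp
  obtain w' where w': "norm w' = 1" "Ps ((?s', x), z) = outer w'" using rank[of "(?s', x)" z] s01 sx z by auto
  have c1: "cmod c = 1" using Gk w by (simp add: norm_scalar_mult)
  let ?v = "Ps ((?s', x), z) *v G k ((s, x), z)"
  have v: "?v = (c * herm w w') *s w'" unfolding w' w(3) outer_mult by (simp add: herm_simps)
  have "herm w w' ~= 0" by (rule close[OF s01 ss sx(2) z w(2) w'(2) w(1)])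
  hence v0: "norm ?v ~= 0" using c1 w'(1) unfolding v by (auto simp: norm_scalar_mult)
  have G1: "G (Suc k) ((s, x), z) = ?v /\<^sub>R norm ?v" unfolding GS by (simp add: Let_def)
  have "norm (G (Suc k) ((s, x), z)) = 1" unfolding G1 using v0 by simp
  moreover have "G (Suc k) ((s, x), z) = (of_real (inverse (norm ?v)) * (c * herm w w')) *s w'"
   unfolding G1 scaleR_s by (subst (2) v) simp
  moreover have "G (Suc k) ((s, x), b *s z) = b *s G (Suc k) ((s, x), z)" if b: "norm b = 1" for b
  proof -
   have "Ps ((?s', x), b *s z) = Ps ((?s', x), z)" by (rule circ) (use s01 sx z b in auto)
   hence "G (Suc k) ((s, x), b *s z) = (b *s ?v) /\<^sub>R norm (b *s ?v)" unfolding GS by (simp add: Let_def eq[OF b] mv_s)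
   thus ?thesis unfolding G1 by (simp add: norm_scalar_mult b scaleR_s mult.commute)
  qed
  moreover have "G (Suc k) ((s, x), z) = z" if f: "s = 1 \<or> x : D"
  proof -
   have "Ps ((?s', x), z) = outer z"
   proof (cases "s = 1")
    case True
    hence "?s' = 1" using N(1) by simp
    thus ?thesis using stop[OF sx(2) z] by simp
   next
    case False
    thus ?thesis using f by (intro bd s01 z) auto
   qed
   hence "?v = z" unfolding fx[OF f] by (simp add: outer_mult herm1 z)
   thus ?thesis unfolding G1 using z by simp
  qed
  ultimately show ?case using w' by blast
 qed
 have cG: "k <= N ==> continuous_on (?T \<times> ?S) (G k)" for k
 proof (induction k)
  case 0
  have "G 0 = snd" by (rule ext) (rule G0)
  thus ?case by (simp add: continuous_on_snd)
 next
  case (Suc k)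
  let ?v = "%p. Ps ((max (fst (fst p)) (1 - real (Suc k) / real N), snd (fst p)), snd p) *v G k p"
  have le: "0 <= 1 - real (Suc k) / real N" using Suc.prems N(1) by (simp add: divide_simps)
  have "continuous_on (?T \<times> ?S) (%p. Ps ((max (fst (fst p)) (1 - real (Suc k) / real N), snd (fst p)), snd p))"
   by (rule contI[of _ "%p. max (fst (fst p)) (1 - real (Suc k) / real N)" "%p. snd (fst p)" snd]; (intro continuous_intros)?) (use le in \<open>auto simp: max_def\<close>)
  hence cv: "continuous_on (?T \<times> ?S) ?v" unfolding matrix_vector_mult_def
   using Suc by (auto intro!: continuous_intros)
  have "norm (?v p) ~= 0" if "p : ?T \<times> ?S" for p
  proof
   assume "norm (?v p) = 0"
   hence "norm (G (Suc k) p) = 0" unfolding GS by (simp add: Let_def)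
   thus False using Gline[OF Suc.prems, of "fst (fst p)" "snd (fst p)" "snd p"] that by auto
  qed
  hence "continuous_on (?T \<times> ?S) (%p. ?v p /\<^sub>R norm (?v p))" by (intro continuous_intros cv) auto
  moreover have "G (Suc k) = (%p. ?v p /\<^sub>R norm (?v p))" by (rule ext) (simp only: GS Let_def)
  ultimately show ?case by simp
 qed
 define F where "F = G N"
 have cF: "continuous_on (?T \<times> ?S) F" unfolding F_def by (rule cG) simp
 have F1: "norm (F ((s, x), z)) = 1" and Feq: "norm b = 1 ==> F ((s, x), b *s z) = b *s F ((s, x), z)"
  and Ffix: "s = 1 \<or> x : D ==> F ((s, x), z) = z"
  if "s : {0..1}" "x : X" "norm z = 1" for s x z b
  using Gline[OF order_refl that] unfolding F_def by blast+
 have Fstart: "EX nu. cmod nu = 1 & F ((0, x), z) = nu *s (V x *v z)" if x: "x : X" and z: "norm z = 1" for x z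
 proof -
  obtain w c where w: "norm w = 1" "Ps ((max 0 (1 - real N / real N), x), z) = outer w" "F ((0, x), z) = c *s w"
   using Gline[OF order_refl _ x z, of 0] unfolding F_def by auto
  hence o: "outer (V x *v z) = outer w" using start[OF x z] N(1) by simp
  have nV: "norm (V x *v z) = 1"
  proof -
   have "complex_of_real ((norm (V x *v z))\<^sup>2) = 1" unfolding herm_self[symmetric] norm_adj_invariant[OF V(1)[OF x]] herm1[OF z] ..
   hence "(norm (V x *v z))\<^sup>2 = 1" by (simp only: of_real_eq_1_iff)
   thus ?thesis using power2_eq_iff_nonneg[of "norm (V x *v z)" 1] by simp
  qed
  have "w = herm w (V x *v z) *s (V x *v z)" by (rule outer_eq_imp[OF o[symmetric] nV])
  hence e: "F ((0, x), z) = (c * herm w (V x *v z)) *s (V x *v z)" using w(3) by (metis vector_smult_assoc)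
  hence "cmod (c * herm w (V x *v z)) = 1" using F1[of 0, OF _ x z] nV by (simp add: norm_scalar_mult del: norm_mult)
  thus ?thesis using e by blast
 qed
 let ?z0 = "axis None 1 :: complex ^ 'n option"
 have nz0: "norm ?z0 = 1" by (simp add: norm_axis_1)
 have Vz0: "(V x *v ?z0) $ l = V x $ l $ None" for x l by (simp add: matrix_vector_mult_def axis_def if_distrib cong: if_cong)
 \<comment> \<open>\<open>V\<close> enters together with its own conjugate, so \<open>A\<close> is
   continuous although only products of entries of \<open>V\<close> with conjugates of entries are
   known to be. The phase is chosen to make \<open>A x\<close> agree with the lift at the base
   vector.\<close>
 define A where "A x = (if x : X then (\<chi> i k. herm (F ((0, x), ?z0)) (V x *v ?z0) * V x $ i $ k) else mat 1)" for x
 have A: "EX c. cmod c = 1 & A x = (\<chi> i k. c * V x $ i $ k) & (ALL z. A x *v z = c *s (V x *v z)) & F ((0, x), ?z0) = A x *v ?z0" if x: "x : X" for x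
 proof -
  obtain nu where nu: "cmod nu = 1" "F ((0, x), ?z0) = nu *s (V x *v ?z0)" using Fstart[OF x nz0] by blast
  have "herm (F ((0, x), ?z0)) (V x *v ?z0) = nu" unfolding nu(2) herm_simps norm_adj_invariant[OF V(1)[OF x]] by (simp add: herm1 nz0)
  hence A: "A x = (\<chi> i k. nu * V x $ i $ k)" using x by (simp add: A_def)
  have "A x *v z = nu *s (V x *v z)" for z unfolding A by (simp add: matrix_vector_mult_def vec_eq_iff sum_distrib_left mult.assoc)
  thus ?thesis using nu A by (intro exI[of _ nu]) auto
 qed
 have uA: "adj (A x) ** A x = mat 1" for x
 proof (cases "x : X")
  case True
  then obtain c where c: "cmod c = 1" "A x = (\<chi> i k. c * V x $ i $ k)" using A by blast
  have cc: "cnj c * c = 1" using c(1) complex_norm_square[of c] by (simp add: mult.commute)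
  have "(adj (A x) ** A x) $ i $ k = cnj c * c * (adj (V x) ** V x) $ i $ k" for i k
   unfolding c(2) by (simp add: adj_defs matrix_matrix_mult_def sum_distrib_left ac_simps)
  thus ?thesis unfolding cc V(1)[OF True] by (simp add: vec_eq_iff)
 next
  case False
  have "adj (mat 1 :: complex ^ 'n option ^ 'n option) = mat 1" by (simp add: adj_defs mat_def vec_eq_iff)
  thus ?thesis using False by (simp add: A_def)
 qed
 have AD: "A x = mat 1" if x: "x : D" for x
 proof -
  obtain v where v: "V x = mat v" using V(2)[OF x] by blast
  have xX: "x : X" using x D by auto
  have "F ((0, x), ?z0) = ?z0" by (rule Ffix) (use x xX nz0 in auto)
  moreover obtain c where c: "A x = (\<chi> i k. c * V x $ i $ k)" "A x *v ?z0 = c *s (V x *v ?z0)" "F ((0, x), ?z0) = A x *v ?z0" using A[OF xX] by blast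
  ultimately have "(c *s (V x *v ?z0)) $ None = ?z0 $ None" by simp
  hence "c * v = 1" unfolding vector_smult_component Vz0 by (simp add: v mat_def axis_def)
  thus ?thesis unfolding c(1) v by (simp add: mat_def vec_eq_iff)
 qed
 have cA: "continuous_on X A"
 proof -
  have "continuous_on X (%x. \<chi> i k. SUM l:UNIV. F ((0, x), ?z0) $ l * (V x $ i $ k * cnj (V x $ l $ None)))"
  proof (intro continuous_on_vec_lambda continuous_on_sum continuous_on_mult[OF _ contV])
   fix l
   have "continuous_on X (%x. F ((0, x), ?z0))"
    by (rule continuous_on_compose2[OF cF]) (use nz0 in \<open>auto intro!: continuous_intros\<close>)
   thus "continuous_on X (%x. F ((0, x), ?z0) $ l)" by (intro continuous_intros)
  qed
  thus ?thesis
  proof (rule continuous_on_eq)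
   fix x assume "x : X"
   thus "(\<chi> i k. SUM l:UNIV. F ((0, x), ?z0) $ l * (V x $ i $ k * cnj (V x $ l $ None))) = A x"
    unfolding A_def by (simp add: herm_def Vz0 vec_eq_iff sum_distrib_left ac_simps)
  qed
 qed
 \<comment> \<open>The remaining phase. It is 1 at the base vector and on \<open>D\<close>, and
   invariant under the circle action.\<close>
 define mu where "mu x z = herm (F ((0, x), z)) (A x *v z)" for x z
 have nA: "norm (A x *v z) = 1" if "norm z = 1" for x z
 proof -
  have "complex_of_real ((norm (A x *v z))\<^sup>2) = 1" unfolding herm_self[symmetric] norm_adj_invariant[OF uA] herm1[OF that] ..
  hence "(norm (A x *v z))\<^sup>2 = 1" by (simp only: of_real_eq_1_iff)
  thus ?thesis using power2_eq_iff_nonneg[of "norm (A x *v z)" 1] by simp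
 qed
 have mu: "F ((0, x), z) = mu x z *s (A x *v z)" "cmod (mu x z) = 1" if x: "x : X" and z: "norm z = 1" for x z
 proof -
  obtain c where c: "cmod c = 1" "!!z. A x *v z = c *s (V x *v z)" using A[OF x] by blast
  obtain nu where nu: "cmod nu = 1" "F ((0, x), z) = nu *s (V x *v z)" using Fstart[OF x z] by blast
  have c0: "c ~= 0" using c(1) by auto
  have e: "F ((0, x), z) = (nu / c) *s (A x *v z)" unfolding nu(2) c(2) using c0 by (simp add: vector_smult_assoc)
  have "mu x z = nu / c" unfolding mu_def e herm_simps herm1[OF nA[OF z]] by simp
  thus "F ((0, x), z) = mu x z *s (A x *v z)" "cmod (mu x z) = 1" using e c(1) nu(1) by (simp_all add: norm_divide)
 qed
 have cAz: "continuous_on (X \<times> ?S) (%p. A (fst p) *v snd p)"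
 proof -
  have "continuous_on (X \<times> ?S) (%p. A (fst p))" by (rule continuous_on_compose2[OF cA]) (auto intro!: continuous_intros)
  thus ?thesis unfolding matrix_vector_mult_def by (intro continuous_intros)
 qed
 have cFz: "continuous_on (X \<times> ?S) (%p. F ((0, fst p), snd p))"
  by (rule continuous_on_compose2[OF cF]) (auto intro!: continuous_intros)
 have cmu: "continuous_on (X \<times> ?S) (%p. mu (fst p) (snd p))"
  unfolding mu_def herm_def by (intro continuous_intros cFz cAz)
 have mu_base: "mu x ?z0 = 1" if "x : X" for x
  using A[OF that] nA[OF nz0, of x] unfolding mu_def by (auto simp: herm1)
 have mu_D: "mu x z = 1" if "x : D" "norm z = 1" for x z
  using Ffix[of 0 x z] that D AD[OF that(1)] by (auto simp: mu_def herm1)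
 have mu_b: "mu x (b *s z) = mu x z" if "x : X" "norm z = 1" "norm b = 1" for x z b
 proof -
  have "b * cnj b = 1" using that(3) complex_norm_square[of b] by simp
  moreover have "mu x (b *s z) = b * cnj b * mu x z"
   unfolding mu_def using Feq[of 0 x z b] that by (simp add: mv_s herm_simps ac_simps)
  ultimately show ?thesis by simp
 qed
 \<comment> \<open>A logarithm of \<open>mu\<close>, by contracting the parameter space.\<close>
  define h where "h p = mu (x0 + fst p *\<^sub>R (fst (snd p) - x0)) (snd (snd p))" for p :: "real \<times> ((real \<times> (complex ^ 'n)) \<times> (complex ^ 'n option))"
 have line: "x0 + ta *\<^sub>R (x - x0) : X" if "ta : {0..1}" "x : X" for ta x
 proof -
  have "(1 - ta) *\<^sub>R x0 + ta *\<^sub>R x : X" by (rule convexD_alt[OF X(2) x0X that(2)]) (use that in auto)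
  thus ?thesis by (simp add: algebra_simps)
 qed
 have ch: "continuous_on ({0..1} \<times> (X \<times> ?S)) h" unfolding h_def
  by (rule continuous_on_compose2[OF cmu, of _ "%p. (x0 + fst p *\<^sub>R (fst (snd p) - x0), snd (snd p))", simplified fst_conv snd_conv])
    (use line in \<open>auto intro!: continuous_intros\<close>)
 have h1: "cmod (h (ta, (x, z))) = 1" if "ta : {0..1}" "x : X" "norm z = 1" for ta x z
  unfolding h_def using mu(2)[OF line[OF that(1,2)] that(3)] by simp
 have "h ` ({0..1} \<times> (X \<times> ?S)) <= - {0}" using h1 by force
 hence hm: "h : {0..1} \<times> (X \<times> ?S) \<rightarrow> - {0}" by blast
 obtain k where k: "continuous_on ({0..1} \<times> (X \<times> ?S)) k" "k : ({0..1} \<times> (X \<times> ?S)) \<rightarrow> UNIV"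
  "!!y. y : X \<times> ?S ==> k (0, y) = 0" "!!p. p : {0..1} \<times> (X \<times> ?S) ==> h p = exp (k p)"
 proof (rule covering_space_lift_homotopy[OF covering_space_exp_punctured_plane ch hm, of "%_. 0"])
  show "h (0, y) = exp 0" if "y : X \<times> ?S" for y
   using that mu_D[OF D(2), of "snd y"] by (auto simp: h_def)
 qed auto
 define ga where "ga x z = k (1, (x, z))" for x z
 have ega: "exp (ga x z) = mu x z" if "x : X" "norm z = 1" for x z
  using k(4)[of "(1, (x, z))"] that by (simp add: ga_def h_def)
 have cga: "continuous_on (X \<times> ?S) (%p. ga (fst p) (snd p))"
  unfolding ga_def by (rule continuous_on_compose2[OF k(1)]) (auto intro!: continuous_intros)
 have ga_base: "ga x ?z0 = 0" if x: "x : X" for x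
  unfolding ga_def
 proof (rule exp_one_const[of "{0..1::real}" "%ta. k (ta, (x, ?z0))" 0 1])
  show "continuous_on {0..1} (%ta. k (ta, (x, ?z0)))"
   by (rule continuous_on_compose2[OF k(1)]) (use x nz0 in \<open>auto intro!: continuous_intros\<close>)
  show "exp (k (ta, (x, ?z0))) = 1" if "ta : {0..1}" for ta
   using k(4)[of "(ta, (x, ?z0))"] that x nz0 mu_base[OF line[OF that x]] by (simp add: h_def)
 qed (use k(3)[of "(x, ?z0)"] x nz0 in auto)
 have conS: "connected ?S" by (rule connected_sphere) (use zero_less_card_finite[where ?'a = "'n option"] in simp)
 \<comment> \<open>On \<open>D\<close> the logarithm takes values among the periods of the
   exponential; connectedness of the sphere spreads the value 0 from the base vector.\<close>
 have ga_D: "ga x z = 0" if x: "x : D" and z: "norm z = 1" for x z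
 proof (rule exp_one_const[OF conS, of "ga x" ?z0])
  have xX: "x : X" using x D by auto
  have "continuous_on ?S (%z. ga (fst (x, z)) (snd (x, z)))"
   by (rule continuous_on_compose2[OF cga continuous_on_Pair[OF continuous_on_const continuous_on_id]]) (use xX in auto)
  thus "continuous_on ?S (ga x)" by simp
  show "exp (ga x z) = 1" if "z : ?S" for z using ega[OF xX, of z] mu_D[OF x, of z] that by simp
  show "ga x ?z0 = 0" by (rule ga_base[OF xX])
 qed (use nz0 z in auto)
 have ga_b: "ga x (b *s z) = ga x z" if x: "x : X" and z: "norm z = 1" and b: "norm b = 1" for x z b
 proof -
  have nb: "norm (b *s z) = 1" if "norm b = 1" for b using that z by (simp add: norm_scalar_mult)
  have "ga x (b *s z) - ga x z = 0"
  proof (rule exp_one_const[of "sphere (0::complex) 1" "%b. ga x (b *s z) - ga x z" 1 b])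
   show "connected (sphere (0::complex) 1)" by (rule connected_sphere) simp
   have "continuous_on (sphere 0 1) (%b. b *s z)" unfolding vector_scalar_mult_def by (intro continuous_intros)
   thus "continuous_on (sphere 0 1) (%b. ga x (b *s z) - ga x z)"
    using x nb by (intro continuous_intros continuous_on_compose2[OF cga, of _ "%b. (x, b *s z)", simplified]) auto
   show "exp (ga x (b *s z) - ga x z) = 1" if "b : sphere 0 1" for b
    using that x z ega[OF x nb[of b]] ega[OF x z] mu_b[OF x z, of b] by (simp add: exp_diff) (metis exp_not_eq_zero divide_self)
  qed (use b in auto)
  thus ?thesis by simp
 qed
 \<comment> \<open>In the first half of the time the remaining phase is faded in, leading from
   \<open>A x *v z\<close> to the lift at time 0; in the second half the lift runs to the
   identity.\<close>
 define F' where "F' p = exp (- of_real (max 0 (1 - 2 * fst (fst p))) * ga (snd (fst p)) (snd p)) *s F ((max 0 (2 * fst (fst p) - 1), snd (fst p)), snd p)" for p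
 have U: "unitary_family X D A"
 proof
  show "A x = mat 1" if "x : D \<or> x ~: X" for x using that by (cases "x : D") (simp add: AD, simp add: A_def)
 qed (rule D cA uA)+
 have rega: "Re (ga x z) = 0" if "x : X" "norm z = 1" for x z
 proof -
  have "exp (Re (ga x z)) = 1" using ega[OF that] mu(2)[OF that] norm_exp_eq_Re[of "ga x z"] by simp
  thus ?thesis by simp
 qed
 have m01: "max 0 (2 * s - 1) : {0..1}" if "s : {0..1}" for s :: real using that by auto
 have "EX V. continuous_on ({0..1::real} \<times> X) V & (ALL t:{0..1} \<times> X. adj (V t) ** V t = mat 1) \<and>
   (ALL x:X. V (0, x) = A x & V (1, x) = mat 1) & (ALL s:{0..1}. ALL x:D. V (s, x) = mat 1)"
 proof (rule unitary_null[OF U X(1) x0X, of F'])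
  have "continuous_on (?T \<times> ?S) (%p. ga (snd (fst p)) (snd p))"
   by (rule continuous_on_compose2[OF cga, of _ "%p. (snd (fst p), snd p)", simplified fst_conv snd_conv]) (auto intro!: continuous_intros)
  moreover have "continuous_on (?T \<times> ?S) (%p. F ((max 0 (2 * fst (fst p) - 1), snd (fst p)), snd p))"
   by (rule continuous_on_compose2[OF cF]) (auto intro!: continuous_intros)
  ultimately show "continuous_on (?T \<times> ?S) F'"
   unfolding F'_def[abs_def] vector_scalar_mult_def by (intro continuous_intros)
  show "norm (F' (t, z)) = 1" if t: "t : ?T" and z: "norm z = 1" for t z
  proof -
   have "norm (F ((max 0 (2 * fst t - 1), snd t), z)) = 1" by (rule F1) (use t z m01 in auto)
   thus ?thesis using rega[of "snd t" z] t z by (auto simp: F'_def norm_scalar_mult)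
  qed
  show "F' (t, b *s z) = b *s F' (t, z)" if t: "t : ?T" and z: "norm z = 1" and b: "norm b = 1" for t z b
  proof -
   have "F ((max 0 (2 * fst t - 1), snd t), b *s z) = b *s F ((max 0 (2 * fst t - 1), snd t), z)"
    by (rule Feq) (use t z b m01 in auto)
   moreover have "ga (snd t) (b *s z) = ga (snd t) z" by (rule ga_b) (use t z b in auto)
   ultimately show ?thesis by (simp add: F'_def vector_smult_assoc mult.commute)
  qed
  show "F' ((0, x), z) = A x *v z" if x: "x : X" and z: "norm z = 1" for x z
  proof -
   have "mu x z ~= 0" using mu(2)[OF x z] by auto
   thus ?thesis using mu(1)[OF x z] ega[OF x z] by (simp add: F'_def exp_minus vector_smult_assoc)
  qed
  show "F' ((1, x), z) = z" if "x : X" "norm z = 1" for x z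
   using Ffix[of 1 x z] that by (simp add: F'_def)
  show "F' ((s, x), z) = z" if "s : {0..1}" "x : D" "norm z = 1" for s x z
   using Ffix[of "max 0 (2 * s - 1)" x z] ga_D[of x z] that D m01[OF that(1)] by (auto simp: F'_def)
 qed
 then obtain W where W: "continuous_on ({0..1::real} \<times> X) W & (ALL t:{0..1} \<times> X. adj (W t) ** W t = mat 1) \<and>
   (ALL x:X. W (0, x) = A x & W (1, x) = mat 1) & (ALL s:{0..1}. ALL x:D. W (s, x) = mat 1)" ..
 have "EX c. norm c = 1 & W (0, x) = (\<chi> i k. c * V x $ i $ k)" if x: "x : X" for x
  using A[OF x] W x by auto
 thus ?thesis using W by (intro exI[of _ W]) simp
qed

section \<open>The unitary action in affine charts\<close>

lemma Rep_line_through: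
 fixes z :: "complex ^ 'n::finite option"
 assumes "z ~= 0" shows "Rep_cproj (line_through z) = vec.span {z}"
proof -
 have "vec.dim (vec.span {z}) = 1"
  using assms by (subst vec.dim_span, subst vec.dim_eq_card_independent) (auto simp: vec.dependent_single)
 thus ?thesis unfolding line_through_def by (intro Abs_cproj_inverse) (auto intro: vec.subspace_span)
qed

lemma line_through_eq_iff:
 fixes z w :: "complex ^ 'n::finite option"
 assumes "z ~= 0" "w ~= 0" shows "line_through z = line_through w \<longleftrightarrow> (EX c. w = c *s z)"
proof
 assume "line_through z = line_through w"
 hence "vec.span {z} = vec.span {w}" using Rep_line_through assms by metis
 thus "EX c. w = c *s z" using vec.span_base[of w "{w}"] by (auto simp: vec.span_singleton)
next
 assume "EX c. w = c *s z"
 then obtain c where c: "w = c *s z" by blast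
 hence "c ~= 0" using assms by auto
 hence "vec.span {w} = vec.span {z}" unfolding vec.span_singleton c
  by (auto simp: vector_smult_assoc image_iff intro!: exI[of _ "_ / c"])
 thus "line_through z = line_through w" by (simp add: line_through_def)
qed

lemma line_through_scale: "c ~= 0 ==> line_through (c *s z) = line_through (z :: complex ^ 'n::finite option)"
proof (cases "z = 0")
 case False
 assume "c ~= 0"
 hence "line_through z = line_through (c *s z)"
  using False by (subst line_through_eq_iff) (auto simp: vector_mul_eq_0)
 thus ?thesis ..
qed simp

lemma cproj_line_through:
 fixes p :: "'n::finite cproj" obtains z where "norm z = 1" "p = line_through z"
proof -
 have p: "vec.subspace (Rep_cproj p)" "vec.dim (Rep_cproj p) = 1" using Rep_cproj[of p] by auto
 obtain B where B: "B <= Rep_cproj p" "vec.independent B" "Rep_cproj p <= vec.span B" "card B = vec.dim (Rep_cproj p)"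
  by (rule vec.basis_exists)
 then obtain z where z: "B = {z}" using p(2) by (metis card_1_singletonE)
 have z0: "z ~= 0" using B(2) z vec.dependent_single by auto
 have "Rep_cproj p = vec.span {z}" using B z vec.span_minimal[OF B(1) p(1)] by auto
 hence pz: "p = line_through z" by (metis Rep_line_through[OF z0] Rep_cproj_inject)
 show ?thesis
 proof (rule that[of "of_real (1 / norm z) *s z"])
  show "norm (of_real (1 / norm z) *s z) = 1" using z0 by (simp add: norm_scalar_mult norm_divide)
  have "complex_of_real (1 / norm z) ~= 0" using z0 by simp
  thus "p = line_through (of_real (1 / norm z) *s z)" unfolding pz by (rule line_through_scale[symmetric])
 qed
qed

text \<open>Left inverse of \<open>homog k c\<close>: the entry displaced to position
  \<open>None\<close> is read back from there.\<close>

definition unhomog :: "'n::finite option => complex ^ 'n option => complex ^ 'n" where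
 "unhomog k y = (\<chi> m. y $ (if k = Some m then None else Some m))"

lemma homog_nth_self [simp]: "homog k c w $ k = c" by (simp add: homog_def)

lemma unhomog_homog [simp]: "unhomog k (homog k c w) = w"
 by (auto simp: unhomog_def homog_def vec_eq_iff)

lemma homog_unhomog: "homog k (y $ k) (unhomog k y) = y"
 by (auto simp: unhomog_def homog_def vec_eq_iff split: option.split)

lemma homog_nonzero [simp]: "homog k 1 w ~= 0"
 using homog_nth_self[of k 1 w] by (metis zero_index zero_neq_one)

lemma line_through_affine:
 assumes "z $ k ~= 0" shows "line_through z = affine_param k (unhomog k (inverse (z $ k) *s z))"
proof -
 have "homog k ((inverse (z $ k) *s z) $ k) (unhomog k (inverse (z $ k) *s z)) = inverse (z $ k) *s z" by (rule homog_unhomog)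
 hence "homog k 1 (unhomog k (inverse (z $ k) *s z)) = inverse (z $ k) *s z" using assms by simp
 thus ?thesis using assms by (simp add: affine_param_def line_through_scale)
qed

lemma inj_affine_param: "inj (affine_param (k :: 'n::finite option))"
proof (rule injI)
 fix w w' :: "complex ^ 'n" assume "affine_param k w = affine_param k w'"
 then obtain c where c: "homog k 1 w' = c *s homog k 1 w" unfolding affine_param_def by (auto simp: line_through_eq_iff)
 have "c = 1" using arg_cong[OF c, of "%y. y $ k"] by simp
 hence "homog k 1 w' = homog k 1 w" using c by simp
 thus "w = w'" by (metis unhomog_homog)
qed

lemma chart_affine_param [simp]: "chart k (affine_param k w) = w"
 unfolding chart_def by (rule inv_into_f_f[OF inj_affine_param UNIV_I])

lemma line_in_chart_domain:
 fixes z :: "complex ^ 'n::finite option"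
 assumes "z ~= 0" shows "line_through z : chart_domain k \<longleftrightarrow> z $ k ~= 0"
proof
 assume "line_through z : chart_domain k"
 then obtain w where "line_through (homog k 1 w) = line_through z" unfolding chart_domain_def affine_param_def by auto
 then obtain c where "z = c *s homog k 1 w" using line_through_eq_iff[of "homog k 1 w" z] assms by auto
 thus "z $ k ~= 0" using assms by auto
qed (simp add: line_through_affine chart_domain_def)

lemma chart_line_through: "z $ k ~= 0 ==> chart k (line_through z) = unhomog k (inverse (z $ k) *s z)"
 by (simp add: line_through_affine)

definition coset_of :: "complex ^ 'm ^ 'm => (complex ^ 'm ^ 'm::finite) set" where
 "coset_of A = unit_scalars #>\<^bsub>unitary_group\<^esub> A"

lemma mem_unitary: "A : carrier unitary_group \<longleftrightarrow> adj A ** A = mat 1"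
 by (simp add: unitary_group_def adj_def)

lemma mat_mult: "mat c ** A = (\<chi> i k. c * A $ i $ k)"
 by (simp add: mat_def matrix_matrix_mult_def vec_eq_iff if_distrib[of "%x. x * _"] cong: if_cong)

lemma mat_mult_vec: "(mat c ** A) *v z = c *s (A *v z)"
 by (simp add: mat_mult matrix_vector_mult_def vec_eq_iff sum_distrib_left mult.assoc)

lemma coset_of_eq: "coset_of A = {mat c ** A | c. norm c = 1}"
 by (auto simp: coset_of_def r_coset_def unit_scalars_def unitary_group_def)

lemma unitary_nonzero: "adj A ** A = mat 1 ==> z ~= 0 ==> A *v z ~= (0 :: complex ^ 'm::finite)"
 by (metis matrix_vector_mul_assoc matrix_vector_mul_lid matrix_vector_mult_0_right)

lemma PU_action_line:
 fixes A :: "complex ^ 'n option ^ 'n::finite option"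
 assumes A: "adj A ** A = mat 1" and z: "z ~= 0"
 shows "PU_action (coset_of A) (line_through z) = line_through (A *v z)"
proof -
 have 1: "Abs_cproj ((*v) (mat c ** A) ` Rep_cproj (line_through z)) = line_through (A *v z)" if "norm c = 1" for c
 proof -
  have c0: "c ~= 0" using that by auto
  have "(*v) (mat c ** A) ` vec.span {z} = vec.span {A *v z}"
  proof -
   have *: "(mat c ** A) *v (k *s z) = (c * k) *s (A *v z)" for k
    by (simp add: mat_mult_vec vector_scalar_commute vector_smult_assoc)
   hence "(*v) (mat c ** A) ` vec.span {z} = range (%k. (c * k) *s (A *v z))" unfolding vec.span_singleton by (simp only: image_image *)
   also have "... = vec.span {A *v z}" unfolding vec.span_singleton
   proof (intro equalityI subsetI)
    fix y assume "y : range (%k. k *s (A *v z))"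
    then obtain k where "y = (c * (k / c)) *s (A *v z)" using c0 by auto
    thus "y : range (%k. (c * k) *s (A *v z))" by blast
   qed auto
   finally show ?thesis .
  qed
  thus ?thesis unfolding Rep_line_through[OF z] by (simp add: line_through_def)
 qed
 have "(%A. Abs_cproj ((*v) A ` Rep_cproj (line_through z))) ` coset_of A = {line_through (A *v z)}"
 proof -
  have "mat 1 ** A : coset_of A" unfolding coset_of_eq by (intro CollectI exI[of _ 1]) simp
  hence ne: "coset_of A ~= {}" by blast
  have "(%A. Abs_cproj ((*v) A ` Rep_cproj (line_through z))) ` coset_of A = (%_. line_through (A *v z)) ` coset_of A"
   by (rule image_cong[OF refl]) (auto simp: coset_of_eq intro: 1)
  thus ?thesis using ne by (simp add: image_constant_conv)
 qed
 thus ?thesis by (simp add: PU_action_def)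
qed

section \<open>Smoothness and invariance of the unitary action in charts\<close>

definition lrep :: "'n::finite option => 'n option => complex ^ 'n option ^ 'n option => complex ^ 'n => complex ^ 'n" where
 "lrep i k A w = unhomog k (inverse ((A *v homog i 1 w) $ k) *s (A *v homog i 1 w))"

definition ldom :: "'n::finite option => 'n option => ((complex ^ 'n option ^ 'n option) \<times> (complex ^ 'n)) set" where
 "ldom i k = {p. (fst p *v homog i 1 (snd p)) $ k ~= 0}"

lemma local_rep_PU_action:
 assumes A: "adj A ** A = mat 1"
 shows "local_rep_domain i k (PU_action (coset_of A)) = {w. (A, w) : ldom i k}"
  and "(A, w) : ldom i k ==> local_rep i k (PU_action (coset_of A)) w = lrep i k A w"
proof -
 have 1: "PU_action (coset_of A) (affine_param i w) = line_through (A *v homog i 1 w)" for w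
  unfolding affine_param_def by (rule PU_action_line[OF A]) simp
 show "local_rep_domain i k (PU_action (coset_of A)) = {w. (A, w) : ldom i k}"
  by (auto simp: local_rep_domain_def 1 ldom_def line_in_chart_domain unitary_nonzero[OF A])
 show "(A, w) : ldom i k ==> local_rep i k (PU_action (coset_of A)) w = lrep i k A w"
  by (simp add: local_rep_def 1 ldom_def chart_line_through lrep_def)
qed

lemma continuous_homog: "continuous_on S f ==> continuous_on S (%x. homog i c (f x))"
 unfolding homog_def
proof (intro continuous_on_vec_lambda)
 fix l assume "continuous_on S f"
 thus "continuous_on S (%x. if l = i then c else case l of None => f x $ the i | Some m => f x $ m)"
  by (cases "l = i"; cases l) (auto intro!: continuous_intros)
qed

lemma open_ldom: "open (ldom i k)"
proof -
 have "continuous_on UNIV (%p. (fst p *v homog i 1 (snd p)) $ k)"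
  unfolding matrix_vector_mult_def by (intro continuous_intros continuous_homog)
 hence "open ((%p. (fst p *v homog i 1 (snd p)) $ k) -` (- {0}))"
  by (intro open_vimage) auto
 thus ?thesis by (simp add: ldom_def vimage_def)
qed

text \<open>A class of functions of a parameter and a point that is closed under partial derivatives
  with respect to the point, so that all of these depend continuously on the parameter.\<close>

inductive rat :: "('a::topological_space \<times> (complex ^ 'n::finite)) set => ('a \<times> (complex ^ 'n) => complex) => bool"
 for Om where
 const: "continuous_on UNIV c ==> rat Om (%p. c (fst p))"
| coord: "rat Om (%p. snd p $ j)"
| add: "rat Om F ==> rat Om G ==> rat Om (%p. F p + G p)"
| mult: "rat Om F ==> rat Om G ==> rat Om (%p. F p * G p)"
| inverse: "rat Om F ==> (!!p. p : Om ==> F p ~= 0) ==> rat Om (%p. inverse (F p))"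

lemma rat_const: "rat Om (%p. c)" by (rule rat.const) simp

lemma rat_sum: "(!!j. j : J ==> rat Om (F j)) ==> rat Om (%p. SUM j:J. F j p)"
 by (induction J rule: infinite_finite_induct) (auto intro: rat_const rat.add)

lemma rat_continuous: "rat Om F ==> continuous_on Om F"
proof (induction rule: rat.induct)
 case (const c)
 thus ?case by (intro continuous_on_compose2[OF const] continuous_intros) auto
qed (auto intro!: continuous_intros)

lemma rat_derivative:
 "rat Om F ==> EX F'. (ALL a w. (a, w) : Om --> ((%w. F (a, w)) has_derivative F' (a, w)) (at w)) & (ALL v. rat Om (%p. F' p v))"
proof (induction rule: rat.induct)
 case (const c)
 show ?case by (intro exI[of _ "%p v. 0"]) (auto intro: rat_const)
next
 case (coord j)
 show ?case by (intro exI[of _ "%p v. v $ j"]) (auto intro: rat_const bounded_linear_imp_has_derivative)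
next
 case (add F G)
 then obtain F' G' where F: "ALL a w. (a, w) : Om --> ((%w. F (a, w)) has_derivative F' (a, w)) (at w)" "ALL v. rat Om (%p. F' p v)"
  "ALL a w. (a, w) : Om --> ((%w. G (a, w)) has_derivative G' (a, w)) (at w)" "ALL v. rat Om (%p. G' p v)" by auto
 show ?case
  by (intro exI[of _ "%p v. F' p v + G' p v"]) (use F in \<open>auto intro!: rat.add has_derivative_add\<close>)
next
 case (mult F G)
 then obtain F' G' where F: "ALL a w. (a, w) : Om --> ((%w. F (a, w)) has_derivative F' (a, w)) (at w)" "ALL v. rat Om (%p. F' p v)"
  "ALL a w. (a, w) : Om --> ((%w. G (a, w)) has_derivative G' (a, w)) (at w)" "ALL v. rat Om (%p. G' p v)" by auto
 show ?case
  by (intro exI[of _ "%p v. F p * G' p v + F' p v * G p"]) (use F mult in \<open>auto intro!: rat.add rat.mult has_derivative_mult\<close>)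
next
 case (inverse F)
 then obtain F' where F: "ALL a w. (a, w) : Om --> ((%w. F (a, w)) has_derivative F' (a, w)) (at w)" "ALL v. rat Om (%p. F' p v)" by auto
 show ?case
 proof (intro exI[of _ "%p v. (- 1) * (inverse (F p) * F' p v * inverse (F p))"] conjI allI impI)
  show "((%w. inverse (F (a, w))) has_derivative (%v. (- 1) * (inverse (F (a, w)) * F' (a, w) v * inverse (F (a, w))))) (at w)"
   if "(a, w) : Om" for a w
   using Deriv.has_derivative_inverse[OF inverse.hyps(2)[OF that] F(1)[rule_format, OF that]] by simp
  show "rat Om (%p. (- 1) * (inverse (F p) * F' p v * inverse (F p)))" for v
   by (intro rat.mult rat_const rat.inverse inverse F(2)[rule_format])
 qed
qed

lemma has_derivative_vecI:
 fixes f :: "'a::real_normed_vector => complex ^ 'n::finite"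
 assumes "!!j. ((%w. f w $ j) has_derivative (%v. f' v $ j)) (at w)"
 shows "(f has_derivative f') (at w)"
proof (rule iffD2[OF has_derivative_componentwise_within], rule ballI)
 fix b :: "complex ^ 'n" assume "b : Basis"
 then obtain j e where b: "b = axis j e" by (auto simp: Basis_vec_def)
 show "((%w. f w \<bullet> b) has_derivative (%v. f' v \<bullet> b)) (at w)"
  unfolding b inner_axis by (rule has_derivative_inner_left[OF assms])
qed

text \<open>\<open>G\<close> depends only on the list of directions, so the derivatives come out
  continuous in parameter and point together. Only agreement of \<open>f\<close> with
  \<open>F\<close> on the slice of \<open>Om\<close> is assumed, because a local representation has
  unspecified values elsewhere; openness of the slice makes derivatives insensitive to
  these.\<close>

lemma iterated_deriv_rat:
 fixes F :: "'a::topological_space \<times> (complex ^ 'n::finite) => complex ^ 'n"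
 assumes op: "!!a. open {w. (a, w) : Om}" and F: "!!j. rat Om (%p. F p $ j)"
 shows "EX G. (ALL j. rat Om (%p. G p $ j)) \<and>
  (ALL a f. (ALL w. (a, w) : Om --> f w = F (a, w)) --> (ALL w. (a, w) : Om --> iterated_deriv vs f w = G (a, w) & iterated_deriv vs f differentiable (at w)))"
proof -
 have diff: "EX G'. (ALL a w. (a, w) : Om --> ((%w. G (a, w)) has_derivative G' (a, w)) (at w)) & (ALL v j. rat Om (%p. G' p v $ j))"
  if G: "!!j. rat Om (%p. G p $ j)" for G :: "'a \<times> (complex ^ 'n) => complex ^ 'n"
 proof -
  have "ALL j. EX F'. (ALL a w. (a, w) : Om --> ((%w. G (a, w) $ j) has_derivative F' (a, w)) (at w)) & (ALL v. rat Om (%p. F' p v))"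
   using rat_derivative[OF G] by simp
  from choice[OF this] obtain F' where F': "ALL j. (ALL a w. (a, w) : Om --> ((%w. G (a, w) $ j) has_derivative F' j (a, w)) (at w)) & (ALL v. rat Om (%p. F' j p v))" ..
  show ?thesis
   by (intro exI[of _ "%p v. \<chi> j. F' j p v"]) (use F' in \<open>auto intro!: has_derivative_vecI\<close>)
 qed
 have ext: "(f has_derivative D) (at w)" if "(a, w) : Om" "!!w. (a, w) : Om ==> f w = g w" "(g has_derivative D) (at w)"
  for f g :: "complex ^ 'n => complex ^ 'n" and a w D
  by (rule has_derivative_transform_within_open[OF that(3) op[of a]]) (use that in auto)
 show ?thesis
 proof (induction vs)
  case Nil
  obtain F' where F': "ALL a w. (a, w) : Om --> ((%w. F (a, w)) has_derivative F' (a, w)) (at w)" using diff[OF F] by blast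
  show ?case
  proof (intro exI[of _ F] conjI allI impI)
   fix a f w assume f: "ALL w. (a, w) : Om --> f w = F (a, w)" and w: "(a, w) : Om"
   show "iterated_deriv [] f w = F (a, w)" using f w by simp
   have "(f has_derivative F' (a, w)) (at w)" by (rule ext[OF w, of f "%w. F (a, w)"]) (use f F' w in auto)
   thus "iterated_deriv [] f differentiable at w" by (auto simp: differentiable_def)
  qed (rule F)
 next
  case (Cons v vs)
  then obtain G where G: "ALL j. rat Om (%p. G p $ j)"
   "ALL a f. (ALL w. (a, w) : Om --> f w = F (a, w)) --> (ALL w. (a, w) : Om --> iterated_deriv vs f w = G (a, w) & iterated_deriv vs f differentiable (at w))"
   by (elim exE conjE)
  obtain G' where G': "ALL a w. (a, w) : Om --> ((%w. G (a, w)) has_derivative G' (a, w)) (at w)" "ALL v j. rat Om (%p. G' p v $ j)"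
   using diff[OF G(1)[rule_format]] by (elim exE conjE)
  obtain G'' where G'': "ALL a w. (a, w) : Om --> ((%w. G' (a, w) v) has_derivative G'' (a, w)) (at w)"
   using diff[of "%p. G' p v", OF G'(2)[rule_format]] by (elim exE conjE)
  show ?case
  proof (intro exI[of _ "%p. G' p v"] conjI allI impI)
   fix a f w assume f: "ALL w. (a, w) : Om --> f w = F (a, w)" and w: "(a, w) : Om"
   have *: "iterated_deriv (v # vs) f w = G' (a, w) v" if w: "(a, w) : Om" for w
   proof -
    have "(iterated_deriv vs f has_derivative G' (a, w)) (at w)"
     by (rule ext[OF w, of _ "%w. G (a, w)"]) (use G(2) f G'(1) w in auto)
    thus ?thesis using frechet_derivative_at by fastforce
   qed
   show "iterated_deriv (v # vs) f w = G' (a, w) v" by (rule *[OF w])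
   have "(iterated_deriv (v # vs) f has_derivative G'' (a, w)) (at w)"
    by (rule ext[OF w, of _ "%w. G' (a, w) v"]) (use * G'' w in auto)
   thus "iterated_deriv (v # vs) f differentiable at w" unfolding differentiable_def by blast
  qed (use G'(2) in auto)
 qed
qed

lemma rat_lrep: "rat (ldom i k) (%p. lrep i k (fst p) (snd p) $ j)"
proof -
 have h: "rat (ldom i k) (%p. homog i 1 (snd p) $ l)" for l
 proof (cases "l = i")
  case False
  thus ?thesis by (cases l) (auto simp: homog_def intro: rat.coord)
 qed (simp add: rat_const)
 have A: "rat (ldom i k) (%p. fst p $ l $ m)" for l m by (rule rat.const) (intro continuous_intros)
 have e: "rat (ldom i k) (%p. (fst p *v homog i 1 (snd p)) $ l)" for l
  unfolding matrix_vector_mult_def vec_lambda_beta by (intro rat_sum rat.mult A h)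
 have inv_rat: "rat (ldom i k) (%p. inverse ((fst p *v homog i 1 (snd p)) $ k))"
  by (rule rat.inverse[OF e]) (simp add: ldom_def)
 show ?thesis unfolding lrep_def unhomog_def vec_lambda_beta vector_smult_component by (rule rat.mult[OF inv_rat e])
qed

lemma open_ldom_slice: "open {w. (A, w) : ldom i k}"
proof -
 have "open (Pair A -` ldom i k)" by (intro open_vimage open_ldom continuous_intros)
 thus ?thesis by (simp add: vimage_def)
qed

lemma iterated_deriv_lrep:
 obtains G where "continuous_on (ldom i k) G"
  "!!A w. adj A ** A = mat 1 ==> (A, w) : ldom i k ==>
   iterated_deriv vs (local_rep i k (PU_action (coset_of A))) w = G (A, w) \<and>
   iterated_deriv vs (local_rep i k (PU_action (coset_of A))) differentiable (at w)"
proof -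
 obtain G where G: "ALL j. rat (ldom i k) (%p. G p $ j)"
  "ALL a f. (ALL w. (a, w) : ldom i k --> f w = lrep i k a w) --> (ALL w. (a, w) : ldom i k --> iterated_deriv vs f w = G (a, w) & iterated_deriv vs f differentiable (at w))"
  using iterated_deriv_rat[of "ldom i k" "%p. lrep i k (fst p) (snd p)", OF open_ldom_slice, of vs] rat_lrep unfolding fst_conv snd_conv by blast
 show ?thesis
 proof (rule that[of G])
  have "continuous_on (ldom i k) (%p. \<chi> j. G p $ j)" by (intro continuous_on_vec_lambda rat_continuous G(1)[rule_format])
  thus "continuous_on (ldom i k) G" by simp
 qed (use G(2) local_rep_PU_action(2) in blast)
qed

lemma smooth_PU_action: assumes A: "adj A ** A = mat 1" shows "smooth_map (PU_action (coset_of A))"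
 unfolding smooth_map_def smooth_on_def local_rep_PU_action(1)[OF A]
proof (intro allI conjI open_ldom_slice ballI)
 fix i k vs w assume "w : {w. (A, w) : ldom i k}"
 thus "iterated_deriv vs (local_rep i k (PU_action (coset_of A))) differentiable at w"
  using iterated_deriv_lrep[of i k vs] A by (metis mem_Collect_eq)
qed

lemma lrep_derivative:
 assumes w: "(A, w) : ldom i k"
 defines "q \<equiv> (A *v homog i 1 w) $ k"
 shows "(lrep i k A has_derivative (%v. unhomog k (inverse q *s (A *v homog i 0 v) +
   (- ((A *v homog i 0 v) $ k) / (q * q)) *s (A *v homog i 1 w)))) (at w)"
proof (rule has_derivative_vecI)
 fix j
 let ?l = "if k = Some j then None else Some j"
 have h: "homog i c (u + v) = homog i c u + homog i 0 v" "homog i 0 (r *\<^sub>R u) = r *\<^sub>R homog i 0 u" for c r and u v :: "complex ^ 'a"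
  by (auto simp: homog_def vec_eq_iff split: option.split)
 have lin: "((%w. (A *v homog i 1 w) $ l) has_derivative (%v. (A *v homog i 0 v) $ l)) (at w)" for l
 proof -
  have "linear (%v. (A *v homog i 0 v) $ l)"
   by (rule linearI) (simp_all add: h matrix_vector_right_distrib, simp add: matrix_vector_mult_def scaleR_sum_right scaleR_conv_of_real[where 'a = complex] sum_distrib_left ac_simps)
  hence "((%v. (A *v homog i 0 v) $ l) has_derivative (%v. (A *v homog i 0 v) $ l)) (at w)"
   by (intro bounded_linear_imp_has_derivative) (simp add: linear_conv_bounded_linear)
  hence "((%v. (A *v homog i 1 0) $ l + (A *v homog i 0 v) $ l) has_derivative (%v. 0 + (A *v homog i 0 v) $ l)) (at w)"
   by (intro has_derivative_add has_derivative_const)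
  moreover have "(A *v homog i 1 0) $ l + (A *v homog i 0 v) $ l = (A *v homog i 1 v) $ l" for v
   using h(1)[of 1 0 v] by (simp add: matrix_vector_right_distrib)
  ultimately show ?thesis by simp
 qed
 have q0: "q ~= 0" using w by (simp add: q_def ldom_def)
 have "((%w. (A *v homog i 1 w) $ ?l / (A *v homog i 1 w) $ k) has_derivative
   (%v. ((A *v homog i 0 v) $ ?l * q - (A *v homog i 1 w) $ ?l * (A *v homog i 0 v) $ k) / (q * q))) (at w)"
  unfolding q_def by (rule has_derivative_divide'[OF lin lin]) (use q0 in \<open>simp add: q_def\<close>)
 moreover have "(x * q - y * z) / (q * q) = inverse q * x + - z / (q * q) * y" for x y z using q0 by (simp add: field_simps)
 ultimately have "((%w. (A *v homog i 1 w) $ ?l / (A *v homog i 1 w) $ k) has_derivative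
   (%v. inverse q * (A *v homog i 0 v) $ ?l + - (A *v homog i 0 v) $ k / (q * q) * (A *v homog i 1 w) $ ?l)) (at w)"
  by simp
 thus "((%w. lrep i k A w $ j) has_derivative (%v. unhomog k (inverse q *s (A *v homog i 0 v) +
   (- ((A *v homog i 0 v) $ k) / (q * q)) *s (A *v homog i 1 w)) $ j)) (at w)"
  by (simp add: lrep_def unhomog_def divide_inverse mult.commute)
qed

text \<open>In homogeneous coordinates the action is linear and preserves the Hermitian form.
  Returning to the chart rescales the base vector and adds multiples of it to tangent vectors, which
  does not change \<open>fs_homog\<close>.\<close>

lemma preserves_PU_action:
 assumes A: "adj A ** A = mat 1" shows "preserves_fs (PU_action (coset_of A))"
 unfolding preserves_fs_def Let_def local_rep_PU_action(1)[OF A]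
proof (intro allI ballI)
 fix i k w u v assume "w : {w. (A, w) : ldom i k}"
 hence w: "(A, w) : ldom i k" by simp
 let ?f = "local_rep i k (PU_action (coset_of A))"
 define q where "q = (A *v homog i 1 w) $ k"
 have q0: "q ~= 0" using w by (simp add: q_def ldom_def)
 define d where "d v = inverse q *s (A *v homog i 0 v) + (- ((A *v homog i 0 v) $ k) / (q * q)) *s (A *v homog i 1 w)" for v
 have "(?f has_derivative (%v. unhomog k (d v))) (at w)"
  unfolding d_def q_def
  by (rule has_derivative_transform_within_open[OF lrep_derivative[OF w] open_ldom_slice]) (use w local_rep_PU_action(2)[OF A] in auto)
 hence D: "frechet_derivative ?f (at w) = (%v. unhomog k (d v))" by (rule frechet_derivative_at[symmetric])
 have "d v $ k = 0" for v using q0 by (simp add: d_def q_def[symmetric] field_simps)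
 hence hd: "homog k 0 (unhomog k (d v)) = d v" for v using homog_unhomog[of k "d v"] by simp
 have fw: "homog k 1 (?f w) = inverse q *s (A *v homog i 1 w)"
 proof -
  have "homog k ((inverse q *s (A *v homog i 1 w)) $ k) (unhomog k (inverse q *s (A *v homog i 1 w))) = inverse q *s (A *v homog i 1 w)"
   by (rule homog_unhomog)
  thus ?thesis using q0 local_rep_PU_action(2)[OF A w] by (simp add: lrep_def q_def)
 qed
 have "fs_form k (?f w) (unhomog k (d u)) (unhomog k (d v)) = fs_homog (A *v homog i 1 w) (A *v homog i 0 u) (A *v homog i 0 v)"
  unfolding fs_form_def hd fw unfolding d_def
  by (rule fs_homog_basic) (use q0 unitary_nonzero[OF A] in auto)
 also have "... = fs_form i w u v" unfolding fs_form_def fs_homog_def norm_adj_invariant[OF A] ..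
 finally show "fs_form k (?f w) (frechet_derivative ?f (at w) u) (frechet_derivative ?f (at w) v) = fs_form i w u v" unfolding D .
qed

lemma adj_unitary: "adj A ** A = mat 1 ==> adj (adj A) ** adj A = mat (1::complex)" for A :: "complex ^ 'm::finite ^ 'm"
proof -
 assume "adj A ** A = mat 1"
 moreover have "adj (adj A) = A" by (simp add: adj_defs vec_eq_iff)
 ultimately show ?thesis by (simp add: adj_right)
qed

lemma PU_action_compose:
 fixes A B :: "complex ^ 'n option ^ 'n::finite option"
 assumes "adj A ** A = mat 1" "adj B ** B = mat 1" "B ** A = mat 1"
 shows "PU_action (coset_of B) (PU_action (coset_of A) p) = p"
proof -
 obtain z where z: "norm z = 1" "p = line_through z" by (rule cproj_line_through)
 have z0: "z ~= 0" using z by auto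
 show ?thesis unfolding z(2) PU_action_line[OF assms(1) z0] PU_action_line[OF assms(2) unitary_nonzero[OF assms(1) z0]]
  by (simp add: matrix_vector_mul_assoc assms(3))
qed

lemma PU_action_Symp: assumes A: "adj A ** A = mat 1" shows "PU_action (coset_of A) : Symp"
proof -
 let ?f = "PU_action (coset_of A)" and ?g = "PU_action (coset_of (adj A))"
 have gf: "?g (?f p) = p" "?f (?g p) = p" for p
  using PU_action_compose[OF A adj_unitary[OF A] A] PU_action_compose[OF adj_unitary[OF A] A adj_right[OF A]] by auto
 have b: "bij ?f" by (rule o_bij[of ?g]) (simp_all add: fun_eq_iff gf)
 have "inv_into UNIV ?f = ?g" by (rule inv_equality) (simp_all add: gf)
 thus ?thesis unfolding Symp_def
  using b smooth_PU_action[OF A] smooth_PU_action[OF adj_unitary[OF A]] preserves_PU_action[OF A] by simp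
qed

text \<open>Finitely many jointly continuous derivatives are involved, so membership means that
  \<open>{A} \<times> K\<close> lies in a fixed open set of pairs; the tube lemma makes this an open
  condition on \<open>A\<close>.\<close>

lemma open_smooth_nhd_PU:
 assumes f: "smooth_map f" and K: "compact K" and True: "K <= local_rep_domain i k f"
 shows "openin (top_of_set (carrier unitary_group)) {A : carrier unitary_group. PU_action (coset_of A) : smooth_nhd f i k K r e}"
proof -
 let ?VS = "{vs :: (complex ^ 'a) list. set vs <= Basis & length vs <= r}"
 have fin: "finite ?VS" using finite_lists_length_le[OF finite_Basis] by (simp add: conj_commute)
 have "ALL vs. EX G. continuous_on (ldom i k) G & (ALL A w. adj A ** A = mat 1 --> (A, w) : ldom i k -->
   iterated_deriv vs (local_rep i k (PU_action (coset_of A))) w = G (A, w))"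
 proof
  fix vs
  show "EX G. continuous_on (ldom i k) G & (ALL A w. adj A ** A = mat 1 --> (A, w) : ldom i k -->
   iterated_deriv vs (local_rep i k (PU_action (coset_of A))) w = G (A, w))"
  proof (rule iterated_deriv_lrep[of i k vs])
   fix G assume 1: "continuous_on (ldom i k) G" and 2: "!!A w. adj A ** A = mat 1 ==> (A, w) : ldom i k ==>
    iterated_deriv vs (local_rep i k (PU_action (coset_of A))) w = G (A, w) \<and>
    iterated_deriv vs (local_rep i k (PU_action (coset_of A))) differentiable (at w)"
   show ?thesis by (intro exI[of _ G] conjI allI impI 1) (rule conjunct1[OF 2])
  qed
 qed
 from choice[OF this] obtain G where G: "ALL vs. continuous_on (ldom i k) (G vs) & (ALL A w. adj A ** A = mat 1 --> (A, w) : ldom i k -->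
   iterated_deriv vs (local_rep i k (PU_action (coset_of A))) w = G vs (A, w))" ..
 define Om where "Om = ldom i k \<inter> UNIV \<times> local_rep_domain i k f"
 have od: "open (local_rep_domain i k f)" using f by (simp add: smooth_map_def)
 have oOm: "open Om" unfolding Om_def by (intro open_Int open_ldom open_Times open_UNIV od)
 have cf: "continuous_on (local_rep_domain i k f) (iterated_deriv vs (local_rep i k f))" for vs
  by (rule continuous_at_imp_continuous_on) (use f in \<open>auto simp: smooth_map_def smooth_on_def intro: differentiable_imp_continuous_within\<close>)
 define W where "W = (INT vs:?VS. {p : Om. norm (iterated_deriv vs (local_rep i k f) (snd p) - G vs p) < e}) \<inter> Om"
 have "open {p : Om. norm (iterated_deriv vs (local_rep i k f) (snd p) - G vs p) < e}" for vs
 proof -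
  have "continuous_on Om (%p. norm (iterated_deriv vs (local_rep i k f) (snd p) - G vs p))"
  proof (intro continuous_on_norm continuous_on_diff)
   show "continuous_on Om (%p. iterated_deriv vs (local_rep i k f) (snd p))"
    by (rule continuous_on_compose2[OF cf continuous_on_snd[OF continuous_on_id]]) (auto simp: Om_def)
   show "continuous_on Om (G vs)"
    by (rule continuous_on_subset[of "ldom i k"]) (use G in \<open>auto simp: Om_def\<close>)
  qed
  from continuous_open_preimage[OF this oOm, of "{..<e}"] show ?thesis by (simp add: vimage_def Int_def conj_commute)
 qed
 hence oW: "open W" unfolding W_def using fin oOm by (intro open_Int open_INT) auto
 have eq: "PU_action (coset_of A) : smooth_nhd f i k K r e \<longleftrightarrow> {A} \<times> K <= W" if A: "adj A ** A = mat 1" for A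
 proof -
  have "PU_action (coset_of A) : smooth_nhd f i k K r e \<longleftrightarrow> (ALL w:K. (A, w) : ldom i k) \<and>
    (ALL vs:?VS. ALL w:K. norm (iterated_deriv vs (local_rep i k f) w - iterated_deriv vs (local_rep i k (PU_action (coset_of A))) w) < e)"
   unfolding smooth_nhd_def using smooth_PU_action[OF A] local_rep_PU_action(1)[OF A] by auto
  also have "... \<longleftrightarrow> (ALL w:K. (A, w) : ldom i k) & (ALL vs:?VS. ALL w:K. norm (iterated_deriv vs (local_rep i k f) w - G vs (A, w)) < e)"
   using G A by auto
  also have "... \<longleftrightarrow> {A} \<times> K <= W" unfolding W_def Om_def using True by auto
  finally show ?thesis .
 qed
 define V where "V = {A. {A} \<times> K <= W}"
 have "open V"
  unfolding open_subopen[of V]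
 proof
  fix A assume "A : V"
  hence "{A} \<times> K <= W" by (simp add: V_def)
  from Elementary_Topology.tube_lemma[OF K oW this] obtain X0 where "A : X0" "open X0" "X0 \<times> K <= W" by (elim exE conjE)
  thus "EX T. open T & A : T & T <= V" unfolding V_def by (intro exI[of _ X0]) auto
 qed
 moreover have "{A : carrier unitary_group. PU_action (coset_of A) : smooth_nhd f i k K r e} = carrier unitary_group \<inter> V"
  unfolding V_def using eq by (auto simp: mem_unitary)
 ultimately show ?thesis by auto
qed

section \<open>The topology of the projective unitary group\<close>

text \<open>An arbitrary choice that carries no continuity. Continuity is always tested on
  \<open>tens2\<close> of the representative, which is independent of the choice.\<close>

definition rep :: "(complex ^ 'm ^ 'm::finite) set => complex ^ 'm ^ 'm" where
 "rep C = (SOME A. A : C)"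

definition tens2 :: "complex ^ 'm ^ 'm::finite => complex ^ 'm ^ 'm ^ 'm ^ 'm" where
 "tens2 A = (\<chi> i k l q. A $ i $ k * cnj (A $ l $ q))"

lemma coset_of_self: "A : coset_of A"
 unfolding coset_of_eq by (intro CollectI exI[of _ 1]) simp

lemma coset_of_scale: assumes "norm c = 1" shows "coset_of (mat c ** A) = coset_of A"
proof -
 have c0: "c ~= 0" using assms by auto
 have m: "mat a ** (mat b ** A) = mat (a * b) ** A" for a b by (simp add: mat_mult vec_eq_iff mult.assoc)
 show ?thesis unfolding coset_of_eq m
 proof (intro equalityI subsetI)
  fix B assume "B : {mat ca ** A |ca. cmod ca = 1}"
  then obtain a where a: "B = mat a ** A" "cmod a = 1" by blast
  thus "B : {mat (ca * c) ** A |ca. cmod ca = 1}"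
   using assms c0 by (intro CollectI exI[of _ "a / c"]) (simp add: norm_divide)
 next
  fix B assume "B : {mat (ca * c) ** A |ca. cmod ca = 1}"
  thus "B : {mat ca ** A |ca. cmod ca = 1}" using assms by (auto simp: norm_mult)
 qed
qed

lemma unitary_scale: assumes "norm c = 1" "adj A ** A = mat 1" shows "adj (mat c ** A) ** (mat c ** A) = mat 1"
proof -
 have cc: "cnj c * c = 1" using assms(1) complex_norm_square[of c] by (simp add: mult.commute)
 have "(adj (mat c ** A) ** (mat c ** A)) $ i $ k = cnj c * c * (adj A ** A) $ i $ k" for i k
  unfolding mat_mult by (simp add: adj_defs matrix_matrix_mult_def sum_distrib_left ac_simps)
 thus ?thesis unfolding cc assms(2) by (simp add: vec_eq_iff)
qed

lemma carrier_PU: "carrier PU = coset_of ` carrier unitary_group"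
 by (auto simp: PU_def FactGroup_def RCOSETS_def coset_of_def)

lemma one_PU: "\<one>\<^bsub>PU\<^esub> = coset_of (mat 1)"
 by (auto simp: PU_def FactGroup_def coset_of_eq unit_scalars_def)

lemma rep_PU:
 assumes "C : carrier PU" shows "adj (rep C) ** rep C = mat 1" "coset_of (rep C) = C"
proof -
 obtain A where A: "adj A ** A = mat 1" "C = coset_of A" using assms unfolding carrier_PU by (auto simp: mem_unitary)
 have "rep C : C" unfolding rep_def using coset_of_self[of A] A(2) by (intro someI_ex[of "%A. A : C"]) auto
 hence "EX c. rep C = mat c ** A & norm c = 1" unfolding A(2) coset_of_eq by blast
 then obtain c where c: "rep C = mat c ** A" "norm c = 1" by blast
 show "adj (rep C) ** rep C = mat 1" unfolding c(1) by (rule unitary_scale[OF c(2) A(1)])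
 have "coset_of (rep C) = coset_of A" unfolding c(1) by (rule coset_of_scale[OF c(2)])
 thus "coset_of (rep C) = C" by (rule trans[OF _ A(2)[symmetric]])
qed

lemma tens2_scale: assumes "norm c = 1" shows "tens2 (mat c ** A) = tens2 A"
proof -
 have "c * cnj c = 1" using assms complex_norm_square[of c] by simp
 moreover have "c * x * (cnj c * y) = c * cnj c * (x * y)" for x y by (simp add: ac_simps)
 ultimately show ?thesis by (simp add: tens2_def mat_mult vec_eq_iff)
qed

lemma tens2_rep: assumes "adj A ** A = mat 1" shows "tens2 (rep (coset_of A)) = tens2 A"
proof -
 have "rep (coset_of A) : coset_of A" unfolding rep_def using coset_of_self[of A] by (intro someI_ex[of "%B. B : coset_of A"]) auto
 thus ?thesis unfolding coset_of_eq by (auto simp: tens2_scale)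
qed

lemma topspace_PU [simp]: "topspace PU_topology = carrier (PU :: (complex ^ 'm ^ 'm::finite) set monoid)"
proof -
 have "{A : carrier unitary_group. unit_scalars #>\<^bsub>unitary_group\<^esub> A : carrier PU} = (carrier unitary_group :: (complex ^ 'm ^ 'm) set)"
  unfolding carrier_PU coset_of_def by auto
 hence "openin PU_topology (carrier (PU :: (complex ^ 'm ^ 'm) set monoid))" by (simp add: openin_PU_topology PU_open_def)
 thus ?thesis unfolding topspace_def by (auto simp: openin_PU_topology PU_open_def)
qed

lemma continuous_coset_of: "continuous_map (top_of_set (carrier unitary_group)) PU_topology coset_of"
 unfolding continuous_map_def
 by (auto simp: carrier_PU openin_PU_topology PU_open_def coset_of_def)

lemma norm_vec_le_sum: "norm v <= (SUM i:UNIV. norm (v $ i))"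
 unfolding norm_vec_def by (rule L2_set_le_sum) simp

lemma compact_unitary: "compact (carrier (unitary_group :: (complex ^ 'm ^ 'm::finite) monoid))"
proof -
 have "continuous_on UNIV (%A :: complex ^ 'm ^ 'm. adj A ** A)"
  unfolding adj_defs matrix_matrix_mult_def
  by (intro continuous_on_vec_lambda continuous_intros)
 hence "closed ((%A :: complex ^ 'm ^ 'm. adj A ** A) -` {mat 1})" by (intro closed_vimage) auto
 hence cl: "closed (carrier (unitary_group :: (complex ^ 'm ^ 'm) monoid))" by (simp add: vimage_def mem_unitary[symmetric])
 have "norm A <= real (CARD('m) * CARD('m))" if "adj A ** A = mat 1" for A :: "complex ^ 'm ^ 'm"
 proof -
  have le1: "cmod (A $ i $ k) <= 1" for i k
  proof -
   have "complex_of_real (SUM l:UNIV. (cmod (A $ l $ k))\<^sup>2) = (adj A ** A) $ k $ k"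
    by (simp add: adj_defs matrix_matrix_mult_def complex_norm_square mult.commute del: of_real_power)
   hence "complex_of_real (SUM l:UNIV. (cmod (A $ l $ k))\<^sup>2) = 1" unfolding that by (simp add: mat_def)
   hence "(SUM l:UNIV. (cmod (A $ l $ k))\<^sup>2) = 1" by (simp only: of_real_eq_1_iff)
   moreover have "(cmod (A $ i $ k))\<^sup>2 <= (SUM l:UNIV. (cmod (A $ l $ k))\<^sup>2)" by (intro member_le_sum) auto
   ultimately show ?thesis using abs_square_le_1[of "cmod (A $ i $ k)"] by simp
  qed
  have "norm A <= (SUM i:UNIV. norm (A $ i))" by (rule norm_vec_le_sum)
  also have "... <= (SUM i:(UNIV :: 'm set). SUM k:(UNIV :: 'm set). 1)"
   by (intro sum_mono order.trans[OF norm_vec_le_sum] le1)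
  finally show ?thesis by simp
 qed
 hence "bounded (carrier (unitary_group :: (complex ^ 'm ^ 'm) monoid))"
  unfolding bounded_iff by (intro exI[of _ "real (CARD('m) * CARD('m))"]) (auto simp: mem_unitary)
 thus ?thesis using cl by (simp add: compact_eq_bounded_closed)
qed

text \<open>A continuous injection from a compact space into a Hausdorff space. For injectivity, the
  products of entries with conjugates determine a matrix up to a phase, which any nonzero entry
  reveals.\<close>

lemma tau_embedding: "embedding_map PU_topology euclidean (%C. tens2 (rep C) :: complex ^ 'm ^ 'm ^ 'm ^ 'm::finite)"
proof (rule continuous_imp_embedding_map)
 have "continuous_on UNIV (tens2 :: complex ^ 'm ^ 'm => _)"
  unfolding tens2_def by (intro continuous_on_vec_lambda continuous_intros)
 hence op: "open (tens2 -` W)" if "open W" for W :: "(complex ^ 'm ^ 'm ^ 'm ^ 'm) set"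
  using that by (intro open_vimage)
 show "continuous_map PU_topology euclidean (%C. tens2 (rep C) :: complex ^ 'm ^ 'm ^ 'm ^ 'm)"
  unfolding continuous_map_def
 proof (intro conjI allI impI)
  fix W :: "(complex ^ 'm ^ 'm ^ 'm ^ 'm) set" assume "openin euclidean W"
  hence "open W" by simp
  have "{A : carrier unitary_group. unit_scalars #>\<^bsub>unitary_group\<^esub> A : {C : carrier PU. tens2 (rep C) : W}} = carrier unitary_group \<inter> tens2 -` W"
   unfolding coset_of_def[symmetric] by (auto simp: carrier_PU mem_unitary tens2_rep)
  thus "openin PU_topology {x : topspace PU_topology. tens2 (rep x) : W}"
   unfolding openin_PU_topology PU_open_def using op[OF \<open>open W\<close>] by auto
 qed auto
 have "compactin (top_of_set (carrier unitary_group)) (carrier (unitary_group :: (complex ^ 'm ^ 'm) monoid))"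
  by (simp add: compactin_subtopology compact_unitary)
 from image_compactin[OF this continuous_coset_of] show "compact_space (PU_topology :: (complex ^ 'm ^ 'm) set topology)"
  by (simp add: compact_space_def carrier_PU)
 show "Hausdorff_space (euclidean :: (complex ^ 'm ^ 'm ^ 'm ^ 'm) topology)" by simp
 show "inj_on (%C. tens2 (rep C) :: complex ^ 'm ^ 'm ^ 'm ^ 'm) (topspace PU_topology)"
 proof (rule inj_onI)
  fix C C' :: "(complex ^ 'm ^ 'm) set"
  assume C: "C : topspace PU_topology" "C' : topspace PU_topology" and eq: "tens2 (rep C) = tens2 (rep C')"
  let ?A = "rep C" and ?B = "rep C'"
  have u: "adj ?A ** ?A = mat 1" "adj ?B ** ?B = mat 1" and co: "coset_of ?A = C" "coset_of ?B = C'" using C rep_PU by auto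
  have e: "?A $ i $ k * cnj (?A $ l $ q) = ?B $ i $ k * cnj (?B $ l $ q)" for i k l q
   using arg_cong[OF eq, of "%T. T $ i $ k $ l $ q"] by (simp add: tens2_def)
  have "?A ~= 0"
  proof
   assume "?A = 0"
   hence "(adj ?A ** ?A) $ i $ i = 0" for i by (simp add: matrix_matrix_mult_def)
   thus False unfolding u by (simp add: mat_def)
  qed
  then obtain l q where lq: "?A $ l $ q ~= 0" by (auto simp: vec_eq_iff)
  have sq: "?B $ l $ q * cnj (?B $ l $ q) = ?A $ l $ q * cnj (?A $ l $ q)" using e[of l q l q] by simp
  have n: "cmod (?B $ l $ q) = cmod (?A $ l $ q)"
  proof -
   have "complex_of_real ((cmod (?B $ l $ q))\<^sup>2) = of_real ((cmod (?A $ l $ q))\<^sup>2)" using sq by (simp only: complex_norm_square)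
   thus ?thesis by (simp only: of_real_eq_iff) (simp add: power2_eq_iff_nonneg)
  qed
  define c where "c = cnj (?B $ l $ q) / cnj (?A $ l $ q)"
  have "cmod c = 1" using n lq by (simp add: c_def norm_divide)
  moreover have "?A = mat c ** ?B"
   unfolding mat_mult using e[of _ _ l q] lq by (simp add: c_def vec_eq_iff field_simps)
  ultimately have "coset_of ?A = coset_of ?B" using coset_of_scale[of c ?B] by simp
  thus "C = C'" using co by simp
 qed
qed

lemma continuous_into_PU:
 fixes k :: "'y => (complex ^ 'm ^ 'm::finite) set"
 assumes "!!y. y : topspace Y ==> k y : carrier PU" "continuous_map Y euclidean (%y. tens2 (rep (k y)))"
 shows "continuous_map Y PU_topology k"
proof -
 obtain g where g: "homeomorphic_maps PU_topology (subtopology euclidean ((%C :: (complex ^ 'm ^ 'm) set. tens2 (rep C)) ` carrier PU)) (%C. tens2 (rep C)) g"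
  using tau_embedding unfolding embedding_map_def homeomorphic_map_maps by auto
 have 1: "continuous_map Y (subtopology euclidean ((%C :: (complex ^ 'm ^ 'm) set. tens2 (rep C)) ` carrier PU)) (%y. tens2 (rep (k y)))"
  by (rule continuous_map_into_subtopology[OF assms(2)]) (use assms(1) in auto)
 have "continuous_map Y PU_topology (g o (%y. tens2 (rep (k y))))"
  by (rule continuous_map_compose[OF 1]) (use g in \<open>simp add: homeomorphic_maps_def\<close>)
 thus ?thesis
  by (rule continuous_map_eq) (use g assms(1) in \<open>auto simp: homeomorphic_maps_def\<close>)
qed

lemma continuous_tens2_rep:
 fixes k :: "'y => (complex ^ 'm ^ 'm::finite) set"
 assumes "continuous_map Y PU_topology k" shows "continuous_map Y euclidean (%y. tens2 (rep (k y)))"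
proof -
 have "continuous_map PU_topology euclidean (%C :: (complex ^ 'm ^ 'm) set. tens2 (rep C))"
  using homeomorphic_imp_continuous_map[OF tau_embedding[where 'm = 'm, unfolded embedding_map_def]] by (simp add: continuous_map_in_subtopology)
 from continuous_map_compose[OF assms this] show ?thesis by (simp add: o_def)
qed

theorem continuous_PU_action: "continuous_map PU_topology Symp_topology (PU_action :: _ => 'n::finite cproj => 'n cproj)"
 unfolding Symp_topology_def
proof (rule continuous_map_into_subtopology)
 show "PU_action : topspace PU_topology \<rightarrow> (Symp :: ('n cproj => 'n cproj) set)"
  by (auto simp: carrier_PU mem_unitary PU_action_Symp)
 show "continuous_map PU_topology smooth_topology (PU_action :: _ => 'n cproj => 'n cproj)"
  unfolding smooth_topology_def continuous_on_generated_topo_iff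
 proof (intro conjI allI impI subsetI)
  fix U :: "('n cproj => 'n cproj) set"
  assume "U : {smooth_nhd f i k K r e |f i k K r e. smooth_map f & compact K & K <= local_rep_domain i k f & 0 < e}"
  then obtain f i k K r e where U: "U = smooth_nhd f i k K r e" "smooth_map f" "compact K" "K <= local_rep_domain i k f" by blast
  have "{A : carrier unitary_group. unit_scalars #>\<^bsub>unitary_group\<^esub> A : PU_action -` U \<inter> topspace PU_topology} =
    {A : carrier unitary_group. PU_action (coset_of A) : smooth_nhd f i k K r e}"
   unfolding coset_of_def[symmetric] by (auto simp: carrier_PU U(1))
  thus "openin PU_topology (PU_action -` U \<inter> topspace PU_topology)"
   unfolding openin_PU_topology PU_open_def using open_smooth_nhd_PU[OF U(2-4), of r e] by simp
 next
  fix h assume "h : (PU_action :: _ => 'n cproj => 'n cproj) ` topspace PU_topology"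
  hence "smooth_map h" by (auto simp: carrier_PU mem_unitary smooth_PU_action)
  \<comment> \<open>With an empty compact set nothing is required beyond smoothness, which shows
    that every smooth map belongs to the space.\<close>
  hence "h : smooth_nhd h None None {} 0 1" by (simp add: smooth_nhd_def)
  thus "h : \<Union>{smooth_nhd f i k K r e |f i k K r e. smooth_map f & compact K & K <= local_rep_domain i k f & 0 < e}"
   using \<open>smooth_map h\<close> by (intro UnionI[of "smooth_nhd h None None {} 0 1"] CollectI exI[of _ h] exI[of _ None] exI[of _ "{}"] exI[of _ 0] exI[of _ 1]) auto
 qed
qed

section \<open>Joint continuity of evaluation\<close>

text \<open>The orthogonal projection onto the line. Continuity of maps into projective space is
  stated through this matrix, without a topology on \<open>cproj\<close>.\<close>

definition pmat :: "'n::finite cproj => complex ^ 'n option ^ 'n option" where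
 "pmat p = outer (SOME z. norm z = 1 & line_through z = p)"

lemma outer_scale: assumes "norm c = 1" shows "outer (c *s z) = outer z"
proof -
 have "c * cnj c = 1" using assms complex_norm_square[of c] by simp
 moreover have "c * x * (cnj c * y) = c * cnj c * (x * y)" for x y by (simp add: ac_simps)
 ultimately show ?thesis by (simp add: outer_def vec_eq_iff)
qed

lemma pmat_line: assumes "norm z = 1" shows "pmat (line_through z) = outer z"
proof -
 let ?y = "SOME y. norm y = 1 & line_through y = line_through z"
 have y: "norm ?y = 1 & line_through ?y = line_through z"
  by (rule someI[of "%y. norm y = 1 & line_through y = line_through z" z]) (simp add: assms)
 hence "?y ~= 0" "z ~= 0" using assms by auto
 then obtain c where c: "z = c *s ?y" using line_through_eq_iff[of ?y z] y by auto
 hence "cmod c = 1" using y assms by (metis mult.right_neutral norm_scalar_mult)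
 thus ?thesis unfolding pmat_def using c outer_scale[of c ?y] by simp
qed

lemma pmat_nonzero: assumes "z ~= 0" shows "pmat (line_through z) = outer (of_real (1 / norm z) *s z)"
proof -
 have c: "complex_of_real (1 / norm z) ~= 0" using assms by simp
 have "norm (of_real (1 / norm z) *s z) = 1" using assms by (simp add: norm_scalar_mult norm_divide)
 from pmat_line[OF this] show ?thesis unfolding line_through_scale[OF c] .
qed

lemma continuous_outer: "continuous_on S f ==> continuous_on S (%x. outer (f x))"
 unfolding outer_def by (intro continuous_on_vec_lambda continuous_intros)

text \<open>Neighbourhoods of order 0 on a compact ball in a chart give uniform closeness of the
  local representations; combined with continuity of the one at \<open>t0\<close>, this gives joint
  continuity.\<close>

theorem continuous_evaluation:
 fixes T :: "'t::metric_space set" and h :: "'t => 'n::finite cproj => 'n cproj"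
 assumes h: "continuous_map (top_of_set T) Symp_topology h"
 shows "continuous_on (T \<times> sphere 0 1) (%p. pmat (h (fst p) (line_through (snd p))))"
 unfolding continuous_on_def
proof
 fix p0 assume p0: "p0 : T \<times> sphere (0 :: complex ^ 'n option) 1"
 obtain t0 z0 where tz: "p0 = (t0, z0)" "t0 : T" "norm z0 = 1" using p0 by auto
 let ?F = "at p0 within T \<times> sphere 0 1"
 have hsmooth: "smooth_map (h t)" and hS: "h t : topspace smooth_topology" if "t : T" for t
  using h that unfolding continuous_map_def Symp_topology_def by (auto simp: Symp_def)
 have z00: "z0 ~= 0" using tz by auto
 then obtain i where i: "z0 $ i ~= 0" by (auto simp: vec_eq_iff)
 define w where "w z = unhomog i (inverse (z $ i) *s z)" for z
 have line_w: "line_through z = affine_param i (w z)" if "z $ i ~= 0" for z using line_through_affine[OF that] by (simp add: w_def)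
 obtain y0 where y0: "norm y0 = 1" "h t0 (line_through z0) = line_through y0" by (rule cproj_line_through)
 hence y00: "y0 ~= 0" by auto
 then obtain k where k: "y0 $ k ~= 0" by (auto simp: vec_eq_iff)
 let ?f = "h t0" and ?lr = "%t. local_rep i k (h t)"
 have sf: "smooth_map ?f" by (rule hsmooth[OF tz(2)])
 have w0: "w z0 : local_rep_domain i k ?f"
  using line_w[OF i] y0 k y00 by (simp add: local_rep_domain_def line_in_chart_domain flip: line_w)
 have "open (local_rep_domain i k ?f)" using sf by (simp add: smooth_map_def)
 then obtain r where r: "r > 0" "cball (w z0) r <= local_rep_domain i k ?f" using w0 open_contains_cball by blast
 let ?K = "cball (w z0) r"
 have nb: "\<forall>\<^sub>F p in ?F. h (fst p) : smooth_nhd ?f i k ?K 0 e" if e: "e > 0" for e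
 proof -
  let ?N = "smooth_nhd ?f i k ?K 0 e"
  have "openin smooth_topology ?N"
   unfolding smooth_topology_def by (rule topology_generated_by_Basis, rule CollectI, intro exI conjI, rule refl) (use sf r e in auto)
  moreover have cm: "continuous_map (top_of_set T) smooth_topology h" using h unfolding Symp_topology_def continuous_map_in_subtopology by blast
  ultimately have "openin (top_of_set T) {t : T. h t : ?N}" using openin_continuous_map_preimage[OF cm, of ?N] by simp
  then obtain V where V: "open V" "{t : T. h t : ?N} = T \<inter> V" unfolding openin_open by auto
  have "?f : ?N" using sf r e by (simp add: smooth_nhd_def)
  hence "t0 : V" using V(2) tz by blast
  hence "\<forall>\<^sub>F p in ?F. p : V \<times> UNIV" unfolding tz(1) by (intro eventually_at_topological[THEN iffD2] exI[of _ "V \<times> UNIV"]) (auto intro: open_Times V)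
  moreover have "\<forall>\<^sub>F p in ?F. p : T \<times> sphere 0 1" by (simp add: eventually_at_filter)
  ultimately show ?thesis
  proof eventually_elim
   case (elim p)
   hence "fst p : T \<inter> V" by auto
   thus ?case unfolding V(2)[symmetric] by simp
  qed
 qed
 have sndF: "(snd \<longlongrightarrow> z0) ?F" using tendsto_snd[OF tendsto_ident_at, of p0 "T \<times> sphere 0 1"] by (simp add: tz)
 have wF: "((%p. w (snd p)) \<longlongrightarrow> w z0) ?F"
  unfolding w_def unhomog_def
  by (intro tendsto_vec_lambda) (use i in \<open>auto simp: vector_scalar_mult_def intro!: tendsto_intros sndF\<close>)
 have iF: "\<forall>\<^sub>F p in ?F. snd p $ i ~= 0"
  by (rule tendsto_imp_eventually_ne[OF tendsto_vec_nth[OF sndF] i])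
 have KF: "\<forall>\<^sub>F p in ?F. w (snd p) : ?K"
  using tendstoD[OF wF r(1)] by eventually_elim (simp add: dist_commute)
 have lim: "((%p. ?lr (fst p) (w (snd p))) \<longlongrightarrow> ?lr t0 (w z0)) ?F"
 proof -
  have "(%w. ?lr t0 w) differentiable at (w z0)"
   using sf w0 unfolding smooth_map_def smooth_on_def by (metis iterated_deriv.simps(1))
  hence "isCont (?lr t0) (w z0)" by (rule differentiable_imp_continuous_within)
  hence 1: "((%p. ?lr t0 (w (snd p))) \<longlongrightarrow> ?lr t0 (w z0)) ?F" by (rule isCont_tendsto_compose[OF _ wF])
  have 2: "((%p. ?lr t0 (w (snd p)) - ?lr (fst p) (w (snd p))) \<longlongrightarrow> 0) ?F"
  proof (rule tendstoI)
   fix e :: real assume "e > 0"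
   from nb[OF this] KF show "\<forall>\<^sub>F p in ?F. dist (?lr t0 (w (snd p)) - ?lr (fst p) (w (snd p))) 0 < e"
   proof eventually_elim
    case (elim p)
    thus ?case unfolding smooth_nhd_def by (auto dest!: spec[of _ "[]"])
   qed
  qed
  from tendsto_diff[OF 1 2] show ?thesis by simp
 qed
 define Ph where "Ph y = pmat (affine_param k y)" for y :: "complex ^ 'n"
 have "continuous_on UNIV (%y. outer (of_real (1 / norm (homog k 1 y)) *s homog k 1 y))"
  unfolding vector_scalar_mult_def
  by (intro continuous_outer continuous_on_vec_lambda continuous_intros continuous_homog) auto
 hence "continuous_on UNIV Ph" unfolding Ph_def affine_param_def by (simp only: pmat_nonzero[OF homog_nonzero])
 hence "isCont Ph (?lr t0 (w z0))" by (simp add: continuous_on_eq_continuous_at)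
 hence "((%p. Ph (?lr (fst p) (w (snd p)))) \<longlongrightarrow> Ph (?lr t0 (w z0))) ?F" by (rule isCont_tendsto_compose[OF _ lim])
 moreover have loc: "Ph (?lr t (w z)) = pmat (h t (line_through z))" if zi: "z $ i ~= 0" and wd: "w z : local_rep_domain i k (h t)" for t z
 proof -
  obtain y where "h t (affine_param i (w z)) = affine_param k y" using wd unfolding local_rep_domain_def chart_domain_def by auto
  thus ?thesis unfolding Ph_def line_w[OF zi] by (simp add: local_rep_def)
 qed
 ultimately have A: "((%p. Ph (?lr (fst p) (w (snd p)))) \<longlongrightarrow> pmat (h (fst p0) (line_through (snd p0)))) ?F"
  using loc[OF i w0] tz(1) by simp
 have "\<forall>\<^sub>F p in ?F. Ph (?lr (fst p) (w (snd p))) = pmat (h (fst p) (line_through (snd p)))"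
  using nb[OF zero_less_one] KF iF
  by eventually_elim (intro loc, auto simp: smooth_nhd_def)
 from Lim_transform_eventually[OF A this]
 show "((%p. pmat (h (fst p) (line_through (snd p)))) \<longlongrightarrow> pmat (h (fst p0) (line_through (snd p0)))) ?F" .
qed


section \<open>Homotopy groups\<close>

abbreviation fixes_boundary :: "nat => 'a => ((nat => real) => 'a) => bool" where
 "fixes_boundary j x0 h \<equiv> ALL t:cube_boundary j. h t = x0"

lemma topspace_cube: "topspace (cube j) = {..<j} \<rightarrow>\<^sub>E {0..1}"
 by (simp add: cube_def)

lemma homotopic_cube:
 "homotopic_with (fixes_boundary j x0) (cube j) X f g \<longleftrightarrow>
  (EX h. continuous_map (prod_topology (top_of_set {0..1::real}) (cube j)) X h \<and>
    (ALL t:topspace (cube j). h (0, t) = f t) & (ALL t:topspace (cube j). h (1, t) = g t) \<and>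
    (ALL s:{0..1}. ALL t:cube_boundary j. h (s, t) = x0))"
 by (rule homotopic_with) (auto simp: cube_boundary_def)

lemma equiv_cube_homotopy: "equiv (based_cubes j X x0) (cube_homotopy j X x0)"
proof (rule equivI)
 show "cube_homotopy j X x0 <= based_cubes j X x0 \<times> based_cubes j X x0" by (auto simp: cube_homotopy_def)
 show "refl_on (based_cubes j X x0) (cube_homotopy j X x0)"
  by (rule refl_onI) (auto simp: cube_homotopy_def based_cubes_def)
 show "sym (cube_homotopy j X x0)" by (rule symI) (auto simp: cube_homotopy_def intro: homotopic_with_symD)
 show "trans (cube_homotopy j X x0)" by (rule transI) (auto simp: cube_homotopy_def intro: homotopic_with_trans)
qed

lemma cube_homotopyI:
 assumes "homotopic_with (fixes_boundary j x0) (cube j) X f g" shows "(f, g) : cube_homotopy j X x0"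
 using homotopic_with_imp_continuous_maps[OF assms] homotopic_with_imp_property[OF assms] assms
 by (simp add: cube_homotopy_def based_cubes_def)

lemma cube_concat_homotopic:
 assumes j: "0 < j" and f: "(f, f') : cube_homotopy j X x0" and g: "(g, g') : cube_homotopy j X x0"
 shows "(cube_concat f g, cube_concat f' g') : cube_homotopy j X x0"
proof (rule cube_homotopyI)
 let ?P = "prod_topology (top_of_set {0..1::real}) (cube j)"
 obtain F where F: "continuous_map ?P X F" "!!t. t : topspace (cube j) ==> F (0, t) = f t" "!!t. t : topspace (cube j) ==> F (1, t) = f' t"
  "!!s t. s : {0..1} ==> t : cube_boundary j ==> F (s, t) = x0"
  using f unfolding cube_homotopy_def homotopic_cube by auto
 obtain G where G: "continuous_map ?P X G" "!!t. t : topspace (cube j) ==> G (0, t) = g t" "!!t. t : topspace (cube j) ==> G (1, t) = g' t"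
  "!!s t. s : {0..1} ==> t : cube_boundary j ==> G (s, t) = x0"
  using g unfolding cube_homotopy_def homotopic_cube by auto
 have upd: "t(0 := a) : topspace (cube j)" if "t : topspace (cube j)" "a : {0..1}" for t a
  using that j by (auto simp: topspace_cube PiE_iff extensional_def)
 have t0: "t 0 : {0..1}" if "t : topspace (cube j)" for t using that j by (auto simp: topspace_cube PiE_iff)
 have bd: "t(0 := a) : cube_boundary j" if "t : topspace (cube j)" "a = 0 \<or> a = 1" for t a
  using upd[OF that(1), of a] that(2) j by (auto simp: cube_boundary_def intro!: exI[of _ 0])
 \<comment> \<open>The concatenation performed at every time of the two homotopies; the halves meet
   where both are at the base point.\<close>
 define K where "K p = (if snd p 0 <= 1 / 2 then F (fst p, (snd p)(0 := 2 * snd p 0)) else G (fst p, (snd p)(0 := 2 * snd p 0 - 1)))" for p :: "real \<times> (nat => real)"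
 have proj: "continuous_map ?P euclideanreal (%p. snd p i)" if "i < j" for i
 proof -
  have "continuous_map (cube j) (top_of_set {0..1}) (%t. t i)"
   unfolding cube_def by (rule continuous_map_product_projection) (use that in auto)
  hence "continuous_map (cube j) euclideanreal (%t. t i)" by (simp add: continuous_map_in_subtopology)
  from continuous_map_compose[OF continuous_map_snd this] show ?thesis by (simp add: o_def)
 qed
 have sub: "continuous_map (subtopology ?P S) ?P (%p. (fst p, (snd p)(0 := a * snd p 0 - b)))"
  if S: "!!p. p : topspace ?P ==> p : S ==> a * snd p 0 - b : {0..1}" for S a b
 proof (rule continuous_map_pairedI)
  show "continuous_map (subtopology ?P S) (top_of_set {0..1}) (%p. fst p)"
   by (rule continuous_map_from_subtopology[OF continuous_map_fst])
  have "continuous_map (subtopology ?P S) (top_of_set {0..1}) (%p. ((snd p)(0 := a * snd p 0 - b)) i)" if i: "i < j" for i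
  proof (rule continuous_map_into_subtopology)
   have "continuous_map ?P euclideanreal (%p. if i = 0 then a * snd p 0 - b else snd p i)"
    by (cases "i = 0") (auto intro!: continuous_intros proj i j)
   hence "continuous_map (subtopology ?P S) euclideanreal (%p. if i = 0 then a * snd p 0 - b else snd p i)"
    by (rule continuous_map_from_subtopology)
   thus "continuous_map (subtopology ?P S) euclideanreal (%p. ((snd p)(0 := a * snd p 0 - b)) i)"
    by (rule continuous_map_eq) auto
   show "(%p. ((snd p)(0 := a * snd p 0 - b)) i) : topspace (subtopology ?P S) \<rightarrow> {0..1}"
    using S i by (auto simp: topspace_cube PiE_iff)
  qed
  moreover have "(%p. (snd p)(0 := a * snd p 0 - b)) ` topspace (subtopology ?P S) <= extensional {..<j}"
   using j by (auto simp: topspace_cube PiE_iff extensional_def)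
  ultimately show "continuous_map (subtopology ?P S) (cube j) (%p. (snd p)(0 := a * snd p 0 - b))"
   unfolding cube_def[of j] continuous_map_componentwise by (auto simp: cube_def)
 qed
 have cK: "continuous_map ?P X K"
  unfolding K_def[abs_def]
 proof (rule continuous_map_cases_le)
  show "continuous_map ?P euclideanreal (%p. snd p 0)" by (rule proj[OF j])
  show "continuous_map (subtopology ?P {p : topspace ?P. snd p 0 <= 1 / 2}) X (%p. F (fst p, (snd p)(0 := 2 * snd p 0)))"
   using continuous_map_compose[OF sub[of "{p : topspace ?P. snd p 0 <= 1 / 2}" 2 0] F(1)] t0 by (auto simp: o_def)
  show "continuous_map (subtopology ?P {p : topspace ?P. 1 / 2 <= snd p 0}) X (%p. G (fst p, (snd p)(0 := 2 * snd p 0 - 1)))"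
   using continuous_map_compose[OF sub[of "{p : topspace ?P. 1 / 2 <= snd p 0}" 2 1] G(1)] t0 by (auto simp: o_def)
  fix p :: "real \<times> (nat => real)" assume p: "p : topspace ?P" "snd p 0 = 1 / 2"
  hence e: "2 * snd p 0 = 1" by simp
  show "F (fst p, (snd p)(0 := 2 * snd p 0)) = G (fst p, (snd p)(0 := 2 * snd p 0 - 1))"
   unfolding e using F(4)[OF _ bd[of "snd p" 1]] G(4)[OF _ bd[of "snd p" 0]] p(1) by auto
 qed simp
 have Kb: "K (s, t) = x0" if s: "s : {0..1}" and t: "t : cube_boundary j" for s t
 proof -
  have tt: "t : topspace (cube j)" using t by (simp add: cube_boundary_def)
  obtain i where i: "i < j" "t i = 0 \<or> t i = 1" using t by (auto simp: cube_boundary_def)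
  have b: "t(0 := a) : cube_boundary j" if "a : {0..1}" "i ~= 0 \<or> a = 0 \<or> a = 1" for a
  proof (cases "i = 0")
   case True
   thus ?thesis using that by (intro bd[OF tt]) auto
  next
   case False
   thus ?thesis unfolding cube_boundary_def using upd[OF tt that(1)] i by (intro CollectI conjI exI[of _ i]) auto
  qed
  show ?thesis
  proof (cases "t 0 <= 1 / 2")
   case True
   have "t(0 := 2 * t 0) : cube_boundary j" by (rule b) (use t0[OF tt] i True in \<open>cases "i = 0"; auto\<close>)+
   thus ?thesis using True F(4)[OF s] by (simp add: K_def)
  next
   case False
   have "t(0 := 2 * t 0 - 1) : cube_boundary j" by (rule b) (use t0[OF tt] i False in \<open>cases "i = 0"; auto\<close>)+
   thus ?thesis using False G(4)[OF s] by (simp add: K_def)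
  qed
 qed
 show "homotopic_with (fixes_boundary j x0) (cube j) X (cube_concat f g) (cube_concat f' g')"
  unfolding homotopic_cube
 proof (intro exI[of _ K] conjI ballI cK)
  fix t assume t: "t : topspace (cube j)"
  hence "t 0 <= 1 / 2 ==> t(0 := 2 * t 0) : topspace (cube j)" "~ t 0 <= 1 / 2 ==> t(0 := 2 * t 0 - 1) : topspace (cube j)"
   using t0[OF t] by (auto intro!: upd)
  thus "K (0, t) = cube_concat f g t" "K (1, t) = cube_concat f' g' t"
   using F G by (simp_all add: K_def cube_concat_def)
 qed (rule Kb)
qed

lemma cube_homotopy_compose:
 assumes h: "continuous_map X Y h" "h x0 = y0" and f: "(f, g) : cube_homotopy j X x0"
 shows "(h o f, h o g) : cube_homotopy j Y y0"
 by (rule cube_homotopyI, rule homotopic_with_compose_continuous_map_left[where p = "fixes_boundary j x0", OF _ h(1)])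
   (use f h in \<open>auto simp: cube_homotopy_def\<close>)

text \<open>The induced map is a union over the classes of the images of all representatives; these
  classes coincide, so the union is a single class.\<close>

lemma homotopy_group_map_class:
 assumes h: "continuous_map X Y h" "h x0 = y0" and f: "f : based_cubes j X x0"
 shows "homotopy_group_map j Y y0 h (cube_homotopy j X x0 `` {f}) = cube_homotopy j Y y0 `` {h o f}"
proof -
 have e: "equiv (based_cubes j Y y0) (cube_homotopy j Y y0)" and e': "equiv (based_cubes j X x0) (cube_homotopy j X x0)"
  by (rule equiv_cube_homotopy)+
 have ff: "(f, f) : cube_homotopy j X x0" by (rule equivE[OF e']) (use f in \<open>auto dest: refl_onD\<close>)
 have "cube_homotopy j Y y0 `` {h o g} = cube_homotopy j Y y0 `` {h o f}" if "(f, g) : cube_homotopy j X x0" for g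
  using equiv_class_eq[OF e cube_homotopy_compose[OF h that]] by simp
 hence "(UN g:cube_homotopy j X x0 `` {f}. cube_homotopy j Y y0 `` {h o g}) = (UN g:cube_homotopy j X x0 `` {f}. cube_homotopy j Y y0 `` {h o f})"
  by (intro SUP_cong refl) simp
 also have "... = cube_homotopy j Y y0 `` {h o f}" using ff by auto
 finally show ?thesis unfolding homotopy_group_map_def by (simp only: Image_eq_UN[of _ "_ ` _"] image_image UN_simps)
qed

lemma homotopy_group_mult_class:
 assumes j: "0 < j" and f: "f : based_cubes j X x0" and g: "g : based_cubes j X x0"
 shows "cube_homotopy j X x0 `` {f} \<otimes>\<^bsub>homotopy_group j X x0\<^esub> cube_homotopy j X x0 `` {g} = cube_homotopy j X x0 `` {cube_concat f g}"
  and "cube_concat f g : based_cubes j X x0"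
proof -
 have e: "equiv (based_cubes j X x0) (cube_homotopy j X x0)" by (rule equiv_cube_homotopy)
 have r: "(f, f) : cube_homotopy j X x0" "(g, g) : cube_homotopy j X x0"
  by (rule equivE[OF e]; use f g in \<open>auto dest: refl_onD\<close>)+
 from cube_concat_homotopic[OF j r] show "cube_concat f g : based_cubes j X x0" by (simp add: cube_homotopy_def)
 have "cube_homotopy j X x0 `` {cube_concat f' g'} = cube_homotopy j X x0 `` {cube_concat f g}"
  if "(f, f') : cube_homotopy j X x0" "(g, g') : cube_homotopy j X x0" for f' g'
  using equiv_class_eq[OF e cube_concat_homotopic[OF j that]] by simp
 thus "cube_homotopy j X x0 `` {f} \<otimes>\<^bsub>homotopy_group j X x0\<^esub> cube_homotopy j X x0 `` {g} = cube_homotopy j X x0 `` {cube_concat f g}"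
 proof -
  assume *: "!!f' g'. (f, f') : cube_homotopy j X x0 ==> (g, g') : cube_homotopy j X x0 ==>
   cube_homotopy j X x0 `` {cube_concat f' g'} = cube_homotopy j X x0 `` {cube_concat f g}"
  let ?A = "cube_homotopy j X x0 `` {f} \<times> cube_homotopy j X x0 `` {g}"
  have "(UN p:?A. cube_homotopy j X x0 `` {cube_concat (fst p) (snd p)}) = (UN p:?A. cube_homotopy j X x0 `` {cube_concat f g})"
   by (rule SUP_cong[OF refl]) (elim SigmaE, simp add: *)
  also have "... = cube_homotopy j X x0 `` {cube_concat f g}" using r by auto
  finally have 1: "(UN p:?A. cube_homotopy j X x0 `` {cube_concat (fst p) (snd p)}) = cube_homotopy j X x0 `` {cube_concat f g}" .
  have "{cube_concat f' g' |f' g'. f' : cube_homotopy j X x0 `` {f} & g' : cube_homotopy j X x0 `` {g}} = (%p. cube_concat (fst p) (snd p)) ` ?A"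
  proof (intro equalityI subsetI)
   fix h assume "h : {cube_concat f' g' |f' g'. f' : cube_homotopy j X x0 `` {f} & g' : cube_homotopy j X x0 `` {g}}"
   then obtain f' g' where "h = cube_concat f' g'" "f' : cube_homotopy j X x0 `` {f}" "g' : cube_homotopy j X x0 `` {g}" by blast
   thus "h : (%p. cube_concat (fst p) (snd p)) ` ?A" by (intro image_eqI[of _ _ "(f', g')"]) auto
  next
   fix h assume "h : (%p. cube_concat (fst p) (snd p)) ` ?A"
   then obtain p where "h = cube_concat (fst p) (snd p)" "p : ?A" by blast
   thus "h : {cube_concat f' g' |f' g'. f' : cube_homotopy j X x0 `` {f} & g' : cube_homotopy j X x0 `` {g}}"
    by (intro CollectI exI[of _ "fst p"] exI[of _ "snd p"]) auto
  qed
  thus ?thesis unfolding homotopy_group_def monoid.simps using 1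
   by (simp only: Image_eq_UN[of _ "_ ` _"] image_image UN_simps)
 qed
qed

lemma homotopy_group_map_hom:
 assumes j: "0 < j" and h: "continuous_map X Y h" "h x0 = y0"
 shows "homotopy_group_map j Y y0 h : hom (homotopy_group j X x0) (homotopy_group j Y y0)"
proof (rule homI)
 have b: "h o f : based_cubes j Y y0" if "f : based_cubes j X x0" for f
  using that h continuous_map_compose[of "cube j" X f Y h] by (auto simp: based_cubes_def)
 fix A B
 assume A: "A : carrier (homotopy_group j X x0)" and B: "B : carrier (homotopy_group j X x0)"
 obtain f where f: "f : based_cubes j X x0" "A = cube_homotopy j X x0 `` {f}" using A by (auto simp: homotopy_group_def elim: quotientE)
 obtain g where g: "g : based_cubes j X x0" "B = cube_homotopy j X x0 `` {g}" using B by (auto simp: homotopy_group_def elim: quotientE)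
 have c: "h o cube_concat f g = cube_concat (h o f) (h o g)" by (auto simp: cube_concat_def fun_eq_iff)
 show "homotopy_group_map j Y y0 h (A \<otimes>\<^bsub>homotopy_group j X x0\<^esub> B) =
   homotopy_group_map j Y y0 h A \<otimes>\<^bsub>homotopy_group j Y y0\<^esub> homotopy_group_map j Y y0 h B"
  unfolding f(2) g(2) homotopy_group_mult_class(1)[OF j f(1) g(1)]
   homotopy_group_map_class[OF h homotopy_group_mult_class(2)[OF j f(1) g(1)]]
   homotopy_group_map_class[OF h f(1)] homotopy_group_map_class[OF h g(1)]
   homotopy_group_mult_class(1)[OF j b[OF f(1)] b[OF g(1)]] c ..
next
 fix A assume A: "A : carrier (homotopy_group j X x0)"
 obtain f where f: "f : based_cubes j X x0" "A = cube_homotopy j X x0 `` {f}" using A by (auto simp: homotopy_group_def elim: quotientE)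
 have "h o f : based_cubes j Y y0"
  using f(1) h continuous_map_compose[of "cube j" X f Y h] by (auto simp: based_cubes_def)
 thus "homotopy_group_map j Y y0 h A : carrier (homotopy_group j Y y0)"
  unfolding f(2) homotopy_group_map_class[OF h f(1)] by (auto simp: homotopy_group_def intro: quotientI)
qed

section \<open>Injectivity\<close>

lemma PU_action_one: "PU_action \<one>\<^bsub>PU\<^esub> = (id :: 'n::finite cproj => 'n cproj)"
proof
 fix p :: "'n cproj"
 obtain z where z: "norm z = 1" "p = line_through z" by (rule cproj_line_through)
 have "adj (mat 1 :: complex ^ 'n option ^ 'n option) = mat 1"
  by (simp add: adj_defs mat_def vec_eq_iff)
 hence u: "adj (mat 1 :: complex ^ 'n option ^ 'n option) ** mat 1 = mat 1" by simp
 have "z ~= 0" using z by auto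
 thus "PU_action \<one>\<^bsub>PU\<^esub> p = id p" unfolding one_PU z(2) by (subst PU_action_line[OF u]) simp_all
qed

lemma outer_conj: "adj G ** outer v ** G = outer (adj G *v (v :: complex ^ 'm::finite))"
proof -
 have "(adj G ** outer v ** G) $ i $ k = (SUM b:UNIV. (SUM a:UNIV. cnj (G $ a $ i) * v $ a) * cnj (cnj (G $ b $ k) * v $ b))" for i k
  by (simp add: matrix_matrix_mult_def outer_def adj_defs sum_distrib_right sum_distrib_left ac_simps)
 thus ?thesis
  by (simp add: vec_eq_iff outer_def matrix_vector_mult_def adj_defs sum_distrib_left)
qed

lemma mult_entry_conj:
 "(A ** B) $ i $ k * cnj ((A ** B) $ l $ q) =
  (SUM a:UNIV. SUM b:UNIV. (A $ i $ a * cnj (A $ l $ b)) * (B $ a $ k * cnj (B $ b $ q)))"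
 for A B :: "complex ^ 'm ^ 'm::finite"
 by (simp add: matrix_matrix_mult_def sum_product ac_simps)

lemma adj_rep_one: assumes "C = \<one>\<^bsub>PU\<^esub>" obtains c :: complex where "norm c = 1" "rep C = mat c"
proof -
 have "rep C : C" unfolding rep_def assms one_PU using coset_of_self[of "mat 1"] by (intro someI_ex[of "%B. B : coset_of (mat 1)"]) auto
 hence "EX c. rep C = mat c ** mat 1 & norm c = 1" unfolding assms one_PU coset_of_eq by blast
 thus ?thesis using that by auto
qed

text \<open>Dividing by \<open>g\<close> makes the family of projections end at the identity: it is
  conjugated by representatives of \<open>g\<close>, and the family to be contracted is
  \<open>V\<close>, the product of the inverse of \<open>G\<close> with \<open>F\<close>.
  Multiplying the resulting unitary contraction \<open>U\<close> by \<open>g\<close> gives the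
  homotopy in the projective group.\<close>

theorem PU_homotopic:
 fixes f g :: "(nat => real) => (complex ^ 'n option ^ 'n::finite option) set"
 assumes j: "0 < j" "j <= 2 * CARD('n) + 1"
  and f: "f : based_cubes j PU_topology \<one>\<^bsub>PU\<^esub>" and g: "g : based_cubes j PU_topology \<one>\<^bsub>PU\<^esub>"
  and fg: "(PU_action o f, PU_action o g) : cube_homotopy j Symp_topology (id :: 'n cproj => 'n cproj)"
 shows "(f, g) : cube_homotopy j PU_topology \<one>\<^bsub>PU\<^esub>"
proof -
 let ?P = "prod_topology (top_of_set {0..1::real}) (cube j)"
 obtain H where H: "continuous_map ?P Symp_topology H"
  "!!t. t : topspace (cube j) ==> H (0, t) = PU_action (f t)" "!!t. t : topspace (cube j) ==> H (1, t) = PU_action (g t)"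
  "!!s t. s : {0..1} ==> t : cube_boundary j ==> H (s, t) = id"
  using fg unfolding cube_homotopy_def homotopic_cube by auto
 have cf: "continuous_map (cube j) PU_topology f" "continuous_map (cube j) PU_topology g"
  and fb: "f t = \<one>\<^bsub>PU\<^esub>" "g t = \<one>\<^bsub>PU\<^esub>" if "t : cube_boundary j" for t
  using f g that by (auto simp: based_cubes_def)
 have cf: "continuous_map (cube j) PU_topology f" "continuous_map (cube j) PU_topology g"
  using f g by (auto simp: based_cubes_def)
 have fPU: "f t : carrier PU" "g t : carrier PU" if "t : topspace (cube j)" for t
  using cf that by (auto simp: continuous_map_def)
 \<comment> \<open>The cube as a convex subset of a Euclidean space of dimension \<open>2n + 1\<close>.\<close>
  have "j <= card (Basis :: (real \<times> (complex ^ 'n)) set)" using j(2) by simp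
 then obtain B where B: "B <= (Basis :: (real \<times> (complex ^ 'n)) set)" "card B = j" by (meson obtain_subset_with_card_n)
 hence "finite B" using finite_subset finite_Basis by blast
 then obtain bt where bt: "bij_betw bt {..<j} B" using B(2) ex_bij_betw_nat_finite[of B] by (auto simp: atLeast0LessThan)
 have btB: "bt i : Basis" if "i < j" for i using bt B that by (auto simp: bij_betw_def)
 have btbt: "bt i \<bullet> bt k = (if i = k then 1 else 0)" if "i < j" "k < j" for i k
  using btB[OF that(1)] btB[OF that(2)] bt that by (auto simp: inner_Basis bij_betw_def inj_on_def)
 define d where "d t = (SUM i<j. t i *\<^sub>R bt i)" for t :: "nat => real"
 define e where "e x = (\<lambda>i\<in>{..<j}. x \<bullet> bt i)" for x
 \<comment> \<open>A box that may be degenerate: directions of \<open>Basis\<close> outside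
   \<open>B\<close> have width 0, so one ambient space of dimension \<open>2 n + 1\<close> serves
   every \<open>j\<close>.\<close>
 define X where "X = cbox 0 (SUM i<j. bt i)"
 have ed: "e (d t) = t" if "t : topspace (cube j)" for t
 proof
  fix i
  have "(SUM k<j. t k * (bt k \<bullet> bt i)) = t i" if "i < j"
  proof -
   have "(SUM k<j. t k * (bt k \<bullet> bt i)) = (SUM k<j. if k = i then t k else 0)" by (rule sum.cong) (auto simp: btbt that)
   thus ?thesis using that by simp
  qed
  thus "e (d t) i = t i"
   using that by (cases "i < j") (auto simp: e_def d_def inner_sum_left topspace_cube PiE_iff extensional_def)
 qed
 have sumbt: "(SUM i<j. c i *\<^sub>R bt i) \<bullet> b = (if b : bt ` {..<j} then c (the_inv_into {..<j} bt b) else 0)" if b: "b : Basis" for c b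
 proof (cases "b : bt ` {..<j}")
  case True
  then obtain k where k: "k < j" "b = bt k" by auto
  have "(SUM i<j. c i * (bt i \<bullet> bt k)) = (SUM i<j. if i = k then c i else 0)" by (rule sum.cong) (auto simp: btbt k)
  thus ?thesis using k bt True by (simp add: inner_sum_left bij_betw_def the_inv_into_f_f)
 next
  case False
  hence "bt i \<bullet> b = 0" if "i < j" for i using btB[OF that] b that by (auto simp: inner_Basis)
  thus ?thesis using False by (simp add: inner_sum_left)
 qed
 have dX: "d t : X" if "t : topspace (cube j)" for t
  unfolding X_def mem_box
 proof (intro ballI)
  fix b :: "real \<times> (complex ^ 'n)" assume b: "b : Basis"
  have "the_inv_into {..<j} bt b < j" if "b : bt ` {..<j}"
   using the_inv_into_into[of bt "{..<j}" b "{..<j}"] bt that by (auto simp: bij_betw_def)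
  thus "0 \<bullet> b <= d t \<bullet> b & d t \<bullet> b <= (SUM i<j. bt i) \<bullet> b"
   using sumbt[OF b, of t] sumbt[OF b, of "%_. 1"] that by (auto simp: d_def topspace_cube PiE_iff)
 qed
 have eX: "e x : topspace (cube j)" if "x : X" for x
 proof -
  have "0 <= x \<bullet> bt i & x \<bullet> bt i <= 1" if i: "i < j" for i
  proof -
   have "(SUM k<j. bt k) \<bullet> bt i = 1" using sumbt[OF btB[OF i], of "%_. 1"] i by auto
   thus ?thesis using \<open>x : X\<close> btB[OF i] unfolding X_def mem_box by (metis inner_zero_left)
  qed
  thus ?thesis by (auto simp: e_def topspace_cube)
 qed
 have X: "compact X" "convex X" by (auto simp: X_def)
 define D where "D = {x : X. e x : cube_boundary j}"
 define t0 :: "nat => real" where "t0 = (\<lambda>i\<in>{..<j}. 0)"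
 have t0: "t0 : topspace (cube j)" "t0 : cube_boundary j"
  using j(1) by (auto simp: t0_def topspace_cube cube_boundary_def intro!: exI[of _ 0])
 have D: "D <= X" "d t0 : D" using t0 dX ed by (auto simp: D_def)
 have ce: "continuous_map (top_of_set X) (cube j) e"
  unfolding cube_def continuous_map_componentwise
 proof (intro conjI ballI)
  show "e ` topspace (top_of_set X) <= extensional {..<j}" by (auto simp: e_def)
  fix k assume "k : {..<j}"
  thus "continuous_map (top_of_set X) (top_of_set {0..1}) (%x. e x k)"
   using eX by (auto simp: e_def topspace_cube PiE_iff intro!: continuous_intros)
 qed
 have cd: "continuous_map (cube j) (top_of_set X) d"
 proof (rule continuous_map_into_subtopology)
  have "continuous_map (cube j) euclideanreal (%t. t i)" if "i < j" for i
  proof -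
   have "continuous_map (cube j) (top_of_set {0..1}) (%t. t i)"
    unfolding cube_def by (rule continuous_map_product_projection) (use that in auto)
   thus ?thesis by (simp add: continuous_map_in_subtopology)
  qed
  moreover have "continuous_map euclideanreal euclidean (%r. r *\<^sub>R bt i)" for i by (simp add: continuous_intros)
  ultimately have "continuous_map (cube j) euclidean (%t. t i *\<^sub>R bt i)" if "i < j" for i
   using that continuous_map_compose[of "cube j" euclideanreal "%t. t i" euclidean "%r. r *\<^sub>R bt i"] by (simp add: o_def)
  thus "continuous_map (cube j) euclidean d" unfolding d_def[abs_def] by (intro continuous_map_sum) auto
 qed (use dX in auto)
 define F where "F x = rep (f (e x))" for x
 define G where "G x = rep (g (e x))" for x
 have uF: "adj (F x) ** F x = mat 1" "coset_of (F x) = f (e x)" and uG: "adj (G x) ** G x = mat 1" "coset_of (G x) = g (e x)" if "x : X" for x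
  unfolding F_def G_def using rep_PU[OF fPU(1)[OF eX[OF that]]] rep_PU[OF fPU(2)[OF eX[OF that]]] by auto
 have FD: "EX c. norm c = 1 & F x = mat c" "EX c. norm c = 1 & G x = mat c" if "x : D" for x
  unfolding F_def G_def using adj_rep_one[OF fb(1)] adj_rep_one[OF fb(2)] that unfolding D_def by (metis (no_types, lifting) mem_Collect_eq)+
 have cont2: "continuous_on X (%x. rep (k (e x)) $ i $ a * cnj (rep (k (e x)) $ l $ b))"
  if "continuous_map (cube j) PU_topology k" for k :: "(nat => real) => (complex ^ 'n option ^ 'n option) set" and i a l b
 proof -
  have "continuous_map (top_of_set X) euclidean (%x. tens2 (rep (k (e x))))"
   using continuous_map_compose[OF ce continuous_tens2_rep[OF that]] by (simp add: o_def)
  hence "continuous_on X (%x. tens2 (rep (k (e x))))" by simp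
  hence "continuous_on X (%x. tens2 (rep (k (e x))) $ i $ a $ l $ b)" by (intro continuous_intros)
  thus ?thesis by (simp add: tens2_def)
 qed
 have cF: "continuous_on X (%x. F x $ i $ a * cnj (F x $ l $ b))" and cG: "continuous_on X (%x. G x $ i $ a * cnj (G x $ l $ b))" for i a l b
  unfolding F_def G_def by (rule cont2[OF cf(1)] cont2[OF cf(2)])+
 define V where "V x = adj (G x) ** F x" for x
 let ?T = "{0..1::real} \<times> X"
 have "continuous_map (top_of_set ?T) ?P (%t. (fst t, e (snd t)))"
 proof (rule continuous_map_pairedI)
  show "continuous_map (top_of_set ?T) (top_of_set {0..1}) (%t. fst t)" by (auto intro!: continuous_intros)
  have "continuous_map (top_of_set ?T) (top_of_set X) snd" by (auto intro!: continuous_intros)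
  from continuous_map_compose[OF this ce] show "continuous_map (top_of_set ?T) (cube j) (%t. e (snd t))" by (simp add: o_def)
 qed
 from continuous_map_compose[OF this H(1)] have "continuous_map (top_of_set ?T) Symp_topology (%t. H (fst t, e (snd t)))" by (simp add: o_def)
 from continuous_evaluation[OF this] have cP: "continuous_on (?T \<times> sphere 0 1) (%p. pmat (H (fst (fst p), e (snd (fst p))) (line_through (snd p))))" .
 \<comment> \<open>Conjugation by \<open>G\<close> does not see the phase of the representative and
   is therefore continuous; it turns the action of \<open>g\<close> at the end of the homotopy into
   the identity.\<close>
 define Ps where "Ps p = adj (G (snd (fst p))) ** pmat (H (fst (fst p), e (snd (fst p))) (line_through (snd p))) ** G (snd (fst p))" for p
 have adjadj: "adj (adj M) = M" for M :: "complex ^ 'n option ^ 'n option" by (simp add: adj_defs vec_eq_iff)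
 have nA: "norm (M *v z) = 1" if "adj M ** M = mat 1" "norm z = 1" for M :: "complex ^ 'n option ^ 'n option" and z
 proof -
  have "complex_of_real ((norm (M *v z))\<^sup>2) = 1" unfolding herm_self[symmetric] norm_adj_invariant[OF that(1)] using that(2) by (simp add: herm_self)
  hence "(norm (M *v z))\<^sup>2 = 1" by (simp only: of_real_eq_1_iff)
  thus ?thesis using power2_eq_iff_nonneg[of "norm (M *v z)" 1] by simp
 qed
 have Pseq: "Ps ((s, x), z) = outer (adj (G x) *v y)" if "norm y = 1" "H (s, e x) (line_through z) = line_through y" for s x z y
  unfolding Ps_def by (simp add: that(2) pmat_line[OF that(1)] outer_conj)
 have "EX U. continuous_on ?T U & (ALL t:?T. adj (U t) ** U t = mat 1) \<and>
   (ALL x:X. (EX c. norm c = 1 & U (0, x) = (\<chi> i k. c * V x $ i $ k)) & U (1, x) = mat 1) & (ALL s:{0..1}. ALL x:D. U (s, x) = mat 1)"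
 proof (rule evaluation_null[OF X D, of Ps V])
  have "continuous_on (?T \<times> sphere 0 1) (%p. \<chi> i k. SUM b:UNIV. SUM a:UNIV.
    (G (snd (fst p)) $ b $ k * cnj (G (snd (fst p)) $ a $ i)) * pmat (H (fst (fst p), e (snd (fst p))) (line_through (snd p))) $ a $ b)"
   by (intro continuous_on_vec_lambda continuous_on_sum continuous_on_mult[OF continuous_on_compose2[OF cG, of _ "%p. snd (fst p)"]] continuous_on_component[OF continuous_on_component[OF cP]])
     (auto intro!: continuous_intros)
  thus "continuous_on (?T \<times> sphere 0 1) Ps"
   by (rule continuous_on_eq) (simp add: Ps_def matrix_matrix_mult_def adj_defs vec_eq_iff sum_distrib_right sum_distrib_left ac_simps)
  show "EX w. norm w = 1 & Ps (t, z) = outer w" if t: "t : ?T" and z: "norm z = 1" for t z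
  proof -
   obtain y where y: "norm y = 1" "H (fst t, e (snd t)) (line_through z) = line_through y" by (rule cproj_line_through)
   have "norm (adj (G (snd t)) *v y) = 1" by (rule nA[OF _ y(1)]) (use uG(1)[of "snd t"] t adj_unitary in auto)
   thus ?thesis using Pseq[OF y] by auto
  qed
  show "Ps (t, b *s z) = Ps (t, z)" if "norm b = 1" for t z b
  proof -
   have "b ~= 0" using that by auto
   thus ?thesis by (simp add: Ps_def line_through_scale)
  qed
  show "Ps ((1, x), z) = outer z" if x: "x : X" and z: "norm z = 1" for x z
  proof -
   have z0: "z ~= 0" using z by auto
   have "H (1, e x) (line_through z) = line_through (G x *v z)"
    using H(3)[OF eX[OF x]] PU_action_line[OF uG(1)[OF x] z0] uG(2)[OF x] by simp
   from Pseq[OF nA[OF uG(1)[OF x] z] this] show ?thesis by (simp add: matrix_vector_mul_assoc uG(1)[OF x])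
  qed
  show "Ps ((s, x), z) = outer z" if s: "s : {0..1}" and x: "x : D" and z: "norm z = 1" for s x z
  proof -
   obtain c where c: "norm c = 1" "G x = mat c" using FD(2)[OF x] by blast
   have "H (s, e x) = id" by (rule H(4)[OF s]) (use x in \<open>simp add: D_def\<close>)
   hence "Ps ((s, x), z) = outer (adj (G x) *v z)" by (intro Pseq[OF z]) simp
   also have "adj (G x) *v z = cnj c *s z"
    unfolding c(2) by (simp add: adj_defs mat_def matrix_vector_mult_def vec_eq_iff if_distrib[of "%x. x * _"] if_distrib[of cnj] cong: if_cong)
   finally show ?thesis using c(1) by (simp add: outer_scale)
  qed
  show "Ps ((0, x), z) = outer (V x *v z)" if x: "x : X" and z: "norm z = 1" for x z
  proof -
   have z0: "z ~= 0" using z by auto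
   have "H (0, e x) (line_through z) = line_through (F x *v z)"
    using H(2)[OF eX[OF x]] PU_action_line[OF uF(1)[OF x] z0] uF(2)[OF x] by simp
   from Pseq[OF nA[OF uF(1)[OF x] z] this] show ?thesis by (simp add: V_def matrix_vector_mul_assoc)
  qed
  show "adj (V x) ** V x = mat 1" if x: "x : X" for x
  proof -
   have "adj (A ** B) = adj B ** adj A" for A B :: "complex ^ 'n option ^ 'n option"
    by (simp add: adj_defs matrix_matrix_mult_def vec_eq_iff mult.commute)
   hence "adj (V x) ** V x = adj (F x) ** (G x ** adj (G x)) ** F x" by (simp add: V_def adjadj matrix_mul_assoc)
   thus ?thesis by (simp add: adj_right[OF uG(1)[OF x]] uF(1)[OF x])
  qed
  show "EX v. V x = mat v" if x: "x : D" for x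
  proof -
   obtain c c' where c: "F x = mat c" "G x = mat c'" using FD[OF x] by blast
   have "V x = mat (cnj c' * c)" unfolding V_def c
    by (simp add: adj_defs mat_def matrix_matrix_mult_def vec_eq_iff if_distrib[of "%x. x * _"] if_distrib[of cnj] cong: if_cong)
   thus ?thesis by blast
  qed
  show "continuous_on X (%x. V x $ i $ k * cnj (V x $ l $ q))" for i k l q
  proof -
   have cG': "continuous_on X (%x. adj (G x) $ i $ a * cnj (adj (G x) $ l $ b))" for a b
    using cG[of b l a i] by (simp add: adj_defs mult.commute)
   show ?thesis unfolding V_def mult_entry_conj by (intro continuous_on_sum continuous_on_mult[OF cG' cF])
  qed
 qed
 then obtain U where U: "continuous_on ?T U" "!!t. t : ?T ==> adj (U t) ** U t = mat 1"
  "!!x. x : X ==> EX c. norm c = 1 & U (0, x) = (\<chi> i k. c * V x $ i $ k)" "!!x. x : X ==> U (1, x) = mat 1"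
  "!!s x. s : {0..1} ==> x : D ==> U (s, x) = mat 1" by blast
 have umult: "adj (A ** B) ** (A ** B) = mat 1" if "adj A ** A = mat 1" "adj B ** B = mat 1" for A B :: "complex ^ 'n option ^ 'n option"
 proof -
  have "adj (A ** B) = adj B ** adj A"
   by (simp add: adj_defs matrix_matrix_mult_def vec_eq_iff mult.commute)
  hence "adj (A ** B) ** (A ** B) = adj B ** (adj A ** A) ** B" by (simp add: matrix_mul_assoc)
  thus ?thesis by (simp add: that)
 qed
 define k where "k p = coset_of (rep (g (snd p)) ** U (fst p, d (snd p)))" for p
 have uk: "adj (rep (g (snd p)) ** U (fst p, d (snd p))) ** (rep (g (snd p)) ** U (fst p, d (snd p))) = mat 1" if "p : topspace ?P" for p
  by (rule umult[OF rep_PU(1)[OF fPU(2)] U(2)]) (use that dX in auto)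
 have ck: "continuous_map ?P PU_topology k"
 proof (rule continuous_into_PU)
  show "k p : carrier PU" if "p : topspace ?P" for p
   unfolding k_def carrier_PU by (rule imageI) (simp only: mem_unitary uk[OF that])
  \<comment> \<open>Expresses \<open>tens2\<close> of the product through \<open>tens2\<close> of
    the representative of \<open>g\<close>, the form in which \<open>g\<close> is known to be
    continuous.\<close>
  define Th where "Th q = (\<chi> i k l r. SUM a:UNIV. SUM b:UNIV. fst q $ i $ a $ l $ b * (snd q $ a $ k * cnj (snd q $ b $ r)))"
   for q :: "(complex ^ 'n option ^ 'n option ^ 'n option ^ 'n option) \<times> (complex ^ 'n option ^ 'n option)"
  have "continuous_on UNIV Th" unfolding Th_def by (intro continuous_on_vec_lambda continuous_intros)
  hence cTh: "continuous_map (prod_topology euclidean euclidean) euclidean Th" by simp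
  have "continuous_map ?P (prod_topology euclidean euclidean) (%p. (tens2 (rep (g (snd p))), U (fst p, d (snd p))))"
  proof (rule continuous_map_pairedI)
   show "continuous_map ?P euclidean (%p. tens2 (rep (g (snd p))))"
    using continuous_map_compose[OF continuous_map_snd continuous_tens2_rep[OF cf(2)]] by (simp add: o_def)
   have 1: "continuous_map ?P (prod_topology (top_of_set {0..1}) (top_of_set X)) (%p. (fst p, d (snd p)))"
    using continuous_map_compose[OF continuous_map_snd cd] by (intro continuous_map_pairedI) (simp_all add: o_def continuous_map_fst)
   have 2: "continuous_map (prod_topology (top_of_set {0..1}) (top_of_set X)) euclidean U"
    using U(1) by (simp add: subtopology_Times[symmetric])
   show "continuous_map ?P euclidean (%p. U (fst p, d (snd p)))"
    using continuous_map_compose[OF 1 2] by (simp add: o_def)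
  qed
  from continuous_map_compose[OF this cTh] have "continuous_map ?P euclidean (%p. Th (tens2 (rep (g (snd p))), U (fst p, d (snd p))))" by (simp add: o_def)
  thus "continuous_map ?P euclidean (%p. tens2 (rep (k p)))"
  proof (rule continuous_map_eq)
   fix p assume p: "p : topspace ?P"
   show "Th (tens2 (rep (g (snd p))), U (fst p, d (snd p))) = tens2 (rep (k p))"
    unfolding k_def tens2_rep[OF uk[OF p]] by (simp add: Th_def tens2_def mult_entry_conj)
  qed
 qed
 show ?thesis
 proof (rule cube_homotopyI, unfold homotopic_cube, intro exI[of _ k] conjI ballI ck)
  fix t assume t: "t : topspace (cube j)"
  obtain c where c: "norm c = 1" "U (0, d t) = (\<chi> i k. c * V (d t) $ i $ k)" using U(3)[OF dX[OF t]] by blast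
  have G: "G (d t) = rep (g t)" "F (d t) = rep (f t)" by (simp_all add: G_def F_def ed[OF t])
  have "rep (g t) ** U (0, d t) = mat c ** (rep (g t) ** adj (rep (g t)) ** rep (f t))"
   unfolding c(2) V_def G by (simp add: mat_mult matrix_mul_assoc[symmetric]) (simp add: matrix_matrix_mult_def[of "rep (g t)" "vec_lambda _"] matrix_matrix_mult_def[of "rep (g t)" "_ ** _"] vec_eq_iff sum_distrib_left ac_simps)
  also have "... = mat c ** rep (f t)" by (simp add: adj_right[OF rep_PU(1)[OF fPU(2)[OF t]]])
  finally have "k (0, t) = coset_of (mat c ** rep (f t))" by (simp add: k_def)
  thus "k (0, t) = f t" by (simp add: coset_of_scale[OF c(1)] rep_PU(2)[OF fPU(1)[OF t]])
  show "k (1, t) = g t" by (simp add: k_def U(4)[OF dX[OF t]] rep_PU(2)[OF fPU(2)[OF t]])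
 next
  fix s :: real and t assume s: "s : {0..1}" and t: "t : cube_boundary j"
  have tt: "t : topspace (cube j)" using t by (simp add: cube_boundary_def)
  have "d t : D" using t ed[OF tt] dX[OF tt] by (simp add: D_def)
  hence "k (s, t) = coset_of (rep (g t))" by (simp add: k_def U(5)[OF s])
  thus "k (s, t) = \<one>\<^bsub>PU\<^esub>" using rep_PU(2)[OF fPU(2)[OF tt]] fb(2)[OF t] by simp
 qed
qed

theorem theorem2:
 fixes j :: nat
 assumes "0 < j" and "j \<le> 2 * CARD('n::finite) + 1"
 shows "homotopy_group_map j Symp_topology id (PU_action :: _ \<Rightarrow> 'n cproj \<Rightarrow> 'n cproj)
  \<in> mon (homotopy_group j PU_topology \<one>\<^bsub>PU\<^esub>) (homotopy_group j Symp_topology id)"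
proof -
 let ?io = "PU_action :: _ => 'n cproj => 'n cproj"
 note c = continuous_PU_action[where 'n = 'n] PU_action_one
 have "inj_on (homotopy_group_map j Symp_topology id ?io) (carrier (homotopy_group j PU_topology \<one>\<^bsub>PU\<^esub>))"
 proof (rule inj_onI)
  fix A B assume A: "A : carrier (homotopy_group j PU_topology \<one>\<^bsub>PU\<^esub>)" and B: "B : carrier (homotopy_group j PU_topology \<one>\<^bsub>PU\<^esub>)"
   and eq: "homotopy_group_map j Symp_topology id ?io A = homotopy_group_map j Symp_topology id ?io B"
  obtain f where f: "f : based_cubes j PU_topology \<one>\<^bsub>PU\<^esub>" "A = cube_homotopy j PU_topology \<one>\<^bsub>PU\<^esub> `` {f}"
   using A by (auto simp: homotopy_group_def elim: quotientE)
  obtain g where g: "g : based_cubes j PU_topology \<one>\<^bsub>PU\<^esub>" "B = cube_homotopy j PU_topology \<one>\<^bsub>PU\<^esub> `` {g}"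
   using B by (auto simp: homotopy_group_def elim: quotientE)
  have gS: "?io o g : based_cubes j Symp_topology id"
   using g(1) c continuous_map_compose[OF _ c(1), of "cube j" g] by (auto simp: based_cubes_def)
  from eq have "cube_homotopy j Symp_topology id `` {?io o f} = cube_homotopy j Symp_topology id `` {?io o g}"
   unfolding f(2) g(2) homotopy_group_map_class[OF c f(1)] homotopy_group_map_class[OF c g(1)] .
  from eq_equiv_class[OF this equiv_cube_homotopy gS]
  have "(?io o f, ?io o g) : cube_homotopy j Symp_topology id" .
  thus "A = B"
   unfolding f(2) g(2) using equiv_class_eq[OF equiv_cube_homotopy PU_homotopic[OF assms f(1) g(1)]] by simp
 qed
 thus ?thesis unfolding mon_def by (intro CollectI conjI homotopy_group_map_hom[OF assms(1) c])
qed

end
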